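(* Let $G$ be a connected and simply connected Poisson-Lie group with Lie algebra $\mathfrak g$. Then $G$ admits a Poisson-compatible left-covariant flat preconnection if and only if the Lie algebra $(\mathfrak g^*,[\ ,\ ]_{\mathfrak g^*})$ admits a (left) pre-Lie structure $\Xi:\mathfrak g^*\otimes\mathfrak g^*\to\mathfrak g^*$ (the correspondence between $\gamma$ and $\Xi$ being $\gamma=\gamma_\Xi$ as in the context). Moreover, such a left-covariant preconnection is bicovariant if and only if $\Xi$ in addition obeys $$\delta_{\mathfrak g^*}\Xi(\phi,\psi)-\Xi(\phi,\psi_{(1)})\otimes\psi_{(2)}-\psi_{(1)}\otimes\Xi(\phi,\psi_{(2)})=\Xi(\phi_{(1)},\psi)\otimes\phi_{(2)}-\psi_{(1)}\otimes\Xi(\psi_{(2)},\phi)$$ for all $\phi,\psi\in\mathfrak g^*$.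
   Context: A Poisson-Lie group $G$ is a (finite-dimensional) Lie group with a Poisson bracket $\{\ ,\ \}$ on $C^\infty(G)$ such that multiplication $G\times G\to G$ is a Poisson map. Let $P$ be its Poisson bivector, $\{f,h\}=P(df,dh)$, and $D^\vee(g)=(L_{g^{-1}})_*P(g)\in\mathfrak g\otimes\mathfrak g$. The Lie algebra $\mathfrak g$ is a Lie bialgebra with cobracket $\delta(x)=\frac{d}{dt}\big|_{0}(R_{\exp(-tx)})_*P(\exp tx)=x_{(1)}\otimes x_{(2)}$ (summation understood). The dual $\mathfrak g^*$ is a Lie bialgebra with $\langle[\phi,\psi]_{\mathfrak g^*},x\rangle=\langle\phi\otimes\psi,\delta(x)\rangle$ and $\langle\delta_{\mathfrak g^*}\phi,x\otimes y\rangle=\langle\phi,[x,y]\rangle$, written $\delta_{\mathfrak g^*}\phi=\phi_{(1)}\otimes\phi_{(2)}$. The coadjoint action is $\mathrm{ad}^*_x\phi=\phi_{(1)}\langle\phi_{(2)},x\rangle$, i.e. $(\mathrm{ad}^*_x\phi)(y)=-\phi([x,y])$; $\mathrm{Ad}^*$ is the corresponding left coadjoint action of $G$. A preconnection on $G$ is a bilinear map $\gamma:C^\infty(G)\otimes\Omega^1(G)\to\Omega^1(G)$ with $\gamma(xy,\tau)=\gamma(x,\tau)y+x\gamma(y,\tau)$ and $\gamma(x,y\tau)=y\gamma(x,\tau)+\{x,y\}\tau$. It is Poisson-compatible if $d\{x,y\}=\gamma(x,dy)-\gamma(y,dx)$. It is flat if $\gamma(x,\gamma(y,\tau))-\gamma(y,\gamma(x,\tau))-\gamma(\{x,y\},\tau)=0$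 for all $x,y\in C^\infty(G)$, $\tau\in\Omega^1(G)$. Let $\{e_i\}$ be a basis of $\mathfrak g$, $\{f^i\}$ the dual basis, $\{\partial_i\}$ the left-invariant vector fields generated by $\{e_i\}$ and $\{\omega^i\}$ the dual basis of left-invariant 1-forms. For a linear map $\Xi:\mathfrak g^*\otimes\mathfrak g^*\to\mathfrak g^*$ with $\Xi(f^i,f^j)=\sum_k\Xi^{ij}_kf^k$ put $$\gamma_\Xi\Big(a,\sum_k\tau_k\omega^k\Big)=\sum_k\Big(\{a,\tau_k\}+\sum_{i,j}\Xi^{ij}_k(\partial_ia)\tau_j\Big)\omega^k .$$ A preconnection is called left-covariant if the associated first-order differential calculus is left-covariant to lowest deformation order; this holds exactly when $\gamma=\gamma_\Xi$ for some (unique) $\Xi$, which is taken as the definition here. A left-covariant $\gamma_\Xi$ is called bicovariant if the calculus is also right-covariant to lowest order; this is equivalent to (and taken here to mean) $$\Xi(\phi,\psi)-\mathrm{Ad}^*_{g^{-1}}\Xi(\mathrm{Ad}^*_g\phi,\mathrm{Ad}^*_g\psi)=\phi(D^\vee(g)^{(1)})\,\mathrm{ad}^*_{D^\vee(g)^{(2)}}\psi,\quad\forall g\in G,\ \phi,\psi\in\mathfrak g^*,$$ where $D^\vee(g)=D^\vee(g)^{(1)}\otimes D^\vee(g)^{(2)}$. A left pre-Lie structure on a Lie algebra $(L,[\ ,\ ])$ is a bilinear product $\circ$ with $(x\circ y)\circ z-(y\circ x)\circ z=x\circ(y\circ z)-y\circ(x\circ z)$ and $x\circ y-y\circ x=[x,y]$.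 For $\Xi$, write $\phi\circ\psi=\Xi(\phi,\psi)$. *)

theory Defs
  imports
    "HOL-Analysis.Analysis"
    "HOL-Algebra.Group"
    "HOL-Library.Function_Algebras"
begin

section \<open>Linear algebra in function spaces\<close>

text \<open>
  Smooth functions, tangent vectors, covectors, vector fields and forms all live in iterated
  function types, with pointwise operations.  Tangent vectors, covectors, vector fields and forms
  are required to vanish off their domain, so that HOL equality is the intended equality.
\<close>

instantiation "fun" :: (type, real_vector) real_vector
begin

definition scaleR_fun :: "real \<Rightarrow> ('a \<Rightarrow> 'b) \<Rightarrow> 'a \<Rightarrow> 'b" where
  "scaleR_fun c f = (\<lambda>x. c *\<^sub>R f x)"

instance
  by standard (simp_all add: scaleR_fun_def fun_eq_iff scaleR_add_right scaleR_add_left)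

end

lemma scaleR_fun_apply [simp]: "(c *\<^sub>R f) x = c *\<^sub>R f x"
  by (simp add: scaleR_fun_def)

definition lin_on :: "'a::real_vector set \<Rightarrow> ('a \<Rightarrow> 'b::real_vector) \<Rightarrow> bool" where
  "lin_on V f \<longleftrightarrow>
     (\<forall>u\<in>V. \<forall>v\<in>V. f (u + v) = f u + f v) \<and> (\<forall>c. \<forall>v\<in>V. f (c *\<^sub>R v) = c *\<^sub>R f v)"

definition bilin_on ::
  "'a::real_vector set \<Rightarrow> 'b::real_vector set \<Rightarrow> 'c::real_vector set \<Rightarrow> ('a \<Rightarrow> 'b \<Rightarrow> 'c) \<Rightarrow> bool" where
  "bilin_on U V W B \<longleftrightarrow>
     (\<forall>u\<in>U. \<forall>v\<in>V. B u v \<in> W) \<and>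
     (\<forall>v\<in>V. lin_on U (\<lambda>u. B u v)) \<and> (\<forall>u\<in>U. lin_on V (B u))"


section \<open>Smooth manifolds\<close>

primrec C_k_on ::
  "nat \<Rightarrow> 'a::real_normed_vector set \<Rightarrow> ('a \<Rightarrow> 'b::real_normed_vector) \<Rightarrow> bool" where
  "C_k_on 0 S f = continuous_on S f"
| "C_k_on (Suc k) S f =
     (\<exists>f'. (\<forall>x\<in>S. (f has_derivative f' x) (at x)) \<and> (\<forall>v. C_k_on k S (\<lambda>x. f' x v)))"

text \<open>Only used for open sets in finite-dimensional spaces.\<close>

definition smooth_on ::
  "'a::real_normed_vector set \<Rightarrow> ('a \<Rightarrow> 'b::real_normed_vector) \<Rightarrow> bool" where
  "smooth_on S f \<longleftrightarrow> (\<forall>k. C_k_on k S f)"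

text \<open>
  A chart is a coordinate domain together with the coordinate map.  The model space is a
  finite-dimensional inner product space; dimension zero is allowed, which is why the class
  \<^class>\<open>euclidean_space\<close> is not used.
\<close>

type_synonym ('m, 'e) chart = "'m set \<times> ('m \<Rightarrow> 'e)"

definition smooth_atlas ::
  "('m::topological_space, 'e::real_inner) chart set \<Rightarrow> bool" where
  "smooth_atlas A \<longleftrightarrow>
     (\<exists>B::'e set. finite B \<and> span B = UNIV) \<and>
     (\<forall>(U, \<phi>)\<in>A. open U \<and> open (\<phi> ` U) \<and> homeomorphism U (\<phi> ` U) \<phi> (inv_into U \<phi>)) \<and>
     (\<Union>(U, \<phi>)\<in>A. U) = UNIV \<and>
     (\<forall>(U, \<phi>)\<in>A. \<forall>(V, \<psi>)\<in>A. smooth_on (\<phi> ` (U \<inter> V)) (\<psi> \<circ> inv_into U \<phi>))"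

definition prod_atlas ::
  "('m, 'e) chart set \<Rightarrow> ('n, 'd) chart set \<Rightarrow> ('m \<times> 'n, 'e \<times> 'd) chart set" where
  "prod_atlas A B = (\<lambda>((U, \<phi>), (V, \<psi>)). (U \<times> V, map_prod \<phi> \<psi>)) ` (A \<times> B)"

definition smooth_map ::
  "('m::topological_space, 'e::real_inner) chart set \<Rightarrow>
   ('n::topological_space, 'd::real_inner) chart set \<Rightarrow> ('m \<Rightarrow> 'n) \<Rightarrow> bool" where
  "smooth_map A B F \<longleftrightarrow>
     continuous_on UNIV F \<and>
     (\<forall>(U, \<phi>)\<in>A. \<forall>(V, \<psi>)\<in>B. smooth_on (\<phi> ` (U \<inter> F -` V)) (\<psi> \<circ> F \<circ> inv_into U \<phi>))"

definition smooth_funs :: "('m, 'e::real_inner) chart set \<Rightarrow> ('m \<Rightarrow> real) set" where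
  "smooth_funs A = {f. \<forall>(U, \<phi>)\<in>A. smooth_on (\<phi> ` U) (f \<circ> inv_into U \<phi>)}"

text \<open>Tangent vectors are point derivations of the algebra of smooth functions.\<close>

definition tangent_space ::
  "('m, 'e::real_inner) chart set \<Rightarrow> 'm \<Rightarrow> (('m \<Rightarrow> real) \<Rightarrow> real) set" where
  "tangent_space A p =
     {v. lin_on (smooth_funs A) v \<and>
         (\<forall>f\<in>smooth_funs A. \<forall>h\<in>smooth_funs A. v (f * h) = v f * h p + f p * v h) \<and>
         (\<forall>f. f \<notin> smooth_funs A \<longrightarrow> v f = 0)}"

definition vector_fields ::
  "('m, 'e::real_inner) chart set \<Rightarrow> (('m \<Rightarrow> real) \<Rightarrow> ('m \<Rightarrow> real)) set" where
  "vector_fields A =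
     {X. (\<forall>f\<in>smooth_funs A. X f \<in> smooth_funs A) \<and> lin_on (smooth_funs A) X \<and>
         (\<forall>f\<in>smooth_funs A. \<forall>h\<in>smooth_funs A. X (f * h) = X f * h + f * X h) \<and>
         (\<forall>f. f \<notin> smooth_funs A \<longrightarrow> X f = 0)}"

text \<open>
  \<open>\<Omega>\<^sup>1\<close> is the dual of the module of vector fields over the algebra of smooth functions;
  \<open>form_scale f \<tau>\<close> is the module action \<open>f \<tau>\<close>.
\<close>

type_synonym 'm form = "(('m \<Rightarrow> real) \<Rightarrow> ('m \<Rightarrow> real)) \<Rightarrow> ('m \<Rightarrow> real)"

definition one_forms :: "('m, 'e::real_inner) chart set \<Rightarrow> 'm form set" where
  "one_forms A =
     {\<tau>. (\<forall>X\<in>vector_fields A. \<tau> X \<in> smooth_funs A) \<and>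
         (\<forall>X\<in>vector_fields A. \<forall>Y\<in>vector_fields A. \<tau> (X + Y) = \<tau> X + \<tau> Y) \<and>
         (\<forall>f\<in>smooth_funs A. \<forall>X\<in>vector_fields A. \<tau> (\<lambda>h. f * X h) = f * \<tau> X) \<and>
         (\<forall>X. X \<notin> vector_fields A \<longrightarrow> \<tau> X = 0)}"

definition form_scale :: "('m \<Rightarrow> real) \<Rightarrow> 'm form \<Rightarrow> 'm form" where
  "form_scale f \<tau> = (\<lambda>X. f * \<tau> X)"

definition ext_d :: "('m, 'e::real_inner) chart set \<Rightarrow> ('m \<Rightarrow> real) \<Rightarrow> 'm form" where
  "ext_d A f = (\<lambda>X. if X \<in> vector_fields A then X f else 0)"


section \<open>Poisson brackets\<close>

type_synonym 'm bracket = "('m \<Rightarrow> real) \<Rightarrow> ('m \<Rightarrow> real) \<Rightarrow> ('m \<Rightarrow> real)"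

definition poisson_bracket :: "('m, 'e::real_inner) chart set \<Rightarrow> 'm bracket \<Rightarrow> bool" where
  "poisson_bracket A pb \<longleftrightarrow>
     bilin_on (smooth_funs A) (smooth_funs A) (smooth_funs A) pb \<and>
     (\<forall>f\<in>smooth_funs A. \<forall>h\<in>smooth_funs A. pb f h = - pb h f) \<and>
     (\<forall>f\<in>smooth_funs A. \<forall>h\<in>smooth_funs A. \<forall>k\<in>smooth_funs A.
        pb f (h * k) = pb f h * k + h * pb f k) \<and>
     (\<forall>f\<in>smooth_funs A. \<forall>h\<in>smooth_funs A. \<forall>k\<in>smooth_funs A.
        pb f (pb h k) + pb h (pb k f) + pb k (pb f h) = 0)"

definition prod_bracket :: "'m bracket \<Rightarrow> 'n bracket \<Rightarrow> ('m \<times> 'n) bracket" where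
  "prod_bracket pb1 pb2 F H =
     (\<lambda>(x, y). pb1 (\<lambda>x'. F (x', y)) (\<lambda>x'. H (x', y)) x + pb2 (\<lambda>y'. F (x, y')) (\<lambda>y'. H (x, y')) y)"

definition poisson_map ::
  "'m bracket \<Rightarrow> ('n, 'd::real_inner) chart set \<Rightarrow> 'n bracket \<Rightarrow> ('m \<Rightarrow> 'n) \<Rightarrow> bool" where
  "poisson_map pb1 B pb2 F \<longleftrightarrow>
     (\<forall>f\<in>smooth_funs B. \<forall>h\<in>smooth_funs B. pb1 (f \<circ> F) (h \<circ> F) = pb2 f h \<circ> F)"

text \<open>
  The tensor square of the tangent space at \<open>p\<close> is represented by biderivations at \<open>p\<close>:
  \<open>v \<otimes> w\<close> is \<open>\<lambda>f h. v f * w h\<close>.  The value \<open>P(p)\<close> of the Poisson bivector is thus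
  \<open>(f, h) \<mapsto> P(df, dh)(p) = {f, h}(p)\<close>.
\<close>

type_synonym 'm tangent2 = "('m \<Rightarrow> real) \<Rightarrow> ('m \<Rightarrow> real) \<Rightarrow> real"

definition bivector :: "('m, 'e::real_inner) chart set \<Rightarrow> 'm bracket \<Rightarrow> 'm \<Rightarrow> 'm tangent2" where
  "bivector A pb p =
     (\<lambda>f h. if f \<in> smooth_funs A \<and> h \<in> smooth_funs A then pb f h p else 0)"

definition push2 :: "('m \<Rightarrow> 'm) \<Rightarrow> 'm tangent2 \<Rightarrow> 'm tangent2" where
  "push2 F t = (\<lambda>f h. t (f \<circ> F) (h \<circ> F))"

text \<open>The contraction \<open>\<phi>(t\<^sub>1) t\<^sub>2\<close> and the pairing \<open>\<phi>(t\<^sub>1) \<psi>(t\<^sub>2)\<close> for \<open>t = t\<^sub>1 \<otimes> t\<^sub>2\<close>.\<close>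

definition contract_fst ::
  "((('m \<Rightarrow> real) \<Rightarrow> real) \<Rightarrow> real) \<Rightarrow> 'm tangent2 \<Rightarrow> ('m \<Rightarrow> real) \<Rightarrow> real" where
  "contract_fst \<phi> t = (\<lambda>h. \<phi> (\<lambda>f. t f h))"

definition pair2 ::
  "((('m \<Rightarrow> real) \<Rightarrow> real) \<Rightarrow> real) \<Rightarrow> ((('m \<Rightarrow> real) \<Rightarrow> real) \<Rightarrow> real) \<Rightarrow> 'm tangent2 \<Rightarrow> real" where
  "pair2 \<phi> \<psi> t = \<psi> (contract_fst \<phi> t)"


section \<open>Poisson-Lie groups\<close>

locale lie_group = group G
  for G :: "('g::{t2_space, second_countable_topology}, 'b) monoid_scheme" (structure)
  and A :: "('g, 'e::real_inner) chart set" +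
  assumes carrier_UNIV: "carrier G = UNIV"
    and atlas: "smooth_atlas A"
    and smooth_mult: "smooth_map (prod_atlas A A) A (\<lambda>(x, y). x \<otimes> y)"
    and smooth_inv: "smooth_map A A (\<lambda>x. inv x)"

locale poisson_lie_group = lie_group G A
  for G :: "('g::{t2_space, second_countable_topology}, 'b) monoid_scheme" (structure)
  and A :: "('g, 'e::real_inner) chart set"
  and pb :: "'g bracket" +
  assumes poisson: "poisson_bracket A pb"
    and mult_poisson_map: "poisson_map (prod_bracket pb pb) A pb (\<lambda>(x, y). x \<otimes> y)"

text \<open>
  The Lie algebra is the tangent space at the identity; its bracket is the value at the identity
  of the commutator of the left-invariant vector fields.
\<close>

type_synonym 'g lie_vec = "('g \<Rightarrow> real) \<Rightarrow> real"
type_synonym 'g lie_covec = "'g lie_vec \<Rightarrow> real"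

definition lie_alg :: "('g, 'b) monoid_scheme \<Rightarrow> ('g, 'e::real_inner) chart set \<Rightarrow> 'g lie_vec set" where
  "lie_alg G A = tangent_space A \<one>\<^bsub>G\<^esub>"

definition left_inv_field ::
  "('g, 'b) monoid_scheme \<Rightarrow> 'g lie_vec \<Rightarrow> ('g \<Rightarrow> real) \<Rightarrow> 'g \<Rightarrow> real" where
  "left_inv_field G x = (\<lambda>a g. x (\<lambda>k. a (g \<otimes>\<^bsub>G\<^esub> k)))"

definition lie_bracket :: "('g, 'b) monoid_scheme \<Rightarrow> 'g lie_vec \<Rightarrow> 'g lie_vec \<Rightarrow> 'g lie_vec" where
  "lie_bracket G x y = (\<lambda>a. x (left_inv_field G y a) - y (left_inv_field G x a))"

definition lie_dual :: "('g, 'b) monoid_scheme \<Rightarrow> ('g, 'e::real_inner) chart set \<Rightarrow> 'g lie_covec set" where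
  "lie_dual G A = {\<phi>. lin_on (lie_alg G A) \<phi> \<and> (\<forall>x. x \<notin> lie_alg G A \<longrightarrow> \<phi> x = 0)}"

definition Ad :: "('g, 'b) monoid_scheme \<Rightarrow> 'g \<Rightarrow> 'g lie_vec \<Rightarrow> 'g lie_vec" where
  "Ad G g x = (\<lambda>a. x (\<lambda>k. a (g \<otimes>\<^bsub>G\<^esub> k \<otimes>\<^bsub>G\<^esub> inv\<^bsub>G\<^esub> g)))"

definition coAd ::
  "('g, 'b) monoid_scheme \<Rightarrow> ('g, 'e::real_inner) chart set \<Rightarrow> 'g \<Rightarrow> 'g lie_covec \<Rightarrow> 'g lie_covec" where
  "coAd G A g \<phi> = (\<lambda>y. if y \<in> lie_alg G A then \<phi> (Ad G (inv\<^bsub>G\<^esub> g) y) else 0)"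

definition coad ::
  "('g, 'b) monoid_scheme \<Rightarrow> ('g, 'e::real_inner) chart set \<Rightarrow> 'g lie_vec \<Rightarrow> 'g lie_covec \<Rightarrow> 'g lie_covec" where
  "coad G A x \<phi> = (\<lambda>y. if y \<in> lie_alg G A then - \<phi> (lie_bracket G x y) else 0)"

text \<open>
  \<open>exp_curve G A x t\<close> is \<open>exp (t x)\<close>: the homomorphism from the reals to \<open>G\<close> with velocity \<open>x\<close>
  at \<open>0\<close>, which exists and is unique and smooth.
\<close>

definition exp_curve ::
  "('g, 'b) monoid_scheme \<Rightarrow> ('g, 'e::real_inner) chart set \<Rightarrow> 'g lie_vec \<Rightarrow> real \<Rightarrow> 'g" where
  "exp_curve G A x =
     (SOME c. (\<forall>s t. c (s + t) = c s \<otimes>\<^bsub>G\<^esub> c t) \<and>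
              (\<forall>f\<in>smooth_funs A. ((\<lambda>t. f (c t)) has_real_derivative x f) (at 0)))"

definition cobracket ::
  "('g, 'b) monoid_scheme \<Rightarrow> ('g, 'e::real_inner) chart set \<Rightarrow> 'g bracket \<Rightarrow> 'g lie_vec \<Rightarrow> 'g tangent2" where
  "cobracket G A pb x = (\<lambda>f h.
     deriv (\<lambda>t. push2 (\<lambda>k. k \<otimes>\<^bsub>G\<^esub> exp_curve G A x (- t)) (bivector A pb (exp_curve G A x t)) f h) 0)"

definition D_check ::
  "('g, 'b) monoid_scheme \<Rightarrow> ('g, 'e::real_inner) chart set \<Rightarrow> 'g bracket \<Rightarrow> 'g \<Rightarrow> 'g tangent2" where
  "D_check G A pb g = push2 (\<lambda>k. inv\<^bsub>G\<^esub> g \<otimes>\<^bsub>G\<^esub> k) (bivector A pb g)"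

definition dual_bracket ::
  "('g, 'b) monoid_scheme \<Rightarrow> ('g, 'e::real_inner) chart set \<Rightarrow> 'g bracket \<Rightarrow>
   'g lie_covec \<Rightarrow> 'g lie_covec \<Rightarrow> 'g lie_covec" where
  "dual_bracket G A pb \<phi> \<psi> =
     (\<lambda>x. if x \<in> lie_alg G A then pair2 \<phi> \<psi> (cobracket G A pb x) else 0)"

text \<open>
  Elements of the tensor square of the dual are represented by bilinear functions:
  \<open>\<phi> \<otimes> \<psi>\<close> is \<open>\<lambda>x y. \<phi> x * \<psi> y\<close>.  For a linear endomorphism \<open>T\<close> of the dual, \<open>map_fst T\<close> and
  \<open>map_snd T\<close> are \<open>T \<otimes> id\<close> and \<open>id \<otimes> T\<close>.
\<close>

definition dual_cobracket ::
  "('g, 'b) monoid_scheme \<Rightarrow> ('g, 'e::real_inner) chart set \<Rightarrow>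
   'g lie_covec \<Rightarrow> 'g lie_vec \<Rightarrow> 'g lie_vec \<Rightarrow> real" where
  "dual_cobracket G A \<phi> =
     (\<lambda>x y. if x \<in> lie_alg G A \<and> y \<in> lie_alg G A then \<phi> (lie_bracket G x y) else 0)"

definition map_fst :: "(('v \<Rightarrow> real) \<Rightarrow> ('v \<Rightarrow> real)) \<Rightarrow> ('v \<Rightarrow> 'v \<Rightarrow> real) \<Rightarrow> 'v \<Rightarrow> 'v \<Rightarrow> real" where
  "map_fst T t = (\<lambda>x y. T (\<lambda>z. t z y) x)"

definition map_snd :: "(('v \<Rightarrow> real) \<Rightarrow> ('v \<Rightarrow> real)) \<Rightarrow> ('v \<Rightarrow> 'v \<Rightarrow> real) \<Rightarrow> 'v \<Rightarrow> 'v \<Rightarrow> real" where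
  "map_snd T t = (\<lambda>x y. T (\<lambda>z. t x z) y)"


section \<open>Preconnections\<close>

definition preconnection ::
  "('g, 'e::real_inner) chart set \<Rightarrow> 'g bracket \<Rightarrow> (('g \<Rightarrow> real) \<Rightarrow> 'g form \<Rightarrow> 'g form) \<Rightarrow> bool" where
  "preconnection A pb \<gamma> \<longleftrightarrow>
     bilin_on (smooth_funs A) (one_forms A) (one_forms A) \<gamma> \<and>
     (\<forall>x\<in>smooth_funs A. \<forall>y\<in>smooth_funs A. \<forall>\<tau>\<in>one_forms A.
        \<gamma> (x * y) \<tau> = form_scale y (\<gamma> x \<tau>) + form_scale x (\<gamma> y \<tau>)) \<and>
     (\<forall>x\<in>smooth_funs A. \<forall>y\<in>smooth_funs A. \<forall>\<tau>\<in>one_forms A.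
        \<gamma> x (form_scale y \<tau>) = form_scale y (\<gamma> x \<tau>) + form_scale (pb x y) \<tau>)"

definition poisson_compatible ::
  "('g, 'e::real_inner) chart set \<Rightarrow> 'g bracket \<Rightarrow> (('g \<Rightarrow> real) \<Rightarrow> 'g form \<Rightarrow> 'g form) \<Rightarrow> bool" where
  "poisson_compatible A pb \<gamma> \<longleftrightarrow>
     (\<forall>x\<in>smooth_funs A. \<forall>y\<in>smooth_funs A.
        ext_d A (pb x y) = \<gamma> x (ext_d A y) - \<gamma> y (ext_d A x))"

definition flat_preconnection ::
  "('g, 'e::real_inner) chart set \<Rightarrow> 'g bracket \<Rightarrow> (('g \<Rightarrow> real) \<Rightarrow> 'g form \<Rightarrow> 'g form) \<Rightarrow> bool" where
  "flat_preconnection A pb \<gamma> \<longleftrightarrow>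
     (\<forall>x\<in>smooth_funs A. \<forall>y\<in>smooth_funs A. \<forall>\<tau>\<in>one_forms A.
        \<gamma> x (\<gamma> y \<tau>) - \<gamma> y (\<gamma> x \<tau>) - \<gamma> (pb x y) \<tau> = 0)"

definition dual_bases ::
  "('g, 'b) monoid_scheme \<Rightarrow> ('g, 'e::real_inner) chart set \<Rightarrow>
   nat \<Rightarrow> (nat \<Rightarrow> 'g lie_vec) \<Rightarrow> (nat \<Rightarrow> 'g lie_covec) \<Rightarrow> bool" where
  "dual_bases G A n e f \<longleftrightarrow>
     inj_on e {..<n} \<and> independent (e ` {..<n}) \<and> span (e ` {..<n}) = lie_alg G A \<and>
     (\<forall>i<n. f i \<in> lie_dual G A) \<and> (\<forall>i<n. \<forall>j<n. f i (e j) = (if i = j then 1 else 0))"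

text \<open>
  The left-invariant 1-form generated by \<open>\<phi>\<close>: at \<open>g\<close> it evaluates \<open>\<phi>\<close> on \<open>X\<^sub>g\<close> translated back
  to the identity.
\<close>

definition left_inv_form ::
  "('g, 'b) monoid_scheme \<Rightarrow> ('g, 'e::real_inner) chart set \<Rightarrow> 'g lie_covec \<Rightarrow> 'g form" where
  "left_inv_form G A \<phi> =
     (\<lambda>X. if X \<in> vector_fields A then (\<lambda>g. \<phi> (\<lambda>a. X (\<lambda>k. a (inv\<^bsub>G\<^esub> g \<otimes>\<^bsub>G\<^esub> k)) g)) else 0)"

text \<open>
  The preconnection associated with \<open>\<Xi>\<close>.  The coefficients \<open>\<tau>\<^sub>k\<close> of \<open>\<tau> = \<Sum>\<^sub>k \<tau>\<^sub>k \<omega>\<^sup>k\<close> are \<open>\<tau>(\<partial>\<^sub>k)\<close>,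
  and the coefficients of \<open>\<Xi>(f\<^sup>i, f\<^sup>j) = \<Sum>\<^sub>k \<Xi>\<^sup>i\<^sup>j\<^sub>k f\<^sup>k\<close> are \<open>\<Xi>(f\<^sup>i, f\<^sup>j)(e\<^sub>k)\<close>.
\<close>

definition gamma ::
  "('g, 'b) monoid_scheme \<Rightarrow> ('g, 'e::real_inner) chart set \<Rightarrow> 'g bracket \<Rightarrow>
   nat \<Rightarrow> (nat \<Rightarrow> 'g lie_vec) \<Rightarrow> (nat \<Rightarrow> 'g lie_covec) \<Rightarrow>
   ('g lie_covec \<Rightarrow> 'g lie_covec \<Rightarrow> 'g lie_covec) \<Rightarrow> ('g \<Rightarrow> real) \<Rightarrow> 'g form \<Rightarrow> 'g form" where
  "gamma G A pb n e f \<Xi> a \<tau> =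
     (\<Sum>k<n. form_scale
        (pb a (\<tau> (left_inv_field G (e k))) +
         (\<Sum>i<n. \<Sum>j<n. \<Xi> (f i) (f j) (e k) *\<^sub>R
            (left_inv_field G (e i) a * \<tau> (left_inv_field G (e j)))))
        (left_inv_form G A (f k)))"

text \<open>Equality \<open>\<gamma> = \<gamma>\<^sub>\<Xi>\<close> of maps on smooth functions and 1-forms, for a bilinear \<open>\<Xi>\<close>.\<close>

definition is_gamma ::
  "('g, 'b) monoid_scheme \<Rightarrow> ('g, 'e::real_inner) chart set \<Rightarrow> 'g bracket \<Rightarrow>
   nat \<Rightarrow> (nat \<Rightarrow> 'g lie_vec) \<Rightarrow> (nat \<Rightarrow> 'g lie_covec) \<Rightarrow>
   (('g \<Rightarrow> real) \<Rightarrow> 'g form \<Rightarrow> 'g form) \<Rightarrow>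
   ('g lie_covec \<Rightarrow> 'g lie_covec \<Rightarrow> 'g lie_covec) \<Rightarrow> bool" where
  "is_gamma G A pb n e f \<gamma> \<Xi> \<longleftrightarrow>
     bilin_on (lie_dual G A) (lie_dual G A) (lie_dual G A) \<Xi> \<and>
     (\<forall>a\<in>smooth_funs A. \<forall>\<tau>\<in>one_forms A. \<gamma> a \<tau> = gamma G A pb n e f \<Xi> a \<tau>)"

definition left_covariant ::
  "('g, 'b) monoid_scheme \<Rightarrow> ('g, 'e::real_inner) chart set \<Rightarrow> 'g bracket \<Rightarrow>
   nat \<Rightarrow> (nat \<Rightarrow> 'g lie_vec) \<Rightarrow> (nat \<Rightarrow> 'g lie_covec) \<Rightarrow>
   (('g \<Rightarrow> real) \<Rightarrow> 'g form \<Rightarrow> 'g form) \<Rightarrow> bool" where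
  "left_covariant G A pb n e f \<gamma> \<longleftrightarrow> (\<exists>\<Xi>. is_gamma G A pb n e f \<gamma> \<Xi>)"

definition bicovariant ::
  "('g, 'b) monoid_scheme \<Rightarrow> ('g, 'e::real_inner) chart set \<Rightarrow> 'g bracket \<Rightarrow>
   nat \<Rightarrow> (nat \<Rightarrow> 'g lie_vec) \<Rightarrow> (nat \<Rightarrow> 'g lie_covec) \<Rightarrow>
   (('g \<Rightarrow> real) \<Rightarrow> 'g form \<Rightarrow> 'g form) \<Rightarrow> bool" where
  "bicovariant G A pb n e f \<gamma> \<longleftrightarrow>
     (\<exists>\<Xi>. is_gamma G A pb n e f \<gamma> \<Xi> \<and>
        (\<forall>g. \<forall>\<phi>\<in>lie_dual G A. \<forall>\<psi>\<in>lie_dual G A.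
           \<Xi> \<phi> \<psi> - coAd G A (inv\<^bsub>G\<^esub> g) (\<Xi> (coAd G A g \<phi>) (coAd G A g \<psi>)) =
           coad G A (contract_fst \<phi> (D_check G A pb g)) \<psi>))"


section \<open>Pre-Lie structures\<close>

definition left_pre_lie ::
  "'v::real_vector set \<Rightarrow> ('v \<Rightarrow> 'v \<Rightarrow> 'v) \<Rightarrow> ('v \<Rightarrow> 'v \<Rightarrow> 'v) \<Rightarrow> bool" where
  "left_pre_lie L br m \<longleftrightarrow>
     bilin_on L L L m \<and>
     (\<forall>x\<in>L. \<forall>y\<in>L. \<forall>z\<in>L. m (m x y) z - m (m y x) z = m x (m y z) - m y (m x z)) \<and>
     (\<forall>x\<in>L. \<forall>y\<in>L. m x y - m y x = br x y)"

end

theory Submission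
  imports Defs "HOL-Probability.Discrete_Topology"
begin

text \<open>
  Every vector field on \<open>G\<close> is a smooth combination of the left-invariant fields \<open>\<partial>\<^sub>i\<close>, and the
  Poisson bracket is \<open>{x, y} = \<Sum> \<pi>\<^sup>i\<^sup>j (\<partial>\<^sub>i x) (\<partial>\<^sub>j y)\<close> with smooth \<open>\<pi>\<^sup>i\<^sup>j = D\<^sup>\<or>(f\<^sup>i, f\<^sup>j)\<close>
  vanishing at the identity.  Differentiating the multiplicativity of the bracket gives
  \<open>\<partial>\<^sub>k {x, y} = {\<partial>\<^sub>k x, y} + {x, \<partial>\<^sub>k y} + \<Sum> c\<^sup>i\<^sup>j\<^sub>k (\<partial>\<^sub>i x) (\<partial>\<^sub>j y)\<close>, where \<open>c\<^sup>i\<^sup>j\<^sub>k\<close> are the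
  structure constants of the dual Lie algebra.  Hence the torsion of \<open>\<gamma>\<^sub>\<Xi>\<close> is
  \<open>[f\<^sup>i, f\<^sup>j] - \<Xi>(f\<^sup>i, f\<^sup>j) + \<Xi>(f\<^sup>j, f\<^sup>i)\<close> and its curvature is the failure of \<open>\<Xi>\<close> to be a
  representation of the dual Lie algebra, both contracted with \<open>(\<partial>\<^sub>i x) (\<partial>\<^sub>j y)\<close>; these vanish
  exactly for pre-Lie structures.  Bicovariance says that a function on \<open>G\<close> with a cocycle property
  and value \<open>0\<close> at the identity vanishes.  Its derivative at the identity is the stated identity, and
  by the cocycle property that derivative determines all right-invariant derivatives, so on a
  connected group the two conditions are equivalent.  Tangent vectors being abstract point
  derivations, all of this rests on Hadamard's lemma, and the cobracket being defined through
  \<open>exp\<close>, on the existence of one-parameter subgroups.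
\<close>

section \<open>Smooth calculus in finite-dimensional inner product spaces\<close>

text \<open>Smooth functions, vector fields and point derivations are global objects, so nothing can
  be differentiated in a chart directly: cutoff functions turn chart expressions into global
  functions, and an expansion f = f q + sum of (coordinate difference) times (smooth function) lets
  the Leibniz rule alone evaluate a point derivation at q. The outcome is isolated in
  \<open>tangent_param_smooth\<close>, \<open>tangent_commute\<close> and
  \<open>tangent_diagonal\<close>; most derivatives on the group are then computed from these
  without charts. The model space is only known to have a finite spanning set, possibly empty, so a
  \<open>coord_basis\<close> carries the finite-dimensional arguments, among them compactness of
  balls and symmetry of second derivatives. The functions \<open>da j\<close>, whose differentials
  at the identity are the covectors \<open>f j\<close>, stand in for coordinates: necessity of each
  tensorial condition is read off by inserting them, and the left-invariant forms, at the
  identity.\<close>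

lemma C_k_on_mono: "C_k_on k S f \<Longrightarrow> T \<subseteq> S \<Longrightarrow> C_k_on k T f"
proof (induction k arbitrary: f)
  case 0
  then show ?case by (auto intro: continuous_on_subset)
next
  case (Suc k)
  then show ?case by simp (meson subsetD)
qed

lemma C_k_on_SucE:
  assumes "C_k_on (Suc k) S f"
  obtains f' where "\<And>x. x \<in> S \<Longrightarrow> (f has_derivative f' x) (at x)" "\<And>v. C_k_on k S (\<lambda>x. f' x v)"
  using assms by auto

lemma C_k_on_SucD: "C_k_on (Suc k) S f \<Longrightarrow> C_k_on k S f"
proof (induction k arbitrary: f)
  case 0
  then show ?case
    by (auto intro!: continuous_at_imp_continuous_on) (blast intro: has_derivative_continuous)
next
  case (Suc k)
  from Suc.prems obtain f' where "\<forall>x\<in>S. (f has_derivative f' x) (at x)"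
    "\<forall>v. C_k_on (Suc k) S (\<lambda>x. f' x v)"
    unfolding C_k_on.simps(2)[of "Suc k"] by blast
  with Suc.IH show ?case unfolding C_k_on.simps(2)[of k] by blast
qed

lemma C_k_on_cong:
  assumes "open S" "\<And>x. x \<in> S \<Longrightarrow> f x = g x" "C_k_on k S f"
  shows "C_k_on k S g"
proof (cases k)
  case 0
  with assms show ?thesis by (simp cong: continuous_on_cong)
next
  case (Suc l)
  with assms(3) obtain f' where f': "\<And>x. x \<in> S \<Longrightarrow> (f has_derivative f' x) (at x)"
    "\<And>v. C_k_on l S (\<lambda>x. f' x v)" by auto
  have "(g has_derivative f' x) (at x)" if "x \<in> S" for x
    using has_derivative_transform_within_open[OF f'(1)[OF that] assms(1) that] assms(2) by blast
  with f'(2) Suc show ?thesis by auto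
qed

text \<open>The derivative at a point is unique, so the existentially bound derivative in
  \<open>C_k_on\<close> can be taken to be \<open>frechet_derivative\<close>. With this canonical
  choice local witnesses agree, which is what \<open>C_k_on_local\<close> needs.\<close>

lemma C_k_on_Suc_iff:
  assumes "open S"
  shows "C_k_on (Suc k) S f \<longleftrightarrow> (\<forall>x\<in>S. f differentiable (at x)) \<and>
    (\<forall>v. C_k_on k S (\<lambda>x. frechet_derivative f (at x) v))"
proof
  assume "C_k_on (Suc k) S f"
  then obtain f' where f': "\<And>x. x \<in> S \<Longrightarrow> (f has_derivative f' x) (at x)"
    "\<And>v. C_k_on k S (\<lambda>x. f' x v)" by auto
  have "C_k_on k S (\<lambda>x. frechet_derivative f (at x) v)" for v
    by (rule C_k_on_cong[OF assms _ f'(2)[of v]]) (use f'(1) frechet_derivative_at in fastforce)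
  then show "(\<forall>x\<in>S. f differentiable (at x)) \<and>
    (\<forall>v. C_k_on k S (\<lambda>x. frechet_derivative f (at x) v))"
    using f'(1) by (auto simp: differentiable_def)
next
  assume "(\<forall>x\<in>S. f differentiable (at x)) \<and>
    (\<forall>v. C_k_on k S (\<lambda>x. frechet_derivative f (at x) v))"
  then show "C_k_on (Suc k) S f"
    unfolding C_k_on.simps(2) by (intro exI[of _ "\<lambda>x. frechet_derivative f (at x)"])
      (simp add: frechet_derivative_works[symmetric])
qed

lemma C_k_on_local:
  assumes "open S" "\<And>x. x \<in> S \<Longrightarrow> \<exists>T. open T \<and> x \<in> T \<and> C_k_on k T f"
  shows "C_k_on k S f"
  using assms(2)
proof (induction k arbitrary: f)
  case 0
  have "isCont f x" if x: "x \<in> S" for x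
    using 0[OF x] by (auto simp: continuous_on_eq_continuous_at)
  then show ?case
    by (simp add: continuous_at_imp_continuous_on)
next
  case (Suc k)
  have "f differentiable (at x)" if "x \<in> S" for x
    using Suc.prems[OF that] C_k_on_Suc_iff by blast
  moreover have "C_k_on k S (\<lambda>x. frechet_derivative f (at x) v)" for v
  proof (rule Suc.IH)
    fix x assume "x \<in> S"
    from Suc.prems[OF this] obtain T where "open T" "x \<in> T" "C_k_on (Suc k) T f" by blast
    then show "\<exists>T. open T \<and> x \<in> T \<and> C_k_on k T (\<lambda>x. frechet_derivative f (at x) v)"
      using C_k_on_Suc_iff by blast
  qed
  ultimately show ?case using C_k_on_Suc_iff[OF assms(1)] by blast
qed

lemma C_k_on_const: "C_k_on k S (\<lambda>x. c)"
proof (induction k arbitrary: c)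
  case (Suc k)
  then show ?case by (auto intro!: exI[of _ "\<lambda>x v. 0"])
qed simp

lemma C_k_on_linear: "bounded_linear f \<Longrightarrow> C_k_on k S f"
proof (cases k)
  case 0
  then show "bounded_linear f \<Longrightarrow> ?thesis" by (simp add: linear_continuous_on)
next
  case (Suc l)
  assume "bounded_linear f"
  then show ?thesis
    by (auto simp: Suc C_k_on_const intro!: exI[of _ "\<lambda>x. f"] bounded_linear_imp_has_derivative)
qed

lemma C_k_on_add: "C_k_on k S f \<Longrightarrow> C_k_on k S g \<Longrightarrow> C_k_on k S (\<lambda>x. f x + g x)"
proof (induction k arbitrary: f g)
  case 0
  then show ?case by (auto intro: continuous_intros)
next
  case (Suc k)
  obtain f' where "\<And>x. x \<in> S \<Longrightarrow> (f has_derivative f' x) (at x)"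
    "\<And>v. C_k_on k S (\<lambda>x. f' x v)" using C_k_on_SucE[OF Suc.prems(1)] by blast
  moreover obtain g' where "\<And>x. x \<in> S \<Longrightarrow> (g has_derivative g' x) (at x)"
    "\<And>v. C_k_on k S (\<lambda>x. g' x v)" using C_k_on_SucE[OF Suc.prems(2)] by blast
  ultimately show ?case using Suc.IH
    by (auto intro!: exI[of _ "\<lambda>x v. f' x v + g' x v"] has_derivative_add)
qed

lemma C_k_on_sum:
  "(\<And>i. i \<in> I \<Longrightarrow> C_k_on k S (f i)) \<Longrightarrow> C_k_on k S (\<lambda>x. \<Sum>i\<in>I. f i x)"
  by (induction I rule: infinite_finite_induct) (auto simp: C_k_on_const C_k_on_add)

lemma C_k_on_bounded_linear:
  "bounded_linear h \<Longrightarrow> C_k_on k S f \<Longrightarrow> C_k_on k S (\<lambda>x. h (f x))"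
proof (induction k arbitrary: f)
  case 0
  then show ?case by (simp add: bounded_linear.continuous_on)
next
  case (Suc k)
  then obtain f' where "\<And>x. x \<in> S \<Longrightarrow> (f has_derivative f' x) (at x)"
    "\<And>v. C_k_on k S (\<lambda>x. f' x v)" by auto
  then have "\<forall>x\<in>S. ((\<lambda>x. h (f x)) has_derivative (\<lambda>v. h (f' x v))) (at x)"
    "\<forall>v. C_k_on k S (\<lambda>x. h (f' x v))"
    using Suc.IH Suc.prems(1) by (auto intro: bounded_linear.has_derivative)
  then show ?case by (auto intro!: exI[of _ "\<lambda>x v. h (f' x v)"])
qed

lemma C_k_on_scaleR:
  fixes f :: "'a::real_normed_vector \<Rightarrow> real"
  shows "C_k_on k S f \<Longrightarrow> C_k_on k S g \<Longrightarrow> C_k_on k S (\<lambda>x. f x *\<^sub>R g x)"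
proof (induction k arbitrary: f g)
  case 0
  then show ?case by (auto intro: continuous_intros)
next
  case (Suc k)
  obtain f' where f': "\<And>x. x \<in> S \<Longrightarrow> (f has_derivative f' x) (at x)"
    "\<And>v. C_k_on k S (\<lambda>x. f' x v)" using C_k_on_SucE[OF Suc.prems(1)] by blast
  obtain g' where g': "\<And>x. x \<in> S \<Longrightarrow> (g has_derivative g' x) (at x)"
    "\<And>v. C_k_on k S (\<lambda>x. g' x v)" using C_k_on_SucE[OF Suc.prems(2)] by blast
  note * = f' g'
  \<comment> \<open>The product rule reproduces the factors undifferentiated, so the induction
    hypothesis needs them at order k as well.\<close>
  have "C_k_on k S f" "C_k_on k S g" by (auto intro: C_k_on_SucD Suc.prems simp del: C_k_on.simps)
  then have "C_k_on k S (\<lambda>x. f x *\<^sub>R g' x v + f' x v *\<^sub>R g x)" for v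
    using * by (intro C_k_on_add Suc.IH) auto
  with * show ?case
    by (auto intro!: exI[of _ "\<lambda>x v. f x *\<^sub>R g' x v + f' x v *\<^sub>R g x"] has_derivative_scaleR)
qed

text \<open>Encoded by the Parseval expansion instead of orthonormality, because every use expands a
  vector. Excluding 0 keeps the two embedded copies in \<open>coord_basis_Times\<close>
  disjoint.\<close>

definition coord_basis :: "'a::real_inner set \<Rightarrow> bool" where
  "coord_basis B \<longleftrightarrow> finite B \<and> 0 \<notin> B \<and> (\<forall>x. (\<Sum>b\<in>B. (x \<bullet> b) *\<^sub>R b) = x)"

lemma coord_basis_finite: "coord_basis B \<Longrightarrow> finite B"
  by (simp add: coord_basis_def)

lemma coord_basis_expand: "coord_basis B \<Longrightarrow> (\<Sum>b\<in>B. (x \<bullet> b) *\<^sub>R b) = x"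
  by (simp add: coord_basis_def)

lemma coord_basis_linear:
  assumes "coord_basis B" "linear f"
  shows "f v = (\<Sum>b\<in>B. (v \<bullet> b) *\<^sub>R f b)"
proof -
  have "f v = f (\<Sum>b\<in>B. (v \<bullet> b) *\<^sub>R b)" using coord_basis_expand[OF assms(1)] by simp
  also have "\<dots> = (\<Sum>b\<in>B. (v \<bullet> b) *\<^sub>R f b)"
    using assms(2) by (simp add: linear_sum linear_cmul)
  finally show ?thesis .
qed

text \<open>The chain rule applies \<open>f' (g x)\<close> to a direction that moves with x, while
  \<open>C_k_on\<close> speaks of fixed directions only. Expanding the moving direction in B leaves
  products of functions covered by the induction hypothesis.\<close>

lemma C_k_on_compose:
  fixes g :: "'a::real_normed_vector \<Rightarrow> 'b::real_inner"
  assumes B: "coord_basis (B :: 'b set)"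
  shows "C_k_on k T f \<Longrightarrow> C_k_on k S g \<Longrightarrow> (\<And>x. x \<in> S \<Longrightarrow> g x \<in> T) \<Longrightarrow> C_k_on k S (\<lambda>x. f (g x))"
proof (induction k arbitrary: f g)
  case 0
  then show ?case using continuous_on_compose2[of T f S g] by auto
next
  case (Suc k)
  obtain f' where f': "\<And>x. x \<in> T \<Longrightarrow> (f has_derivative f' x) (at x)"
    "\<And>v. C_k_on k T (\<lambda>x. f' x v)" using C_k_on_SucE[OF Suc.prems(1)] by blast
  obtain g' where g': "\<And>x. x \<in> S \<Longrightarrow> (g has_derivative g' x) (at x)"
    "\<And>v. C_k_on k S (\<lambda>x. g' x v)" using C_k_on_SucE[OF Suc.prems(2)] by blast
  note * = f' g'
  have "C_k_on k S g" by (rule C_k_on_SucD[OF Suc.prems(2)])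
  then have "C_k_on k S (\<lambda>x. f' (g x) b)" for b
    using Suc.IH[OF *(2)] Suc.prems(3) by blast
  then have "C_k_on k S (\<lambda>x. \<Sum>b\<in>B. (g' x v \<bullet> b) *\<^sub>R f' (g x) b)" for v
    by (intro C_k_on_sum C_k_on_scaleR)
      (auto intro: C_k_on_bounded_linear[OF bounded_linear_inner_left] *)
  moreover have "((\<lambda>x. f (g x)) has_derivative (\<lambda>v. \<Sum>b\<in>B. (g' x v \<bullet> b) *\<^sub>R f' (g x) b)) (at x)"
    if "x \<in> S" for x
  proof -
    have "(f has_derivative f' (g x)) (at (g x))" using that Suc.prems(3) * by blast
    moreover from this have "f' (g x) w = (\<Sum>b\<in>B. (w \<bullet> b) *\<^sub>R f' (g x) b)" for w
      using coord_basis_linear[OF B] has_derivative_linear by blast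
    ultimately show ?thesis
      by (intro has_derivative_eq_rhs[OF has_derivative_compose[OF *(3)[OF that]]]) (simp, rule ext)
  qed
  ultimately show ?case
    unfolding C_k_on.simps
    by (intro exI[of _ "\<lambda>x v. \<Sum>b\<in>B. (g' x v \<bullet> b) *\<^sub>R f' (g x) b"]) simp
qed

lemma C_k_on_inverse:
  fixes f :: "'a::real_normed_vector \<Rightarrow> real"
  shows "C_k_on k S f \<Longrightarrow> (\<And>x. x \<in> S \<Longrightarrow> f x \<noteq> 0) \<Longrightarrow> C_k_on k S (\<lambda>x. inverse (f x))"
proof (induction k)
  case 0
  then show ?case by (auto intro: continuous_intros)
next
  case (Suc k)
  then obtain f' where *: "\<And>x. x \<in> S \<Longrightarrow> (f has_derivative f' x) (at x)"
    "\<And>v. C_k_on k S (\<lambda>x. f' x v)" by auto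
  have i: "C_k_on k S (\<lambda>x. inverse (f x))"
    using Suc by (blast intro: C_k_on_SucD)
  have "C_k_on k S (\<lambda>x. (-1) *\<^sub>R (inverse (f x) *\<^sub>R (f' x v *\<^sub>R inverse (f x))))" for v
    by (intro C_k_on_scaleR i * C_k_on_const)
  then have "C_k_on k S (\<lambda>x. - (inverse (f x) * f' x v * inverse (f x)))" for v
    by (simp add: mult.assoc)
  moreover have "((\<lambda>x. inverse (f x)) has_derivative
      (\<lambda>v. - (inverse (f x) * f' x v * inverse (f x)))) (at x)" if "x \<in> S" for x
    by (rule Deriv.has_derivative_inverse[OF Suc.prems(2)[OF that] *(1)[OF that]])
  ultimately show ?case
    unfolding C_k_on.simps
    by (intro exI[of _ "\<lambda>x v. - (inverse (f x) * f' x v * inverse (f x))"]) simp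
qed

lemma smooth_on_mono: "smooth_on S f \<Longrightarrow> T \<subseteq> S \<Longrightarrow> smooth_on T f"
  by (auto simp: smooth_on_def intro: C_k_on_mono)

lemma smooth_on_cong:
  "open S \<Longrightarrow> smooth_on S f \<Longrightarrow> (\<And>x. x \<in> S \<Longrightarrow> f x = g x) \<Longrightarrow> smooth_on S g"
  by (auto simp: smooth_on_def intro: C_k_on_cong)

lemma smooth_on_local:
  "open S \<Longrightarrow> (\<And>x. x \<in> S \<Longrightarrow> \<exists>T. open T \<and> x \<in> T \<and> smooth_on T f) \<Longrightarrow> smooth_on S f"
  unfolding smooth_on_def by (metis C_k_on_local)

lemma smooth_on_const: "smooth_on S (\<lambda>x. c)"
  by (simp add: smooth_on_def C_k_on_const)

lemma smooth_on_linear: "bounded_linear f \<Longrightarrow> smooth_on S f"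
  by (simp add: smooth_on_def C_k_on_linear)

lemma smooth_on_add: "smooth_on S f \<Longrightarrow> smooth_on S g \<Longrightarrow> smooth_on S (\<lambda>x. f x + g x)"
  by (simp add: smooth_on_def C_k_on_add)

lemma smooth_on_sum:
  "(\<And>i. i \<in> I \<Longrightarrow> smooth_on S (f i)) \<Longrightarrow> smooth_on S (\<lambda>x. \<Sum>i\<in>I. f i x)"
  by (simp add: smooth_on_def C_k_on_sum)

lemma smooth_on_bounded_linear:
  "bounded_linear h \<Longrightarrow> smooth_on S f \<Longrightarrow> smooth_on S (\<lambda>x. h (f x))"
  by (simp add: smooth_on_def C_k_on_bounded_linear)

lemma smooth_on_scaleR:
  fixes f :: "'a::real_normed_vector \<Rightarrow> real"
  shows "smooth_on S f \<Longrightarrow> smooth_on S g \<Longrightarrow> smooth_on S (\<lambda>x. f x *\<^sub>R g x)"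
  by (simp add: smooth_on_def C_k_on_scaleR)

lemma smooth_on_mult:
  fixes f :: "'a::real_normed_vector \<Rightarrow> real"
  shows "smooth_on S f \<Longrightarrow> smooth_on S g \<Longrightarrow> smooth_on S (\<lambda>x. f x * g x)"
  using smooth_on_scaleR[of S f g] by simp

lemma smooth_on_diff:
  "smooth_on S f \<Longrightarrow> smooth_on S g \<Longrightarrow> smooth_on S (\<lambda>x. f x - g x)"
  using smooth_on_add[of S f "\<lambda>x. (-1) *\<^sub>R g x"] smooth_on_scaleR[OF smooth_on_const, of S g "-1"]
  by simp

lemma smooth_on_compose:
  fixes g :: "'a::real_normed_vector \<Rightarrow> 'b::real_inner"
  assumes "coord_basis (B :: 'b set)" "smooth_on T f" "smooth_on S g" "g ` S \<subseteq> T"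
  shows "smooth_on S (\<lambda>x. f (g x))"
  using assms(2-) unfolding smooth_on_def image_subset_iff
  by (metis C_k_on_compose[OF assms(1)])

lemma coord_basis_real: "coord_basis {1::real}"
  by (simp add: coord_basis_def)

lemma smooth_on_real_compose:
  fixes g :: "'a::real_normed_vector \<Rightarrow> real"
  assumes "smooth_on UNIV f" "smooth_on S g"
  shows "smooth_on S (\<lambda>x. f (g x))"
  using smooth_on_compose[OF coord_basis_real assms] by simp

lemma smooth_on_inverse:
  fixes f :: "'a::real_normed_vector \<Rightarrow> real"
  shows "smooth_on S f \<Longrightarrow> (\<And>x. x \<in> S \<Longrightarrow> f x \<noteq> 0) \<Longrightarrow> smooth_on S (\<lambda>x. inverse (f x))"
  by (simp add: smooth_on_def C_k_on_inverse)

lemma smooth_on_componentwise: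
  assumes "coord_basis B" "\<And>b. b \<in> B \<Longrightarrow> smooth_on S (\<lambda>x. f x \<bullet> b)"
  shows "smooth_on S f"
proof -
  have "smooth_on S (\<lambda>x. \<Sum>b\<in>B. (f x \<bullet> b) *\<^sub>R b)"
    by (intro smooth_on_sum smooth_on_scaleR smooth_on_const assms)
  then show ?thesis by (simp add: coord_basis_expand[OF assms(1)])
qed

lemma smooth_on_continuous: "smooth_on S f \<Longrightarrow> continuous_on S f"
  unfolding smooth_on_def using C_k_on.simps(1) by blast

lemma smooth_on_differentiable:
  "smooth_on S f \<Longrightarrow> x \<in> S \<Longrightarrow> f differentiable (at x)"
  unfolding smooth_on_def differentiable_def by (metis C_k_on_SucE)

lemma smooth_on_has_derivative:
  "smooth_on S f \<Longrightarrow> x \<in> S \<Longrightarrow> (f has_derivative frechet_derivative f (at x)) (at x)"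
  using smooth_on_differentiable frechet_derivative_works by blast

lemma smooth_on_frechet_derivative:
  "open S \<Longrightarrow> smooth_on S f \<Longrightarrow> smooth_on S (\<lambda>x. frechet_derivative f (at x) v)"
  unfolding smooth_on_def using C_k_on_Suc_iff by blast

lemma smooth_on_Pair:
  "smooth_on S f \<Longrightarrow> smooth_on S g \<Longrightarrow> smooth_on S (\<lambda>x. (f x, g x))"
proof -
  have *: "bounded_linear (\<lambda>x. (x, 0))" "bounded_linear (\<lambda>x. (0, x))"
    by (auto intro!: bounded_linear_Pair bounded_linear_ident bounded_linear_zero)
  assume "smooth_on S f" "smooth_on S g"
  then have "smooth_on S (\<lambda>x. (f x, 0) + (0, g x))"
    by (intro smooth_on_add smooth_on_bounded_linear[OF *(1)] smooth_on_bounded_linear[OF *(2)])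
  then show ?thesis by simp
qed

lemma coord_basis_Times:
  fixes B :: "'a::real_inner set" and C :: "'b::real_inner set"
  assumes "coord_basis B" "coord_basis C"
  shows "coord_basis ((\<lambda>b. (b, 0)) ` B \<union> (\<lambda>c. (0, c)) ` C)"
proof -
  have d: "(\<lambda>b. (b, 0)) ` B \<inter> (\<lambda>c. (0, c)) ` C = {}" 
    using assms by (auto simp: coord_basis_def)
  have "(\<Sum>b\<in>(\<lambda>b. (b, 0)) ` B \<union> (\<lambda>c. (0, c)) ` C. (x \<bullet> b) *\<^sub>R b) = x" for x
  proof (cases x)
    case (Pair u v)
    have "(\<Sum>b\<in>B. ((u \<bullet> b) *\<^sub>R b, 0 :: 'b)) = (u, 0)"
      using assms(1) by (simp add: prod_eq_iff fst_sum snd_sum coord_basis_def)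
    moreover have "(\<Sum>b\<in>C. (0 :: 'a, (v \<bullet> b) *\<^sub>R b)) = (0, v)"
      using assms(2) by (simp add: prod_eq_iff fst_sum snd_sum coord_basis_def)
    ultimately show ?thesis
      using assms d by (subst sum.union_disjoint)
        (simp_all add: coord_basis_def sum.reindex inj_on_def Pair)
  qed
  then show ?thesis using assms by (auto simp: coord_basis_def zero_prod_def)
qed

text \<open>Gram-Schmidt (\<open>basis_orthogonal\<close>) gives an orthogonal spanning set;
  dropping 0 and normalising makes it orthonormal. The expansion is then linear in x and holds on D,
  hence on its span.\<close>

lemma finite_span_imp_coord_basis:
  assumes "finite (B::'a::real_inner set)" "span B = UNIV"
  shows "\<exists>C::'a set. coord_basis C"
proof -
  obtain C where C: "finite C" "span C = (UNIV::'a set)" "pairwise orthogonal C"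
    using basis_orthogonal[OF assms(1)] assms(2) by auto
  define D where "D = (\<lambda>x. x /\<^sub>R norm x) ` (C - {0})"
  have D: "finite D" "0 \<notin> D" using C by (auto simp: D_def)
  have on: "b \<bullet> c = (if b = c then 1 else 0)" if "b \<in> D" "c \<in> D" for b c
  proof (cases "b = c")
    case True
    moreover have "norm b = 1" using that by (auto simp: D_def)
    ultimately show ?thesis by (simp add: dot_square_norm)
  next
    case False
    from that obtain x y where xy: "x \<in> C" "y \<in> C" "b = x /\<^sub>R norm x" "c = y /\<^sub>R norm y"
      by (auto simp: D_def)
    with False have "x \<noteq> y" by blast
    then have "x \<bullet> y = 0" using C(3) xy by (simp add: pairwise_def orthogonal_def)
    then show ?thesis using False xy by simp
  qed
  have "x \<in> span D" for x
  proof -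
    have "C \<subseteq> span D"
    proof
      fix c assume "c \<in> C"
      show "c \<in> span D"
      proof (cases "c = 0")
        case False
        then have "c = norm c *\<^sub>R (c /\<^sub>R norm c)" by simp
        moreover have "c /\<^sub>R norm c \<in> D" using False \<open>c \<in> C\<close> by (auto simp: D_def)
        ultimately show ?thesis by (metis span_base span_scale)
      qed (simp add: span_zero)
    qed
    then show ?thesis using C(2) span_minimal subspace_span by (metis UNIV_I subsetD)
  qed
  moreover have "(\<Sum>b\<in>D. (x \<bullet> b) *\<^sub>R b) = x" if "x \<in> span D" for x
    using that
  proof (induction rule: span_induct_alt)
    case base
    then show ?case by simp
  next
    case (step c x y)
    have "(\<Sum>b\<in>D. ((c *\<^sub>R x + y) \<bullet> b) *\<^sub>R b) = c *\<^sub>R (\<Sum>b\<in>D. (x \<bullet> b) *\<^sub>R b) + y"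
      using step by (simp add: inner_add_left scaleR_add_left sum.distrib scaleR_sum_right)
    also have "(\<Sum>b\<in>D. (x \<bullet> b) *\<^sub>R b) = (\<Sum>b\<in>D. if x = b then b else 0)"
      using step on by (intro sum.cong) auto
    also have "\<dots> = x" using step D by (simp add: sum.delta)
    finally show ?case .
  qed
  ultimately show ?thesis using D by (auto simp: coord_basis_def)
qed

section \<open>Cutoff functions and compactness of balls in the model space\<close>

definition flat_exp :: "nat \<Rightarrow> real \<Rightarrow> real" where
  "flat_exp m t = (if t > 0 then inverse t ^ m / exp (inverse t) else 0)"

text \<open>The powers of 1/t are carried along because they close the family exp(-1/t) / t^m under
  differentiation; smoothness of all members then follows by one induction on the order.\<close>

lemma flat_exp_has_derivative:
  "(flat_exp m has_real_derivative flat_exp (m + 2) t - m * flat_exp (m + 1) t) (at t)"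
proof -
  consider "t > 0" | "t < 0" | "t = 0" by linarith
  then show ?thesis
  proof cases
    case 1
    have "((\<lambda>t. inverse t) has_real_derivative - (inverse t * inverse t)) (at t)"
      using 1 by (auto intro!: derivative_eq_intros simp: power2_eq_square)
    from DERIV_mult[OF DERIV_power[OF this, of m] DERIV_fun_exp[OF DERIV_minus[OF this]]]
    have "((\<lambda>t. inverse t ^ m / exp (inverse t)) has_real_derivative
        flat_exp (m + 2) t - m * flat_exp (m + 1) t) (at t)"
      using 1 by (cases m) (simp_all add: flat_exp_def exp_minus divide_inverse algebra_simps)
    then show ?thesis
      by (rule has_field_derivative_transform_within_open[of _ _ _ "{0<..}"])
        (use 1 in \<open>auto simp: flat_exp_def\<close>)
  next
    case 2
    have "((\<lambda>t. 0) has_real_derivative flat_exp (m + 2) t - m * flat_exp (m + 1) t) (at t)"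
      using 2 by (auto simp: flat_exp_def)
    then show ?thesis
      by (rule has_field_derivative_transform_within_open[of _ _ _ "{..<0}"])
        (use 2 in \<open>auto simp: flat_exp_def\<close>)
  next
    case 3
    have "((\<lambda>h. (flat_exp m (0 + h) - flat_exp m 0) / h) \<longlongrightarrow> 0) (at 0)"
    proof (rule filterlim_split_at)
      show "((\<lambda>h. (flat_exp m (0 + h) - flat_exp m 0) / h) \<longlongrightarrow> 0) (at_left 0)"
        by (rule tendsto_eventually) (auto simp: eventually_at_filter flat_exp_def)
      \<comment> \<open>From the right the difference quotient at 0 is s^(m+1) / exp s with s = 1/h
        tending to infinity.\<close>
      have "((\<lambda>h::real. inverse h ^ Suc m / exp (inverse h)) \<longlongrightarrow> 0) (at_right 0)"
        by (rule filterlim_compose[OF tendsto_power_div_exp_0 filterlim_inverse_at_top_right])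
      moreover have "eventually (\<lambda>h. inverse h ^ Suc m / exp (inverse h) =
          (flat_exp m (0 + h) - flat_exp m 0) / h) (at_right (0::real))"
        unfolding eventually_at_filter by (auto simp: flat_exp_def field_simps)
      ultimately show "((\<lambda>h. (flat_exp m (0 + h) - flat_exp m 0) / h) \<longlongrightarrow> 0) (at_right 0)"
        by (simp add: tendsto_cong)
    qed
    then show ?thesis using 3 by (simp add: DERIV_def flat_exp_def)
  qed
qed

lemma C_k_on_flat_exp: "C_k_on k S (flat_exp m)"
proof (induction k arbitrary: m)
  case 0
  have "isCont (flat_exp m) x" for x
    using flat_exp_has_derivative[of m x] by (rule DERIV_isCont)
  then show ?case by (simp add: continuous_at_imp_continuous_on)
next
  case (Suc k)
  have "C_k_on k S (\<lambda>x. v *\<^sub>R (flat_exp (m + 2) x + (- real m) *\<^sub>R flat_exp (m + 1) x))" for v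
    by (intro C_k_on_add C_k_on_scaleR Suc C_k_on_const)
  moreover have "(flat_exp m has_derivative
      (\<lambda>v. v *\<^sub>R (flat_exp (m + 2) x + (- real m) *\<^sub>R flat_exp (m + 1) x))) (at x)" for x
    by (rule has_derivative_eq_rhs[OF flat_exp_has_derivative[of m x, unfolded has_field_derivative_def]])
      (auto simp: algebra_simps)
  ultimately show ?case
    unfolding C_k_on.simps by (intro exI[of _ "\<lambda>x v. v *\<^sub>R (flat_exp (m + 2) x + (- real m) *\<^sub>R flat_exp (m + 1) x)"]) simp
qed

definition smooth_step :: "real \<Rightarrow> real" where
  "smooth_step t = flat_exp 0 t * inverse (flat_exp 0 t + flat_exp 0 (1 - t))"

lemma smooth_on_smooth_step: "smooth_on S smooth_step"
proof -
  have 1: "smooth_on S (flat_exp 0)" for S by (simp add: smooth_on_def C_k_on_flat_exp)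
  have 2: "smooth_on S (\<lambda>t::real. 1 - t)"
    by (intro smooth_on_diff smooth_on_const smooth_on_linear bounded_linear_ident)
  \<comment> \<open>t and 1 - t are never both nonpositive, so one summand is positive and the other
    nonnegative.\<close>
  have "flat_exp 0 t + flat_exp 0 (1 - t) > 0" for t
    by (cases "t > 0") (auto simp: flat_exp_def add_pos_nonneg)
  then have "smooth_on S (\<lambda>t. flat_exp 0 t * inverse (flat_exp 0 t + flat_exp 0 (1 - t)))"
    by (intro smooth_on_mult smooth_on_inverse smooth_on_add 1 smooth_on_real_compose[OF _ 2]) 
      (metis less_irrefl)
  then show ?thesis by (simp add: smooth_step_def[abs_def])
qed

lemma smooth_step_0: "t \<le> 0 \<Longrightarrow> smooth_step t = 0"
  and smooth_step_1: "t \<ge> 1 \<Longrightarrow> smooth_step t = 1"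
  by (auto simp: smooth_step_def flat_exp_def)

lemma coord_basis_inner:
  assumes "coord_basis B"
  shows "x \<bullet> y = (\<Sum>b\<in>B. (x \<bullet> b) * (y \<bullet> b))"
proof -
  have "x \<bullet> y = x \<bullet> (\<Sum>b\<in>B. (y \<bullet> b) *\<^sub>R b)" by (simp add: coord_basis_expand[OF assms])
  then show ?thesis by (simp add: inner_sum_right mult.commute)
qed

lemma bump_exists:
  fixes p :: "'e::real_inner"
  assumes B: "coord_basis (B :: 'e set)" and r: "r > 0"
  shows "\<exists>\<eta>::'e \<Rightarrow> real. smooth_on UNIV \<eta> \<and> (\<forall>x\<in>ball p r. \<eta> x = 1) \<and> (\<forall>x. x \<notin> ball p (2 * r) \<longrightarrow> \<eta> x = 0)"
proof -
  \<comment> \<open>The argument is 2 - |x - p|^2 / r^2: at least 1 within distance r, at most 0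
    beyond sqrt 2 * r and so outside the ball of radius 2 r. Writing the square in coordinates makes
    it visibly smooth.\<close>
  define \<eta> where "\<eta> x = smooth_step (2 - (\<Sum>b\<in>B. (x \<bullet> b - p \<bullet> b) * (x \<bullet> b - p \<bullet> b)) * inverse (r\<^sup>2))" for x
  have \<eta>: "\<eta> x = smooth_step (2 - (norm (x - p))\<^sup>2 / r\<^sup>2)" for x
    unfolding \<eta>_def power2_norm_eq_inner coord_basis_inner[OF B, of "x - p" "x - p"]
    by (simp add: inner_diff_left divide_inverse)
  have l: "smooth_on UNIV (\<lambda>x::'e. x \<bullet> b)" for b
    by (rule smooth_on_linear[OF bounded_linear_inner_left])
  have "smooth_on UNIV \<eta>"
    unfolding \<eta>_def[abs_def]
    by (rule smooth_on_real_compose[OF smooth_on_smooth_step])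
      (intro smooth_on_diff smooth_on_mult smooth_on_sum smooth_on_const l)
  moreover have "\<eta> x = 1" if "x \<in> ball p r" for x
  proof -
    have "(norm (x - p))\<^sup>2 \<le> r\<^sup>2"
      using that by (intro power_mono) (auto simp: dist_norm norm_minus_commute)
    then show ?thesis unfolding \<eta> using r by (intro smooth_step_1) (simp add: field_simps)
  qed
  moreover have "\<eta> x = 0" if "x \<notin> ball p (2 * r)" for x
  proof -
    have "(2 * r)\<^sup>2 \<le> (norm (x - p))\<^sup>2"
      using that r by (intro power_mono) (auto simp: dist_norm norm_minus_commute)
    moreover have "2 * r\<^sup>2 \<le> (2 * r)\<^sup>2" by (simp add: power_mult_distrib)
    ultimately have "2 * r\<^sup>2 \<le> (norm (x - p))\<^sup>2" by linarith 
    then show ?thesis unfolding \<eta> using r by (intro smooth_step_0) (simp add: field_simps)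
  qed
  ultimately show ?thesis by blast
qed

text \<open>Each further basis vector exhibits the box as a continuous image of an interval times
  the previous box.\<close>

lemma compact_box_sum:
  fixes B :: "'e::real_normed_vector set"
  assumes "finite B"
  shows "compact {(\<Sum>b\<in>B. u b *\<^sub>R b) |u. \<forall>b\<in>B. \<bar>u b\<bar> \<le> R}"
  using assms
proof induction
  case empty
  have "{(\<Sum>b\<in>{}. u b *\<^sub>R b) |u::'e\<Rightarrow>real. \<forall>b\<in>{}. \<bar>u b\<bar> \<le> R} = {0}" by auto
  then show ?case by simp
next
  case (insert c B)
  let ?C = "{(\<Sum>b\<in>B. u b *\<^sub>R b) |u. \<forall>b\<in>B. \<bar>u b\<bar> \<le> R}"
  have "{(\<Sum>b\<in>insert c B. u b *\<^sub>R b) |u. \<forall>b\<in>insert c B. \<bar>u b\<bar> \<le> R} =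
      (\<lambda>(s, x). s *\<^sub>R c + x) ` ({-R..R} \<times> ?C)" (is "?L = ?R")
  proof
    show "?L \<subseteq> ?R"
    proof clarify
      fix u :: "'e \<Rightarrow> real" assume u: "\<forall>b\<in>insert c B. \<bar>u b\<bar> \<le> R"
      have "(\<Sum>b\<in>insert c B. u b *\<^sub>R b) = (\<lambda>(s, x). s *\<^sub>R c + x) (u c, \<Sum>b\<in>B. u b *\<^sub>R b)"
        using insert.hyps by simp
      moreover have "(u c, \<Sum>b\<in>B. u b *\<^sub>R b) \<in> {-R..R} \<times> ?C"
        using u by (auto simp: abs_le_iff)
      ultimately show "(\<Sum>b\<in>insert c B. u b *\<^sub>R b) \<in> ?R" by (rule image_eqI)
    qed
    show "?R \<subseteq> ?L"
    proof clarify
      fix s u assume "s \<in> {-R..R}" "\<forall>b\<in>B. \<bar>u b\<bar> \<le> R"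
      moreover have "(\<Sum>b\<in>insert c B. (u(c := s)) b *\<^sub>R b) = s *\<^sub>R c + (\<Sum>b\<in>B. u b *\<^sub>R b)"
        using insert.hyps by (simp, intro sum.cong) auto
      ultimately show "\<exists>v. s *\<^sub>R c + (\<Sum>b\<in>B. u b *\<^sub>R b) = (\<Sum>b\<in>insert c B. v b *\<^sub>R b) \<and>
          (\<forall>b\<in>insert c B. \<bar>v b\<bar> \<le> R)"
        by (intro exI[of _ "u(c := s)"]) (auto simp: abs_le_iff)
    qed
  qed
  moreover have "compact ?R"
    using insert.IH
    by (intro compact_continuous_image compact_Times)
      (auto intro!: continuous_intros simp: case_prod_beta)
  ultimately show ?case by simp
qed

text \<open>Heine-Borel for the model space: by Cauchy-Schwarz the coordinates of a ball around 0
  are bounded, so the ball is a closed subset of a compact box; translation moves the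
  centre.\<close>

lemma compact_cball_coord_basis:
  assumes B: "coord_basis (B :: 'e::real_inner set)"
  shows "compact (cball (p::'e) r)"
proof -
  define N where "N = (\<Sum>b\<in>B. norm b)"
  have N: "norm b \<le> N" if "b \<in> B" for b
    unfolding N_def using that coord_basis_finite[OF B] by (intro member_le_sum) auto
  have sub: "cball 0 r \<subseteq> {(\<Sum>b\<in>B. u b *\<^sub>R b) |u. \<forall>b\<in>B. \<bar>u b\<bar> \<le> r * N}"
  proof
    fix x :: 'e assume x: "x \<in> cball 0 r"
    have "\<bar>x \<bullet> b\<bar> \<le> r * N" if "b \<in> B" for b
    proof -
      have "\<bar>x \<bullet> b\<bar> \<le> norm x * norm b" by (rule Cauchy_Schwarz_ineq2)
      also have "\<dots> \<le> r * N"
        using x N[OF that] order_trans[OF norm_ge_zero[of x], of r] by (intro mult_mono) auto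
      finally show ?thesis .
    qed
    then show "x \<in> {(\<Sum>b\<in>B. u b *\<^sub>R b) |u. \<forall>b\<in>B. \<bar>u b\<bar> \<le> r * N}"
      using coord_basis_expand[OF B, of x] by (auto intro!: exI[of _ "\<lambda>b. x \<bullet> b"])
  qed
  have "compact (cball (0::'e) r)"
    using compact_Int_closed[OF compact_box_sum[OF coord_basis_finite[OF B]] closed_cball, of "r * N" 0 r]
      sub by (simp add: Int_absorb1)
  then have "compact ((+) p ` cball 0 r)" by (intro compact_continuous_image) (auto intro: continuous_intros)
  then show ?thesis by (simp add: cball_translation)
qed

section \<open>Ray integrals, Hadamard's lemma and symmetry of second derivatives\<close>

lemma has_derivative_mean_value_form:
  fixes G :: "'e::real_inner \<Rightarrow> real"
  assumes B: "coord_basis B" and S: "open S" "convex S" and x: "x \<in> S"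
    and K: "\<And>b. b \<in> B \<Longrightarrow> continuous_on S (K b)"
    and mv: "\<And>y. y \<in> S \<Longrightarrow> \<exists>\<xi>\<in>closed_segment x y. G y - G x = (\<Sum>b\<in>B. ((y - x) \<bullet> b) * K b \<xi>)"
  shows "(G has_derivative (\<lambda>v. \<Sum>b\<in>B. (v \<bullet> b) * K b x)) (at x)"
  unfolding has_derivative_at_alt
proof (intro conjI allI impI)
  show "bounded_linear (\<lambda>v. \<Sum>b\<in>B. (v \<bullet> b) * K b x)"
    by (intro bounded_linear_sum bounded_linear_mult_left
        bounded_linear_compose[OF bounded_linear_mult_left bounded_linear_inner_left])
  fix e :: real assume e: "e > 0"
  \<comment> \<open>The sum of norms converts a bound on each \<open>K b\<close> into a bound on the
    whole sum; adding 1 keeps C positive in dimension zero.\<close>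
  define C where "C = (\<Sum>b\<in>B. norm b) + 1"
  have C: "C > 0" unfolding C_def by (simp add: add_nonneg_pos sum_nonneg)
  have "\<forall>\<^sub>F y in nhds x. \<forall>b\<in>B. dist (K b y) (K b x) < e / C"
  proof (intro eventually_ball_finite coord_basis_finite[OF B] ballI)
    fix b assume "b \<in> B"
    then have "isCont (K b) x" using K S x continuous_on_eq_continuous_at by blast
    then have "(K b \<longlongrightarrow> K b x) (nhds x)" by (simp add: continuous_at tendsto_at_iff_tendsto_nhds)
    then show "\<forall>\<^sub>F y in nhds x. dist (K b y) (K b x) < e / C"
      using e C tendstoD by (metis divide_pos_pos)
  qed
  moreover have "\<forall>\<^sub>F y in nhds x. y \<in> S" using S x eventually_nhds by blast
  ultimately have "\<forall>\<^sub>F y in nhds x. y \<in> S \<and> (\<forall>b\<in>B. dist (K b y) (K b x) < e / C)"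
    by (rule eventually_conj[rotated])
  then obtain d where d: "d > 0" "\<And>y. dist y x < d \<Longrightarrow> y \<in> S \<and> (\<forall>b\<in>B. dist (K b y) (K b x) < e / C)"
    unfolding eventually_nhds_metric by blast
  show "\<exists>d>0. \<forall>y. norm (y - x) < d \<longrightarrow>
      norm (G y - G x - (\<Sum>b\<in>B. ((y - x) \<bullet> b) * K b x)) \<le> e * norm (y - x)"
  proof (intro exI[of _ d] conjI d allI impI)
    fix y assume y: "norm (y - x) < d"
    then have "y \<in> S" using d by (simp add: dist_norm)
    from mv[OF this] obtain \<xi> where \<xi>: "\<xi> \<in> closed_segment x y"
      "G y - G x = (\<Sum>b\<in>B. ((y - x) \<bullet> b) * K b \<xi>)" by blast
    \<comment> \<open>The intermediate point is no farther from x than y is, so continuity of the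
      coefficients at x controls them at \<xi>.\<close>
    obtain u where "0 \<le> u" "u \<le> 1" "\<xi> = (1 - u) *\<^sub>R x + u *\<^sub>R y"
      using \<xi>(1) by (auto simp: closed_segment_def)
    then have "\<xi> - x = u *\<^sub>R (y - x)" by (simp add: algebra_simps)
    then have "dist \<xi> x = u * norm (y - x)" using \<open>0 \<le> u\<close> by (simp add: dist_norm)
    moreover have "u * norm (y - x) \<le> norm (y - x)"
      using \<open>u \<le> 1\<close> mult_right_mono[of u 1 "norm (y - x)"] by simp
    ultimately have "dist \<xi> x < d" using y by simp
    note k = d(2)[OF this]
    have "norm (G y - G x - (\<Sum>b\<in>B. ((y - x) \<bullet> b) * K b x)) =
        norm (\<Sum>b\<in>B. ((y - x) \<bullet> b) * (K b \<xi> - K b x))"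
      by (simp add: \<xi> sum_subtractf right_diff_distrib)
    also have "\<dots> \<le> (\<Sum>b\<in>B. (norm (y - x) * norm b) * (e / C))"
    proof (rule sum_norm_le)
      fix b assume b: "b \<in> B"
      have "norm ((y - x) \<bullet> b * (K b \<xi> - K b x)) = \<bar>(y - x) \<bullet> b\<bar> * dist (K b \<xi>) (K b x)"
        by (simp add: abs_mult dist_real_def)
      also have "\<dots> \<le> (norm (y - x) * norm b) * (e / C)"
        using k b by (intro mult_mono Cauchy_Schwarz_ineq2) auto
      finally show "norm ((y - x) \<bullet> b * (K b \<xi> - K b x)) \<le> (norm (y - x) * norm b) * (e / C)" .
    qed
    also have "\<dots> = (C - 1) * (e / C) * norm (y - x)"
      by (simp add: C_def sum_distrib_left sum_distrib_right sum_divide_distrib algebra_simps)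
    also have "\<dots> \<le> e * norm (y - x)"
      using C e by (intro mult_right_mono) (auto simp: field_simps)
    finally show "norm (G y - G x - (\<Sum>b\<in>B. ((y - x) \<bullet> b) * K b x)) \<le> e * norm (y - x)" .
  qed
qed

text \<open>The weight \<open>t ^ j\<close> makes the family closed under differentiation in x: the
  chain rule brings out one factor t each time. Weight 0 is the case that occurs in Hadamard's
  lemma.\<close>

definition ray_integral :: "'e::real_inner \<Rightarrow> nat \<Rightarrow> ('e \<Rightarrow> real) \<Rightarrow> 'e \<Rightarrow> real" where
  "ray_integral p j \<phi> x = integral {0..1} (\<lambda>t. t ^ j * \<phi> (p + t *\<^sub>R (x - p)))"

lemma convex_ray:
  assumes "convex S" "p \<in> S" "x \<in> S" "0 \<le> t" "t \<le> 1"
  shows "p + t *\<^sub>R (x - p) \<in> S"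
proof -
  have "p + t *\<^sub>R (x - p) = (1 - t) *\<^sub>R p + t *\<^sub>R x" by (simp add: algebra_simps)
  then show ?thesis using assms convexD_alt[of S p x t] by simp
qed

lemma continuous_on_ray_integrand:
  fixes p :: "'e::real_normed_vector"
  assumes "convex S" "p \<in> S" "continuous_on S \<phi>"
  shows "continuous_on (S \<times> {0..1}) (\<lambda>(x, t). t ^ j * (\<phi> (p + t *\<^sub>R (x - p)) :: real))"
proof -
  have "continuous_on (S \<times> {0..1}) (\<lambda>x. \<phi> (p + snd x *\<^sub>R (fst x - p)))"
    by (rule continuous_on_compose2[OF assms(3)], intro continuous_intros)
      (use convex_ray[OF assms(1,2)] in auto)
  then show ?thesis
    unfolding case_prod_beta by (intro continuous_intros)
qed

lemma continuous_on_ray_integral: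
  assumes "convex S" "p \<in> S" "continuous_on S \<phi>"
  shows "continuous_on S (ray_integral p j \<phi>)"
proof -
  have "continuous_on S (\<lambda>x. integral (cbox 0 1) (\<lambda>t. t ^ j * \<phi> (p + t *\<^sub>R (x - p))))"
    by (rule integral_continuous_on_param) (simp add: continuous_on_ray_integrand[OF assms])
  then show ?thesis by (simp add: ray_integral_def[abs_def])
qed

lemma ray_integral_integrable:
  fixes p :: "'e::real_normed_vector"
  assumes "convex S" "p \<in> S" "continuous_on S \<phi>" "x \<in> S"
  shows "(\<lambda>t. t ^ j * \<phi> (p + t *\<^sub>R (x - p))) integrable_on {0..1::real}"
proof -
  have "continuous_on {0..1} (\<lambda>t. \<phi> (p + t *\<^sub>R (x - p)))"
    by (rule continuous_on_compose2[OF assms(3)], intro continuous_intros)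
      (use convex_ray[OF assms(1,2,4)] in auto)
  then show ?thesis
    by (intro integrable_continuous_real continuous_intros)
qed

lemma ray_integral_sum:
  assumes "convex S" "p \<in> S" "\<And>b. b \<in> B \<Longrightarrow> continuous_on S (\<phi> b)" "x \<in> S" "finite B"
  shows "ray_integral p j (\<lambda>y. \<Sum>b\<in>B. c b * \<phi> b y) x = (\<Sum>b\<in>B. c b * ray_integral p j (\<phi> b) x)"
proof -
  have "ray_integral p j (\<lambda>y. \<Sum>b\<in>B. c b * \<phi> b y) x =
      integral {0..1} (\<lambda>t. \<Sum>b\<in>B. c b * (t ^ j * \<phi> b (p + t *\<^sub>R (x - p))))"
    by (simp add: ray_integral_def sum_distrib_left mult_ac)
  also have "\<dots> = (\<Sum>b\<in>B. c b * ray_integral p j (\<phi> b) x)"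
    using assms by (subst integral_sum)
      (auto simp: ray_integral_def intro!: integrable_on_mult_right ray_integral_integrable)
  finally show ?thesis .
qed

text \<open>Restricting to the segment from x to y leaves one real variable: the integral is
  differentiated under the integral sign and the one-variable mean value theorem is applied.
  \<open>has_derivative_mean_value_form\<close> turns the result into a total derivative.\<close>

lemma ray_integral_mean_value:
  fixes B :: "'e::real_inner set" and p :: 'e
  assumes B: "coord_basis B" and S: "open S" "convex S" and p: "p \<in> S" and xy: "x \<in> S" "y \<in> S"
    and d: "\<And>x. x \<in> S \<Longrightarrow> (\<phi> has_derivative \<phi>' x) (at x)"
    and c: "\<And>v. continuous_on S (\<lambda>x. \<phi>' x v)"
  shows "\<exists>\<xi>\<in>closed_segment x y. ray_integral p j \<phi> y - ray_integral p j \<phi> x =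
    (\<Sum>b\<in>B. ((y - x) \<bullet> b) * ray_integral p (Suc j) (\<lambda>z. \<phi>' z b) \<xi>)"
proof -
  let ?f = "\<lambda>s t. t ^ j * \<phi> (p + t *\<^sub>R (x + s *\<^sub>R (y - x) - p))"
  let ?f' = "\<lambda>s t. t ^ Suc j * \<phi>' (p + t *\<^sub>R (x + s *\<^sub>R (y - x) - p)) (y - x)"
  have seg: "x + s *\<^sub>R (y - x) \<in> S" if "s \<in> {0..1}" for s
    using convex_ray[OF S(2) xy] that by simp
  have c\<phi>: "continuous_on S \<phi>"
    using d has_derivative_continuous by (blast intro: continuous_at_imp_continuous_on)
  have "((\<lambda>s. integral (cbox 0 1) (?f s)) has_real_derivative integral (cbox 0 1) (?f' s)) (at s within {0..1})"
    if s: "s \<in> {0..1}" for s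
  proof (rule leibniz_rule_field_derivative[where U="{0..1}"])
    fix s t :: real assume st: "s \<in> {0..1}" "t \<in> cbox 0 1"
    let ?z = "p + t *\<^sub>R (x + s *\<^sub>R (y - x) - p)"
    have zS: "?z \<in> S" using convex_ray[OF S(2) p seg[OF st(1)]] st(2) by simp
    have "((\<lambda>s. p + t *\<^sub>R (x + s *\<^sub>R (y - x) - p)) has_derivative (\<lambda>h. h *\<^sub>R t *\<^sub>R (y - x))) (at s within {0..1})"
      by (auto intro!: derivative_eq_intros simp: mult.commute)
    from has_derivative_compose[OF this d[OF zS]]
    have "((\<lambda>s. \<phi> (p + t *\<^sub>R (x + s *\<^sub>R (y - x) - p))) has_derivative (\<lambda>h. \<phi>' ?z (h *\<^sub>R t *\<^sub>R (y - x)))) (at s within {0..1})" .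
    moreover have "\<phi>' ?z (h *\<^sub>R t *\<^sub>R (y - x)) = h * (t * \<phi>' ?z (y - x))" for h
      using has_derivative_linear[OF d[OF zS]] by (simp add: linear_cmul)
    ultimately have "((\<lambda>s. \<phi> (p + t *\<^sub>R (x + s *\<^sub>R (y - x) - p))) has_real_derivative t * \<phi>' ?z (y - x)) (at s within {0..1})"
      by (simp add: has_field_derivative_def mult.commute[of _ "t * _"])
    from DERIV_cmult[OF this, of "t ^ j"]
    show "((\<lambda>s. ?f s t) has_real_derivative ?f' s t) (at s within {0..1})"
      by (simp add: mult_ac)
  next
    fix s :: real assume s: "s \<in> {0..1}"
    show "(?f s) integrable_on cbox 0 1"
      using ray_integral_integrable[OF S(2) p c\<phi> seg[OF s]] by simp
  next
    show "continuous_on ({0..1} \<times> cbox 0 1) (\<lambda>(s, t). ?f' s t)"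
    proof -
      have "continuous_on ({0..1} \<times> {0..1})
          (\<lambda>z. \<phi>' (p + snd z *\<^sub>R (x + fst z *\<^sub>R (y - x) - p)) (y - x))"
        by (rule continuous_on_compose2[OF c], intro continuous_intros)
          (use convex_ray[OF S(2) p seg] in auto)
      then show ?thesis
        unfolding case_prod_beta cbox_interval by (intro continuous_intros)
    qed
  qed (use s in auto)
  then have D: "((\<lambda>s. integral (cbox 0 1) (?f s)) has_derivative (\<lambda>h. h * integral (cbox 0 1) (?f' s))) (at s within {0..1})"
    if "0 \<le> s" "s \<le> 1" for s
    using that by (simp add: has_field_derivative_def mult.commute[of _ "integral _ _"])
  obtain s where s: "s \<in> {0<..<1}" "integral (cbox 0 1) (?f 1) - integral (cbox 0 1) (?f 0) =
      (1 - 0) * integral (cbox 0 1) (?f' s)"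
    using mvt_simple[OF zero_less_one D] by blast
  let ?\<xi> = "x + s *\<^sub>R (y - x)"
  have s01: "s \<in> {0..1}" using s by simp
  have "integral (cbox 0 1) (?f' s) = ray_integral p (Suc j) (\<lambda>z. \<phi>' z (y - x)) ?\<xi>"
    by (simp add: ray_integral_def)
  also have "\<dots> = ray_integral p (Suc j) (\<lambda>z. \<Sum>b\<in>B. ((y - x) \<bullet> b) * \<phi>' z b) ?\<xi>"
    unfolding ray_integral_def
  proof (rule integral_cong)
    fix t :: real assume "t \<in> {0..1}"
    then have "p + t *\<^sub>R (?\<xi> - p) \<in> S" using convex_ray[OF S(2) p seg[OF s01]] by simp
    from coord_basis_linear[OF B has_derivative_linear[OF d[OF this]], of "y - x"]
    show "t ^ Suc j * \<phi>' (p + t *\<^sub>R (?\<xi> - p)) (y - x) =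
      t ^ Suc j * (\<Sum>b\<in>B. ((y - x) \<bullet> b) * \<phi>' (p + t *\<^sub>R (?\<xi> - p)) b)" by simp
  qed
  also have "\<dots> = (\<Sum>b\<in>B. ((y - x) \<bullet> b) * ray_integral p (Suc j) (\<lambda>z. \<phi>' z b) ?\<xi>)"
    using coord_basis_finite[OF B] by (intro ray_integral_sum[OF S(2) p c seg[OF s01]])
  finally have "integral (cbox 0 1) (?f' s) = \<dots>" .
  moreover have "?\<xi> \<in> closed_segment x y"
    using s01 by (auto simp: closed_segment_def algebra_simps intro!: exI[of _ s])
  ultimately show ?thesis using s by (auto simp: ray_integral_def intro!: bexI[of _ ?\<xi>])
qed

text \<open>The partial derivatives are ray integrals of the partial derivatives of \<phi> with
  weight raised by one, so the induction on k must leave both \<phi> and j free.\<close>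

lemma C_k_on_ray_integral:
  fixes B :: "'e::real_inner set" and p :: 'e
  assumes B: "coord_basis B" and S: "open S" "convex S" and p: "p \<in> S"
  shows "C_k_on k S \<phi> \<Longrightarrow> C_k_on k S (ray_integral p j \<phi>)"
proof (induction k arbitrary: \<phi> j)
  case 0
  then show ?case using continuous_on_ray_integral[OF S(2) p] by simp
next
  case (Suc k)
  obtain \<phi>' where d: "\<And>x. x \<in> S \<Longrightarrow> (\<phi> has_derivative \<phi>' x) (at x)"
    and k: "\<And>v. C_k_on k S (\<lambda>x. \<phi>' x v)"
    using C_k_on_SucE[OF Suc.prems] by blast
  have c: "continuous_on S (\<lambda>x. \<phi>' x v)" for v
    using C_k_on_mono[OF k[of v] order_refl]
  proof (induction k)
    case (Suc k) then show ?case using C_k_on_SucD by blast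
  qed simp
  let ?K = "\<lambda>b. ray_integral p (Suc j) (\<lambda>z. \<phi>' z b)"
  have "(ray_integral p j \<phi> has_derivative (\<lambda>v. \<Sum>b\<in>B. (v \<bullet> b) * ?K b x)) (at x)" if "x \<in> S" for x
    using has_derivative_mean_value_form[OF B S that, of ?K]
      continuous_on_ray_integral[OF S(2) p c] ray_integral_mean_value[OF B S p that _ d c] by blast
  moreover have "C_k_on k S (\<lambda>x. \<Sum>b\<in>B. (v \<bullet> b) *\<^sub>R ?K b x)" for v
    by (intro C_k_on_sum C_k_on_scaleR C_k_on_const Suc.IH k)
  ultimately show ?case
    unfolding C_k_on.simps by (intro exI[of _ "\<lambda>x v. \<Sum>b\<in>B. (v \<bullet> b) * ?K b x"]) simp
qed

text \<open>By the fundamental theorem of calculus on the segment from p to x, f x - f p is the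
  integral of the derivative in direction x - p. Expanding that direction in B gives ray integrals
  as coefficients; at x = p the integrand is constant.\<close>

lemma Hadamard:
  fixes f :: "'e::real_inner \<Rightarrow> real"
  assumes B: "coord_basis B" and S: "open S" "convex S" and p: "p \<in> S" and f: "smooth_on S f"
  shows "\<exists>g. (\<forall>b\<in>B. smooth_on S (g b) \<and> g b p = frechet_derivative f (at p) b) \<and>
    (\<forall>x\<in>S. f x = f p + (\<Sum>b\<in>B. ((x - p) \<bullet> b) * g b x))"
proof -
  let ?D = "\<lambda>b x. frechet_derivative f (at x) b"
  define g where "g b = ray_integral p 0 (?D b)" for b
  have D: "smooth_on S (?D b)" for b by (rule smooth_on_frechet_derivative[OF S(1) f])
  have "smooth_on S (g b)" for b
    using D[of b] C_k_on_ray_integral[OF B S p] unfolding g_def smooth_on_def by blast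
  moreover have "g b p = ?D b p" for b by (simp add: g_def ray_integral_def)
  moreover have "f x = f p + (\<Sum>b\<in>B. ((x - p) \<bullet> b) * g b x)" if x: "x \<in> S" for x
  proof -
    have "((\<lambda>t. f (p + t *\<^sub>R (x - p))) has_vector_derivative
        (\<Sum>b\<in>B. ((x - p) \<bullet> b) * ?D b (p + t *\<^sub>R (x - p)))) (at t within {0..1})"
      if t: "t \<in> {0..1}" for t
    proof -
      let ?z = "p + t *\<^sub>R (x - p)"
      have z: "?z \<in> S" using convex_ray[OF S(2) p x] t by simp
      note d = smooth_on_has_derivative[OF f z]
      have "((\<lambda>t. p + t *\<^sub>R (x - p)) has_derivative (\<lambda>h. h *\<^sub>R (x - p))) (at t within {0..1})"
        by (auto intro!: derivative_eq_intros)
      from has_derivative_compose[OF this d]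
      have "((\<lambda>t. f (p + t *\<^sub>R (x - p))) has_derivative
          (\<lambda>h. frechet_derivative f (at ?z) (h *\<^sub>R (x - p)))) (at t within {0..1})" .
      moreover have "frechet_derivative f (at ?z) (h *\<^sub>R (x - p)) =
          h *\<^sub>R (\<Sum>b\<in>B. ((x - p) \<bullet> b) * ?D b ?z)" for h
        using has_derivative_linear[OF d] coord_basis_linear[OF B has_derivative_linear[OF d], of "x - p"]
        by (simp add: linear_cmul)
      ultimately show ?thesis by (simp add: has_vector_derivative_def)
    qed
    from fundamental_theorem_of_calculus[OF zero_le_one this]
    have "((\<lambda>t. \<Sum>b\<in>B. ((x - p) \<bullet> b) * ?D b (p + t *\<^sub>R (x - p))) has_integral f x - f p) {0..1}"
      by simp
    then have "f x - f p = ray_integral p 0 (\<lambda>y. \<Sum>b\<in>B. ((x - p) \<bullet> b) * ?D b y) x"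
      by (simp add: ray_integral_def integral_unique)
    also have "\<dots> = (\<Sum>b\<in>B. ((x - p) \<bullet> b) * g b x)"
      unfolding g_def
      by (intro ray_integral_sum[OF S(2) p] x coord_basis_finite[OF B] smooth_on_continuous D)
    finally show ?thesis by simp
  qed
  ultimately show ?thesis by blast
qed

text \<open>Hadamard's lemma applied twice writes f near p as an affine function plus a quadratic
  expression in x - p with smooth coefficients \<open>h b c\<close>. Its second derivative at p
  involves only the values \<open>h b c p\<close> and is visibly symmetric in u and v.\<close>

lemma frechet_derivative_commute:
  fixes f :: "'e::real_inner \<Rightarrow> real"
  assumes B: "coord_basis (B :: 'e set)" and S: "open S" "convex S" and p: "p \<in> S" and f: "smooth_on S f"
  shows "frechet_derivative (\<lambda>x. frechet_derivative f (at x) v) (at p) u =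
    frechet_derivative (\<lambda>x. frechet_derivative f (at x) u) (at p) v"
proof -
  obtain g where g: "\<And>b. b \<in> B \<Longrightarrow> smooth_on S (g b)"
    "\<And>x. x \<in> S \<Longrightarrow> f x = f p + (\<Sum>b\<in>B. ((x - p) \<bullet> b) * g b x)"
    using Hadamard[OF B S p f] by blast
  have "\<forall>b\<in>B. \<exists>h. (\<forall>c\<in>B. smooth_on S (h c)) \<and> (\<forall>x\<in>S. g b x = g b p + (\<Sum>c\<in>B. ((x - p) \<bullet> c) * h c x))"
    using Hadamard[OF B S p g(1)] by blast
  then obtain h where h: "\<And>b c. b \<in> B \<Longrightarrow> c \<in> B \<Longrightarrow> smooth_on S (h b c)"
    "\<And>b x. b \<in> B \<Longrightarrow> x \<in> S \<Longrightarrow> g b x = g b p + (\<Sum>c\<in>B. ((x - p) \<bullet> c) * h b c x)"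
    by metis
  have f_eq: "f x = f p + (\<Sum>b\<in>B. ((x - p) \<bullet> b) * g b p + (\<Sum>c\<in>B. ((x - p) \<bullet> b) * ((x - p) \<bullet> c) * h b c x))"
    if x: "x \<in> S" for x
    unfolding g(2)[OF x]
    by (intro arg_cong2[where f="(+)"] refl sum.cong)
      (simp add: h(2)[OF _ x] distrib_left sum_distrib_left mult.assoc)
  let ?D = "\<lambda>b c v x. frechet_derivative (h b c) (at x) v"
  let ?E = "\<lambda>v x. \<Sum>b\<in>B. (v \<bullet> b) * g b p + (\<Sum>c\<in>B.
    ((v \<bullet> b) * ((x - p) \<bullet> c) + ((x - p) \<bullet> b) * (v \<bullet> c)) * h b c x + ((x - p) \<bullet> b) * ((x - p) \<bullet> c) * ?D b c v x)"
  have l: "((\<lambda>x. (x - p) \<bullet> b) has_derivative (\<lambda>v. v \<bullet> b)) (at x)" for b x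
    by (auto intro!: derivative_eq_intros)
  have E1: "frechet_derivative f (at x) v = ?E v x" if x: "x \<in> S" for x v
  proof -
    note hd = smooth_on_has_derivative[OF h(1) x]
    have "((\<lambda>x. f p + (\<Sum>b\<in>B. ((x - p) \<bullet> b) * g b p + (\<Sum>c\<in>B. ((x - p) \<bullet> b) * ((x - p) \<bullet> c) * h b c x)))
        has_derivative (\<lambda>v. 0 + ?E v x)) (at x)"
    proof (intro has_derivative_add has_derivative_const has_derivative_sum has_derivative_mult_left l)
      fix b c assume "b \<in> B" "c \<in> B"
      from has_derivative_mult[OF has_derivative_mult[OF l[of b x] l[of c x]] hd[OF this]]
      show "((\<lambda>x. ((x - p) \<bullet> b) * ((x - p) \<bullet> c) * h b c x) has_derivative
        (\<lambda>v. ((v \<bullet> b) * ((x - p) \<bullet> c) + ((x - p) \<bullet> b) * (v \<bullet> c)) * h b c x +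
          ((x - p) \<bullet> b) * ((x - p) \<bullet> c) * ?D b c v x)) (at x)"
        by (rule has_derivative_eq_rhs) (auto simp: algebra_simps)
    qed
    then have "(f has_derivative (\<lambda>v. 0 + ?E v x)) (at x)"
      by (rule has_derivative_transform_within_open[OF _ S(1) x]) (simp add: f_eq)
    from fun_cong[OF frechet_derivative_at[OF this], of v] show ?thesis by simp
  qed
  \<comment> \<open>Every term of the derivative that keeps a factor x - p vanishes at p, including
    those with derivatives of \<open>h b c\<close>.\<close>
  have E2: "frechet_derivative (?E v) (at p) u =
      (\<Sum>b\<in>B. \<Sum>c\<in>B. ((v \<bullet> b) * (u \<bullet> c) + (u \<bullet> b) * (v \<bullet> c)) * h b c p)" for u v
  proof -
    note hd = smooth_on_has_derivative[OF h(1) p]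
    note Dd = smooth_on_has_derivative[OF smooth_on_frechet_derivative[OF S(1) h(1)] p]
    have "(?E v has_derivative (\<lambda>u. \<Sum>b\<in>B. 0 + (\<Sum>c\<in>B. ((v \<bullet> b) * (u \<bullet> c) + (u \<bullet> b) * (v \<bullet> c)) * h b c p + 0))) (at p)"
    proof (intro has_derivative_add has_derivative_const has_derivative_sum)
      fix b c assume bc: "b \<in> B" "c \<in> B"
      have "((\<lambda>x. (v \<bullet> b) * ((x - p) \<bullet> c) + ((x - p) \<bullet> b) * (v \<bullet> c)) has_derivative
          (\<lambda>u. (v \<bullet> b) * (u \<bullet> c) + (u \<bullet> b) * (v \<bullet> c))) (at p)"
        by (intro has_derivative_add has_derivative_mult_left has_derivative_mult_right l)
      from has_derivative_mult[OF this hd[OF bc]]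
      show "((\<lambda>x. ((v \<bullet> b) * ((x - p) \<bullet> c) + ((x - p) \<bullet> b) * (v \<bullet> c)) * h b c x) has_derivative
          (\<lambda>u. ((v \<bullet> b) * (u \<bullet> c) + (u \<bullet> b) * (v \<bullet> c)) * h b c p)) (at p)"
        by (rule has_derivative_eq_rhs) auto
      from has_derivative_mult[OF has_derivative_mult[OF l[of b p] l[of c p]] Dd[OF bc, of v]]
      show "((\<lambda>x. ((x - p) \<bullet> b) * ((x - p) \<bullet> c) * ?D b c v x) has_derivative (\<lambda>u. 0)) (at p)"
        by (rule has_derivative_eq_rhs) auto
    qed
    from fun_cong[OF frechet_derivative_at[OF this], of u] show ?thesis by simp
  qed
  have E3: "frechet_derivative (\<lambda>x. frechet_derivative f (at x) v) (at p) = frechet_derivative (?E v) (at p)" for v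
  proof -
    have "((\<lambda>x. frechet_derivative f (at x) v) has_derivative frechet_derivative (\<lambda>x. frechet_derivative f (at x) v) (at p)) (at p)"
      by (rule smooth_on_has_derivative[OF smooth_on_frechet_derivative[OF S(1) f] p])
    then have "(?E v has_derivative frechet_derivative (\<lambda>x. frechet_derivative f (at x) v) (at p)) (at p)"
      by (rule has_derivative_transform_within_open[OF _ S(1) p]) (simp add: E1)
    then show ?thesis by (rule frechet_derivative_at)
  qed
  show ?thesis unfolding E3 E2 by (simp add: algebra_simps)
qed

section \<open>Smooth functions and point derivations\<close>

lemma smooth_atlas_coord_basis:
  "smooth_atlas (A :: ('m::topological_space, 'e::real_inner) chart set) \<Longrightarrow> \<exists>B::'e set. coord_basis B"
  unfolding smooth_atlas_def using finite_span_imp_coord_basis by blast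

lemma smooth_atlas_cover: "smooth_atlas A \<Longrightarrow> \<exists>U \<phi>. (U, \<phi>) \<in> A \<and> p \<in> U"
  unfolding smooth_atlas_def by blast

lemma chart_facts:
  assumes "smooth_atlas A" "(U, \<phi>) \<in> A"
  shows chart_open: "open U" and chart_image_open: "open (\<phi> ` U)"
    and chart_continuous: "continuous_on U \<phi>"
    and chart_inv_continuous: "continuous_on (\<phi> ` U) (inv_into U \<phi>)"
    and chart_inv: "p \<in> U \<Longrightarrow> inv_into U \<phi> (\<phi> p) = p"
    and chart_inj: "inj_on \<phi> U"
proof -
  have *: "open U \<and> open (\<phi> ` U) \<and> homeomorphism U (\<phi> ` U) \<phi> (inv_into U \<phi>)"
    using assms unfolding smooth_atlas_def by blast
  show "open U" "open (\<phi> ` U)" using * by auto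
  have h: "homeomorphism U (\<phi> ` U) \<phi> (inv_into U \<phi>)" using * by blast
  show "continuous_on U \<phi>" "continuous_on (\<phi> ` U) (inv_into U \<phi>)"
    and 1: "\<And>p. p \<in> U \<Longrightarrow> inv_into U \<phi> (\<phi> p) = p"
    using h unfolding homeomorphism_def by auto
  show "inj_on \<phi> U" using 1 by (metis inj_onI)
qed

lemma chart_open_image:
  assumes "smooth_atlas A" "(U, \<phi>) \<in> A" "open W" "W \<subseteq> U"
  shows "open (\<phi> ` W)"
proof -
  note c = chart_facts[OF assms(1,2)]
  have "\<phi> ` W = \<phi> ` U \<inter> inv_into U \<phi> -` W"
    using assms(4) c(5) by auto
  then show ?thesis
    using continuous_open_preimage[OF c(4) c(2) assms(3)] by simp
qed

lemma chart_transition: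
  assumes "smooth_atlas A" "(U, \<phi>) \<in> A" "(V, \<psi>) \<in> A"
  shows "smooth_on (\<phi> ` (U \<inter> V)) (\<psi> \<circ> inv_into U \<phi>)"
  using assms unfolding smooth_atlas_def by blast

definition smooth_at :: "('m::topological_space, 'e::real_inner) chart set \<Rightarrow> 'm \<Rightarrow> ('m \<Rightarrow> real) \<Rightarrow> bool" where
  "smooth_at A p f \<longleftrightarrow> (\<exists>U \<phi> W. (U, \<phi>) \<in> A \<and> open W \<and> p \<in> W \<and> W \<subseteq> U \<and> smooth_on (\<phi> ` W) (f \<circ> inv_into U \<phi>))"

lemma smooth_funsD: "f \<in> smooth_funs A \<Longrightarrow> (U, \<phi>) \<in> A \<Longrightarrow> smooth_on (\<phi> ` U) (f \<circ> inv_into U \<phi>)"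
  unfolding smooth_funs_def by blast

text \<open>Smoothness in one freely chosen chart around each point passes to all charts by
  composing with transition maps, since smoothness of a function on an open set is local.\<close>

lemma smooth_funsI:
  assumes A: "smooth_atlas (A :: ('m::topological_space, 'e::real_inner) chart set)"
    and loc: "\<And>p. smooth_at A p f"
  shows "f \<in> smooth_funs A"
proof -
  obtain B :: "'e set" where B: "coord_basis B" using smooth_atlas_coord_basis[OF A] by blast
  have "smooth_on (\<psi> ` V) (f \<circ> inv_into V \<psi>)" if V: "(V, \<psi>) \<in> A" for V \<psi>
  proof (rule smooth_on_local[OF chart_image_open[OF A V]])
    fix y assume "y \<in> \<psi> ` V"
    then obtain q where q: "q \<in> V" "y = \<psi> q" by blast
    obtain U \<phi> W where U: "(U, \<phi>) \<in> A" and W: "open W" "q \<in> W" "W \<subseteq> U"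
      and s: "smooth_on (\<phi> ` W) (f \<circ> inv_into U \<phi>)"
      using loc[of q] unfolding smooth_at_def by blast
    let ?T = "\<psi> ` (V \<inter> W)"
    have T: "open ?T" by (rule chart_open_image[OF A V]) (use chart_open[OF A V] W in auto)
    have "smooth_on ?T (\<phi> \<circ> inv_into V \<psi>)"
      by (rule smooth_on_mono[OF chart_transition[OF A V U]]) (use W in auto)
    moreover have "(\<phi> \<circ> inv_into V \<psi>) ` ?T \<subseteq> \<phi> ` W"
      using chart_inv[OF A V] by auto
    ultimately have "smooth_on ?T (\<lambda>x. (f \<circ> inv_into U \<phi>) ((\<phi> \<circ> inv_into V \<psi>) x))"
      by (rule smooth_on_compose[OF B s])
    then have "smooth_on ?T (f \<circ> inv_into V \<psi>)"
      by (rule smooth_on_cong[OF T]) (use chart_inv[OF A V] chart_inv[OF A U] W(3) in auto)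
    then show "\<exists>T. open T \<and> y \<in> T \<and> smooth_on T (f \<circ> inv_into V \<psi>)"
      using T q W by blast
  qed
  then show ?thesis unfolding smooth_funs_def by blast
qed

lemma smooth_at_chart_comp:
  assumes A: "smooth_atlas A" and U: "(U, \<phi>) \<in> A" and W: "open W" "p \<in> W" "W \<subseteq> U"
    and s: "smooth_on (\<phi> ` W) h" and eq: "\<And>q. q \<in> W \<Longrightarrow> f q = h (\<phi> q)"
  shows "smooth_at A p f"
proof -
  have "smooth_on (\<phi> ` W) (f \<circ> inv_into U \<phi>)"
    by (rule smooth_on_cong[OF chart_open_image[OF A U W(1,3)] s])
      (use W eq chart_inv[OF A U] in auto)
  then show ?thesis using U W unfolding smooth_at_def by blast
qed

lemma smooth_funs_const: "(\<lambda>x. c) \<in> smooth_funs A"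
  by (auto simp: smooth_funs_def o_def smooth_on_const)

lemma smooth_funs_add: "f \<in> smooth_funs A \<Longrightarrow> h \<in> smooth_funs A \<Longrightarrow> (\<lambda>x. f x + h x) \<in> smooth_funs A"
  using smooth_on_add by (fastforce simp: smooth_funs_def o_def)

lemma smooth_funs_mult: "f \<in> smooth_funs A \<Longrightarrow> h \<in> smooth_funs A \<Longrightarrow> (\<lambda>x. f x * h x) \<in> smooth_funs A"
  using smooth_on_mult by (fastforce simp: smooth_funs_def o_def)

lemma smooth_funs_cmult: "f \<in> smooth_funs A \<Longrightarrow> (\<lambda>x. c * f x) \<in> smooth_funs A"
  using smooth_funs_mult[OF smooth_funs_const] by blast

lemma smooth_funs_minus: "f \<in> smooth_funs A \<Longrightarrow> (\<lambda>x. - f x) \<in> smooth_funs A"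
  using smooth_funs_cmult[of f A "-1"] by simp

lemma smooth_funs_diff: "f \<in> smooth_funs A \<Longrightarrow> h \<in> smooth_funs A \<Longrightarrow> (\<lambda>x. f x - h x) \<in> smooth_funs A"
  using smooth_funs_add[OF _ smooth_funs_minus] by fastforce

lemma smooth_funs_sum:
  "(\<And>i. i \<in> I \<Longrightarrow> f i \<in> smooth_funs A) \<Longrightarrow> (\<lambda>x. \<Sum>i\<in>I. f i x) \<in> smooth_funs A"
  by (induction I rule: infinite_finite_induct) (auto simp: smooth_funs_const intro: smooth_funs_add)

lemma smooth_funs_fun_ops:
  "0 \<in> smooth_funs A" "1 \<in> smooth_funs A"
  "f \<in> smooth_funs A \<Longrightarrow> h \<in> smooth_funs A \<Longrightarrow> f + h \<in> smooth_funs A"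
  "f \<in> smooth_funs A \<Longrightarrow> h \<in> smooth_funs A \<Longrightarrow> f * h \<in> smooth_funs A"
  "f \<in> smooth_funs A \<Longrightarrow> h \<in> smooth_funs A \<Longrightarrow> f - h \<in> smooth_funs A"
  "f \<in> smooth_funs A \<Longrightarrow> - f \<in> smooth_funs A"
  "f \<in> smooth_funs A \<Longrightarrow> c *\<^sub>R f \<in> smooth_funs A"
  using smooth_funs_const[of 0 A] smooth_funs_const[of 1 A] smooth_funs_add[of f A h]
    smooth_funs_mult[of f A h] smooth_funs_diff[of f A h] smooth_funs_minus[of f A]
    smooth_funs_cmult[of f A c]
  by (simp_all add: zero_fun_def one_fun_def plus_fun_def times_fun_def fun_diff_def fun_Compl_def
      scaleR_fun_def)

text \<open>The components of g are globally smooth functions, so g can be the cut-off coordinates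
  of a map into another manifold, which are correct only on W.\<close>

lemma smooth_at_comp:
  fixes g :: "'m::topological_space \<Rightarrow> 'd::real_inner"
  assumes A: "smooth_atlas A" and C: "coord_basis C" and g: "\<And>c. c \<in> C \<Longrightarrow> (\<lambda>x. g x \<bullet> c) \<in> smooth_funs A"
    and W: "open W" "p \<in> W" and F: "smooth_on T F" and gT: "\<And>x. x \<in> W \<Longrightarrow> g x \<in> T"
    and eq: "\<And>x. x \<in> W \<Longrightarrow> f x = F (g x)"
  shows "smooth_at A p f"
proof -
  obtain U \<phi> where U: "(U, \<phi>) \<in> A" "p \<in> U" using smooth_atlas_cover[OF A] by blast
  let ?S = "\<phi> ` (W \<inter> U)"
  have "smooth_on ?S (\<lambda>y. g (inv_into U \<phi> y))"
  proof (rule smooth_on_componentwise[OF C])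
    fix c assume "c \<in> C"
    from smooth_on_mono[OF smooth_funsD[OF g[OF this] U(1)], of ?S]
    show "smooth_on ?S (\<lambda>y. g (inv_into U \<phi> y) \<bullet> c)" by (simp add: o_def image_mono)
  qed
  then have "smooth_on ?S (\<lambda>y. F (g (inv_into U \<phi> y)))"
    by (rule smooth_on_compose[OF C F]) (use gT chart_inv[OF A U(1)] in auto)
  then show ?thesis
    by (rule smooth_at_chart_comp[OF A U(1), rotated 3])
      (use chart_open[OF A U(1)] W U eq chart_inv[OF A U(1)] in auto)
qed

text \<open>The support lies in K, the image of a compact coordinate ball. Hausdorffness makes K
  closed in the whole manifold, so points outside U have a neighbourhood on which the extension by 0
  vanishes and smoothness holds there too.\<close>

lemma bump_function:
  fixes A :: "('m::t2_space, 'e::real_inner) chart set"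
  assumes A: "smooth_atlas A" and U: "(U, \<phi>) \<in> A" and W: "open W" "W \<subseteq> U" "p \<in> W"
  shows "\<exists>\<eta>\<in>smooth_funs A. \<exists>W' K. open W' \<and> p \<in> W' \<and> W' \<subseteq> K \<and> closed K \<and> K \<subseteq> W \<and>
    (\<forall>x\<in>W'. \<eta> x = 1) \<and> (\<forall>x. x \<notin> K \<longrightarrow> \<eta> x = 0)"
proof -
  obtain B :: "'e set" where B: "coord_basis B" using smooth_atlas_coord_basis[OF A] by blast
  have "open (\<phi> ` W)" by (rule chart_open_image[OF A U W(1,2)])
  then obtain r where r: "r > 0" "ball (\<phi> p) r \<subseteq> \<phi> ` W"
    using W(3) by (metis imageI openE)
  \<comment> \<open>Since 2 s < r, even the closed ball of radius 2 s around the centre lies in the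
    chart image of W.\<close>
  define s where "s = r / 3"
  have s: "s > 0" "cball (\<phi> p) (2 * s) \<subseteq> \<phi> ` W"
    using r by (auto simp: s_def subset_iff)
  obtain \<mu> :: "'e \<Rightarrow> real" where \<mu>: "smooth_on UNIV \<mu>" "\<And>x. x \<in> ball (\<phi> p) s \<Longrightarrow> \<mu> x = 1"
    "\<And>x. x \<notin> ball (\<phi> p) (2 * s) \<Longrightarrow> \<mu> x = 0"
    using bump_exists[OF B s(1), of "\<phi> p"] by blast
  define K where "K = inv_into U \<phi> ` cball (\<phi> p) (2 * s)"
  define W' where "W' = U \<inter> \<phi> -` ball (\<phi> p) s"
  define \<eta> where "\<eta> q = (if q \<in> U then \<mu> (\<phi> q) else 0)" for q
  have "compact K"
    unfolding K_def using s(2) W(2)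
    by (intro compact_continuous_image compact_cball_coord_basis[OF B]
        continuous_on_subset[OF chart_inv_continuous[OF A U]]) auto
  then have K: "closed K" by (rule compact_imp_closed)
  have KW: "K \<subseteq> W"
  proof
    fix q assume "q \<in> K"
    then obtain w where "w \<in> W" "q = inv_into U \<phi> (\<phi> w)" using s(2) unfolding K_def by blast
    then show "q \<in> W" using chart_inv[OF A U] W(2) by auto
  qed
  have inK: "q \<in> K" if "q \<in> U" "\<phi> q \<in> cball (\<phi> p) (2 * s)" for q
    unfolding K_def using that chart_inv[OF A U that(1)] by (metis imageI)
  have 0: "\<eta> q = 0" if "q \<notin> K" for q
    using that inK[of q] \<mu>(3)[of "\<phi> q"] by (cases "dist (\<phi> p) (\<phi> q) \<le> 2 * s") (auto simp: \<eta>_def)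
  have "smooth_at A q \<eta>" for q
  proof (cases "q \<in> U")
    case True
    show ?thesis
      by (rule smooth_at_chart_comp[OF A U chart_open[OF A U] True order_refl smooth_on_mono[OF \<mu>(1)]])
        (auto simp: \<eta>_def)
  next
    case False
    obtain V \<psi> where V: "(V, \<psi>) \<in> A" "q \<in> V" using smooth_atlas_cover[OF A] by blast
    show ?thesis
      by (rule smooth_at_chart_comp[OF A V(1), of "V - K" _ "\<lambda>_. 0"])
        (use V False KW W(2) K chart_open[OF A V(1)] 0 in \<open>auto simp: smooth_on_const\<close>)
  qed
  then have "\<eta> \<in> smooth_funs A" by (rule smooth_funsI[OF A])
  moreover have "open W'"
    unfolding W'_def by (rule continuous_open_preimage[OF chart_continuous[OF A U] chart_open[OF A U] open_ball])
  moreover have "p \<in> W'" using W s by (auto simp: W'_def)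
  moreover have "W' \<subseteq> K" using inK s(1) by (fastforce simp: W'_def)
  moreover have "\<forall>x\<in>W'. \<eta> x = 1" using \<mu>(2) by (auto simp: W'_def \<eta>_def)
  ultimately show ?thesis using K KW 0 by blast
qed

text \<open>Makes a function known only in coordinates available to point derivations, which act on
  global functions.\<close>

lemma cutoff_smooth:
  assumes A: "smooth_atlas A" and U: "(U, \<phi>) \<in> A" and W: "open W" "W \<subseteq> U"
    and \<eta>: "\<eta> \<in> smooth_funs A" "\<And>x. x \<notin> K \<Longrightarrow> \<eta> x = 0" and K: "closed K" "K \<subseteq> W"
    and h: "smooth_on (\<phi> ` W) h"
  shows "(\<lambda>q. \<eta> q * (if q \<in> W then h (\<phi> q) else 0)) \<in> smooth_funs A" (is "?f \<in> _")
proof (rule smooth_funsI[OF A])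
  fix q
  show "smooth_at A q ?f"
  proof (cases "q \<in> W")
    case True
    have "smooth_on (\<phi> ` W) (\<lambda>y. (\<eta> \<circ> inv_into U \<phi>) y * h y)"
      by (intro smooth_on_mult h smooth_on_mono[OF smooth_funsD[OF \<eta>(1) U]]) (use W in auto)
    then show ?thesis
      by (rule smooth_at_chart_comp[OF A U W(1) True W(2)]) (use W chart_inv[OF A U] in auto)
  next
    case False
    obtain V \<psi> where V: "(V, \<psi>) \<in> A" "q \<in> V" using smooth_atlas_cover[OF A] by blast
    show ?thesis
      by (rule smooth_at_chart_comp[OF A V(1), of "V - K" _ "\<lambda>_. 0"])
        (use V False K chart_open[OF A V(1)] \<eta> in \<open>auto simp: smooth_on_const\<close>)
  qed
qed

section \<open>Point derivations and their coordinate expression\<close>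

lemma tangent_spaceD:
  assumes "v \<in> tangent_space A p"
  shows tangent_add: "f \<in> smooth_funs A \<Longrightarrow> h \<in> smooth_funs A \<Longrightarrow> v (\<lambda>x. f x + h x) = v f + v h"
    and tangent_mult: "f \<in> smooth_funs A \<Longrightarrow> h \<in> smooth_funs A \<Longrightarrow> v (\<lambda>x. f x * h x) = v f * h p + f p * v h"
    and tangent_cmult: "f \<in> smooth_funs A \<Longrightarrow> v (\<lambda>x. c * f x) = c * v f"
    and tangent_nonsmooth: "f \<notin> smooth_funs A \<Longrightarrow> v f = 0"
  using assms by (simp_all add: tangent_space_def lin_on_def plus_fun_def times_fun_def scaleR_fun_def)

lemma tangent_const:
  assumes "v \<in> tangent_space A p"
  shows "v (\<lambda>x. c) = 0"
proof -
  have "v (\<lambda>x. 1) = 0"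
    using tangent_mult[OF assms smooth_funs_const[of 1] smooth_funs_const[of 1]] by simp
  then show ?thesis
    using tangent_cmult[OF assms smooth_funs_const[of 1], of c] by simp
qed

lemma tangent_minus: "v \<in> tangent_space A p \<Longrightarrow> f \<in> smooth_funs A \<Longrightarrow> v (\<lambda>x. - f x) = - v f"
  using tangent_cmult[of v A p f "-1"] by simp

lemma tangent_diff:
  "v \<in> tangent_space A p \<Longrightarrow> f \<in> smooth_funs A \<Longrightarrow> h \<in> smooth_funs A \<Longrightarrow> v (\<lambda>x. f x - h x) = v f - v h"
  using tangent_add[of v A p f "\<lambda>x. - h x"] by (simp add: smooth_funs_minus tangent_minus)

lemma tangent_sum:
  assumes "v \<in> tangent_space A p"
  shows "(\<And>i. i \<in> I \<Longrightarrow> f i \<in> smooth_funs A) \<Longrightarrow> v (\<lambda>x. \<Sum>i\<in>I. f i x) = (\<Sum>i\<in>I. v (f i))"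
  by (induction I rule: infinite_finite_induct)
    (simp_all add: tangent_const[OF assms] tangent_add[OF assms] smooth_funs_sum)

text \<open>With a bump function \<eta> supported in W, the product of f - h and \<eta> is
  identically 0. The Leibniz rule evaluates v on it as v f - v h, because f - h vanishes at p and
  \<eta> is 1 there.\<close>

lemma tangent_local:
  fixes A :: "('m::t2_space, 'e::real_inner) chart set"
  assumes A: "smooth_atlas A" and v: "v \<in> tangent_space A p" and f: "f \<in> smooth_funs A" and h: "h \<in> smooth_funs A"
    and W: "open W" "p \<in> W" and eq: "\<And>x. x \<in> W \<Longrightarrow> f x = h x"
  shows "v f = v h"
proof -
  obtain U \<phi> where U: "(U, \<phi>) \<in> A" "p \<in> U" using smooth_atlas_cover[OF A] by blast
  obtain \<eta> K W' where \<eta>: "\<eta> \<in> smooth_funs A" "p \<in> W'" "\<forall>x\<in>W'. \<eta> x = 1" "\<forall>x. x \<notin> K \<longrightarrow> \<eta> x = 0" "K \<subseteq> W \<inter> U"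
    using bump_function[OF A U(1), of "W \<inter> U" p] W U chart_open[OF A U(1)] by (metis IntI Int_lower2 open_Int)
  have "(\<lambda>x. (f x - h x) * \<eta> x) = (\<lambda>x. 0)"
    using \<eta>(4,5) eq by (intro ext) (metis IntE diff_self mult_eq_0_iff subsetD)
  then have "0 = v (\<lambda>x. (f x - h x) * \<eta> x)" by (simp add: tangent_const[OF v])
  also have "\<dots> = v (\<lambda>x. f x - h x)"
    using tangent_mult[OF v smooth_funs_diff[OF f h] \<eta>(1)] \<eta>(2,3) eq W by simp
  finally show ?thesis using tangent_diff[OF v f h] by simp
qed

text \<open>In the Hadamard expansion of f at q each term is a coordinate difference, vanishing at
  q, times a smooth function; the Leibniz rule keeps only v of the coordinate times the value of the
  other factor. The same global functions c b serve for all q in W, which later gives smoothness in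
  q.\<close>

lemma local_coordinates:
  fixes A :: "('m::t2_space, 'e::real_inner) chart set"
  assumes A: "smooth_atlas A" and U: "(U, \<phi>) \<in> A" and p: "p \<in> U" and B: "coord_basis (B::'e set)"
  shows "\<exists>W c. open W \<and> p \<in> W \<and> W \<subseteq> U \<and> (\<forall>b. c b \<in> smooth_funs A \<and> (\<forall>q\<in>W. c b q = \<phi> q \<bullet> b)) \<and>
    (\<forall>q\<in>W. \<forall>v\<in>tangent_space A q. \<forall>f\<in>smooth_funs A.
       v f = (\<Sum>b\<in>B. v (c b) * frechet_derivative (f \<circ> inv_into U \<phi>) (at (\<phi> q)) b))"
proof -
  obtain r where r: "r > 0" "ball (\<phi> p) r \<subseteq> \<phi> ` U"
    using chart_image_open[OF A U] p by (metis imageI openE)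
  \<comment> \<open>A ball, because Hadamard's lemma is applied at every point of it and needs a
    convex domain.\<close>
  define S where "S = ball (\<phi> p) r"
  define W0 where "W0 = U \<inter> \<phi> -` S"
  have S: "open S" "convex S" by (auto simp: S_def)
  have W0: "open W0" "W0 \<subseteq> U" "p \<in> W0"
    unfolding W0_def using continuous_open_preimage[OF chart_continuous[OF A U] chart_open[OF A U] S(1)] p r
    by (auto simp: S_def)
  have \<phi>W0: "\<phi> ` W0 = S" using r(2) by (auto simp: W0_def S_def)
  obtain \<eta> W K where \<eta>: "\<eta> \<in> smooth_funs A" "\<And>x. x \<in> W \<Longrightarrow> \<eta> x = 1" "\<And>x. x \<notin> K \<Longrightarrow> \<eta> x = 0"
    and W: "open W" "p \<in> W" "W \<subseteq> K" and K: "closed K" "K \<subseteq> W0"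
    using bump_function[OF A U W0] by blast
  have WW0: "q \<in> W0" if "q \<in> W" for q using W(3) K(2) that by blast
  define ext where "ext h q = \<eta> q * (if q \<in> W0 then h (\<phi> q) else 0)" for h :: "'e \<Rightarrow> real" and q
  have ext: "ext h \<in> smooth_funs A" if "smooth_on S h" for h
    unfolding ext_def by (rule cutoff_smooth[OF A U W0(1,2) \<eta>(1,3) K]) (simp_all add: \<phi>W0 that)
  have ext_eq: "ext h q = h (\<phi> q)" if "q \<in> W" for h q
    using that WW0 \<eta>(2) by (simp add: ext_def)
  define c where "c b = ext (\<lambda>y. y \<bullet> b)" for b
  have c: "c b \<in> smooth_funs A" for b
    unfolding c_def by (rule ext) (rule smooth_on_linear[OF bounded_linear_inner_left])
  have "v f = (\<Sum>b\<in>B. v (c b) * frechet_derivative (f \<circ> inv_into U \<phi>) (at (\<phi> q)) b)"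
    if q: "q \<in> W" and v: "v \<in> tangent_space A q" and f: "f \<in> smooth_funs A" for q v f
  proof -
    let ?f = "f \<circ> inv_into U \<phi>"
    have \<phi>q: "\<phi> q \<in> S" using WW0[OF q] by (simp add: W0_def)
    have "smooth_on S ?f" by (rule smooth_on_mono[OF smooth_funsD[OF f U]]) (use r in \<open>auto simp: S_def\<close>)
    from Hadamard[OF B S \<phi>q this] obtain g where
      g: "\<And>b. b \<in> B \<Longrightarrow> smooth_on S (g b)" "\<And>b. b \<in> B \<Longrightarrow> g b (\<phi> q) = frechet_derivative ?f (at (\<phi> q)) b"
      "\<And>x. x \<in> S \<Longrightarrow> ?f x = ?f (\<phi> q) + (\<Sum>b\<in>B. ((x - \<phi> q) \<bullet> b) * g b x)" by blast
    \<comment> \<open>The Hadamard expansion with all ingredients cut off: globally smooth, and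
      equal to f on W, so \<open>tangent_local\<close> applies.\<close>
    define h where "h = (\<lambda>x. f q + (\<Sum>b\<in>B. (c b x - c b q) * ext (g b) x))"
    have hs: "h \<in> smooth_funs A"
      unfolding h_def by (intro smooth_funs_add smooth_funs_const smooth_funs_sum smooth_funs_mult smooth_funs_diff c ext g)
    have "v f = v h"
    proof (rule tangent_local[OF A v f hs W(1) q])
      fix x assume x: "x \<in> W"
      then have "\<phi> x \<in> S" "x \<in> U" "q \<in> U" using WW0[OF x] WW0[OF q] by (auto simp: W0_def)
      then show "f x = h x"
        using g(3)[of "\<phi> x"] x q by (simp add: h_def ext_eq c_def chart_inv[OF A U] inner_diff_left)
    qed
    also have "\<dots> = (\<Sum>b\<in>B. v (\<lambda>x. (c b x - c b q) * ext (g b) x))"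
    proof -
      have m: "(\<lambda>x. (c b x - c b q) * ext (g b) x) \<in> smooth_funs A" if "b \<in> B" for b
        using that by (intro smooth_funs_mult smooth_funs_diff smooth_funs_const c ext g)
      show ?thesis
        unfolding h_def
        by (simp add: tangent_add[OF v smooth_funs_const smooth_funs_sum] m tangent_sum[OF v] tangent_const[OF v])
    qed
    also have "\<dots> = (\<Sum>b\<in>B. v (c b) * g b (\<phi> q))"
    proof (rule sum.cong[OF refl])
      fix b assume b: "b \<in> B"
      show "v (\<lambda>x. (c b x - c b q) * ext (g b) x) = v (c b) * g b (\<phi> q)"
        using tangent_mult[OF v smooth_funs_diff[OF c smooth_funs_const] ext[OF g(1)[OF b]]]
          tangent_diff[OF v c smooth_funs_const] tangent_const[OF v] ext_eq[OF q]
        by simp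
    qed
    finally show ?thesis using g(2) by simp
  qed
  moreover have "c b q = \<phi> q \<bullet> b" if "q \<in> W" for b q
    using ext_eq[OF that] by (simp add: c_def)
  ultimately show ?thesis
    using W WW0 W0 c by (intro exI[of _ W] exI[of _ c]) auto
qed

section \<open>Products of manifolds and smooth morphisms\<close>

lemma smooth_map_comp_smooth_funs:
  fixes A :: "('m::topological_space, 'e::real_inner) chart set"
    and B :: "('n::topological_space, 'd::real_inner) chart set"
  assumes A: "smooth_atlas A" and B: "smooth_atlas B" and F: "smooth_map A B F" and f: "f \<in> smooth_funs B"
  shows "(\<lambda>x. f (F x)) \<in> smooth_funs A"
proof (rule smooth_funsI[OF A])
  fix p
  obtain C :: "'d set" where C: "coord_basis C" using smooth_atlas_coord_basis[OF B] by blast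
  obtain U \<phi> where U: "(U, \<phi>) \<in> A" "p \<in> U" using smooth_atlas_cover[OF A] by blast
  obtain V \<psi> where V: "(V, \<psi>) \<in> B" "F p \<in> V" using smooth_atlas_cover[OF B] by blast
  let ?W = "U \<inter> F -` V"
  have W: "open ?W"
    using F chart_open[OF A U(1)] chart_open[OF B V(1)]
    by (auto simp: smooth_map_def intro!: open_Int open_vimage)
  have s: "smooth_on (\<phi> ` ?W) (\<psi> \<circ> F \<circ> inv_into U \<phi>)"
    using F U(1) V(1) unfolding smooth_map_def by blast
  have "smooth_on (\<phi> ` ?W) (\<lambda>y. (f \<circ> inv_into V \<psi>) ((\<psi> \<circ> F \<circ> inv_into U \<phi>) y))"
    by (rule smooth_on_compose[OF C smooth_funsD[OF f V(1)] s])
      (use chart_inv[OF A U(1)] in auto)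
  then show "smooth_at A p (\<lambda>x. f (F x))"
    by (rule smooth_at_chart_comp[OF A U(1) W, rotated 2])
      (use U V chart_inv[OF A U(1)] chart_inv[OF B V(1)] in auto)
qed

lemma prod_atlas_iff:
  "(W, \<theta>) \<in> prod_atlas A B \<longleftrightarrow> (\<exists>U \<phi> V \<psi>. (U, \<phi>) \<in> A \<and> (V, \<psi>) \<in> B \<and> W = U \<times> V \<and> \<theta> = map_prod \<phi> \<psi>)"
  unfolding prod_atlas_def by force

lemma prod_atlasI: "(U, \<phi>) \<in> A \<Longrightarrow> (V, \<psi>) \<in> B \<Longrightarrow> (U \<times> V, map_prod \<phi> \<psi>) \<in> prod_atlas A B"
  unfolding prod_atlas_iff by blast

lemma map_prod_image_Times: "map_prod f g ` (U \<times> V) = f ` U \<times> g ` V"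
  by force

lemma inv_into_map_prod:
  assumes "inj_on \<phi> U" "inj_on \<psi> V" "p \<in> U" "q \<in> V"
  shows "inv_into (U \<times> V) (map_prod \<phi> \<psi>) (\<phi> p, \<psi> q) = (p, q)"
  using inv_into_f_f[OF map_prod_inj_on[OF assms(1,2)], of "(p, q)"] assms(3,4) by simp

lemma coord_basis_span: "coord_basis B \<Longrightarrow> span B = UNIV"
proof -
  assume B: "coord_basis B"
  have "x \<in> span B" for x
  proof -
    have "(\<Sum>b\<in>B. (x \<bullet> b) *\<^sub>R b) \<in> span B" by (intro span_sum span_scale span_base)
    then show ?thesis by (simp add: coord_basis_expand[OF B])
  qed
  then show ?thesis by blast
qed

lemma smooth_atlas_prod:
  fixes A :: "('m::topological_space, 'e::real_inner) chart set"
    and B :: "('n::topological_space, 'd::real_inner) chart set"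
  assumes A: "smooth_atlas A" and B: "smooth_atlas B"
  shows "smooth_atlas (prod_atlas A B)"
  unfolding smooth_atlas_def
proof (intro conjI)
  obtain C :: "'e set" where C: "coord_basis C" using smooth_atlas_coord_basis[OF A] by blast
  obtain D :: "'d set" where D: "coord_basis D" using smooth_atlas_coord_basis[OF B] by blast
  show "\<exists>B::('e \<times> 'd) set. finite B \<and> span B = UNIV"
    using coord_basis_Times[OF C D] coord_basis_span coord_basis_finite by blast
  show "(\<Union>(U, \<phi>)\<in>prod_atlas A B. U) = UNIV"
  proof -
    have "\<exists>W \<theta>. (W, \<theta>) \<in> prod_atlas A B \<and> z \<in> W" for z
    proof -
      obtain U \<phi> V \<psi> where "(U, \<phi>) \<in> A" "fst z \<in> U" "(V, \<psi>) \<in> B" "snd z \<in> V"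
        using smooth_atlas_cover[OF A] smooth_atlas_cover[OF B] by metis
      then show ?thesis using prod_atlasI[of U \<phi> A V \<psi> B] mem_Times_iff by blast
    qed
    then show ?thesis by blast
  qed
  show "\<forall>(W, \<theta>)\<in>prod_atlas A B. open W \<and> open (\<theta> ` W) \<and> homeomorphism W (\<theta> ` W) \<theta> (inv_into W \<theta>)"
  proof clarify
    fix W \<theta> assume "(W, \<theta>) \<in> prod_atlas A B"
    then obtain U \<phi> V \<psi> where U: "(U, \<phi>) \<in> A" and V: "(V, \<psi>) \<in> B" and W: "W = U \<times> V" "\<theta> = map_prod \<phi> \<psi>"
      unfolding prod_atlas_iff by blast
    note cU = chart_facts[OF A U] and cV = chart_facts[OF B V]
    note inv = inv_into_map_prod[OF cU(6) cV(6)]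
    have im: "\<theta> ` W = \<phi> ` U \<times> \<psi> ` V" unfolding W by (rule map_prod_image_Times)
    have "homeomorphism W (\<theta> ` W) \<theta> (inv_into W \<theta>)"
    proof (rule homeomorphismI)
      have "continuous_on (U \<times> V) (\<lambda>x. (\<phi> (fst x), \<psi> (snd x)))"
        by (intro continuous_on_Pair continuous_on_compose2[OF cU(3)] continuous_on_compose2[OF cV(3)]
            continuous_on_fst continuous_on_snd continuous_on_id) auto
      then show "continuous_on W \<theta>"
        unfolding W by (rule continuous_on_eq) auto
      have "continuous_on (\<phi> ` U \<times> \<psi> ` V) (\<lambda>x. (inv_into U \<phi> (fst x), inv_into V \<psi> (snd x)))"
        by (intro continuous_on_Pair continuous_on_compose2[OF cU(4)] continuous_on_compose2[OF cV(4)]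
            continuous_on_fst continuous_on_snd continuous_on_id) auto
      then show "continuous_on (\<theta> ` W) (inv_into W \<theta>)"
        unfolding im by (rule continuous_on_eq) (auto simp: W inv cU(5) cV(5))
    qed (auto simp: W inv)
    then show "open W \<and> open (\<theta> ` W) \<and> homeomorphism W (\<theta> ` W) \<theta> (inv_into W \<theta>)"
      using cU(1,2) cV(1,2) im W by (auto intro: open_Times)
  qed
  show "\<forall>(W, \<theta>)\<in>prod_atlas A B. \<forall>(W', \<theta>')\<in>prod_atlas A B. smooth_on (\<theta> ` (W \<inter> W')) (\<theta>' \<circ> inv_into W \<theta>)"
  proof clarify
    fix W \<theta> W' \<theta>' assume "(W, \<theta>) \<in> prod_atlas A B" "(W', \<theta>') \<in> prod_atlas A B"
    then obtain U \<phi> V \<psi> U' \<phi>' V' \<psi>' where U: "(U, \<phi>) \<in> A" and V: "(V, \<psi>) \<in> B" and W: "W = U \<times> V" "\<theta> = map_prod \<phi> \<psi>"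
      and U': "(U', \<phi>') \<in> A" and V': "(V', \<psi>') \<in> B" and W': "W' = U' \<times> V'" "\<theta>' = map_prod \<phi>' \<psi>'"
      unfolding prod_atlas_iff by blast
    note cU = chart_facts[OF A U] and cV = chart_facts[OF B V]
    let ?S = "\<phi> ` (U \<inter> U') \<times> \<psi> ` (V \<inter> V')"
    have im: "\<theta> ` (W \<inter> W') = ?S"
      unfolding W W' Times_Int_Times map_prod_image_Times by (rule refl)
    have op: "open ?S"
      by (intro open_Times chart_open_image[OF A U] chart_open_image[OF B V] open_Int
          chart_open[OF A U] chart_open[OF A U'] chart_open[OF B V] chart_open[OF B V']) auto
    have "smooth_on ?S (\<lambda>x. ((\<phi>' \<circ> inv_into U \<phi>) (fst x), (\<psi>' \<circ> inv_into V \<psi>) (snd x)))"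
      by (intro smooth_on_Pair smooth_on_compose[OF C chart_transition[OF A U U']]
          smooth_on_compose[OF D chart_transition[OF B V V']] smooth_on_linear bounded_linear_fst bounded_linear_snd) auto
    then have "smooth_on ?S (\<theta>' \<circ> inv_into W \<theta>)"
      by (rule smooth_on_cong[OF op])
        (auto simp: W W' inv_into_map_prod[OF cU(6) cV(6)] cU(5) cV(5))
    then show "smooth_on (\<theta> ` (W \<inter> W')) (\<theta>' \<circ> inv_into W \<theta>)" by (simp only: im)
  qed
qed

text \<open>Pulling back smooth functions is what point derivations see, and it composes without
  charts, unlike \<open>smooth_map\<close>. Continuity is recorded for shrinking neighbourhoods in
  \<open>smooth_morphism_Pair\<close>.\<close>

definition smooth_morphism ::
  "('m::topological_space, 'e::real_inner) chart set \<Rightarrow> ('n::topological_space, 'd::real_inner) chart set \<Rightarrow> ('m \<Rightarrow> 'n) \<Rightarrow> bool"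
  where "smooth_morphism A B F \<longleftrightarrow> continuous_on UNIV F \<and> (\<forall>f\<in>smooth_funs B. (\<lambda>x. f (F x)) \<in> smooth_funs A)"

lemma smooth_morphism_funs: "smooth_morphism A B F \<Longrightarrow> f \<in> smooth_funs B \<Longrightarrow> (\<lambda>x. f (F x)) \<in> smooth_funs A"
  by (simp add: smooth_morphism_def)

lemma smooth_morphism_comp:
  "smooth_morphism A B F \<Longrightarrow> smooth_morphism B C H \<Longrightarrow> smooth_morphism A C (\<lambda>x. H (F x))"
  by (auto simp: smooth_morphism_def intro: continuous_on_compose2)

lemma smooth_morphism_id: "smooth_morphism A A (\<lambda>x. x)"
  by (auto simp: smooth_morphism_def)

lemma smooth_morphism_const: "smooth_morphism A B (\<lambda>x. c)"
  by (auto simp: smooth_morphism_def smooth_funs_const)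

lemma smooth_map_imp_morphism:
  "smooth_atlas A \<Longrightarrow> smooth_atlas B \<Longrightarrow> smooth_map A B F \<Longrightarrow> smooth_morphism A B F"
  using smooth_map_comp_smooth_funs by (fastforce simp: smooth_morphism_def smooth_map_def)

lemma smooth_morphism_fst:
  fixes A :: "('m::topological_space, 'e::real_inner) chart set"
    and B :: "('n::topological_space, 'd::real_inner) chart set"
  assumes A: "smooth_atlas A" and B: "smooth_atlas B"
  shows "smooth_morphism (prod_atlas A B) A fst"
  unfolding smooth_morphism_def
proof (intro conjI ballI)
  obtain C :: "'e set" where C: "coord_basis C" using smooth_atlas_coord_basis[OF A] by blast
  fix f assume f: "f \<in> smooth_funs A"
  show "(\<lambda>x. f (fst x)) \<in> smooth_funs (prod_atlas A B)"
  proof (rule smooth_funsI[OF smooth_atlas_prod[OF A B]])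
    fix z :: "'m \<times> 'n"
    obtain U \<phi> where U: "(U, \<phi>) \<in> A" "fst z \<in> U" using smooth_atlas_cover[OF A] by blast
    obtain V \<psi> where V: "(V, \<psi>) \<in> B" "snd z \<in> V" using smooth_atlas_cover[OF B] by blast
    have "smooth_on (map_prod \<phi> \<psi> ` (U \<times> V)) (\<lambda>y. (f \<circ> inv_into U \<phi>) (fst y))"
      by (rule smooth_on_compose[OF C smooth_funsD[OF f U(1)]])
        (auto intro: smooth_on_linear bounded_linear_fst)
    then show "smooth_at (prod_atlas A B) z (\<lambda>x. f (fst x))"
      by (rule smooth_at_chart_comp[OF smooth_atlas_prod[OF A B] prod_atlasI[OF U(1) V(1)] _ _ order_refl, rotated 2])
        (use U V chart_open[OF A U(1)] chart_open[OF B V(1)] in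
          \<open>auto simp: chart_inv[OF A U(1)] mem_Times_iff intro: open_Times\<close>)
  qed
qed (simp add: continuous_on_fst continuous_on_id)

lemma smooth_morphism_snd:
  fixes A :: "('m::topological_space, 'e::real_inner) chart set"
    and B :: "('n::topological_space, 'd::real_inner) chart set"
  assumes A: "smooth_atlas A" and B: "smooth_atlas B"
  shows "smooth_morphism (prod_atlas A B) B snd"
  unfolding smooth_morphism_def
proof (intro conjI ballI)
  obtain C :: "'d set" where C: "coord_basis C" using smooth_atlas_coord_basis[OF B] by blast
  fix f assume f: "f \<in> smooth_funs B"
  show "(\<lambda>x. f (snd x)) \<in> smooth_funs (prod_atlas A B)"
  proof (rule smooth_funsI[OF smooth_atlas_prod[OF A B]])
    fix z :: "'m \<times> 'n"
    obtain U \<phi> where U: "(U, \<phi>) \<in> A" "fst z \<in> U" using smooth_atlas_cover[OF A] by blast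
    obtain V \<psi> where V: "(V, \<psi>) \<in> B" "snd z \<in> V" using smooth_atlas_cover[OF B] by blast
    have "smooth_on (map_prod \<phi> \<psi> ` (U \<times> V)) (\<lambda>y. (f \<circ> inv_into V \<psi>) (snd y))"
      by (rule smooth_on_compose[OF C smooth_funsD[OF f V(1)]])
        (auto intro: smooth_on_linear bounded_linear_snd)
    then show "smooth_at (prod_atlas A B) z (\<lambda>x. f (snd x))"
      by (rule smooth_at_chart_comp[OF smooth_atlas_prod[OF A B] prod_atlasI[OF U(1) V(1)] _ _ order_refl, rotated 2])
        (use U V chart_open[OF A U(1)] chart_open[OF B V(1)] in
          \<open>auto simp: chart_inv[OF B V(1)] mem_Times_iff intro: open_Times\<close>)
  qed
qed (simp add: continuous_on_snd continuous_on_id)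

text \<open>Near p the coordinates of F and H are pullbacks of globally smooth functions from
  \<open>local_coordinates\<close>, hence smooth; f is a smooth function of these coordinates, so
  \<open>smooth_at_comp\<close> finishes.\<close>

lemma smooth_morphism_Pair:
  fixes A :: "('m::t2_space, 'e::real_inner) chart set"
    and B :: "('n::t2_space, 'd::real_inner) chart set"
    and C :: "('o::t2_space, 'c::real_inner) chart set"
  assumes A: "smooth_atlas A" and B: "smooth_atlas B" and C: "smooth_atlas C"
    and F: "smooth_morphism A B F" and H: "smooth_morphism A C H"
  shows "smooth_morphism A (prod_atlas B C) (\<lambda>x. (F x, H x))"
  unfolding smooth_morphism_def
proof (intro conjI ballI)
  show "continuous_on UNIV (\<lambda>x. (F x, H x))"
    using F H by (simp add: smooth_morphism_def continuous_on_Pair)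
  obtain D :: "'d set" where D: "coord_basis D" using smooth_atlas_coord_basis[OF B] by blast
  obtain E :: "'c set" where E: "coord_basis E" using smooth_atlas_coord_basis[OF C] by blast
  fix f assume f: "f \<in> smooth_funs (prod_atlas B C)"
  show "(\<lambda>x. f (F x, H x)) \<in> smooth_funs A"
  proof (rule smooth_funsI[OF A])
    fix p
    obtain V \<psi> where V: "(V, \<psi>) \<in> B" "F p \<in> V" using smooth_atlas_cover[OF B] by blast
    obtain W \<theta> where W: "(W, \<theta>) \<in> C" "H p \<in> W" using smooth_atlas_cover[OF C] by blast
    obtain V' c where V': "open V'" "F p \<in> V'" "V' \<subseteq> V" "\<And>b. c b \<in> smooth_funs B" "\<And>b q. q \<in> V' \<Longrightarrow> c b q = \<psi> q \<bullet> b"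
      using local_coordinates[OF B V D] by metis
    obtain W' d where W': "open W'" "H p \<in> W'" "W' \<subseteq> W" "\<And>b. d b \<in> smooth_funs C" "\<And>b q. q \<in> W' \<Longrightarrow> d b q = \<theta> q \<bullet> b"
      using local_coordinates[OF C W E] by metis
    define g where "g x = ((\<Sum>b\<in>D. c b (F x) *\<^sub>R b), (\<Sum>b\<in>E. d b (H x) *\<^sub>R b))" for x
    have g: "(\<lambda>x. g x \<bullet> k) \<in> smooth_funs A" for k
    proof -
      have "(\<lambda>x. (\<Sum>b\<in>D. c b (F x) * (b \<bullet> fst k)) + (\<Sum>b\<in>E. d b (H x) * (b \<bullet> snd k))) \<in> smooth_funs A"
        by (intro smooth_funs_add smooth_funs_sum smooth_funs_mult smooth_funs_const
            smooth_morphism_funs[OF F] smooth_morphism_funs[OF H] V' W')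
      then show ?thesis by (cases k) (simp add: g_def inner_sum_left)
    qed
    have g_eq: "g x = (\<psi> (F x), \<theta> (H x))" if "F x \<in> V'" "H x \<in> W'" for x
      using that by (simp add: g_def V' W' coord_basis_expand[OF D] coord_basis_expand[OF E])
    show "smooth_at A p (\<lambda>x. f (F x, H x))"
    proof (rule smooth_at_comp[OF A coord_basis_Times[OF D E] g, of "F -` V' \<inter> H -` W'"])
      show "open (F -` V' \<inter> H -` W')"
        using F H V' W' by (auto simp: smooth_morphism_def intro!: open_Int open_vimage)
      show "smooth_on (map_prod \<psi> \<theta> ` (V \<times> W)) (f \<circ> inv_into (V \<times> W) (map_prod \<psi> \<theta>))"
        by (rule smooth_funsD[OF f prod_atlasI[OF V(1) W(1)]])
      fix x assume x: "x \<in> F -` V' \<inter> H -` W'"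
      show "g x \<in> map_prod \<psi> \<theta> ` (V \<times> W)"
        using x V'(3) W'(3) by (auto simp: g_eq)
      show "f (F x, H x) = (f \<circ> inv_into (V \<times> W) (map_prod \<psi> \<theta>)) (g x)"
        using x V'(3) W'(3) by (auto simp: g_eq subset_iff
            inv_into_map_prod[OF chart_inj[OF B V(1)] chart_inj[OF C W(1)]])
    qed (use V' W' in auto)
  qed
qed

section \<open>Derivatives of slices, dependence on parameters, and the product rule on the
  diagonal\<close>

lemma frechet_derivative_along:
  assumes "(F has_derivative F') (at (g y))" "(g has_derivative g') (at y)" "open T" "y \<in> T"
    "\<And>z. z \<in> T \<Longrightarrow> f z = F (g z)"
  shows "frechet_derivative f (at y) h = F' (g' h)"
proof -
  have "(f has_derivative (\<lambda>h. F' (g' h))) (at y)"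
    by (rule has_derivative_transform_within_open[OF has_derivative_compose[OF assms(2,1)] assms(3,4)])
      (simp add: assms(5))
  from fun_cong[OF frechet_derivative_at[OF this], of h] show ?thesis by simp
qed

context
  fixes A :: "('m::t2_space, 'e::real_inner) chart set"
    and C :: "('n::t2_space, 'd::real_inner) chart set"
    and F :: "'m \<times> 'n \<Rightarrow> real" and U \<phi> V \<psi> F'
  assumes A: "smooth_atlas A" and C: "smooth_atlas C" and F: "F \<in> smooth_funs (prod_atlas A C)"
    and U: "(U, \<phi>) \<in> A" and V: "(V, \<psi>) \<in> C"
  defines "F' \<equiv> F \<circ> inv_into (U \<times> V) (map_prod \<phi> \<psi>)"
begin

lemma prod_chart_eq: "p \<in> U \<Longrightarrow> q \<in> V \<Longrightarrow> F' (\<phi> p, \<psi> q) = F (p, q)"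
  by (simp add: F'_def inv_into_map_prod[OF chart_inj[OF A U] chart_inj[OF C V]])

lemma prod_chart_smooth: "smooth_on (\<phi> ` U \<times> \<psi> ` V) F'"
  using smooth_funsD[OF F prod_atlasI[OF U V]] by (simp add: F'_def map_prod_image_Times)

lemma prod_chart_open: "open (\<phi> ` U \<times> \<psi> ` V)"
  by (intro open_Times chart_image_open[OF A U] chart_image_open[OF C V])

lemma prod_chart_derivative:
  "p \<in> U \<Longrightarrow> q \<in> V \<Longrightarrow> (F' has_derivative frechet_derivative F' (at (\<phi> p, \<psi> q))) (at (\<phi> p, \<psi> q))"
  by (rule smooth_on_has_derivative[OF prod_chart_smooth]) auto

lemma derivative_slice_fst:
  assumes "p \<in> U" "q \<in> V"
  shows "frechet_derivative ((\<lambda>k. F (k, q)) \<circ> inv_into U \<phi>) (at (\<phi> p)) b = frechet_derivative F' (at (\<phi> p, \<psi> q)) (b, 0)"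
proof (rule frechet_derivative_along[where F=F' and g="\<lambda>y. (y, \<psi> q)" and T="\<phi> ` U"])
  show "((\<lambda>y. (y, \<psi> q)) has_derivative (\<lambda>h. (h, 0))) (at (\<phi> p))"
    by (auto intro!: derivative_eq_intros)
qed (use assms chart_image_open[OF A U] prod_chart_derivative in
    \<open>auto simp: prod_chart_eq chart_inv[OF A U]\<close>)

lemma derivative_slice_snd:
  assumes "p \<in> U" "q \<in> V"
  shows "frechet_derivative ((\<lambda>k. F (p, k)) \<circ> inv_into V \<psi>) (at (\<psi> q)) b = frechet_derivative F' (at (\<phi> p, \<psi> q)) (0, b)"
proof (rule frechet_derivative_along[where F=F' and g="\<lambda>y. (\<phi> p, y)" and T="\<psi> ` V"])
  show "((\<lambda>y. (\<phi> p, y)) has_derivative (\<lambda>h. (0, h))) (at (\<psi> q))"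
    by (auto intro!: derivative_eq_intros)
qed (use assms chart_image_open[OF C V] prod_chart_derivative in
    \<open>auto simp: prod_chart_eq chart_inv[OF C V]\<close>)

end

lemma smooth_slice:
  fixes A :: "('m::t2_space, 'e::real_inner) chart set" and C :: "('n::t2_space, 'd::real_inner) chart set"
  assumes "smooth_atlas A" "smooth_atlas C" "F \<in> smooth_funs (prod_atlas A C)"
  shows smooth_slice_fst: "(\<lambda>k. F (k, q)) \<in> smooth_funs A"
    and smooth_slice_snd: "(\<lambda>l. F (p, l)) \<in> smooth_funs C"
  using smooth_morphism_funs[OF smooth_morphism_Pair[OF assms(1) assms(1,2) smooth_morphism_id smooth_morphism_const[of A C q]] assms(3)]
    smooth_morphism_funs[OF smooth_morphism_Pair[OF assms(2) assms(1,2) smooth_morphism_const[of C A p] smooth_morphism_id] assms(3)]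
  by auto

text \<open>By \<open>local_coordinates\<close>, v applied to a slice is a combination, with
  constant coefficients, of partial derivatives of F at (p, q), and these are smooth in q.\<close>

lemma tangent_param_smooth:
  fixes A :: "('m::t2_space, 'e::real_inner) chart set" and C :: "('n::t2_space, 'd::real_inner) chart set"
  assumes A: "smooth_atlas A" and C: "smooth_atlas C" and F: "F \<in> smooth_funs (prod_atlas A C)"
    and v: "v \<in> tangent_space A p"
  shows "(\<lambda>q. v (\<lambda>k. F (k, q))) \<in> smooth_funs C"
proof (rule smooth_funsI[OF C])
  fix q0
  obtain D :: "'d set" where D: "coord_basis D" using smooth_atlas_coord_basis[OF C] by blast
  obtain E :: "'e set" where E: "coord_basis E" using smooth_atlas_coord_basis[OF A] by blast
  obtain U \<phi> where U: "(U, \<phi>) \<in> A" "p \<in> U" using smooth_atlas_cover[OF A] by blast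
  obtain V \<psi> where V: "(V, \<psi>) \<in> C" "q0 \<in> V" using smooth_atlas_cover[OF C] by blast
  obtain c where c: "\<And>f. f \<in> smooth_funs A \<Longrightarrow> v f = (\<Sum>b\<in>E. v (c b) * frechet_derivative (f \<circ> inv_into U \<phi>) (at (\<phi> p)) b)"
    using local_coordinates[OF A U E] v by metis
  let ?F = "F \<circ> inv_into (U \<times> V) (map_prod \<phi> \<psi>)"
  have "smooth_on (\<psi> ` V) (\<lambda>y. \<Sum>b\<in>E. v (c b) * frechet_derivative ?F (at (\<phi> p, y)) (b, 0))"
    by (intro smooth_on_sum smooth_on_mult smooth_on_const
        smooth_on_compose[OF coord_basis_Times[OF E D] smooth_on_frechet_derivative[OF prod_chart_open[OF A C F U(1) V(1)] prod_chart_smooth[OF A C F U(1) V(1)]]]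
        smooth_on_Pair smooth_on_linear bounded_linear_ident)
      (use U in auto)
  then show "smooth_at C q0 (\<lambda>q. v (\<lambda>k. F (k, q)))"
    by (rule smooth_at_chart_comp[OF C V(1) chart_open[OF C V(1)] V(2) order_refl])
      (simp add: c smooth_slice_fst[OF A C F] derivative_slice_fst[OF A C F U(1) V(1) U(2)])
qed

text \<open>Here the base point moves as well. The coefficients become the smooth functions X (c b),
  since the functions c b work at every point of a neighbourhood.\<close>

lemma field_param_smooth:
  fixes A :: "('m::t2_space, 'e::real_inner) chart set" and C :: "('n::t2_space, 'd::real_inner) chart set"
  assumes A: "smooth_atlas A" and C: "smooth_atlas C" and F: "F \<in> smooth_funs (prod_atlas A C)"
    and X: "\<And>f. f \<in> smooth_funs A \<Longrightarrow> X f \<in> smooth_funs A" "\<And>p. (\<lambda>f. X f p) \<in> tangent_space A p"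
  shows "(\<lambda>z. X (\<lambda>k. F (k, snd z)) (fst z)) \<in> smooth_funs (prod_atlas A C)"
proof (rule smooth_funsI[OF smooth_atlas_prod[OF A C]])
  fix z0 :: "'m \<times> 'n"
  obtain D :: "'d set" where D: "coord_basis D" using smooth_atlas_coord_basis[OF C] by blast
  obtain E :: "'e set" where E: "coord_basis E" using smooth_atlas_coord_basis[OF A] by blast
  obtain U \<phi> where U: "(U, \<phi>) \<in> A" "fst z0 \<in> U" using smooth_atlas_cover[OF A] by blast
  obtain V \<psi> where V: "(V, \<psi>) \<in> C" "snd z0 \<in> V" using smooth_atlas_cover[OF C] by blast
  obtain W c where W: "open W" "fst z0 \<in> W" "W \<subseteq> U" and c: "\<And>b. c b \<in> smooth_funs A"
    "\<And>q v f. q \<in> W \<Longrightarrow> v \<in> tangent_space A q \<Longrightarrow> f \<in> smooth_funs A \<Longrightarrow>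
      v f = (\<Sum>b\<in>E. v (c b) * frechet_derivative (f \<circ> inv_into U \<phi>) (at (\<phi> q)) b)"
    using local_coordinates[OF A U E] by metis
  let ?F = "F \<circ> inv_into (U \<times> V) (map_prod \<phi> \<psi>)"
  let ?S = "map_prod \<phi> \<psi> ` (W \<times> V)"
  have sub: "?S \<subseteq> \<phi> ` U \<times> \<psi> ` V" using W by auto
  have "smooth_on ?S (\<lambda>y. \<Sum>b\<in>E. (X (c b) \<circ> inv_into U \<phi>) (fst y) * frechet_derivative ?F (at y) (b, 0))"
    by (intro smooth_on_sum smooth_on_mult smooth_on_compose[OF E smooth_funsD[OF X(1)[OF c(1)] U(1)]]
        smooth_on_mono[OF smooth_on_frechet_derivative[OF prod_chart_open[OF A C F U(1) V(1)] prod_chart_smooth[OF A C F U(1) V(1)]] sub]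
        smooth_on_linear bounded_linear_fst)
      (use W in auto)
  then show "smooth_at (prod_atlas A C) z0 (\<lambda>z. X (\<lambda>k. F (k, snd z)) (fst z))"
  proof (rule smooth_at_chart_comp[OF smooth_atlas_prod[OF A C] prod_atlasI[OF U(1) V(1)], rotated 3])
    fix z assume z: "z \<in> W \<times> V"
    then have "fst z \<in> W" "fst z \<in> U" "snd z \<in> V" using W by auto
    then show "X (\<lambda>k. F (k, snd z)) (fst z) = (\<Sum>b\<in>E. (X (c b) \<circ> inv_into U \<phi>) (fst (map_prod \<phi> \<psi> z)) *
        frechet_derivative ?F (at (map_prod \<phi> \<psi> z)) (b, 0))"
      by (simp add: c(2)[OF _ X(2) smooth_slice_fst[OF A C F]] chart_inv[OF A U(1)]
          derivative_slice_fst[OF A C F U(1) V(1)] map_prod_def split_beta)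
  qed (use W V chart_open[OF C V(1)] in \<open>auto simp: mem_Times_iff intro: open_Times\<close>)
qed

text \<open>In charts both sides are double sums of mixed second partial derivatives of F with the
  same coefficients; \<open>frechet_derivative_commute\<close> identifies them.\<close>

lemma tangent_commute:
  fixes A :: "('m::t2_space, 'e::real_inner) chart set" and C :: "('n::t2_space, 'd::real_inner) chart set"
  assumes A: "smooth_atlas A" and C: "smooth_atlas C" and F: "F \<in> smooth_funs (prod_atlas A C)"
    and v: "v \<in> tangent_space A p" and w: "w \<in> tangent_space C q"
  shows "v (\<lambda>k. w (\<lambda>l. F (k, l))) = w (\<lambda>l. v (\<lambda>k. F (k, l)))"
proof -
  obtain D :: "'d set" where D: "coord_basis D" using smooth_atlas_coord_basis[OF C] by blast
  obtain E :: "'e set" where E: "coord_basis E" using smooth_atlas_coord_basis[OF A] by blast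
  obtain U \<phi> where U: "(U, \<phi>) \<in> A" "p \<in> U" using smooth_atlas_cover[OF A] by blast
  obtain V \<psi> where V: "(V, \<psi>) \<in> C" "q \<in> V" using smooth_atlas_cover[OF C] by blast
  obtain c where c: "\<And>f. f \<in> smooth_funs A \<Longrightarrow> v f = (\<Sum>b\<in>E. v (c b) * frechet_derivative (f \<circ> inv_into U \<phi>) (at (\<phi> p)) b)"
    using local_coordinates[OF A U E] v by metis
  obtain d where d: "\<And>f. f \<in> smooth_funs C \<Longrightarrow> w f = (\<Sum>b\<in>D. w (d b) * frechet_derivative (f \<circ> inv_into V \<psi>) (at (\<psi> q)) b)"
    using local_coordinates[OF C V D] w by metis
  define F' where "F' = F \<circ> inv_into (U \<times> V) (map_prod \<phi> \<psi>)"
  let ?D = "\<lambda>h y. frechet_derivative F' (at y) h"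
  note op = prod_chart_open[OF A C F U(1) V(1)]
  have F': "smooth_on (\<phi> ` U \<times> \<psi> ` V) F'"
    unfolding F'_def by (rule prod_chart_smooth[OF A C F U(1) V(1)])
  have D': "(?D h has_derivative frechet_derivative (?D h) (at (\<phi> p, \<psi> q))) (at (\<phi> p, \<psi> q))" for h
    by (rule smooth_on_has_derivative[OF smooth_on_frechet_derivative[OF op F']]) (use U V in auto)
  have E1: "v (\<lambda>k. F (k, l)) = (\<Sum>b\<in>E. v (c b) * ?D (b, 0) (\<phi> p, \<psi> l))" if "l \<in> V" for l
    unfolding F'_def
    by (simp add: c smooth_slice_fst[OF A C F] derivative_slice_fst[OF A C F U(1) V(1) U(2) that])
  have E2: "w (\<lambda>l. F (k, l)) = (\<Sum>b\<in>D. w (d b) * ?D (0, b) (\<phi> k, \<psi> q))" if "k \<in> U" for k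
    unfolding F'_def
    by (simp add: d smooth_slice_snd[OF A C F] derivative_slice_snd[OF A C F U(1) V(1) that V(2)])
  have s1: "(\<lambda>l. v (\<lambda>k. F (k, l))) \<in> smooth_funs C" by (rule tangent_param_smooth[OF A C F v])
  have s2: "(\<lambda>k. w (\<lambda>l. F (k, l))) \<in> smooth_funs A"
  proof -
    have "(\<lambda>z. F (snd z, fst z)) \<in> smooth_funs (prod_atlas C A)"
      by (rule smooth_morphism_funs[OF smooth_morphism_Pair[OF smooth_atlas_prod[OF C A] A C
            smooth_morphism_snd[OF C A] smooth_morphism_fst[OF C A]] F])
    from tangent_param_smooth[OF C A this w] show ?thesis by simp
  qed
  have "v (\<lambda>k. w (\<lambda>l. F (k, l))) = (\<Sum>b\<in>E. v (c b) * (\<Sum>b'\<in>D. w (d b') * frechet_derivative (?D (0, b')) (at (\<phi> p, \<psi> q)) (b, 0)))"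
    unfolding c[OF s2]
  proof (intro sum.cong refl arg_cong2[where f="(*)"])
    fix b
    show "frechet_derivative ((\<lambda>k. w (\<lambda>l. F (k, l))) \<circ> inv_into U \<phi>) (at (\<phi> p)) b =
      (\<Sum>b'\<in>D. w (d b') * frechet_derivative (?D (0, b')) (at (\<phi> p, \<psi> q)) (b, 0))"
    proof (rule frechet_derivative_along[where F="\<lambda>y. \<Sum>b'\<in>D. w (d b') * ?D (0, b') y" and g="\<lambda>y. (y, \<psi> q)" and T="\<phi> ` U"])
      show "((\<lambda>y. (y, \<psi> q)) has_derivative (\<lambda>h. (h, 0))) (at (\<phi> p))"
        by (auto intro!: derivative_eq_intros)
      show "((\<lambda>y. \<Sum>b'\<in>D. w (d b') * ?D (0, b') y) has_derivative
        (\<lambda>h. \<Sum>b'\<in>D. w (d b') * frechet_derivative (?D (0, b')) (at (\<phi> p, \<psi> q)) h)) (at (\<phi> p, \<psi> q))"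
        by (intro has_derivative_sum has_derivative_mult_right D')
    qed (use U E2 chart_image_open[OF A U(1)] chart_inv[OF A U(1)] in auto)
  qed
  moreover have "w (\<lambda>l. v (\<lambda>k. F (k, l))) = (\<Sum>b'\<in>D. w (d b') * (\<Sum>b\<in>E. v (c b) * frechet_derivative (?D (b, 0)) (at (\<phi> p, \<psi> q)) (0, b')))"
    unfolding d[OF s1]
  proof (intro sum.cong refl arg_cong2[where f="(*)"])
    fix b'
    show "frechet_derivative ((\<lambda>l. v (\<lambda>k. F (k, l))) \<circ> inv_into V \<psi>) (at (\<psi> q)) b' =
      (\<Sum>b\<in>E. v (c b) * frechet_derivative (?D (b, 0)) (at (\<phi> p, \<psi> q)) (0, b'))"
    proof (rule frechet_derivative_along[where F="\<lambda>y. \<Sum>b\<in>E. v (c b) * ?D (b, 0) y" and g="\<lambda>y. (\<phi> p, y)" and T="\<psi> ` V"])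
      show "((\<lambda>y. (\<phi> p, y)) has_derivative (\<lambda>h. (0, h))) (at (\<psi> q))"
        by (auto intro!: derivative_eq_intros)
      show "((\<lambda>y. \<Sum>b\<in>E. v (c b) * ?D (b, 0) y) has_derivative
        (\<lambda>h. \<Sum>b\<in>E. v (c b) * frechet_derivative (?D (b, 0)) (at (\<phi> p, \<psi> q)) h)) (at (\<phi> p, \<psi> q))"
        by (intro has_derivative_sum has_derivative_mult_right D')
    qed (use V E1 chart_image_open[OF C V(1)] chart_inv[OF C V(1)] in auto)
  qed
  moreover have "frechet_derivative (?D h) (at (\<phi> p, \<psi> q)) h' = frechet_derivative (?D h') (at (\<phi> p, \<psi> q)) h" for h h'
  proof -
    have "(\<phi> p, \<psi> q) \<in> \<phi> ` U \<times> \<psi> ` V" using U V by simp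
    then obtain r where r: "r > 0" "ball (\<phi> p, \<psi> q) r \<subseteq> \<phi> ` U \<times> \<psi> ` V"
      using op openE by blast
    show ?thesis
      by (rule frechet_derivative_commute[OF coord_basis_Times[OF E D] open_ball convex_ball _ smooth_on_mono[OF F' r(2)]])
        (use r in simp)
  qed
  ultimately show ?thesis
    by (simp add: sum_distrib_left mult_ac) (subst sum.swap, simp)
qed

text \<open>Along k to (k, k) the direction b becomes (b, b) = (b, 0) + (0, b). On the group this
  differentiates expressions in which one element occurs twice, such as k times its inverse or a
  conjugation.\<close>

lemma tangent_diagonal:
  fixes A :: "('m::t2_space, 'e::real_inner) chart set"
  assumes A: "smooth_atlas A" and F: "F \<in> smooth_funs (prod_atlas A A)" and v: "v \<in> tangent_space A p"
  shows "v (\<lambda>k. F (k, k)) = v (\<lambda>k. F (k, p)) + v (\<lambda>k. F (p, k))"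
proof -
  obtain E :: "'e set" where E: "coord_basis E" using smooth_atlas_coord_basis[OF A] by blast
  obtain U \<phi> where U: "(U, \<phi>) \<in> A" "p \<in> U" using smooth_atlas_cover[OF A] by blast
  obtain c where c: "\<And>f. f \<in> smooth_funs A \<Longrightarrow> v f = (\<Sum>b\<in>E. v (c b) * frechet_derivative (f \<circ> inv_into U \<phi>) (at (\<phi> p)) b)"
    using local_coordinates[OF A U E] v by metis
  let ?F = "F \<circ> inv_into (U \<times> U) (map_prod \<phi> \<phi>)"
  note d = prod_chart_derivative[OF A A F U(1) U(1) U(2) U(2)]
  have "(\<lambda>k. F (k, k)) \<in> smooth_funs A"
    using smooth_morphism_funs[OF smooth_morphism_Pair[OF A A A smooth_morphism_id smooth_morphism_id] F] .
  moreover have "frechet_derivative ((\<lambda>k. F (k, k)) \<circ> inv_into U \<phi>) (at (\<phi> p)) b =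
      frechet_derivative ?F (at (\<phi> p, \<phi> p)) (b, b)" for b
  proof (rule frechet_derivative_along[where F="?F" and g="\<lambda>y. (y, y)" and T="\<phi> ` U"])
    show "((\<lambda>y. (y, y)) has_derivative (\<lambda>h. (h, h))) (at (\<phi> p))"
      by (auto intro!: derivative_eq_intros)
    show "(?F has_derivative frechet_derivative ?F (at (\<phi> p, \<phi> p))) (at (\<phi> p, \<phi> p))" by (rule d)
  qed (use U chart_image_open[OF A U(1)] in
      \<open>auto simp: chart_inv[OF A U(1)] inv_into_map_prod[OF chart_inj[OF A U(1)] chart_inj[OF A U(1)]]\<close>)
  moreover have "frechet_derivative ?F (at (\<phi> p, \<phi> p)) (b, b) =
      frechet_derivative ?F (at (\<phi> p, \<phi> p)) (b, 0) + frechet_derivative ?F (at (\<phi> p, \<phi> p)) (0, b)" for b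
    using linear_add[OF has_derivative_linear[OF d], of "(b, 0)" "(0, b)"] by simp
  ultimately show ?thesis
    by (simp add: c smooth_slice_fst[OF A A F] smooth_slice_snd[OF A A F] derivative_slice_fst[OF A A F U(1) U(1) U(2) U(2)]
        derivative_slice_snd[OF A A F U(1) U(1) U(2) U(2)] distrib_left sum.distrib)
qed

text \<open>Supplies enough abstract tangent vectors: a function annihilated by all of them has zero
  partial derivatives in every chart.\<close>

lemma chart_direction_tangent:
  fixes A :: "('m::t2_space, 'e::real_inner) chart set"
  assumes A: "smooth_atlas A" and U: "(U, \<phi>) \<in> A" and p: "p \<in> U"
  shows "(\<lambda>f. if f \<in> smooth_funs A then frechet_derivative (f \<circ> inv_into U \<phi>) (at (\<phi> p)) u else 0) \<in> tangent_space A p"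
proof -
  have d: "(f \<circ> inv_into U \<phi> has_derivative frechet_derivative (f \<circ> inv_into U \<phi>) (at (\<phi> p))) (at (\<phi> p))"
    if "f \<in> smooth_funs A" for f
    by (rule smooth_on_has_derivative[OF smooth_funsD[OF that U]]) (use p in auto)
  let ?D = "\<lambda>f. frechet_derivative (f \<circ> inv_into U \<phi>) (at (\<phi> p)) u"
  have "?D (f + h) = ?D f + ?D h" if "f \<in> smooth_funs A" "h \<in> smooth_funs A" for f h
    using fun_cong[OF frechet_derivative_at[OF has_derivative_add[OF d[OF that(1)] d[OF that(2)]]], of u]
    by (simp add: o_def plus_fun_def)
  moreover have "?D (c *\<^sub>R f) = c *\<^sub>R ?D f" if "f \<in> smooth_funs A" for f c
    using fun_cong[OF frechet_derivative_at[OF has_derivative_scaleR_right[OF d[OF that], of c]], of u]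
    by (simp add: o_def scaleR_fun_def)
  moreover have "?D (f * h) = ?D f * h p + f p * ?D h" if "f \<in> smooth_funs A" "h \<in> smooth_funs A" for f h
    using fun_cong[OF frechet_derivative_at[OF has_derivative_mult[OF d[OF that(1)] d[OF that(2)]]], of u]
    by (simp add: o_def times_fun_def chart_inv[OF A U p])
  ultimately show ?thesis
    by (auto simp: tangent_space_def lin_on_def smooth_funs_fun_ops)
qed

text \<open>Vanishing derivatives make f constant on the chart preimages of balls, which are open
  neighbourhoods; connectedness turns locally constant into constant.\<close>

lemma tangent_zero_imp_constant:
  fixes A :: "('m::t2_space, 'e::real_inner) chart set"
  assumes A: "smooth_atlas A" and f: "f \<in> smooth_funs A" and conn: "connected (UNIV :: 'm set)"
    and z: "\<And>p v. v \<in> tangent_space A p \<Longrightarrow> v f = 0"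
  shows "f p = f q"
proof -
  have loc: "\<exists>W. open W \<and> x \<in> W \<and> (\<forall>y\<in>W. f y = f x)" for x
  proof -
    obtain U \<phi> where U: "(U, \<phi>) \<in> A" "x \<in> U" using smooth_atlas_cover[OF A] by blast
    obtain r where r: "r > 0" "ball (\<phi> x) r \<subseteq> \<phi> ` U"
      using chart_image_open[OF A U(1)] U(2) by (metis imageI openE)
    let ?f = "f \<circ> inv_into U \<phi>"
    have "frechet_derivative ?f (at y) u = 0" if "y \<in> \<phi> ` U" for y u
    proof -
      from that obtain p where p: "p \<in> U" "y = \<phi> p" by blast
      show ?thesis using z[OF chart_direction_tangent[OF A U(1) p(1), of u]] f p by simp
    qed
    then have D0: "frechet_derivative ?f (at y) = (\<lambda>u. 0)" if "y \<in> \<phi> ` U" for y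
      using that by blast
    have D1: "(?f has_derivative frechet_derivative ?f (at y)) (at y within ball (\<phi> x) r)"
      if "y \<in> ball (\<phi> x) r" for y
      by (rule has_derivative_at_withinI[OF smooth_on_has_derivative[OF smooth_funsD[OF f U(1)]]])
        (rule subsetD[OF r(2) that])
    have "(?f has_derivative (\<lambda>u. 0)) (at y within ball (\<phi> x) r)" if "y \<in> ball (\<phi> x) r" for y
    proof -
      have "y \<in> \<phi> ` U" using r(2) that by (rule subsetD)
      from D1[OF that] show ?thesis unfolding D0[OF \<open>y \<in> \<phi> ` U\<close>] .
    qed
    then have const: "\<exists>c. \<forall>y\<in>ball (\<phi> x) r. ?f y = c"
      by (intro has_derivative_zero_constant convex_ball)
    have "f y = f x" if "y \<in> U \<inter> \<phi> -` ball (\<phi> x) r" for y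
    proof -
      obtain c where c: "\<And>y. y \<in> ball (\<phi> x) r \<Longrightarrow> ?f y = c" using const by blast
      show ?thesis using c[of "\<phi> y"] c[of "\<phi> x"] that r U(2) by (simp add: chart_inv[OF A U(1)])
    qed
    moreover have "open (U \<inter> \<phi> -` ball (\<phi> x) r)"
      by (rule continuous_open_preimage[OF chart_continuous[OF A U(1)] chart_open[OF A U(1)] open_ball])
    moreover have "x \<in> U \<inter> \<phi> -` ball (\<phi> x) r" using U(2) r(1) by simp
    ultimately show ?thesis by blast
  qed
  have "f constant_on UNIV"
  proof (rule locally_constant_imp_constant[OF conn])
    fix a
    show "\<exists>T. openin (top_of_set UNIV) T \<and> a \<in> T \<and> (\<forall>x\<in>T. f x = f a)"
      using loc[of a] by auto
  qed
  then show ?thesis by (auto simp: constant_on_def)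
qed

section \<open>Integral curves\<close>

text \<open>
  The state space is \<open>nat \<Rightarrow> real\<close> with only the first \<open>N\<close> coordinates relevant, so that no
  completeness of the model space is assumed.  The Banach fixed-point theorem is then applied to bounded
  continuous functions on \<open>nat discrete \<times> real\<close>: the index is part of the argument, and time
  and values are clamped to the admissible ranges by \<open>cl\<close> and \<open>P\<close>.
\<close>

lemma Picard:
  fixes V :: "nat \<Rightarrow> (nat \<Rightarrow> real) \<Rightarrow> real" and y0 :: "nat \<Rightarrow> real" and N :: nat and r K M :: real
  defines "bx \<equiv> {u. \<forall>j<N. \<bar>u j - y0 j\<bar> \<le> r}"
  assumes r: "r > 0" and K: "K \<ge> 0"
    and lip: "\<And>i u w. i < N \<Longrightarrow> u \<in> bx \<Longrightarrow> w \<in> bx \<Longrightarrow> \<bar>V i u - V i w\<bar> \<le> K * (\<Sum>j<N. \<bar>u j - w j\<bar>)"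
    and bdd: "\<And>i u. i < N \<Longrightarrow> u \<in> bx \<Longrightarrow> \<bar>V i u\<bar> \<le> M"
  shows "\<exists>\<delta>>0. \<exists>c. (\<forall>i<N. c 0 i = y0 i) \<and> (\<forall>t. \<bar>t\<bar> < \<delta> \<longrightarrow> c t \<in> bx \<and>
    (\<forall>i<N. ((\<lambda>t. c t i) has_real_derivative V i (c t)) (at t)))"
proof -
  define M' where "M' = max M 0"
  \<comment> \<open>The first bound makes the Picard operator a contraction with factor 1/2, the
    second keeps its values within r of \<open>y0\<close>. The added 1s keep the denominators
    positive.\<close>
  define \<delta> where "\<delta> = min (1 / (2 * (K * N + 1))) (r / (M' + 1))"
  have KN: "K * N + 1 > 0" using K by (simp add: add_nonneg_pos)
  have M': "M' \<ge> 0" "M \<le> M'" by (auto simp: M'_def)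
  have \<delta>: "\<delta> > 0" using KN r M' by (simp add: \<delta>_def)
  have \<delta>K: "\<delta> * (K * N) \<le> 1 / 2"
  proof -
    have "\<delta> * (K * N) \<le> 1 / (2 * (K * N + 1)) * (K * N)"
      using K by (intro mult_right_mono) (auto simp: \<delta>_def)
    also have "\<dots> \<le> 1 / 2" using KN by (simp add: field_simps)
    finally show ?thesis .
  qed
  have \<delta>M: "M' * \<delta> \<le> r"
  proof -
    have "M' * \<delta> \<le> M' * (r / (M' + 1))" using M' by (intro mult_left_mono) (auto simp: \<delta>_def)
    also have "\<dots> \<le> r" using M' r by (simp add: field_simps)
    finally show ?thesis .
  qed
  define P where "P u j = max (y0 j - r) (min (y0 j + r) (u j))" for u :: "nat \<Rightarrow> real" and j
  have P_bx: "P u \<in> bx" for u using r by (auto simp: bx_def P_def)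
  have P_id: "P u j = u j" if "u \<in> bx" "j < N" for u j
    using that by (auto simp: bx_def P_def abs_le_iff)
  have P_lip: "\<bar>P u j - P w j\<bar> \<le> \<bar>u j - w j\<bar>" for u w j by (auto simp: P_def)
  have VP_lip: "\<bar>V i (P u) - V i (P w)\<bar> \<le> K * (\<Sum>j<N. \<bar>u j - w j\<bar>)" if "i < N" for i u w
    using lip[OF that P_bx P_bx] mult_left_mono[OF sum_mono[of "{..<N}", OF P_lip] K] by (rule order_trans)
  define cl where "cl t = max (-\<delta>) (min \<delta> t)" for t
  have cl: "cl t \<in> {-\<delta>..\<delta>}" for t using \<delta> by (auto simp: cl_def)
  have cl_id: "cl t = t" if "t \<in> {-\<delta>..\<delta>}" for t using that by (auto simp: cl_def)
  define G where "G u i s = V i (P (\<lambda>j. apply_bcontfun u (discrete j, s)))" for u :: "(nat discrete \<times> real) \<Rightarrow>\<^sub>C real" and i s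
  \<comment> \<open>The oriented integral from 0 to t, also for negative t, expressed through
    integrals that start at the left end of the time interval.\<close>
  define I where "I g t = integral {-\<delta>..t} g - integral {-\<delta>..0} g" for g :: "real \<Rightarrow> real" and t
  have I0: "I g 0 = 0" for g by (simp add: I_def)
  have I_deriv: "(I g has_real_derivative g t) (at t within {-\<delta>..\<delta>})"
    if "continuous_on {-\<delta>..\<delta>} g" "t \<in> {-\<delta>..\<delta>}" for g t
    unfolding I_def using integral_has_real_derivative[OF that] by (auto intro!: derivative_eq_intros)
  have u_cont: "continuous_on S (\<lambda>s. apply_bcontfun u (discrete j, s))" for u :: "(nat discrete \<times> real) \<Rightarrow>\<^sub>C real" and j S
    by (intro continuous_on_compose2[OF continuous_on_apply_bcontfun] continuous_intros) auto
  have G_cont: "continuous_on S (G u i)" if "i < N" for u i S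
    unfolding continuous_on_def
  proof (intro ballI)
    fix s assume "s \<in> S"
    have tu: "((\<lambda>s'. apply_bcontfun u (discrete j, s')) \<longlongrightarrow> apply_bcontfun u (discrete j, s)) (at s within S)" for j
      using u_cont[of S u j] \<open>s \<in> S\<close> by (simp add: continuous_on_def)
    have lim: "((\<lambda>s'. K * (\<Sum>j<N. \<bar>apply_bcontfun u (discrete j, s') - apply_bcontfun u (discrete j, s)\<bar>)) \<longlongrightarrow>
        K * (\<Sum>j<N. \<bar>apply_bcontfun u (discrete j, s) - apply_bcontfun u (discrete j, s)\<bar>)) (at s within S)"
      by (intro tendsto_mult tendsto_const tendsto_sum tendsto_rabs tendsto_diff tu)
    have "((\<lambda>s'. G u i s' - G u i s) \<longlongrightarrow> 0) (at s within S)"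
    proof (rule Lim_null_comparison[OF always_eventually])
      show "\<forall>s'. norm (G u i s' - G u i s) \<le> K * (\<Sum>j<N. \<bar>apply_bcontfun u (discrete j, s') - apply_bcontfun u (discrete j, s)\<bar>)"
        unfolding G_def real_norm_def by (intro allI VP_lip that)
      show "((\<lambda>s'. K * (\<Sum>j<N. \<bar>apply_bcontfun u (discrete j, s') - apply_bcontfun u (discrete j, s)\<bar>)) \<longlongrightarrow> 0) (at s within S)"
        using lim by simp
    qed
    then show "(G u i \<longlongrightarrow> G u i s) (at s within S)" by (rule Lim_null[THEN iffD2])
  qed
  have GM: "\<bar>G u i s\<bar> \<le> M'" if "i < N" for u i s
    using bdd[OF that P_bx] M'(2) unfolding G_def by (rule order_trans)
  have I_bound: "\<bar>I g t\<bar> \<le> B * \<delta>"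
    if "continuous_on {-\<delta>..\<delta>} g" "\<And>s. s \<in> {-\<delta>..\<delta>} \<Longrightarrow> \<bar>g s\<bar> \<le> B" "t \<in> {-\<delta>..\<delta>}" for g B t
  proof -
    have "norm (I g t - I g 0) \<le> B * norm (t - 0)"
      by (rule field_differentiable_bound[OF convex_real_interval(5) I_deriv[OF that(1)]])
        (use that \<delta> in auto)
    moreover have "B \<ge> 0" using that(2)[of 0] \<delta> by simp
    ultimately show ?thesis using that(3) mult_left_mono[of "\<bar>t\<bar>" \<delta> B] by (simp add: I0 abs_le_iff)
  qed
  \<comment> \<open>The irrelevant components are set to 0, so that one bound holds for all indices
    and the image is a bounded function.\<close>
  define \<Phi> where "\<Phi> u z = (if of_discrete (fst z) < N then y0 (of_discrete (fst z)) + I (G u (of_discrete (fst z))) (cl (snd z)) else 0)" for u z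
  have \<Phi>_bcont: "\<Phi> u \<in> bcontfun" for u
  proof (rule bcontfun_normI)
    have "continuous_on ({discrete i} \<times> UNIV) (\<Phi> u)" for i
    proof (cases "i < N")
      case True
      have "continuous_on {-\<delta>..\<delta>} (I (G u i))"
        using I_deriv[OF G_cont[OF True]] by (intro DERIV_continuous_on) blast
      moreover have "continuous_on ({discrete i} \<times> UNIV) (\<lambda>z::nat discrete \<times> real. cl (snd z))"
        unfolding cl_def by (intro continuous_intros)
      ultimately have "continuous_on ({discrete i} \<times> UNIV) (\<lambda>z::nat discrete \<times> real. I (G u i) (cl (snd z)))"
        by (rule continuous_on_compose2) (use cl in auto)
      then have "continuous_on ({discrete i} \<times> UNIV) (\<lambda>z. y0 i + I (G u i) (cl (snd z)))"
        by (intro continuous_on_add continuous_on_const)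
      then show ?thesis by (rule continuous_on_eq) (auto simp: \<Phi>_def True discrete_inverse)
    next
      case False
      have "continuous_on ({discrete i} \<times> (UNIV::real set)) (\<lambda>z. 0 :: real)" by simp
      then show ?thesis by (rule continuous_on_eq) (auto simp: \<Phi>_def False discrete_inverse)
    qed
    \<comment> \<open>Continuity may be checked for each index separately, because singletons of the
      discrete factor are open.\<close>
    then have "continuous_on (\<Union>i\<in>UNIV. {discrete i} \<times> UNIV) (\<Phi> u)"
      by (intro continuous_on_open_UN) (auto intro!: open_Times Discrete_Topology.open_discrete)
    moreover have "(\<Union>i\<in>UNIV. {discrete i} \<times> UNIV) = (UNIV :: (nat discrete \<times> real) set)"
      by (auto intro: exI[of _ "of_discrete _"] simp: of_discrete_inverse) (metis of_discrete_inverse)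
    ultimately show "continuous_on UNIV (\<Phi> u)" by simp
    fix z
    show "norm (\<Phi> u z) \<le> (\<Sum>j<N. \<bar>y0 j\<bar>) + M' * \<delta>"
    proof (cases "of_discrete (fst z) < N")
      case True
      have "\<bar>y0 (of_discrete (fst z))\<bar> \<le> (\<Sum>j<N. \<bar>y0 j\<bar>)" using True by (intro member_le_sum) auto
      moreover have "\<bar>I (G u (of_discrete (fst z))) (cl (snd z))\<bar> \<le> M' * \<delta>"
        using GM[OF True] by (intro I_bound G_cont[OF True] cl)
      ultimately show ?thesis by (simp add: \<Phi>_def True)
    next
      case False
      then show ?thesis using M' \<delta> by (simp add: \<Phi>_def add_nonneg_nonneg sum_nonneg)
    qed
  qed
  have "\<exists>!u. Bcontfun (\<Phi> u) = u"
  proof (rule banach_fix_type[of "1/2" "\<lambda>u. Bcontfun (\<Phi> u)"])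
    show "\<forall>u w. dist (Bcontfun (\<Phi> u)) (Bcontfun (\<Phi> w)) \<le> 1 / 2 * dist u w"
    proof (intro allI dist_bound)
      fix u w :: "(nat discrete \<times> real) \<Rightarrow>\<^sub>C real" and z :: "nat discrete \<times> real"
      show "dist (apply_bcontfun (Bcontfun (\<Phi> u)) z) (apply_bcontfun (Bcontfun (\<Phi> w)) z) \<le> 1 / 2 * dist u w"
      proof (cases "of_discrete (fst z) < N")
        case True
        let ?t = "cl (snd z)"
        let ?g = "\<lambda>s. G u (of_discrete (fst z)) s - G w (of_discrete (fst z)) s"
        have c: "continuous_on {-\<delta>..\<delta>} ?g" by (intro continuous_intros G_cont True)
        have b: "\<bar>?g s\<bar> \<le> K * (N * dist u w)" for s
        proof -
          have "\<bar>?g s\<bar> \<le> K * (\<Sum>j<N. \<bar>apply_bcontfun u (discrete j, s) - apply_bcontfun w (discrete j, s)\<bar>)"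
            unfolding G_def by (rule VP_lip[OF True])
          also have "\<dots> \<le> K * (\<Sum>j<N. dist u w)"
            using dist_bounded[of u _ w] by (intro mult_left_mono K sum_mono) (auto simp: dist_real_def)
          finally show ?thesis by simp
        qed
        have "(\<lambda>t. I (G u (of_discrete (fst z))) t - I (G w (of_discrete (fst z))) t) ?t = I ?g ?t"
        proof -
          have "(G u' (of_discrete (fst z))) integrable_on {-\<delta>..y}" for u' y
            by (intro integrable_continuous_real G_cont True)
          then show ?thesis by (simp add: I_def integral_diff)
        qed
        then have "\<bar>I (G u (of_discrete (fst z))) ?t - I (G w (of_discrete (fst z))) ?t\<bar> \<le> K * (N * dist u w) * \<delta>"
          using I_bound[OF c b cl] by simp
        also have "\<dots> = \<delta> * (K * N) * dist u w" by simp
        also have "\<dots> \<le> 1 / 2 * dist u w" by (intro mult_right_mono \<delta>K) simp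
        finally show ?thesis
          by (simp add: Bcontfun_inverse \<Phi>_bcont dist_real_def \<Phi>_def True)
      qed (simp add: Bcontfun_inverse \<Phi>_bcont \<Phi>_def)
    qed
  qed auto
  then obtain u where "Bcontfun (\<Phi> u) = u" by blast
  then have u: "apply_bcontfun u z = \<Phi> u z" for z
    using Bcontfun_inverse[OF \<Phi>_bcont, of u] by simp
  define c where "c t i = apply_bcontfun u (discrete i, t)" for t i
  have c_eq: "c t i = y0 i + I (G u i) t" if "i < N" "t \<in> {-\<delta>..\<delta>}" for i t
    using that cl_id by (simp add: c_def u \<Phi>_def discrete_inverse)
  have c_bx: "c t \<in> bx" if "t \<in> {-\<delta>..\<delta>}" for t
  proof -
    have "\<bar>I (G u i) t\<bar> \<le> r" if "i < N" for i
      using I_bound[OF G_cont[OF that] GM[OF that] \<open>t \<in> {-\<delta>..\<delta>}\<close>, of u] \<delta>M by linarith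
    then show ?thesis using that by (simp add: bx_def c_eq)
  qed
  \<comment> \<open>The fixed point stays in the box for these times, so clamping its values changes
    nothing and it solves the original equation.\<close>
  have G_V: "G u i t = V i (c t)" if "i < N" "t \<in> {-\<delta>..\<delta>}" for i t
  proof -
    have "\<bar>V i (P (c t)) - V i (c t)\<bar> \<le> K * (\<Sum>j<N. \<bar>P (c t) j - c t j\<bar>)"
      by (rule lip[OF that(1) P_bx c_bx[OF that(2)]])
    also have "(\<Sum>j<N. \<bar>P (c t) j - c t j\<bar>) = 0"
      using P_id[OF c_bx[OF that(2)]] by simp
    finally show ?thesis by (simp add: G_def c_def[abs_def])
  qed
  have "((\<lambda>t. c t i) has_real_derivative V i (c t)) (at t)" if i: "i < N" and t: "\<bar>t\<bar> < \<delta>" for i t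
  proof -
    have t': "t \<in> {-\<delta>..\<delta>}" "t \<in> {-\<delta><..<\<delta>}" using t by auto
    have "(I (G u i) has_real_derivative G u i t) (at t)"
      using I_deriv[OF G_cont[OF i] t'(1)] t'(2) by (simp add: at_within_Icc_at)
    then have "((\<lambda>t. y0 i + I (G u i) t) has_real_derivative G u i t) (at t)"
      by (auto intro!: derivative_eq_intros)
    then have "((\<lambda>t. c t i) has_real_derivative G u i t) (at t)"
      by (rule has_field_derivative_transform_within_open[OF _ open_greaterThanLessThan t'(2)])
        (use i c_eq in auto)
    then show ?thesis using G_V[OF i t'(1)] by simp
  qed
  moreover have "c t \<in> bx" if "\<bar>t\<bar> < \<delta>" for t
    using that by (intro c_bx) auto
  moreover have "c 0 i = y0 i" if "i < N" for i
    using c_eq[OF that, of 0] I0 \<delta> by simp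
  ultimately show ?thesis
    using \<delta> by (intro exI[of _ \<delta>] conjI exI[of _ c]) auto
qed

section \<open>Integral curves on manifolds and differentiation along curves\<close>

lemma smooth_on_locally_Lipschitz:
  fixes f :: "'e::real_inner \<Rightarrow> real"
  assumes B: "coord_basis (B::'e set)" and S: "open S" "y0 \<in> S" and f: "smooth_on S f"
  shows "\<exists>r>0. \<exists>K\<ge>0. \<exists>M. ball y0 r \<subseteq> S \<and> (\<forall>y\<in>ball y0 r. \<bar>f y\<bar> \<le> M \<and> (\<forall>z\<in>ball y0 r. \<bar>f y - f z\<bar> \<le> K * norm (y - z)))"
proof -
  obtain r where r: "r > 0" "cball y0 r \<subseteq> S" using S open_contains_cball by blast
  have bd: "\<exists>M\<ge>0. \<forall>y\<in>cball y0 r. \<bar>h y\<bar> \<le> M" if "smooth_on S h" for h :: "'e \<Rightarrow> real"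
  proof -
    have "compact (h ` cball y0 r)"
      by (intro compact_continuous_image compact_cball_coord_basis[OF B]
          continuous_on_subset[OF smooth_on_continuous[OF that] r(2)])
    then obtain M where "\<forall>y\<in>cball y0 r. \<bar>h y\<bar> \<le> M" 
      using compact_imp_bounded bounded_iff by (metis image_eqI real_norm_def)
    moreover from this have "M \<ge> 0" using r(1) by (metis abs_ge_zero centre_in_cball less_imp_le order_trans)
    ultimately show ?thesis by blast
  qed
  let ?D = "\<lambda>b y. frechet_derivative f (at y) b"
  have "\<forall>b. \<exists>M\<ge>0. \<forall>y\<in>cball y0 r. \<bar>?D b y\<bar> \<le> M"
    using bd[OF smooth_on_frechet_derivative[OF S(1) f]] by blast
  then obtain k where k: "\<And>b. k b \<ge> 0" "\<And>b y. y \<in> cball y0 r \<Longrightarrow> \<bar>?D b y\<bar> \<le> k b" by metis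
  \<comment> \<open>Bounds on the partial derivatives over the compact ball add up, through the
    expansion of a direction in B, to a bound on the operator norm of the derivative.\<close>
  define K where "K = (\<Sum>b\<in>B. norm b * k b)"
  have K: "K \<ge> 0" unfolding K_def by (intro sum_nonneg mult_nonneg_nonneg k norm_ge_zero)
  have "\<bar>f y - f z\<bar> \<le> K * norm (y - z)" if "y \<in> ball y0 r" "z \<in> ball y0 r" for y z
  proof -
    have "norm (f y - f z) \<le> K * norm (y - z)"
    proof (rule differentiable_bound[OF convex_ball _ _ that])
      fix x assume x: "x \<in> ball y0 r"
      then have xS: "x \<in> S" using r by auto
      note d = smooth_on_has_derivative[OF f xS]
      show "(f has_derivative frechet_derivative f (at x)) (at x within ball y0 r)"
        by (rule has_derivative_at_withinI[OF d])
      show "onorm (frechet_derivative f (at x)) \<le> K"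
      proof (rule onorm_bound[OF K])
        fix v
        have "norm (frechet_derivative f (at x) v) = norm (\<Sum>b\<in>B. (v \<bullet> b) * ?D b x)"
          using coord_basis_linear[OF B has_derivative_linear[OF d], of v] by simp
        also have "\<dots> \<le> (\<Sum>b\<in>B. (norm v * norm b) * k b)"
        proof (rule sum_norm_le)
          fix b
          show "norm ((v \<bullet> b) * ?D b x) \<le> (norm v * norm b) * k b"
            using x k(1)[of b] by (auto simp: abs_mult intro!: mult_mono Cauchy_Schwarz_ineq2 k(2))
        qed
        finally show "norm (frechet_derivative f (at x) v) \<le> K * norm v"
          by (simp add: K_def sum_distrib_left sum_distrib_right mult_ac)
      qed
    qed
    then show ?thesis by simp
  qed
  moreover obtain M where "\<And>y. y \<in> cball y0 r \<Longrightarrow> \<bar>f y\<bar> \<le> M" using bd[OF f] by blast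
  then have "\<bar>f y\<bar> \<le> M" if "y \<in> ball y0 r" for y using that by simp
  moreover have "ball y0 r \<subseteq> S" using r(2) ball_subset_cball by blast
  ultimately show ?thesis using r(1) K by blast
qed

text \<open>In the coordinates of \<open>local_coordinates\<close> the field has the locally
  Lipschitz components X (c b). The equation is solved there after numbering the basis, and the
  coordinate formula for X f shows that the lifted curve has the required derivative on every smooth
  f.\<close>

lemma integral_curve_exists:
  fixes A :: "('m::t2_space, 'e::real_inner) chart set"
  assumes A: "smooth_atlas A"
    and X: "\<And>f. f \<in> smooth_funs A \<Longrightarrow> X f \<in> smooth_funs A" "\<And>p. (\<lambda>f. X f p) \<in> tangent_space A p"
  shows "\<exists>\<delta>>0. \<exists>c. c 0 = p \<and> (\<forall>t. \<bar>t\<bar> < \<delta> \<longrightarrow>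
    (\<forall>f\<in>smooth_funs A. ((\<lambda>t. f (c t)) has_real_derivative X f (c t)) (at t)))"
proof -
  obtain B :: "'e set" where B: "coord_basis B" using smooth_atlas_coord_basis[OF A] by blast
  obtain U \<phi> where U: "(U, \<phi>) \<in> A" "p \<in> U" using smooth_atlas_cover[OF A] by blast
  obtain W c where W: "open W" "p \<in> W" "W \<subseteq> U"
    and c': "\<forall>b. c b \<in> smooth_funs A \<and> (\<forall>q\<in>W. c b q = \<phi> q \<bullet> b)"
    "\<forall>q\<in>W. \<forall>v\<in>tangent_space A q. \<forall>f\<in>smooth_funs A.
       v f = (\<Sum>b\<in>B. v (c b) * frechet_derivative (f \<circ> inv_into U \<phi>) (at (\<phi> q)) b)"
    using local_coordinates[OF A U B] by (elim exE conjE)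
  note c = conjunct1[OF spec[OF c'(1)]] bspec[OF conjunct2[OF spec[OF c'(1)]]] bspec[OF bspec[OF bspec[OF c'(2)]]]
  have opW: "open (\<phi> ` W)" by (rule chart_open_image[OF A U(1) W(1,3)])
  let ?V = "\<lambda>b y. X (c b) (inv_into U \<phi> y)"
  have V: "smooth_on (\<phi> ` W) (?V b)" for b
    using smooth_on_mono[OF smooth_funsD[OF X(1)[OF c(1)] U(1)], of "\<phi> ` W" b] W by (simp add: o_def image_mono)
  have "\<forall>b. \<exists>r>0. \<exists>K\<ge>0. \<exists>M. ball (\<phi> p) r \<subseteq> \<phi> ` W \<and> (\<forall>y\<in>ball (\<phi> p) r. \<bar>?V b y\<bar> \<le> M \<and>
      (\<forall>z\<in>ball (\<phi> p) r. \<bar>?V b y - ?V b z\<bar> \<le> K * norm (y - z)))"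
    using smooth_on_locally_Lipschitz[OF B opW _ V] W(2) by blast
  then obtain \<rho> K M where \<rho>: "\<And>b. \<rho> b > 0" and K: "\<And>b. K b \<ge> 0" and
    VM: "\<And>b y. y \<in> ball (\<phi> p) (\<rho> b) \<Longrightarrow> \<bar>?V b y\<bar> \<le> M b" and
    VK: "\<And>b y z. y \<in> ball (\<phi> p) (\<rho> b) \<Longrightarrow> z \<in> ball (\<phi> p) (\<rho> b) \<Longrightarrow> \<bar>?V b y - ?V b z\<bar> \<le> K b * norm (y - z)"
    by metis
  obtain \<rho>0 where \<rho>0: "\<rho>0 > 0" "ball (\<phi> p) \<rho>0 \<subseteq> \<phi> ` W" using opW W(2) by (metis imageI openE)
  \<comment> \<open>A common radius for all components. Inserting \<open>\<rho>0\<close> keeps the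
    ball in the chart image and the set nonempty when the dimension is zero.\<close>
  define R where "R = Min (insert \<rho>0 (\<rho> ` B))"
  note finB = coord_basis_finite[OF B]
  have R: "R > 0" "R \<le> \<rho>0" "\<And>b. b \<in> B \<Longrightarrow> R \<le> \<rho> b"
    unfolding R_def using finB \<rho> \<rho>0 by auto
  define N where "N = card B"
  obtain \<beta> where \<beta>: "bij_betw \<beta> {..<N} B"
    using ex_bij_betw_nat_finite[OF finB] unfolding N_def lessThan_atLeast0 by blast
  have \<beta>B: "\<beta> i \<in> B" if "i < N" for i using \<beta> that by (auto simp: bij_betw_def)
  have sum_\<beta>: "(\<Sum>i<N. h (\<beta> i)) = (\<Sum>b\<in>B. h b)" for h :: "'e \<Rightarrow> 'x::comm_monoid_add"
    by (rule sum.reindex_bij_betw[OF \<beta>])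
  define S where "S = (\<Sum>b\<in>B. norm b) + 1"
  have S: "S > 0" unfolding S_def by (simp add: add_nonneg_pos sum_nonneg)
  \<comment> \<open>A coordinate error of at most r in each component moves the point by at most r
    times the sum of norms, hence by less than R.\<close>
  define r where "r = R / (2 * S)"
  have r: "r > 0" using R S by (simp add: r_def)
  define y0 where "y0 i = \<phi> p \<bullet> \<beta> i" for i
  define Y where "Y u = (\<Sum>i<N. u i *\<^sub>R \<beta> i)" for u :: "nat \<Rightarrow> real"
  have Yy0: "Y y0 = \<phi> p"
    unfolding Y_def y0_def using sum_\<beta>[of "\<lambda>b. (\<phi> p \<bullet> b) *\<^sub>R b"] coord_basis_expand[OF B] by simp
  define bx where "bx = {u. \<forall>j<N. \<bar>u j - y0 j\<bar> \<le> r}"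
  have norm_Y: "norm (Y u - Y w) \<le> S * (\<Sum>j<N. \<bar>u j - w j\<bar>)" for u w
  proof -
    have "norm (Y u - Y w) = norm (\<Sum>j<N. (u j - w j) *\<^sub>R \<beta> j)"
      by (simp add: Y_def scaleR_diff_left sum_subtractf)
    also have "\<dots> \<le> (\<Sum>j<N. S * \<bar>u j - w j\<bar>)"
    proof (rule sum_norm_le)
      fix j assume "j \<in> {..<N}"
      then have "norm (\<beta> j) \<le> (\<Sum>b\<in>B. norm b)" using \<beta>B finB by (intro member_le_sum) auto
      then have "norm (\<beta> j) \<le> S" by (simp add: S_def)
      then show "norm ((u j - w j) *\<^sub>R \<beta> j) \<le> S * \<bar>u j - w j\<bar>"
        by (simp add: mult.commute[of S] mult_left_mono)
    qed
    finally show ?thesis by (simp add: sum_distrib_left)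
  qed
  have Y_ball: "Y u \<in> ball (\<phi> p) R" if "u \<in> bx" for u
  proof -
    have "norm (Y u - Y y0) = norm (\<Sum>j<N. (u j - y0 j) *\<^sub>R \<beta> j)"
      by (simp add: Y_def scaleR_diff_left sum_subtractf)
    also have "\<dots> \<le> (\<Sum>j<N. r * norm (\<beta> j))"
      using that by (intro sum_norm_le) (auto simp: bx_def intro!: mult_right_mono)
    also have "\<dots> = r * (\<Sum>b\<in>B. norm b)"
      using sum_\<beta>[of "\<lambda>b. r * norm b"] by (simp add: sum_distrib_left)
    also have "\<dots> \<le> r * S" using r by (intro mult_left_mono) (auto simp: S_def)
    also have "\<dots> < R" using R S by (simp add: r_def)
    finally show ?thesis by (simp add: Yy0 dist_norm norm_minus_commute)
  qed
  define K' where "K' = (\<Sum>b\<in>B. K b) * S"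
  have K': "K' \<ge> 0" using K S by (simp add: K'_def sum_nonneg)
  have "\<exists>\<delta>>0. \<exists>u. (\<forall>i<N. u 0 i = y0 i) \<and> (\<forall>t. \<bar>t\<bar> < \<delta> \<longrightarrow> u t \<in> {u. \<forall>j<N. \<bar>u j - y0 j\<bar> \<le> r} \<and>
    (\<forall>i<N. ((\<lambda>t. u t i) has_real_derivative ?V (\<beta> i) (Y (u t))) (at t)))"
  proof (rule Picard[OF r K'])
    fix i u w assume i: "i < N" and uw: "u \<in> {u. \<forall>j<N. \<bar>u j - y0 j\<bar> \<le> r}" "w \<in> {u. \<forall>j<N. \<bar>u j - y0 j\<bar> \<le> r}"
    have *: "Y u \<in> ball (\<phi> p) (\<rho> (\<beta> i))" "Y w \<in> ball (\<phi> p) (\<rho> (\<beta> i))"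
      using Y_ball[of u] Y_ball[of w] uw R(3)[OF \<beta>B[OF i]] by (auto simp: bx_def)
    have "\<bar>?V (\<beta> i) (Y u) - ?V (\<beta> i) (Y w)\<bar> \<le> K (\<beta> i) * norm (Y u - Y w)" by (rule VK[OF *])
    also have "\<dots> \<le> (\<Sum>b\<in>B. K b) * (S * (\<Sum>j<N. \<bar>u j - w j\<bar>))"
      using \<beta>B[OF i] finB K by (intro mult_mono norm_Y member_le_sum sum_nonneg) auto
    finally show "\<bar>?V (\<beta> i) (Y u) - ?V (\<beta> i) (Y w)\<bar> \<le> K' * (\<Sum>j<N. \<bar>u j - w j\<bar>)"
      by (simp add: K'_def mult.assoc)
  next
    fix i u assume i: "i < N" and u: "u \<in> {u. \<forall>j<N. \<bar>u j - y0 j\<bar> \<le> r}"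
    have "Y u \<in> ball (\<phi> p) (\<rho> (\<beta> i))"
      using Y_ball[of u] u R(3)[OF \<beta>B[OF i]] by (auto simp: bx_def)
    from VM[OF this] have "\<bar>?V (\<beta> i) (Y u)\<bar> \<le> \<bar>M (\<beta> i)\<bar>" by linarith
    also have "\<dots> \<le> (\<Sum>b\<in>B. \<bar>M b\<bar>)" using \<beta>B[OF i] finB by (intro member_le_sum) auto
    finally show "\<bar>?V (\<beta> i) (Y u)\<bar> \<le> (\<Sum>b\<in>B. \<bar>M b\<bar>)" .
  qed
  then obtain \<delta> u where \<delta>: "\<delta> > 0" and u0: "\<And>i. i < N \<Longrightarrow> u 0 i = y0 i"
    and ub: "\<And>t. \<bar>t\<bar> < \<delta> \<Longrightarrow> u t \<in> bx"
    and ud: "\<And>t i. \<bar>t\<bar> < \<delta> \<Longrightarrow> i < N \<Longrightarrow> ((\<lambda>t. u t i) has_real_derivative ?V (\<beta> i) (Y (u t))) (at t)"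
    unfolding bx_def by blast
  let ?c = "\<lambda>t. inv_into U \<phi> (Y (u t))"
  have "Y (u 0) = \<phi> p" using u0 Yy0 by (simp add: Y_def)
  then have "?c 0 = p" by (simp add: chart_inv[OF A U(1) U(2)])
  moreover have d: "((\<lambda>t. f (?c t)) has_real_derivative X f (?c t)) (at t)"
    if t: "\<bar>t\<bar> < \<delta>" and f: "f \<in> smooth_funs A" for t f
  proof -
    let ?f = "f \<circ> inv_into U \<phi>"
    have "Y (u t) \<in> \<phi> ` W" using Y_ball[OF ub[OF t]] R(2) \<rho>0(2) by auto
    then obtain q where q: "q \<in> W" "Y (u t) = \<phi> q" by blast
    then have cq: "?c t = q" using W(3) chart_inv[OF A U(1)] by auto
    have df: "(?f has_derivative frechet_derivative ?f (at (Y (u t)))) (at (Y (u t)))"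
      by (rule smooth_on_has_derivative[OF smooth_funsD[OF f U(1)]]) (use q W(3) in auto)
    have "((\<lambda>t. Y (u t)) has_derivative (\<lambda>h. \<Sum>i<N. (h * ?V (\<beta> i) (Y (u t))) *\<^sub>R \<beta> i)) (at t)"
      unfolding Y_def
    proof (intro has_derivative_sum has_derivative_scaleR_left)
      fix i assume "i \<in> {..<N}"
      then have "((\<lambda>t. u t i) has_derivative (*) (?V (\<beta> i) (Y (u t)))) (at t)"
        using ud[OF t, of i] by (simp add: has_field_derivative_def)
      then show "((\<lambda>t. u t i) has_derivative (\<lambda>h. h * ?V (\<beta> i) (\<Sum>i<N. u t i *\<^sub>R \<beta> i))) (at t)"
        by (rule has_derivative_eq_rhs) (simp add: Y_def fun_eq_iff)
    qed
    from has_derivative_compose[OF this df]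
    have "((\<lambda>t. ?f (Y (u t))) has_derivative (\<lambda>h. frechet_derivative ?f (at (Y (u t))) (\<Sum>i<N. (h * ?V (\<beta> i) (Y (u t))) *\<^sub>R \<beta> i))) (at t)" .
    moreover have "frechet_derivative ?f (at (Y (u t))) (\<Sum>i<N. (h * ?V (\<beta> i) (Y (u t))) *\<^sub>R \<beta> i) = X f q * h" for h
    proof -
      have "frechet_derivative ?f (at (Y (u t))) (\<Sum>i<N. (h * ?V (\<beta> i) (Y (u t))) *\<^sub>R \<beta> i) =
          (\<Sum>i<N. (h * ?V (\<beta> i) (Y (u t))) * frechet_derivative ?f (at (Y (u t))) (\<beta> i))"
        using has_derivative_linear[OF df] by (simp add: linear_sum linear_cmul)
      also have "\<dots> = (\<Sum>b\<in>B. (h * ?V b (Y (u t))) * frechet_derivative ?f (at (Y (u t))) b)"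
        by (rule sum_\<beta>[of "\<lambda>b. (h * ?V b (Y (u t))) * frechet_derivative ?f (at (Y (u t))) b"])
      also have "\<dots> = X f q * h"
        using c(3)[OF q(1) X(2) f] cq q(2) by (simp add: sum_distrib_left sum_distrib_right mult_ac)
      finally show ?thesis .
    qed
    ultimately show ?thesis by (simp add: has_field_derivative_def cq)
  qed
  ultimately show ?thesis
    by (intro exI[of _ \<delta>] conjI exI[of _ ?c] \<delta> allI impI ballI) (simp, rule d)
qed

text \<open>Continuity of the curve is known only after composing with smooth functions; a bump
  function at u t that vanishes off W recovers it as a topological statement.\<close>

lemma smooth_curve_eventually_in:
  fixes A :: "('m::t2_space, 'e::real_inner) chart set"
  assumes A: "smooth_atlas A" and u: "\<And>f. f \<in> smooth_funs A \<Longrightarrow> isCont (\<lambda>s::real. f (u s)) t"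
    and W: "open W" "u t \<in> W"
  shows "\<forall>\<^sub>F s in nhds t. u s \<in> W"
proof -
  obtain U \<phi> where U: "(U, \<phi>) \<in> A" "u t \<in> U" using smooth_atlas_cover[OF A] by blast
  obtain \<eta> K W' where \<eta>: "\<eta> \<in> smooth_funs A" "u t \<in> W'" "\<forall>x\<in>W'. \<eta> x = 1" "\<forall>x. x \<notin> K \<longrightarrow> \<eta> x = 0" "K \<subseteq> W \<inter> U"
    using bump_function[OF A U(1), of "W \<inter> U" "u t"] W U chart_open[OF A U(1)] by (metis IntI Int_lower2 open_Int)
  have "((\<lambda>s. \<eta> (u s)) \<longlongrightarrow> \<eta> (u t)) (nhds t)"
    using u[OF \<eta>(1)] tendsto_at_iff_tendsto_nhds[of "\<lambda>s. \<eta> (u s)" t] by (simp add: continuous_at)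
  then have "((\<lambda>s. \<eta> (u s)) \<longlongrightarrow> 1) (nhds t)" using \<eta>(2,3) by simp
  then have "\<forall>\<^sub>F s in nhds t. \<eta> (u s) > 0" by (rule order_tendstoD) simp
  then show ?thesis by (rule eventually_mono) (use \<eta> in force)
qed

lemma smooth_funs_separate:
  fixes A :: "('m::t2_space, 'e::real_inner) chart set"
  assumes A: "smooth_atlas A" and eq: "\<And>f. f \<in> smooth_funs A \<Longrightarrow> f p = f q"
  shows "p = q"
proof (rule ccontr)
  assume "p \<noteq> q"
  obtain U \<phi> where U: "(U, \<phi>) \<in> A" "p \<in> U" using smooth_atlas_cover[OF A] by blast
  obtain \<eta> K W' where \<eta>: "\<eta> \<in> smooth_funs A" "p \<in> W'" "\<forall>x\<in>W'. \<eta> x = 1" "\<forall>x. x \<notin> K \<longrightarrow> \<eta> x = 0" "K \<subseteq> U - {q}"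
    using bump_function[OF A U(1), of "U - {q}" p] U chart_open[OF A U(1)] \<open>p \<noteq> q\<close>
    by (metis Diff_iff Diff_subset open_delete singletonD)
  then have "\<eta> p = 1" "\<eta> q = 0" by auto
  then show False using eq[OF \<eta>(1)] by simp
qed

text \<open>Chain rule for curves whose derivatives are known only through smooth functions. Both
  curves are replaced by their cut-off coordinates, where the ordinary chain rule applies, and the
  direction is split into its two components.\<close>

lemma curve_pair_derivative:
  fixes A :: "('m::t2_space, 'e::real_inner) chart set" and C :: "('n::t2_space, 'd::real_inner) chart set"
  assumes A: "smooth_atlas A" and C: "smooth_atlas C" and F: "F \<in> smooth_funs (prod_atlas A C)"
    and v: "v \<in> tangent_space A (u t)" and w: "w \<in> tangent_space C (k t)"
    and u: "\<And>f. f \<in> smooth_funs A \<Longrightarrow> ((\<lambda>s. f (u s)) has_real_derivative v f) (at t)"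
    and k: "\<And>f. f \<in> smooth_funs C \<Longrightarrow> ((\<lambda>s. f (k s)) has_real_derivative w f) (at t)"
  shows "((\<lambda>s. F (u s, k s)) has_real_derivative v (\<lambda>p. F (p, k t)) + w (\<lambda>q. F (u t, q))) (at t)"
proof -
  obtain D :: "'d set" where D: "coord_basis D" using smooth_atlas_coord_basis[OF C] by blast
  obtain E :: "'e set" where E: "coord_basis E" using smooth_atlas_coord_basis[OF A] by blast
  obtain U \<phi> where U: "(U, \<phi>) \<in> A" "u t \<in> U" using smooth_atlas_cover[OF A] by blast
  obtain V \<psi> where V: "(V, \<psi>) \<in> C" "k t \<in> V" using smooth_atlas_cover[OF C] by blast
  obtain U' c where U': "open U'" "u t \<in> U'" "U' \<subseteq> U"
    and c': "\<forall>b. c b \<in> smooth_funs A \<and> (\<forall>q\<in>U'. c b q = \<phi> q \<bullet> b)"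
    "\<forall>q\<in>U'. \<forall>v\<in>tangent_space A q. \<forall>f\<in>smooth_funs A.
       v f = (\<Sum>b\<in>E. v (c b) * frechet_derivative (f \<circ> inv_into U \<phi>) (at (\<phi> q)) b)"
    using local_coordinates[OF A U E] by (elim exE conjE)
  note c = conjunct1[OF spec[OF c'(1)]] bspec[OF conjunct2[OF spec[OF c'(1)]]] bspec[OF bspec[OF bspec[OF c'(2)]]]
  obtain V' d where V': "open V'" "k t \<in> V'" "V' \<subseteq> V"
    and d': "\<forall>b. d b \<in> smooth_funs C \<and> (\<forall>q\<in>V'. d b q = \<psi> q \<bullet> b)"
    "\<forall>q\<in>V'. \<forall>v\<in>tangent_space C q. \<forall>f\<in>smooth_funs C.
       v f = (\<Sum>b\<in>D. v (d b) * frechet_derivative (f \<circ> inv_into V \<psi>) (at (\<psi> q)) b)"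
    using local_coordinates[OF C V D] by (elim exE conjE)
  note d = conjunct1[OF spec[OF d'(1)]] bspec[OF conjunct2[OF spec[OF d'(1)]]] bspec[OF bspec[OF bspec[OF d'(2)]]]
  define F' where "F' = F \<circ> inv_into (U \<times> V) (map_prod \<phi> \<psi>)"
  define g where "g s = ((\<Sum>b\<in>E. c b (u s) *\<^sub>R b), (\<Sum>b\<in>D. d b (k s) *\<^sub>R b))" for s
  have g_eq: "g s = (\<phi> (u s), \<psi> (k s))" if "u s \<in> U'" "k s \<in> V'" for s
    using that by (simp add: g_def c d coord_basis_expand[OF D] coord_basis_expand[OF E])
  have dF: "(F' has_derivative frechet_derivative F' (at (\<phi> (u t), \<psi> (k t)))) (at (g t))"
    using prod_chart_derivative[OF A C F U(1) V(1) U(2) V(2)] by (simp add: F'_def g_eq U' V')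
  have dc: "((\<lambda>s. c b (u s)) has_derivative (\<lambda>h. h * v (c b))) (at t)" for b
    by (rule has_derivative_eq_rhs[OF u[OF c(1), unfolded has_field_derivative_def]]) (simp add: fun_eq_iff)
  have dd: "((\<lambda>s. d b (k s)) has_derivative (\<lambda>h. h * w (d b))) (at t)" for b
    by (rule has_derivative_eq_rhs[OF k[OF d(1), unfolded has_field_derivative_def]]) (simp add: fun_eq_iff)
  have "(g has_derivative (\<lambda>h. ((\<Sum>b\<in>E. (h * v (c b)) *\<^sub>R b), (\<Sum>b\<in>D. (h * w (d b)) *\<^sub>R b)))) (at t)"
    unfolding g_def by (intro has_derivative_Pair has_derivative_sum has_derivative_scaleR_left dc dd)
  from has_derivative_compose[OF this dF]
  have *: "((\<lambda>s. F' (g s)) has_derivative (\<lambda>h. frechet_derivative F' (at (\<phi> (u t), \<psi> (k t)))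
      ((\<Sum>b\<in>E. (h * v (c b)) *\<^sub>R b), (\<Sum>b\<in>D. (h * w (d b)) *\<^sub>R b)))) (at t)" .
  have "frechet_derivative F' (at (\<phi> (u t), \<psi> (k t))) ((\<Sum>b\<in>E. (h * v (c b)) *\<^sub>R b), (\<Sum>b\<in>D. (h * w (d b)) *\<^sub>R b)) =
      (v (\<lambda>p. F (p, k t)) + w (\<lambda>q. F (u t, q))) * h" for h
  proof -
    let ?L = "frechet_derivative F' (at (\<phi> (u t), \<psi> (k t)))"
    have lin: "linear ?L" by (rule has_derivative_linear[OF dF])
    have e1: "((\<Sum>b\<in>E. (h * v (c b)) *\<^sub>R b), 0 :: 'd) = (\<Sum>b\<in>E. (h * v (c b)) *\<^sub>R (b, 0))"
      by (simp add: prod_eq_iff fst_sum snd_sum)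
    have e2: "(0 :: 'e, (\<Sum>b\<in>D. (h * w (d b)) *\<^sub>R b)) = (\<Sum>b\<in>D. (h * w (d b)) *\<^sub>R (0, b))"
      by (simp add: prod_eq_iff fst_sum snd_sum)
    have "?L ((\<Sum>b\<in>E. (h * v (c b)) *\<^sub>R b), (\<Sum>b\<in>D. (h * w (d b)) *\<^sub>R b)) =
        ?L (\<Sum>b\<in>E. (h * v (c b)) *\<^sub>R (b, 0)) + ?L (\<Sum>b\<in>D. (h * w (d b)) *\<^sub>R (0, b))"
      unfolding e1[symmetric] e2[symmetric] linear_add[OF lin, symmetric] by simp
    also have "\<dots> = (\<Sum>b\<in>E. (h * v (c b)) * ?L (b, 0)) + (\<Sum>b\<in>D. (h * w (d b)) * ?L (0, b))"
      by (simp only: linear_sum[OF lin] linear_cmul[OF lin] real_scaleR_def)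
    also have "\<dots> = (v (\<lambda>p. F (p, k t)) + w (\<lambda>q. F (u t, q))) * h"
      unfolding c(3)[OF U'(2) v smooth_slice_fst[OF A C F]] d(3)[OF V'(2) w smooth_slice_snd[OF A C F]]
        derivative_slice_fst[OF A C F U(1) V(1) U(2) V(2)] derivative_slice_snd[OF A C F U(1) V(1) U(2) V(2)]
        F'_def[symmetric]
      by (simp add: distrib_left sum_distrib_left mult_ac)
    finally show ?thesis .
  qed
  with * have D: "((\<lambda>s. F' (g s)) has_real_derivative v (\<lambda>p. F (p, k t)) + w (\<lambda>q. F (u t, q))) (at t)"
    by (simp add: has_field_derivative_def)
  \<comment> \<open>The cut-off coordinates represent the curves only while these stay in the small
    neighbourhoods, which suffices for a derivative at t.\<close>
  have ev: "\<forall>\<^sub>F s in nhds t. F' (g s) = F (u s, k s)"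
  proof -
    have "\<forall>\<^sub>F s in nhds t. u s \<in> U'"
      by (rule smooth_curve_eventually_in[where u=u, OF A DERIV_isCont[OF u] U'(1,2)])
    moreover have "\<forall>\<^sub>F s in nhds t. k s \<in> V'"
      by (rule smooth_curve_eventually_in[where u=k, OF C DERIV_isCont[OF k] V'(1,2)])
    ultimately show ?thesis
    proof eventually_elim
      case (elim s)
      then have "u s \<in> U" "k s \<in> V" using U'(3) V'(3) by auto
      then show ?case using prod_chart_eq[OF A C F U(1) V(1)] by (simp add: F'_def g_eq elim)
    qed
  qed
  from D show ?thesis by (rule DERIV_cong_ev[OF refl ev refl, THEN iffD1])
qed

section \<open>Lie groups\<close>

lemma tangent_spaceI:
  assumes "\<And>f h. f \<in> smooth_funs A \<Longrightarrow> h \<in> smooth_funs A \<Longrightarrow> v (\<lambda>x. f x + h x) = v f + v h"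
    and "\<And>f c. f \<in> smooth_funs A \<Longrightarrow> v (\<lambda>x. c * f x) = c * v f"
    and "\<And>f h. f \<in> smooth_funs A \<Longrightarrow> h \<in> smooth_funs A \<Longrightarrow> v (\<lambda>x. f x * h x) = v f * h p + f p * v h"
    and "\<And>f. f \<notin> smooth_funs A \<Longrightarrow> v f = 0"
  shows "v \<in> tangent_space A p"
  using assms by (simp add: tangent_space_def lin_on_def plus_fun_def times_fun_def scaleR_fun_def)

lemma vector_field_smooth: "X \<in> vector_fields A \<Longrightarrow> f \<in> smooth_funs A \<Longrightarrow> X f \<in> smooth_funs A"
  by (simp add: vector_fields_def)

lemma vector_field_tangent: "X \<in> vector_fields A \<Longrightarrow> (\<lambda>f. X f p) \<in> tangent_space A p"
  by (auto simp: vector_fields_def tangent_space_def lin_on_def)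

lemma vector_fieldsI:
  assumes "\<And>f. f \<in> smooth_funs A \<Longrightarrow> X f \<in> smooth_funs A" and t: "\<And>p. (\<lambda>f. X f p) \<in> tangent_space A p"
  shows "X \<in> vector_fields A"
  using assms(1) t unfolding vector_fields_def tangent_space_def lin_on_def
  by (auto simp: fun_eq_iff)

text \<open>The second assumption is there because point derivations must vanish on nonsmooth
  functions: a nonsmooth function has to pull back to a nonsmooth one. For translations and
  conjugations the inverse map provides this.\<close>

lemma tangent_push:
  assumes F: "smooth_morphism A A F" and iff: "\<And>a. (\<lambda>k. a (F k)) \<in> smooth_funs A \<Longrightarrow> a \<in> smooth_funs A"
    and v: "v \<in> tangent_space A p"
  shows "(\<lambda>a. v (\<lambda>k. a (F k))) \<in> tangent_space A (F p)"
proof (rule tangent_spaceI)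
  fix f assume "f \<notin> smooth_funs A"
  then show "v (\<lambda>k. f (F k)) = 0" using iff tangent_nonsmooth[OF v] by blast
qed (simp_all add: tangent_add[OF v] tangent_mult[OF v] tangent_cmult[OF v] smooth_morphism_funs[OF F])

lemma subspace_tangent_space: "subspace (tangent_space A p)"
  by (auto simp: subspace_def tangent_space_def lin_on_def smooth_funs_fun_ops algebra_simps)

context lie_group
begin

lemma in_carrier [simp]: "x \<in> carrier G"
  by (simp add: carrier_UNIV)

lemmas atlas_prod = smooth_atlas_prod[OF atlas atlas]

lemma inv_mult_cancel [simp]: "inv x \<otimes> (x \<otimes> y) = y" "x \<otimes> (inv x \<otimes> y) = y"
  by (simp_all flip: m_assoc)

lemma mult_morphism:
  fixes C :: "('n::t2_space, 'd::real_inner) chart set"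
  assumes C: "smooth_atlas C" and F: "smooth_morphism C A F" and H: "smooth_morphism C A H"
  shows "smooth_morphism C A (\<lambda>x. F x \<otimes> H x)"
proof -
  have "smooth_morphism (prod_atlas A A) A (\<lambda>(x, y). x \<otimes> y)"
    by (rule smooth_map_imp_morphism[OF atlas_prod atlas smooth_mult])
  from smooth_morphism_comp[OF smooth_morphism_Pair[OF C atlas atlas F H] this] show ?thesis by simp
qed

lemma inv_morphism:
  "smooth_morphism C A F \<Longrightarrow> smooth_morphism C A (\<lambda>x. inv (F x))"
  by (rule smooth_morphism_comp[OF _ smooth_map_imp_morphism[OF atlas atlas smooth_inv]])

lemmas fst_morphism = smooth_morphism_fst[OF atlas atlas]
lemmas snd_morphism = smooth_morphism_snd[OF atlas atlas]

lemmas morphism_intros = mult_morphism[OF atlas] mult_morphism[OF atlas_prod] inv_morphism fst_morphism snd_morphism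
  smooth_morphism_id smooth_morphism_const

lemma ltrans_morphism: "smooth_morphism A A (\<lambda>k. g \<otimes> k)"
  by (intro morphism_intros)

lemma ltrans_smooth_iff [simp]: "(\<lambda>k. a (g \<otimes> k)) \<in> smooth_funs A \<longleftrightarrow> a \<in> smooth_funs A"
proof
  assume "(\<lambda>k. a (g \<otimes> k)) \<in> smooth_funs A"
  from smooth_morphism_funs[OF ltrans_morphism[of "inv g"] this] show "a \<in> smooth_funs A" by simp
qed (rule smooth_morphism_funs[OF ltrans_morphism])

lemma rtrans_morphism: "smooth_morphism A A (\<lambda>k. k \<otimes> g)"
  by (intro morphism_intros)

lemma rtrans_smooth_iff [simp]: "(\<lambda>k. a (k \<otimes> g)) \<in> smooth_funs A \<longleftrightarrow> a \<in> smooth_funs A"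
proof
  assume "(\<lambda>k. a (k \<otimes> g)) \<in> smooth_funs A"
  from smooth_morphism_funs[OF rtrans_morphism[of "inv g"] this] show "a \<in> smooth_funs A" by (simp add: m_assoc)
qed (rule smooth_morphism_funs[OF rtrans_morphism])

section \<open>Left-invariant fields and one-parameter subgroups\<close>

lemma left_inv_field_tangent:
  assumes "x \<in> lie_alg G A"
  shows "(\<lambda>a. left_inv_field G x a g) \<in> tangent_space A g"
  using tangent_push[OF ltrans_morphism, of g x \<one>] assms by (simp add: left_inv_field_def lie_alg_def)

lemma left_inv_field_smooth:
  assumes x: "x \<in> lie_alg G A" and a: "a \<in> smooth_funs A"
  shows "left_inv_field G x a \<in> smooth_funs A"
proof -
  have "(\<lambda>z. a (snd z \<otimes> fst z)) \<in> smooth_funs (prod_atlas A A)"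
    by (rule smooth_morphism_funs[OF _ a]) (intro morphism_intros)
  from tangent_param_smooth[OF atlas atlas this] x show ?thesis
    by (simp add: left_inv_field_def[abs_def] lie_alg_def)
qed

lemma left_inv_field_vector_field: "x \<in> lie_alg G A \<Longrightarrow> left_inv_field G x \<in> vector_fields A"
  by (intro vector_fieldsI left_inv_field_smooth left_inv_field_tangent)

lemma left_inv_field_one: "left_inv_field G x a \<one> = x a"
  by (simp add: left_inv_field_def)

lemma left_inv_field_ltrans: "left_inv_field G x (\<lambda>k. a (g \<otimes> k)) h = left_inv_field G x a (g \<otimes> h)"
  by (simp add: left_inv_field_def m_assoc)

lemma left_translate_lie_alg:
  assumes "v \<in> tangent_space A g"
  shows "(\<lambda>a. v (\<lambda>k. a (inv g \<otimes> k))) \<in> lie_alg G A"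
  using tangent_push[OF ltrans_morphism, of "inv g" v g] assms by (simp add: lie_alg_def)

text \<open>The product of k and its inverse is constant, so its two derivatives along the diagonal
  add up to 0.\<close>

lemma inv_tangent:
  assumes x: "x \<in> lie_alg G A" and a: "a \<in> smooth_funs A"
  shows "x (\<lambda>k. a (inv k)) = - x a"
proof -
  have F: "(\<lambda>z. a (fst z \<otimes> inv (snd z))) \<in> smooth_funs (prod_atlas A A)"
    by (rule smooth_morphism_funs[OF _ a]) (intro morphism_intros)
  from tangent_diagonal[OF atlas F x[unfolded lie_alg_def]]
  show ?thesis using tangent_const[OF x[unfolded lie_alg_def]] by (simp add: r_inv)
qed

text \<open>Uniqueness of integral curves without estimates: in the derivative of u times the
  inverse of w, the two contributions of the left-invariant field are opposite by
  \<open>inv_tangent\<close>. So the quotient is constant on smooth functions, which separate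
  points.\<close>

lemma integral_curves_quotient:
  assumes x: "x \<in> lie_alg G A"
    and u: "\<And>t f. \<bar>t\<bar> < d \<Longrightarrow> f \<in> smooth_funs A \<Longrightarrow> ((\<lambda>s. f (u s)) has_real_derivative left_inv_field G x f (u t)) (at t)"
    and w: "\<And>t f. \<bar>t\<bar> < d \<Longrightarrow> f \<in> smooth_funs A \<Longrightarrow> ((\<lambda>s. f (w s)) has_real_derivative left_inv_field G x f (w t)) (at t)"
    and eq: "u 0 = w 0" and t: "\<bar>t\<bar> < d"
  shows "u t = w t"
proof -
  have "f (u t \<otimes> inv (w t)) = f \<one>" if f: "f \<in> smooth_funs A" for f
  proof -
    have F: "(\<lambda>z. f (fst z \<otimes> inv (snd z))) \<in> smooth_funs (prod_atlas A A)"
      by (rule smooth_morphism_funs[OF _ f]) (intro morphism_intros)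
    have d0: "((\<lambda>s. f (u s \<otimes> inv (w s))) has_real_derivative 0) (at s)" if s: "\<bar>s\<bar> < d" for s
    proof -
      have "left_inv_field G x (\<lambda>q. f (u s \<otimes> inv q)) (w s) = x (\<lambda>k. (\<lambda>k. f (u s \<otimes> k \<otimes> inv (w s))) (inv k))"
        by (simp add: left_inv_field_def inv_mult_group m_assoc)
      also have "\<dots> = - x (\<lambda>k. f (u s \<otimes> k \<otimes> inv (w s)))"
        by (rule inv_tangent[OF x], rule smooth_morphism_funs[OF _ f]) (intro morphism_intros)
      also have "x (\<lambda>k. f (u s \<otimes> k \<otimes> inv (w s))) = left_inv_field G x (\<lambda>p. f (p \<otimes> inv (w s))) (u s)"
        by (simp add: left_inv_field_def)
      finally show ?thesis
        using curve_pair_derivative[OF atlas atlas F left_inv_field_tangent[OF x] left_inv_field_tangent[OF x] u[OF s] w[OF s]]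
        by simp
    qed
    have "f (u t \<otimes> inv (w t)) = f (u 0 \<otimes> inv (w 0))"
    proof (rule has_field_derivative_zero_constant[of "{-d<..<d}" "\<lambda>s. f (u s \<otimes> inv (w s))", THEN exE])
      show "convex {- d<..<d}" by simp
      show "((\<lambda>s. f (u s \<otimes> inv (w s))) has_real_derivative 0) (at s within {-d<..<d})" if "s \<in> {-d<..<d}" for s
        using d0[of s] that by (auto intro: has_field_derivative_at_within)
      fix c assume "\<forall>s\<in>{-d<..<d}. f (u s \<otimes> inv (w s)) = c"
      then show ?thesis using t by (auto simp: abs_less_iff)
    qed
    then show ?thesis by (simp add: eq)
  qed
  then have "u t \<otimes> inv (w t) = \<one>" by (rule smooth_funs_separate[OF atlas])
  then show ?thesis by (metis in_carrier inv_equality inv_inv)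
qed

text \<open>Left translation carries integral curves of a left-invariant field to integral curves,
  so uniqueness makes the local curve through the identity a local homomorphism. It extends to all
  times by c(t/m)^m with m large.\<close>

lemma one_parameter_subgroup_exists:
  assumes x: "x \<in> lie_alg G A"
  shows "\<exists>c. (\<forall>s t. c (s + t) = c s \<otimes> c t) \<and> (\<forall>f\<in>smooth_funs A. ((\<lambda>t. f (c t)) has_real_derivative x f) (at 0))"
proof -
  let ?L = "left_inv_field G x"
  obtain d c where d: "d > 0" and c0: "c 0 = \<one>" and
    c: "\<And>t f. \<bar>t\<bar> < d \<Longrightarrow> f \<in> smooth_funs A \<Longrightarrow> ((\<lambda>t. f (c t)) has_real_derivative ?L f (c t)) (at t)"
    using integral_curve_exists[of A ?L \<one>, OF atlas left_inv_field_smooth[OF x] left_inv_field_tangent[OF x]] by blast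
  \<comment> \<open>Half the interval, so that sums of two admissible times stay where c is an
    integral curve.\<close>
  define \<epsilon> where "\<epsilon> = d / 2"
  have \<epsilon>: "\<epsilon> > 0" using d by (simp add: \<epsilon>_def)
  have add: "c (s + t) = c s \<otimes> c t" if s: "\<bar>s\<bar> < \<epsilon>" and t: "\<bar>t\<bar> < \<epsilon>" for s t
  proof (rule integral_curves_quotient[OF x, of \<epsilon> "\<lambda>t. c (s + t)" "\<lambda>t. c s \<otimes> c t"])
    fix t f assume t: "\<bar>t\<bar> < \<epsilon>" and f: "f \<in> smooth_funs A"
    have "((\<lambda>t. f (c t)) has_real_derivative ?L f (c (s + t))) (at (s + t))"
      using s t by (intro c f) (auto simp: \<epsilon>_def)
    then show "((\<lambda>t. f (c (s + t))) has_real_derivative ?L f (c (s + t))) (at t)"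
      using DERIV_shift[of "\<lambda>t. f (c t)" "?L f (c (s + t))" t s] by (simp add: add.commute[of s])
    have "((\<lambda>t. (\<lambda>k. f (c s \<otimes> k)) (c t)) has_real_derivative ?L (\<lambda>k. f (c s \<otimes> k)) (c t)) (at t)"
      using t by (intro c) (auto simp: \<epsilon>_def f)
    then show "((\<lambda>t. f (c s \<otimes> c t)) has_real_derivative ?L f (c s \<otimes> c t)) (at t)"
      by (simp add: left_inv_field_ltrans)
  qed (use t c0 in auto)
  have pow: "c (real n * a) = c a [^] n" if "real n * \<bar>a\<bar> < \<epsilon>" for n a
    using that
  proof (induction n)
    case (Suc n)
    show ?case
    proof (cases "n = 0")
      case False
      have "real n * \<bar>a\<bar> < \<epsilon>" "\<bar>a\<bar> < \<epsilon>"
      proof -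
        have "real (Suc n) * \<bar>a\<bar> = real n * \<bar>a\<bar> + \<bar>a\<bar>" by (simp add: algebra_simps)
        moreover have "\<bar>a\<bar> \<le> real n * \<bar>a\<bar>" using False mult_right_mono[of 1 "real n" "\<bar>a\<bar>"] by simp
        ultimately show "real n * \<bar>a\<bar> < \<epsilon>" "\<bar>a\<bar> < \<epsilon>" using Suc.prems by linarith+
      qed
      then have "c (real n * a + a) = c a [^] n \<otimes> c a"
        using add[of "real n * a" a] Suc.IH by (simp add: abs_mult)
      then show ?thesis by (simp add: algebra_simps)
    qed simp
  qed (simp add: c0)
  \<comment> \<open>The chosen exponent exceeds |t| / \<epsilon>, so the fraction of t lies in the
    range of the local homomorphism. It jumps with t; \<open>indep\<close> shows that any other
    admissible exponent gives the same value.\<close>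
  define C where "C t = c (t / real (Suc (nat \<lceil>\<bar>t\<bar> / \<epsilon>\<rceil>))) [^] Suc (nat \<lceil>\<bar>t\<bar> / \<epsilon>\<rceil>)" for t
  \<comment> \<open>Both sides are compared with the common refinement into m * n steps.\<close>
  have indep: "c (t / real m) [^] m = c (t / real n) [^] n"
    if "m > 0" "n > 0" "\<bar>t\<bar> / real m < \<epsilon>" "\<bar>t\<bar> / real n < \<epsilon>" for t m n
  proof -
    have *: "c (t / real m) [^] m = c (t / real (m * n)) [^] (n * m)" if "m > 0" "n > 0" "\<bar>t\<bar> / real m < \<epsilon>" for m n
    proof -
      have "c (t / real m) = c (real n * (t / real (m * n)))" using that by simp
      also have "\<dots> = c (t / real (m * n)) [^] n" by (rule pow) (use that in \<open>simp add: abs_mult\<close>)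
      finally show ?thesis by (simp add: nat_pow_pow)
    qed
    show ?thesis using *[OF that(1,2,3)] *[OF that(2,1,4)] by (simp add: mult.commute)
  qed
  have C: "C t = c (t / real m) [^] m" if "m > 0" "\<bar>t\<bar> / real m < \<epsilon>" for t m
  proof -
    define N where "N = Suc (nat \<lceil>\<bar>t\<bar> / \<epsilon>\<rceil>)"
    have "\<bar>t\<bar> / \<epsilon> < real N" unfolding N_def by linarith
    moreover have N: "N > 0" by (simp add: N_def)
    ultimately have "\<bar>t\<bar> / real N < \<epsilon>" using \<epsilon> by (simp add: field_simps)
    then show ?thesis unfolding C_def N_def[symmetric] using that N by (intro indep)
  qed
  have "C (s + t) = C s \<otimes> C t" for s t
  proof -
    obtain m where m: "(\<bar>s\<bar> + \<bar>t\<bar>) / \<epsilon> < real m" using reals_Archimedean2 by blast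
    have m0: "m > 0"
    proof (rule ccontr)
      assume "\<not> m > 0"
      with m \<epsilon> show False by (simp add: divide_less_0_iff)
    qed
    have b: "\<bar>r\<bar> / real m < \<epsilon>" if "\<bar>r\<bar> \<le> \<bar>s\<bar> + \<bar>t\<bar>" for r
    proof -
      have "\<bar>r\<bar> \<le> \<bar>s\<bar> + \<bar>t\<bar>" by (rule that)
      also have "\<dots> < \<epsilon> * real m" using m \<epsilon> by (simp add: field_simps)
      finally show ?thesis using m0 by (simp add: field_simps)
    qed
    have bs: "\<bar>s\<bar> / real m < \<epsilon>" "\<bar>t\<bar> / real m < \<epsilon>" "\<bar>s + t\<bar> / real m < \<epsilon>" by (auto intro: b)
    then have *: "\<bar>s / real m\<bar> < \<epsilon>" "\<bar>t / real m\<bar> < \<epsilon>" by simp_all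
    have "C (s + t) = (c (s / real m) \<otimes> c (t / real m)) [^] m"
      using C[OF m0 bs(3)] add[OF *] by (simp add: add_divide_distrib)
    \<comment> \<open>The two factors commute, because both orders equal c of the sum of the times;
      hence the power distributes over the product.\<close>
    also have "\<dots> = c (s / real m) [^] m \<otimes> c (t / real m) [^] m"
      using add[OF *] add[OF *(2,1)] by (intro pow_mult_distrib) (auto simp: add.commute)
    finally show ?thesis by (simp add: C[OF m0 bs(1)] C[OF m0 bs(2)])
  qed
  moreover have "((\<lambda>t. f (C t)) has_real_derivative x f) (at 0)" if f: "f \<in> smooth_funs A" for f
  proof -
    have "((\<lambda>t. f (c t)) has_real_derivative x f) (at 0)"
      using c[of 0 f] d f by (simp add: c0 left_inv_field_one)
    then show ?thesis
      by (rule has_field_derivative_transform_within_open[of _ _ _ "{-\<epsilon><..<\<epsilon>}"])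
        (use \<epsilon> C[of 1] in \<open>auto simp: abs_less_iff\<close>)
  qed
  ultimately show ?thesis by blast
qed

lemma exp_curve:
  assumes x: "x \<in> lie_alg G A"
  shows exp_curve_add: "exp_curve G A x (s + t) = exp_curve G A x s \<otimes> exp_curve G A x t"
    and exp_curve_derivative: "f \<in> smooth_funs A \<Longrightarrow> ((\<lambda>t. f (exp_curve G A x t)) has_real_derivative x f) (at 0)"
  using someI_ex[OF one_parameter_subgroup_exists[OF x]] unfolding exp_curve_def by blast+

lemma exp_curve_minus:
  assumes x: "x \<in> lie_alg G A"
  shows "exp_curve G A x (- t) = inv (exp_curve G A x t)"
proof -
  let ?c = "exp_curve G A x"
  have "inv (?c 0) \<otimes> (?c 0 \<otimes> ?c 0) = inv (?c 0) \<otimes> ?c 0" using exp_curve_add[OF x, of 0 0] by simp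
  then have "?c 0 = \<one>" by simp
  then have "?c (- t) \<otimes> ?c t = \<one>" using exp_curve_add[OF x, of "- t" t] by simp
  then show ?thesis using inv_equality[of "?c (- t)" "?c t"] by simp
qed

end

section \<open>Left-invariant frames on a Poisson-Lie group\<close>

lemma sum_fun_apply: "(\<Sum>i\<in>I. F i) x = (\<Sum>i\<in>I. F i x)" for F :: "'i \<Rightarrow> 'a \<Rightarrow> 'b::comm_monoid_add"
  by (induction I rule: infinite_finite_induct) auto

lemma tangent_sum2:
  assumes v: "v \<in> tangent_space A p" and f: "\<And>i j. i \<in> I \<Longrightarrow> j \<in> J \<Longrightarrow> f i j \<in> smooth_funs A"
  shows "v (\<lambda>x. \<Sum>i\<in>I. \<Sum>j\<in>J. f i j x) = (\<Sum>i\<in>I. \<Sum>j\<in>J. v (f i j))"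
proof -
  have "v (\<lambda>x. \<Sum>i\<in>I. \<Sum>j\<in>J. f i j x) = (\<Sum>i\<in>I. v (\<lambda>x. \<Sum>j\<in>J. f i j x))"
    by (rule tangent_sum[OF v]) (intro smooth_funs_sum f)
  also have "\<dots> = (\<Sum>i\<in>I. \<Sum>j\<in>J. v (f i j))"
    by (intro sum.cong refl tangent_sum[OF v] f)
  finally show ?thesis .
qed

locale poisson_lie_frame = poisson_lie_group G A pb
  for G :: "('g::{t2_space, second_countable_topology}, 'b) monoid_scheme" (structure)
    and A :: "('g, 'e::real_inner) chart set"
    and pb :: "'g bracket" +
  fixes n :: nat and e :: "nat \<Rightarrow> 'g lie_vec" and f :: "nat \<Rightarrow> 'g lie_covec"
  assumes bases: "dual_bases G A n e f"
begin

abbreviation "C \<equiv> smooth_funs A"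
abbreviation "L \<equiv> left_inv_field G"

lemma e_in: "i < n \<Longrightarrow> e i \<in> lie_alg G A"
  using bases span_base[of "e i" "e ` {..<n}"] by (auto simp: dual_bases_def)

lemma f_in: "i < n \<Longrightarrow> f i \<in> lie_dual G A"
  and f_e: "i < n \<Longrightarrow> j < n \<Longrightarrow> f i (e j) = (if i = j then 1 else 0)"
  using bases by (auto simp: dual_bases_def)

lemma e_tangent: "i < n \<Longrightarrow> e i \<in> tangent_space A \<one>"
  using e_in by (simp add: lie_alg_def)

lemma subspace_lie_alg: "subspace (lie_alg G A)"
  by (simp add: lie_alg_def subspace_tangent_space)

lemma lie_dual_lin: "\<phi> \<in> lie_dual G A \<Longrightarrow> lin_on (lie_alg G A) \<phi>"
  by (simp add: lie_dual_def)

lemma lie_dual_zero: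
  assumes "\<phi> \<in> lie_dual G A"
  shows "\<phi> 0 = 0"
proof -
  have "\<phi> (0 *\<^sub>R 0) = 0 *\<^sub>R \<phi> 0"
    using lie_dual_lin[OF assms] subspace_0[OF subspace_lie_alg] unfolding lin_on_def by blast
  then show ?thesis by (simp only: scaleR_zero_left)
qed

lemma lie_dual_sum:
  assumes "\<phi> \<in> lie_dual G A" "finite I" "\<And>i. i \<in> I \<Longrightarrow> x i \<in> lie_alg G A"
  shows "\<phi> (\<Sum>i\<in>I. r i *\<^sub>R x i) = (\<Sum>i\<in>I. r i * \<phi> (x i))"
  using assms(2,3)
proof induction
  case empty
  then show ?case by (simp only: sum.empty lie_dual_zero[OF assms(1)])
next
  case (insert i I)
  have m: "r i *\<^sub>R x i \<in> lie_alg G A" "(\<Sum>i\<in>I. r i *\<^sub>R x i) \<in> lie_alg G A"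
    using insert.prems by (auto intro!: subspace_scale[OF subspace_lie_alg] subspace_sum[OF subspace_lie_alg])
  have "\<phi> (r i *\<^sub>R x i + (\<Sum>i\<in>I. r i *\<^sub>R x i)) = \<phi> (r i *\<^sub>R x i) + \<phi> (\<Sum>i\<in>I. r i *\<^sub>R x i)"
    using lie_dual_lin[OF assms(1)] m unfolding lin_on_def by blast
  moreover have "\<phi> (r i *\<^sub>R x i) = r i * \<phi> (x i)"
    using lie_dual_lin[OF assms(1)] insert.prems unfolding lin_on_def by simp
  moreover have "\<phi> (\<Sum>i\<in>I. r i *\<^sub>R x i) = (\<Sum>i\<in>I. r i * \<phi> (x i))"
    by (rule insert.IH) (simp add: insert.prems)
  ultimately show ?case by (simp only: sum.insert[OF insert.hyps(1,2)])
qed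

lemma lie_alg_expand:
  assumes "x \<in> lie_alg G A"
  shows "x = (\<Sum>i<n. f i x *\<^sub>R e i)"
proof -
  have "x \<in> span (e ` {..<n})" and inj: "inj_on e {..<n}" using assms bases by (auto simp: dual_bases_def)
  then obtain u where "x = (\<Sum>v\<in>e ` {..<n}. u v *\<^sub>R v)"
    by (auto simp: span_finite)
  then have x: "x = (\<Sum>i<n. u (e i) *\<^sub>R e i)" by (simp add: sum.reindex[OF inj])
  have "f j x = u (e j)" if "j < n" for j
  proof -
    have "f j x = (\<Sum>i<n. u (e i) * f j (e i))"
      unfolding x by (rule lie_dual_sum[OF f_in[OF that]]) (auto simp: e_in)
    also have "\<dots> = (\<Sum>i<n. if i = j then u (e i) else 0)"
      by (rule sum.cong) (auto simp: f_e that)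
    finally show ?thesis using that by simp
  qed
  then show ?thesis using x by simp
qed

lemma lie_alg_expand_apply: "x \<in> lie_alg G A \<Longrightarrow> x a = (\<Sum>i<n. f i x * e i a)"
  by (subst lie_alg_expand) (simp_all add: sum_fun_apply)

lemma lie_dual_expand:
  assumes "\<phi> \<in> lie_dual G A" "x \<in> lie_alg G A"
  shows "\<phi> x = (\<Sum>i<n. f i x * \<phi> (e i))"
proof -
  have "\<phi> x = \<phi> (\<Sum>i<n. f i x *\<^sub>R e i)" using lie_alg_expand[OF assms(2)] by simp
  also have "\<dots> = (\<Sum>i<n. f i x * \<phi> (e i))"
    by (rule lie_dual_sum[OF assms(1)]) (auto simp: e_in)
  finally show ?thesis .
qed

lemma lie_dual_eqI:
  assumes "\<phi> \<in> lie_dual G A" "\<psi> \<in> lie_dual G A" "\<And>i. i < n \<Longrightarrow> \<phi> (e i) = \<psi> (e i)"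
  shows "\<phi> = \<psi>"
proof
  fix x
  show "\<phi> x = \<psi> x"
  proof (cases "x \<in> lie_alg G A")
    case True
    then show ?thesis using assms by (simp add: lie_dual_expand)
  next
    case False
    then show ?thesis using assms by (simp add: lie_dual_def)
  qed
qed

text \<open>A linearly independent family of point derivations has a dual family of smooth
  functions, built as in Gram-Schmidt. If every smooth b satisfied the equation negated below,
  \<open>e m\<close> would be a combination of its predecessors, which \<open>f m\<close>
  forbids.\<close>

lemma dual_functions_exist:
  "m \<le> n \<Longrightarrow> \<exists>a. \<forall>j<m. a j \<in> C \<and> (\<forall>i<m. e i (a j) = (if i = j then 1 else 0))"
proof (induction m)
  case (Suc m)
  then obtain a where a: "\<And>j. j < m \<Longrightarrow> a j \<in> C" "\<And>i j. i < m \<Longrightarrow> j < m \<Longrightarrow> e i (a j) = (if i = j then 1 else 0)"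
    by auto
  have m: "m < n" using Suc by simp
  have lt: "i < n" if "i < m" for i using that m by simp
  have "\<exists>b\<in>C. e m b \<noteq> (\<Sum>i<m. e m (a i) * e i b)"
  proof (rule ccontr)
    assume "\<not> ?thesis"
    then have *: "e m b = (\<Sum>i<m. e m (a i) * e i b)" if "b \<in> C" for b using that by blast
    have eq: "e m b = (\<Sum>i<m. e m (a i) * e i b)" for b
    proof (cases "b \<in> C")
      case False
      have "(\<Sum>i<m. e m (a i) * e i b) = 0"
        by (intro sum.neutral ballI) (simp add: tangent_nonsmooth[OF e_tangent False] lt)
      then show ?thesis by (simp add: tangent_nonsmooth[OF e_tangent[OF m] False])
    qed (rule *)
    have "e m = (\<Sum>i<m. e m (a i) *\<^sub>R e i)"
      by (rule ext) (simp only: sum_fun_apply scaleR_fun_apply real_scaleR_def eq[symmetric])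
    then have "f m (e m) = f m (\<Sum>i<m. e m (a i) *\<^sub>R e i)" by (rule arg_cong)
    also have "\<dots> = (\<Sum>i<m. e m (a i) * f m (e i))"
      using lt by (intro lie_dual_sum f_in m) (auto simp: e_in)
    also have "\<dots> = 0" using lt m by (intro sum.neutral) (auto simp: f_e)
    finally show False using m by (simp add: f_e)
  qed
  then obtain b where b: "b \<in> C" "e m b \<noteq> (\<Sum>i<m. e m (a i) * e i b)" by blast
  \<comment> \<open>The correction makes all earlier derivations vanish on b', while the choice of b
    keeps the value of \<open>e m\<close> nonzero.\<close>
  define b' where "b' = (\<lambda>x. b x - (\<Sum>i<m. e i b * a i x))"
  have b'C: "b' \<in> C" unfolding b'_def by (intro smooth_funs_diff b smooth_funs_sum smooth_funs_cmult a) simp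
  have eb': "e j b' = e j b - (\<Sum>i<m. e i b * e j (a i))" if "j < n" for j
  proof -
    note t = e_tangent[OF that]
    have s: "(\<lambda>x. e i b * a i x) \<in> C" if "i < m" for i using that by (intro smooth_funs_cmult a)
    have "e j b' = e j b - e j (\<lambda>x. \<Sum>i<m. e i b * a i x)"
      unfolding b'_def by (rule tangent_diff[OF t b(1) smooth_funs_sum]) (simp add: s)
    also have "e j (\<lambda>x. \<Sum>i<m. e i b * a i x) = (\<Sum>i<m. e j (\<lambda>x. e i b * a i x))"
      by (rule tangent_sum[OF t]) (simp add: s)
    also have "\<dots> = (\<Sum>i<m. e i b * e j (a i))"
      by (intro sum.cong refl tangent_cmult[OF t a(1)]) simp
    finally show ?thesis .
  qed
  have eb'0: "e j b' = 0" if "j < m" for j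
  proof -
    have "(\<Sum>i<m. e i b * e j (a i)) = (\<Sum>i<m. if i = j then e i b else 0)"
      by (rule sum.cong) (auto simp: a that)
    then show ?thesis using that by (simp add: eb' lt)
  qed
  define r where "r = e m b'"
  have r: "r \<noteq> 0" using b(2) by (simp add: r_def eb' m mult.commute)
  define c where "c = (\<lambda>x. (1 / r) * b' x)"
  have cC: "c \<in> C" unfolding c_def by (intro smooth_funs_cmult b'C)
  have ec: "e j c = e j b' / r" if "j < n" for j
    using tangent_cmult[OF e_tangent[OF that] b'C, of "1 / r"] unfolding c_def by simp
  \<comment> \<open>The normalised c becomes the new dual function; subtracting multiples of it
    removes the value of \<open>e m\<close> on the old ones without disturbing the earlier
    derivations.\<close>
  define a' where "a' j = (if j = m then c else (\<lambda>x. a j x - e m (a j) * c x))" for j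
  have "a' j \<in> C" if "j < Suc m" for j
    using that by (auto simp: a'_def intro!: smooth_funs_diff smooth_funs_cmult cC a)
  moreover have "e i (a' j) = (if i = j then 1 else 0)" if ij: "i < Suc m" "j < Suc m" for i j
  proof -
    have i: "i < n" using ij m by simp
    have eic: "e i c = (if i = m then 1 else 0)"
    proof (cases "i = m")
      case True
      then show ?thesis using ec[OF m] r by (simp add: r_def)
    next
      case False
      then show ?thesis using ec[OF i] eb'0[of i] ij by simp
    qed
    show ?thesis
    proof (cases "j = m")
      case True
      then show ?thesis by (simp add: a'_def eic)
    next
      case False
      then have j: "j < m" using ij by simp
      have "e i (a' j) = e i (a j) - e m (a j) * e i c"
        using False by (simp add: a'_def tangent_diff[OF e_tangent[OF i] a(1)[OF j] smooth_funs_cmult[OF cC]]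
            tangent_cmult[OF e_tangent[OF i] cC])
      then show ?thesis using ij j False by (auto simp: eic a less_Suc_eq)
    qed
  qed
  ultimately show ?case by blast
qed simp

definition da :: "nat \<Rightarrow> 'g \<Rightarrow> real" where
  "da = (SOME a. \<forall>j<n. a j \<in> C \<and> (\<forall>i<n. e i (a j) = (if i = j then 1 else 0)))"

lemma da: "j < n \<Longrightarrow> da j \<in> C" "i < n \<Longrightarrow> j < n \<Longrightarrow> e i (da j) = (if i = j then 1 else 0)"
  using someI_ex[OF dual_functions_exist[OF order_refl]] unfolding da_def[symmetric] by auto

lemma f_eq_da:
  assumes "x \<in> lie_alg G A" "i < n"
  shows "f i x = x (da i)"
proof -
  have "x (da i) = (\<Sum>j<n. f j x * e j (da i))" by (rule lie_alg_expand_apply[OF assms(1)])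
  also have "\<dots> = (\<Sum>j<n. if j = i then f j x else 0)" by (rule sum.cong) (auto simp: da assms)
  finally show ?thesis using assms by simp
qed

text \<open>v is moved to the identity, expanded there in the basis, and moved back. The
  coefficients are values of v on translated functions \<open>da i\<close>, so their smoothness
  becomes a question about functions on the group.\<close>

lemma tangent_frame:
  assumes v: "v \<in> tangent_space A g"
  shows "v b = (\<Sum>i<n. v (\<lambda>k. da i (inv g \<otimes> k)) * L (e i) b g)"
proof -
  let ?x = "\<lambda>a. v (\<lambda>k. a (inv g \<otimes> k))"
  have x: "?x \<in> lie_alg G A" by (rule left_translate_lie_alg[OF v])
  have "v b = ?x (\<lambda>k. b (g \<otimes> k))" by simp
  also have "\<dots> = (\<Sum>i<n. f i ?x * e i (\<lambda>k. b (g \<otimes> k)))" by (rule lie_alg_expand_apply[OF x])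
  also have "\<dots> = (\<Sum>i<n. v (\<lambda>k. da i (inv g \<otimes> k)) * L (e i) b g)"
    by (rule sum.cong) (simp_all add: f_eq_da[OF x] left_inv_field_def)
  finally show ?thesis .
qed

text \<open>The differentiated function depends on the point of evaluation too. Separating the two
  roles of g gives a smooth function on the product by \<open>field_param_smooth\<close>, which is
  then restricted to the diagonal.\<close>

lemma frame_coefficient_smooth:
  assumes X: "X \<in> vector_fields A" and a: "a \<in> C"
  shows "(\<lambda>g. X (\<lambda>k. a (inv g \<otimes> k)) g) \<in> C"
proof -
  have F: "(\<lambda>z. a (inv (snd z) \<otimes> fst z)) \<in> smooth_funs (prod_atlas A A)"
    by (rule smooth_morphism_funs[OF _ a]) (intro morphism_intros)
  have "(\<lambda>z. X (\<lambda>k. a (inv (snd z) \<otimes> k)) (fst z)) \<in> smooth_funs (prod_atlas A A)"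
    using field_param_smooth[OF atlas atlas F vector_field_smooth[OF X] vector_field_tangent[OF X]] by simp
  from smooth_morphism_funs[OF smooth_morphism_Pair[OF atlas atlas atlas smooth_morphism_id smooth_morphism_id] this]
  show ?thesis by simp
qed

section \<open>The Poisson bivector in the left-invariant frame\<close>

lemma pb_smooth: "x \<in> C \<Longrightarrow> y \<in> C \<Longrightarrow> pb x y \<in> C"
  using poisson unfolding poisson_bracket_def bilin_on_def by blast

lemma pb_anti:
  assumes "x \<in> C" "y \<in> C"
  shows "pb x y g = - pb y x g"
proof -
  have "pb x y = - pb y x" using poisson assms unfolding poisson_bracket_def by blast
  then show ?thesis by (simp only: fun_Compl_def)
qed

lemma pb_tangent_snd:
  assumes x: "x \<in> C"
  shows "(\<lambda>y. if y \<in> C then pb x y g else 0) \<in> tangent_space A g"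
proof -
  have lin: "lin_on C (pb x)" and mult: "\<And>h k. h \<in> C \<Longrightarrow> k \<in> C \<Longrightarrow> pb x (h * k) = pb x h * k + h * pb x k"
    using poisson x unfolding poisson_bracket_def bilin_on_def by blast+
  show ?thesis
  proof (rule tangent_spaceI)
    fix u w assume uw: "u \<in> C" "w \<in> C"
    have "pb x (u + w) = pb x u + pb x w" using lin uw unfolding lin_on_def by blast
    then show "(if (\<lambda>x. u x + w x) \<in> C then pb x (\<lambda>x. u x + w x) g else 0) =
      (if u \<in> C then pb x u g else 0) + (if w \<in> C then pb x w g else 0)"
      using uw by (simp add: smooth_funs_add plus_fun_def)
    show "(if (\<lambda>x. u x * w x) \<in> C then pb x (\<lambda>x. u x * w x) g else 0) =
      (if u \<in> C then pb x u g else 0) * w g + u g * (if w \<in> C then pb x w g else 0)"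
      using uw mult[OF uw] by (simp add: smooth_funs_mult plus_fun_def times_fun_def)
  next
    fix u c assume u: "u \<in> C"
    have "pb x (c *\<^sub>R u) = c *\<^sub>R pb x u" using lin u unfolding lin_on_def by blast
    then show "(if (\<lambda>x. c * u x) \<in> C then pb x (\<lambda>x. c * u x) g else 0) = c * (if u \<in> C then pb x u g else 0)"
      using u by (simp add: smooth_funs_cmult scaleR_fun_def)
  qed simp
qed

lemma pb_tangent_fst:
  assumes y: "y \<in> C"
  shows "(\<lambda>x. if x \<in> C then pb x y g else 0) \<in> tangent_space A g"
proof -
  have "(\<lambda>x. if x \<in> C then pb x y g else 0) = (-1) *\<^sub>R (\<lambda>x. if x \<in> C then pb y x g else 0)"
    using pb_anti[OF _ y] by (auto simp: fun_eq_iff)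
  then show ?thesis using subspace_scale[OF subspace_tangent_space pb_tangent_snd[OF y]] by metis
qed

definition \<pi> :: "nat \<Rightarrow> nat \<Rightarrow> 'g \<Rightarrow> real" where
  "\<pi> i j g = pb (\<lambda>k. da i (inv g \<otimes> k)) (\<lambda>k. da j (inv g \<otimes> k)) g"

lemma pb_expand:
  assumes x: "x \<in> C" and y: "y \<in> C"
  shows "pb x y g = (\<Sum>i<n. \<Sum>j<n. \<pi> i j g * L (e i) x g * L (e j) y g)"
proof -
  have "pb x y g = (\<Sum>j<n. pb x (\<lambda>k. da j (inv g \<otimes> k)) g * L (e j) y g)"
    using tangent_frame[OF pb_tangent_snd[OF x, of g], of y] y by (simp add: da)
  also have "\<dots> = (\<Sum>j<n. (\<Sum>i<n. \<pi> i j g * L (e i) x g) * L (e j) y g)"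
  proof (intro sum.cong refl arg_cong2[where f="(*)"])
    fix j assume "j \<in> {..<n}"
    then have "(\<lambda>k. da j (inv g \<otimes> k)) \<in> C" by (simp add: da)
    from tangent_frame[OF pb_tangent_fst[OF this, of g], of x] x
    show "pb x (\<lambda>k. da j (inv g \<otimes> k)) g = (\<Sum>i<n. \<pi> i j g * L (e i) x g)"
      by (simp add: da \<pi>_def)
  qed
  also have "\<dots> = (\<Sum>i<n. \<Sum>j<n. \<pi> i j g * L (e i) x g * L (e j) y g)"
    unfolding sum_distrib_right by (rule sum.swap)
  finally show ?thesis .
qed

text \<open>Both arguments of the bracket move with g, and \<open>frame_coefficient_smooth\<close>
  treats one at a time: applied to Hamiltonian fields it shows that ?Y is a vector field, and
  applied to ?Y it gives the claim.\<close>

lemma \<pi>_smooth: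
  assumes i: "i < n" and j: "j < n"
  shows "\<pi> i j \<in> C"
proof -
  have ham: "(\<lambda>h. if h \<in> C then pb x h else 0) \<in> vector_fields A" if "x \<in> C" for x
  proof (rule vector_fieldsI)
    show "(\<lambda>f. (if f \<in> C then pb x f else 0) p) \<in> tangent_space A p" for p
      using pb_tangent_snd[OF that, of p] by (simp add: if_distrib[of "\<lambda>h. h p"] cong: if_cong)
  qed (simp add: pb_smooth that)
  let ?Y = "\<lambda>x. if x \<in> C then (\<lambda>g. pb x (\<lambda>k. da j (inv g \<otimes> k)) g) else 0"
  have "?Y \<in> vector_fields A"
  proof (rule vector_fieldsI)
    fix x assume "x \<in> C"
    then show "?Y x \<in> C" using frame_coefficient_smooth[OF ham da(1)[OF j], of x] by (simp add: da j)
  next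
    fix p
    have "(\<lambda>k. da j (inv p \<otimes> k)) \<in> C" by (simp add: da j)
    from pb_tangent_fst[OF this, of p] show "(\<lambda>x. ?Y x p) \<in> tangent_space A p"
      by (simp add: if_distrib[of "\<lambda>h. h p"] cong: if_cong)
  qed
  from frame_coefficient_smooth[OF this da(1)[OF i]] show ?thesis
    by (simp add: \<pi>_def[abs_def] da i)
qed

lemma pb_mult:
  assumes "x \<in> C" "y \<in> C"
  shows "pb x y (g \<otimes> h) = pb (\<lambda>k. x (k \<otimes> h)) (\<lambda>k. y (k \<otimes> h)) g + pb (\<lambda>k. x (g \<otimes> k)) (\<lambda>k. y (g \<otimes> k)) h"
  using fun_cong[OF mult_poisson_map[unfolded poisson_map_def, rule_format, OF assms], of "(g, h)"]
  by (simp add: prod_bracket_def)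

text \<open>At g = h = \<one> multiplicativity says that the bracket equals twice itself.\<close>

lemma \<pi>_one: "i < n \<Longrightarrow> j < n \<Longrightarrow> \<pi> i j \<one> = 0"
  using pb_mult[of "da i" "da j" \<one> \<one>] by (simp add: \<pi>_def da)

text \<open>As \<pi> vanishes at the identity, the Leibniz rule leaves only the terms in which \<pi>
  is differentiated. This removes all dependence on how the other factors vary.\<close>

lemma one_tangent_pb:
  assumes z: "z \<in> lie_alg G A"
    and ab: "\<And>i. i < n \<Longrightarrow> a i \<in> C" "\<And>i. i < n \<Longrightarrow> b i \<in> C"
  shows "z (\<lambda>g. \<Sum>i<n. \<Sum>j<n. \<pi> i j g * a i g * b j g) = (\<Sum>i<n. \<Sum>j<n. z (\<pi> i j) * a i \<one> * b j \<one>)"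
proof -
  have zt: "z \<in> tangent_space A \<one>" using z by (simp add: lie_alg_def)
  have m: "z (\<lambda>g. \<pi> i j g * a i g * b j g) = z (\<pi> i j) * a i \<one> * b j \<one>" if "i < n" "j < n" for i j
    using tangent_mult[OF zt smooth_funs_mult[OF \<pi>_smooth[OF that] ab(1)[OF that(1)]] ab(2)[OF that(2)]]
      tangent_mult[OF zt \<pi>_smooth[OF that] ab(1)[OF that(1)]] \<pi>_one[OF that] by simp
  have "z (\<lambda>g. \<Sum>i<n. \<Sum>j<n. \<pi> i j g * a i g * b j g) = (\<Sum>i<n. \<Sum>j<n. z (\<lambda>g. \<pi> i j g * a i g * b j g))"
    by (rule tangent_sum2[OF zt]) (auto intro!: smooth_funs_mult \<pi>_smooth ab)
  then show ?thesis by (simp add: m)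
qed

lemma z_pb:
  assumes z: "z \<in> lie_alg G A" and x: "x \<in> C" and y: "y \<in> C"
  shows "z (pb x y) = (\<Sum>i<n. \<Sum>j<n. z (\<pi> i j) * e i x * e j y)"
proof -
  have "pb x y = (\<lambda>g. \<Sum>i<n. \<Sum>j<n. \<pi> i j g * L (e i) x g * L (e j) y g)"
    using pb_expand[OF x y] by blast
  then show ?thesis
    using one_tangent_pb[OF z, of "\<lambda>i. L (e i) x" "\<lambda>j. L (e j) y"] x y
    by (simp add: left_inv_field_smooth e_in left_inv_field_one)
qed

section \<open>Cobracket, \<open>D_check\<close>, dual bracket, and derivatives of the Poisson
  bracket\<close>

definition tensor2 :: "(nat \<Rightarrow> nat \<Rightarrow> real) \<Rightarrow> 'g tangent2" where
  "tensor2 c = (\<lambda>x y. \<Sum>i<n. \<Sum>j<n. c i j * e i x * e j y)"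

lemma e_nonsmooth: "i < n \<Longrightarrow> x \<notin> C \<Longrightarrow> e i x = 0"
  using tangent_nonsmooth[OF e_tangent] .

lemma conj_smooth: "x \<in> C \<Longrightarrow> (\<lambda>z. x (snd z \<otimes> fst z \<otimes> inv (snd z))) \<in> smooth_funs (prod_atlas A A)"
  by (rule smooth_morphism_funs[where B=A and F="\<lambda>z. snd z \<otimes> fst z \<otimes> inv (snd z)"]) (intro morphism_intros)

text \<open>Translating the left frame back to the identity from the right turns \<open>e i\<close>
  into its conjugate by g, the function ?a. The conjugation does not affect the derivative, since it
  multiplies the coefficients \<pi>, which vanish at the identity.\<close>

lemma cobracket_eq:
  assumes z: "z \<in> lie_alg G A"
  shows "cobracket G A pb z = tensor2 (\<lambda>i j. z (\<pi> i j))"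
proof (intro ext)
  fix x y
  let ?c = "exp_curve G A z"
  show "cobracket G A pb z x y = tensor2 (\<lambda>i j. z (\<pi> i j)) x y"
  proof (cases "x \<in> C \<and> y \<in> C")
    case True
    then have x: "x \<in> C" and y: "y \<in> C" by auto
    let ?a = "\<lambda>x i g. e i (\<lambda>k. x (g \<otimes> k \<otimes> inv g))"
    have a: "?a x i \<in> C" if "x \<in> C" "i < n" for x i
      using tangent_param_smooth[OF atlas atlas conj_smooth[OF that(1)] e_tangent[OF that(2)]] by simp
    let ?\<Phi> = "\<lambda>g. \<Sum>i<n. \<Sum>j<n. \<pi> i j g * ?a x i g * ?a y j g"
    have \<Phi>: "?\<Phi> \<in> C" by (intro smooth_funs_sum smooth_funs_mult \<pi>_smooth a x y) auto
    have "push2 (\<lambda>k. k \<otimes> ?c (- t)) (bivector A pb (?c t)) x y = ?\<Phi> (?c t)" for t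
      using x y by (simp add: push2_def o_def bivector_def exp_curve_minus[OF z] pb_expand left_inv_field_def)
    then have "cobracket G A pb z x y = deriv (\<lambda>t. ?\<Phi> (?c t)) 0"
      by (simp add: cobracket_def)
    also have "\<dots> = z ?\<Phi>"
      by (rule DERIV_imp_deriv[OF exp_curve_derivative[OF z \<Phi>]])
    also have "\<dots> = tensor2 (\<lambda>i j. z (\<pi> i j)) x y"
      using one_tangent_pb[OF z a[OF x] a[OF y]] by (simp add: tensor2_def)
    finally show ?thesis .
  next
    case False
    then have "push2 (\<lambda>k. k \<otimes> ?c (- t)) (bivector A pb (?c t)) x y = 0" for t
      by (auto simp: push2_def o_def bivector_def)
    moreover have "tensor2 (\<lambda>i j. z (\<pi> i j)) x y = 0"
      unfolding tensor2_def using False by (intro sum.neutral ballI) (auto simp: e_nonsmooth)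
    ultimately show ?thesis by (simp add: cobracket_def)
  qed
qed

lemma D_check_eq: "D_check G A pb g = tensor2 (\<lambda>i j. \<pi> i j g)"
proof (intro ext)
  fix x y
  show "D_check G A pb g x y = tensor2 (\<lambda>i j. \<pi> i j g) x y"
  proof (cases "x \<in> C \<and> y \<in> C")
    case True
    then show ?thesis
      by (simp add: D_check_def push2_def o_def bivector_def pb_expand left_inv_field_def tensor2_def)
  next
    case False
    then have "D_check G A pb g x y = 0"
      by (auto simp: D_check_def push2_def o_def bivector_def)
    moreover have "tensor2 (\<lambda>i j. \<pi> i j g) x y = 0"
      unfolding tensor2_def using False by (intro sum.neutral ballI) (auto simp: e_nonsmooth)
    ultimately show ?thesis by simp
  qed
qed

lemma contract_fst_tensor2:
  assumes \<phi>: "\<phi> \<in> lie_dual G A"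
  shows "contract_fst \<phi> (tensor2 c) = (\<Sum>j<n. (\<Sum>i<n. c i j * \<phi> (e i)) *\<^sub>R e j)"
proof
  fix y
  have "(\<lambda>x. tensor2 c x y) = (\<Sum>i<n. (\<Sum>j<n. c i j * e j y) *\<^sub>R e i)"
    by (simp add: fun_eq_iff tensor2_def sum_fun_apply sum_distrib_left sum_distrib_right mult_ac)
  then have "contract_fst \<phi> (tensor2 c) y = \<phi> (\<Sum>i<n. (\<Sum>j<n. c i j * e j y) *\<^sub>R e i)"
    by (simp add: contract_fst_def)
  also have "\<dots> = (\<Sum>i<n. (\<Sum>j<n. c i j * e j y) * \<phi> (e i))"
    by (rule lie_dual_sum[OF \<phi>]) (auto simp: e_in)
  also have "\<dots> = (\<Sum>j<n. \<Sum>i<n. c i j * \<phi> (e i) * e j y)"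
    unfolding sum_distrib_right by (subst sum.swap) (simp add: mult_ac)
  finally show "contract_fst \<phi> (tensor2 c) y = (\<Sum>j<n. (\<Sum>i<n. c i j * \<phi> (e i)) *\<^sub>R e j) y"
    by (simp add: sum_fun_apply sum_distrib_right)
qed

lemma pair2_tensor2:
  assumes "\<phi> \<in> lie_dual G A" "\<psi> \<in> lie_dual G A"
  shows "pair2 \<phi> \<psi> (tensor2 c) = (\<Sum>i<n. \<Sum>j<n. c i j * \<phi> (e i) * \<psi> (e j))"
proof -
  have "pair2 \<phi> \<psi> (tensor2 c) = (\<Sum>j<n. (\<Sum>i<n. c i j * \<phi> (e i)) * \<psi> (e j))"
    unfolding pair2_def contract_fst_tensor2[OF assms(1)]
    by (rule lie_dual_sum[OF assms(2)]) (auto simp: e_in)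
  also have "\<dots> = (\<Sum>i<n. \<Sum>j<n. c i j * \<phi> (e i) * \<psi> (e j))"
    unfolding sum_distrib_right by (rule sum.swap)
  finally show ?thesis .
qed

lemma dual_bracket_eq:
  assumes "\<phi> \<in> lie_dual G A" "\<psi> \<in> lie_dual G A" "z \<in> lie_alg G A"
  shows "dual_bracket G A pb \<phi> \<psi> z = (\<Sum>i<n. \<Sum>j<n. z (\<pi> i j) * \<phi> (e i) * \<psi> (e j))"
  using assms by (simp add: dual_bracket_def cobracket_eq pair2_tensor2)

text \<open>With g fixed, z is applied in the variable h to both terms of \<open>pb_mult\<close>. In
  the first it commutes with \<open>L (e i)\<close>, which acts on the other variable, and hits one
  argument at a time; the second contributes only derivatives of \<pi> at the identity, by
  \<open>z_pb\<close>.\<close>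

lemma left_inv_derivative_pb:
  assumes z: "z \<in> lie_alg G A" and x: "x \<in> C" and y: "y \<in> C"
  shows "L z (pb x y) g = pb (L z x) y g + pb x (L z y) g + (\<Sum>i<n. \<Sum>j<n. z (\<pi> i j) * L (e i) x g * L (e j) y g)"
proof -
  have zt: "z \<in> tangent_space A \<one>" using z by (simp add: lie_alg_def)
  let ?a = "\<lambda>x i h. L (e i) (\<lambda>k. x (k \<otimes> h)) g"
  have F: "(\<lambda>w. x (g \<otimes> fst w \<otimes> snd w)) \<in> smooth_funs (prod_atlas A A)" if "x \<in> C" for x
    by (rule smooth_morphism_funs[OF _ that]) (intro morphism_intros)
  have a: "?a x i \<in> C" if "x \<in> C" "i < n" for x i
    using tangent_param_smooth[OF atlas atlas F[OF that(1)] e_tangent[OF that(2)]] by (simp add: left_inv_field_def)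
  have za: "z (?a x i) = L (e i) (L z x) g" if "x \<in> C" "i < n" for x i
    using tangent_commute[OF atlas atlas F[OF that(1)] e_tangent[OF that(2)] zt] by (simp add: left_inv_field_def)
  have a1: "?a x i \<one> = L (e i) x g" for x i by simp
  have "L z (pb x y) g = z (\<lambda>h. pb (\<lambda>k. x (k \<otimes> h)) (\<lambda>k. y (k \<otimes> h)) g + pb (\<lambda>k. x (g \<otimes> k)) (\<lambda>k. y (g \<otimes> k)) h)"
    by (simp add: left_inv_field_def pb_mult x y)
  also have "\<dots> = z (\<lambda>h. (\<Sum>i<n. \<Sum>j<n. \<pi> i j g * ?a x i h * ?a y j h) + pb (\<lambda>k. x (g \<otimes> k)) (\<lambda>k. y (g \<otimes> k)) h)"
    using x y by (simp add: pb_expand[where x="\<lambda>k. x (k \<otimes> _)"])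
  also have "\<dots> = z (\<lambda>h. \<Sum>i<n. \<Sum>j<n. \<pi> i j g * ?a x i h * ?a y j h) + z (pb (\<lambda>k. x (g \<otimes> k)) (\<lambda>k. y (g \<otimes> k)))"
    by (rule tangent_add[OF zt]) (intro smooth_funs_sum smooth_funs_mult smooth_funs_const a x y pb_smooth | simp add: x y)+
  also have "z (pb (\<lambda>k. x (g \<otimes> k)) (\<lambda>k. y (g \<otimes> k))) = (\<Sum>i<n. \<Sum>j<n. z (\<pi> i j) * L (e i) x g * L (e j) y g)"
    using x y by (simp add: z_pb[OF z] left_inv_field_def)
  also have "z (\<lambda>h. \<Sum>i<n. \<Sum>j<n. \<pi> i j g * ?a x i h * ?a y j h) =
      (\<Sum>i<n. \<Sum>j<n. \<pi> i j g * (L (e i) (L z x) g * L (e j) y g + L (e i) x g * L (e j) (L z y) g))"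
  proof -
    have "z (\<lambda>h. \<pi> i j g * ?a x i h * ?a y j h) =
        \<pi> i j g * (L (e i) (L z x) g * L (e j) y g + L (e i) x g * L (e j) (L z y) g)" if "i < n" "j < n" for i j
    proof -
      have "z (\<lambda>h. \<pi> i j g * ?a x i h * ?a y j h) = z (\<lambda>h. \<pi> i j g * (?a x i h * ?a y j h))"
        by (simp only: mult.assoc)
      also have "\<dots> = \<pi> i j g * z (\<lambda>h. ?a x i h * ?a y j h)"
        by (rule tangent_cmult[OF zt smooth_funs_mult[OF a[OF x that(1)] a[OF y that(2)]]])
      also have "z (\<lambda>h. ?a x i h * ?a y j h) = z (?a x i) * ?a y j \<one> + ?a x i \<one> * z (?a y j)"
        by (rule tangent_mult[OF zt a[OF x that(1)] a[OF y that(2)]])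
      finally show ?thesis by (simp only: za[OF x that(1)] za[OF y that(2)] a1)
    qed
    moreover have "(\<lambda>h. \<pi> i j g * ?a x i h * ?a y j h) \<in> C" if "i < n" "j < n" for i j
      using that by (intro smooth_funs_mult smooth_funs_const a x y)
    ultimately show ?thesis
      by (subst tangent_sum2[OF zt]) simp_all
  qed
  also have "\<dots> = pb (L z x) y g + pb x (L z y) g"
    by (simp add: pb_expand left_inv_field_smooth[OF z] x y distrib_left sum.distrib mult.assoc)
  finally show ?thesis by simp
qed

end

section \<open>The preconnection of a product on the dual\<close>

lemma lin_on_sum:
  assumes "lin_on V F" "subspace V" "finite I" "\<And>i. i \<in> I \<Longrightarrow> x i \<in> V"
  shows "F (\<Sum>i\<in>I. r i *\<^sub>R x i) = (\<Sum>i\<in>I. r i *\<^sub>R F (x i))"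
  using assms(3,4)
proof induction
  case empty
  have "F (0 *\<^sub>R 0) = 0 *\<^sub>R F 0"
    using assms(1) subspace_0[OF assms(2)] unfolding lin_on_def by blast
  then show ?case by (simp only: sum.empty scaleR_zero_left)
next
  case (insert i I)
  have m: "r i *\<^sub>R x i \<in> V" "(\<Sum>i\<in>I. r i *\<^sub>R x i) \<in> V"
    using insert.prems by (auto intro!: subspace_scale[OF assms(2)] subspace_sum[OF assms(2)])
  have "F (r i *\<^sub>R x i + (\<Sum>i\<in>I. r i *\<^sub>R x i)) = F (r i *\<^sub>R x i) + F (\<Sum>i\<in>I. r i *\<^sub>R x i)"
    using assms(1) m unfolding lin_on_def by blast
  moreover have "F (r i *\<^sub>R x i) = r i *\<^sub>R F (x i)"
    using assms(1) insert.prems unfolding lin_on_def by blast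
  moreover have "F (\<Sum>i\<in>I. r i *\<^sub>R x i) = (\<Sum>i\<in>I. r i *\<^sub>R F (x i))"
    by (rule insert.IH) (simp add: insert.prems)
  ultimately show ?case by (simp only: sum.insert[OF insert.hyps(1,2)])
qed

lemma sum4_reverse:
  fixes t :: "_ \<Rightarrow> _ \<Rightarrow> _ \<Rightarrow> _ \<Rightarrow> 'a::comm_monoid_add"
  shows "(\<Sum>i\<in>I. \<Sum>m\<in>M. \<Sum>a\<in>P. \<Sum>b\<in>Q. t i m a b) = (\<Sum>a\<in>P. \<Sum>b\<in>Q. \<Sum>m\<in>M. \<Sum>i\<in>I. t i m a b)"
proof -
  have "(\<Sum>i\<in>I. \<Sum>m\<in>M. \<Sum>a\<in>P. \<Sum>b\<in>Q. t i m a b) = (\<Sum>m\<in>M. \<Sum>i\<in>I. \<Sum>a\<in>P. \<Sum>b\<in>Q. t i m a b)"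
    by (rule sum.swap)
  also have "\<dots> = (\<Sum>m\<in>M. \<Sum>a\<in>P. \<Sum>i\<in>I. \<Sum>b\<in>Q. t i m a b)" by (intro sum.cong refl sum.swap)
  also have "\<dots> = (\<Sum>m\<in>M. \<Sum>a\<in>P. \<Sum>b\<in>Q. \<Sum>i\<in>I. t i m a b)" by (intro sum.cong refl sum.swap)
  also have "\<dots> = (\<Sum>a\<in>P. \<Sum>m\<in>M. \<Sum>b\<in>Q. \<Sum>i\<in>I. t i m a b)" by (rule sum.swap)
  also have "\<dots> = (\<Sum>a\<in>P. \<Sum>b\<in>Q. \<Sum>m\<in>M. \<Sum>i\<in>I. t i m a b)" by (intro sum.cong refl sum.swap)
  finally show ?thesis .
qed

text \<open>The coordinate form of \<Xi>(p, \<Xi>(q, t)), shared by the curvature of the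
  preconnection and the associator of the product.\<close>

lemma trilinear_nested:
  fixes X :: "nat \<Rightarrow> nat \<Rightarrow> nat \<Rightarrow> real"
  shows "(\<Sum>i<n. \<Sum>j<n. X i j k * (p i * (\<Sum>l<n. \<Sum>m<n. X l m j * (q l * t m)))) =
    (\<Sum>a<n. \<Sum>b<n. \<Sum>m<n. (\<Sum>j<n. X a j k * X b m j) * (p a * q b * t m))"
proof -
  have "(\<Sum>i<n. \<Sum>j<n. X i j k * (p i * (\<Sum>l<n. \<Sum>m<n. X l m j * (q l * t m)))) =
    (\<Sum>i<n. \<Sum>j<n. \<Sum>l<n. \<Sum>m<n. X i j k * X l m j * (p i * q l * t m))"
    by (simp add: sum_distrib_left mult_ac)
  also have "\<dots> = (\<Sum>i<n. \<Sum>l<n. \<Sum>m<n. \<Sum>j<n. X i j k * X l m j * (p i * q l * t m))"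
  proof (rule sum.cong[OF refl])
    fix i
    have "(\<Sum>j<n. \<Sum>l<n. \<Sum>m<n. X i j k * X l m j * (p i * q l * t m)) =
      (\<Sum>l<n. \<Sum>j<n. \<Sum>m<n. X i j k * X l m j * (p i * q l * t m))" by (rule sum.swap)
    also have "\<dots> = (\<Sum>l<n. \<Sum>m<n. \<Sum>j<n. X i j k * X l m j * (p i * q l * t m))"
      by (intro sum.cong refl sum.swap)
    finally show "(\<Sum>j<n. \<Sum>l<n. \<Sum>m<n. X i j k * X l m j * (p i * q l * t m)) = \<dots>" .
  qed
  finally show ?thesis by (simp add: sum_distrib_right)
qed

text \<open>The coordinate form of \<Xi>([p, q], t) for a bracket with structure constants
  c.\<close>

lemma trilinear_bracket:
  fixes X c :: "nat \<Rightarrow> nat \<Rightarrow> nat \<Rightarrow> real"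
  shows "(\<Sum>i<n. \<Sum>j<n. X i j k * ((\<Sum>a<n. \<Sum>b<n. c a b i * (p a * q b)) * t j)) =
    (\<Sum>a<n. \<Sum>b<n. \<Sum>m<n. (\<Sum>j<n. X j m k * c a b j) * (p a * q b * t m))"
proof -
  have "(\<Sum>i<n. \<Sum>j<n. X i j k * ((\<Sum>a<n. \<Sum>b<n. c a b i * (p a * q b)) * t j)) =
    (\<Sum>i<n. \<Sum>m<n. \<Sum>a<n. \<Sum>b<n. X i m k * c a b i * (p a * q b * t m))"
    by (simp add: sum_distrib_left sum_distrib_right mult_ac)
  also have "\<dots> = (\<Sum>a<n. \<Sum>b<n. \<Sum>m<n. \<Sum>i<n. X i m k * c a b i * (p a * q b * t m))"
    by (rule sum4_reverse)
  finally show ?thesis by (simp add: sum_distrib_right)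
qed

lemma vector_fields_add:
  assumes "X \<in> vector_fields A" "Y \<in> vector_fields A"
  shows "X + Y \<in> vector_fields A"
proof (rule vector_fieldsI)
  fix p
  have "(\<lambda>f. X f p) + (\<lambda>f. Y f p) \<in> tangent_space A p"
    using subspace_add[OF subspace_tangent_space vector_field_tangent[OF assms(1)] vector_field_tangent[OF assms(2)]] .
  then show "(\<lambda>f. (X + Y) f p) \<in> tangent_space A p" by (simp add: plus_fun_def)
qed (use assms in \<open>simp add: vector_field_smooth smooth_funs_fun_ops\<close>)

lemma vector_fields_scale:
  assumes "X \<in> vector_fields A" "a \<in> smooth_funs A"
  shows "(\<lambda>h. a * X h) \<in> vector_fields A"
proof (rule vector_fieldsI)
  fix p
  have "a p *\<^sub>R (\<lambda>f. X f p) \<in> tangent_space A p"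
    using subspace_scale[OF subspace_tangent_space vector_field_tangent[OF assms(1)]] .
  then show "(\<lambda>f. (a * X f) p) \<in> tangent_space A p" by (simp add: scaleR_fun_def)
qed (use assms in \<open>simp add: vector_field_smooth smooth_funs_fun_ops\<close>)

lemma vector_fields_zero: "0 \<in> vector_fields A"
  by (rule vector_fieldsI)
    (use subspace_0[OF subspace_tangent_space] in \<open>simp_all add: smooth_funs_const zero_fun_def\<close>)

lemma one_formsD:
  assumes "\<tau> \<in> one_forms A"
  shows one_form_smooth: "X \<in> vector_fields A \<Longrightarrow> \<tau> X \<in> smooth_funs A"
    and one_form_add: "X \<in> vector_fields A \<Longrightarrow> Y \<in> vector_fields A \<Longrightarrow> \<tau> (X + Y) = \<tau> X + \<tau> Y"
    and one_form_scale: "h \<in> smooth_funs A \<Longrightarrow> X \<in> vector_fields A \<Longrightarrow> \<tau> (\<lambda>k. h * X k) = h * \<tau> X"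
    and one_form_outside: "X \<notin> vector_fields A \<Longrightarrow> \<tau> X = 0"
  using assms by (simp_all add: one_forms_def)

lemma one_form_zero:
  assumes "\<tau> \<in> one_forms A"
  shows "\<tau> 0 = 0"
proof -
  have "\<tau> (\<lambda>k. 0 * (0 :: ('a \<Rightarrow> real) \<Rightarrow> 'a \<Rightarrow> real) k) = 0 * \<tau> 0"
    by (rule one_form_scale[OF assms smooth_funs_fun_ops(1) vector_fields_zero])
  then show ?thesis by (simp add: zero_fun_def times_fun_def)
qed

lemma one_forms_sum_closed:
  "(\<And>i. i \<in> I \<Longrightarrow> \<tau> i \<in> one_forms A) \<Longrightarrow> (\<Sum>i\<in>I. \<tau> i) \<in> one_forms A"
proof (induction I rule: infinite_finite_induct)
  case (insert i I)
  then have "\<tau> i \<in> one_forms A" "(\<Sum>i\<in>I. \<tau> i) \<in> one_forms A" by auto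
  then have "\<tau> i + (\<Sum>i\<in>I. \<tau> i) \<in> one_forms A"
    unfolding one_forms_def by (auto simp: smooth_funs_fun_ops distrib_left)
  then show ?case by (simp only: sum.insert[OF insert.hyps])
qed (simp_all add: one_forms_def smooth_funs_fun_ops)

lemma one_forms_closed:
  assumes "\<tau> \<in> one_forms A"
  shows one_forms_add: "\<sigma> \<in> one_forms A \<Longrightarrow> \<tau> + \<sigma> \<in> one_forms A"
    and one_forms_diff: "\<sigma> \<in> one_forms A \<Longrightarrow> \<tau> - \<sigma> \<in> one_forms A"
    and one_forms_scaleR: "c *\<^sub>R \<tau> \<in> one_forms A"
    and one_forms_form_scale: "h \<in> smooth_funs A \<Longrightarrow> form_scale h \<tau> \<in> one_forms A"
  using assms unfolding one_forms_def form_scale_def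
  by (auto simp: smooth_funs_fun_ops algebra_simps scaleR_add_right)

lemma ext_d_one_form: "y \<in> smooth_funs A \<Longrightarrow> ext_d A y \<in> one_forms A"
  by (auto simp: one_forms_def ext_d_def vector_fields_add vector_fields_scale vector_field_smooth)

context poisson_lie_frame
begin

abbreviation "\<Omega> \<equiv> one_forms A"
abbreviation "\<omega> k \<equiv> left_inv_form G A (f k)"

lemma L_vf: "k < n \<Longrightarrow> L (e k) \<in> vector_fields A"
  by (rule left_inv_field_vector_field[OF e_in])

lemma \<omega>_eq:
  assumes "X \<in> vector_fields A" "k < n"
  shows "\<omega> k X g = X (\<lambda>h. da k (inv g \<otimes> h)) g"
  using assms f_eq_da[OF left_translate_lie_alg[OF vector_field_tangent[OF assms(1)]] assms(2), of g]
  by (simp add: left_inv_form_def)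

lemma \<omega>_form:
  assumes k: "k < n"
  shows "\<omega> k \<in> \<Omega>"
  unfolding one_forms_def
proof (intro CollectI conjI ballI allI impI)
  fix X assume X: "X \<in> vector_fields A"
  have "\<omega> k X = (\<lambda>g. X (\<lambda>h. da k (inv g \<otimes> h)) g)" using \<omega>_eq[OF X k] by blast
  then show "\<omega> k X \<in> C" using frame_coefficient_smooth[OF X da(1)[OF k]] by simp
  fix Y assume Y: "Y \<in> vector_fields A"
  show "\<omega> k (X + Y) = \<omega> k X + \<omega> k Y"
    by (rule ext) (simp add: \<omega>_eq X Y k vector_fields_add)
next
  fix h X assume "h \<in> C" "X \<in> vector_fields A"
  then show "\<omega> k (\<lambda>k. h * X k) = h * \<omega> k X"
    by (intro ext) (simp add: \<omega>_eq k vector_fields_scale)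
qed (simp add: left_inv_form_def)

lemma \<omega>_L:
  assumes "j < n" "k < n"
  shows "\<omega> k (L (e j)) g = (if k = j then 1 else 0)"
  unfolding \<omega>_eq[OF L_vf[OF assms(1)] assms(2)] using assms by (auto simp: left_inv_field_def da)

text \<open>By \<open>tangent_frame\<close> a vector field is a combination of frame fields with the
  smooth coefficients \<omega>(X), and a 1-form is linear over smooth functions. The induction on
  partial sums keeps every intermediate sum a vector field, where \<tau> is additive.\<close>

lemma one_form_expand:
  assumes \<tau>: "\<tau> \<in> \<Omega>" and X: "X \<in> vector_fields A"
  shows "\<tau> X = (\<Sum>k<n. \<omega> k X * \<tau> (L (e k)))"
proof -
  let ?S = "\<lambda>m. \<Sum>k<m. (\<lambda>h. \<omega> k X * L (e k) h)"
  have S: "?S m \<in> vector_fields A \<and> \<tau> (?S m) = (\<Sum>k<m. \<omega> k X * \<tau> (L (e k)))" if "m \<le> n" for m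
    using that
  proof (induction m)
    case 0
    show ?case using one_form_zero[OF \<tau>] vector_fields_zero by (simp only: lessThan_0 sum.empty simp_thms)
  next
    case (Suc m)
    then have "(\<lambda>h. \<omega> m X * L (e m) h) \<in> vector_fields A"
      by (intro vector_fields_scale L_vf one_form_smooth[OF \<omega>_form X]) auto
    moreover have "\<tau> (\<lambda>h. \<omega> m X * L (e m) h) = \<omega> m X * \<tau> (L (e m))"
      using Suc.prems by (intro one_form_scale[OF \<tau>] one_form_smooth[OF \<omega>_form X] L_vf) auto
    moreover have "?S m \<in> vector_fields A" "\<tau> (?S m) = (\<Sum>k<m. \<omega> k X * \<tau> (L (e k)))"
      using Suc.IH[OF Suc_leD[OF Suc.prems]] by blast+
    ultimately show ?case
      by (simp only: sum.lessThan_Suc vector_fields_add one_form_add[OF \<tau>] simp_thms)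
  qed
  have "X = ?S n"
  proof (intro ext)
    fix h g
    show "X h g = ?S n h g"
      using tangent_frame[OF vector_field_tangent[OF X, of g], of h] by (simp add: sum_fun_apply \<omega>_eq X)
  qed
  then show ?thesis using S[OF order_refl] by simp
qed

lemma one_form_eqI:
  assumes "\<tau> \<in> \<Omega>" "\<sigma> \<in> \<Omega>" "\<And>k g. k < n \<Longrightarrow> \<tau> (L (e k)) g = \<sigma> (L (e k)) g"
  shows "\<tau> = \<sigma>"
proof
  fix X
  have *: "\<tau> (L (e k)) = \<sigma> (L (e k))" if "k < n" for k using assms(3)[OF that] by blast
  show "\<tau> X = \<sigma> X"
    by (cases "X \<in> vector_fields A")
      (simp_all add: one_form_expand[OF assms(1)] one_form_expand[OF assms(2)] * one_form_outside[OF assms(1)]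
        one_form_outside[OF assms(2)])
qed

lemma form_L_smooth: "\<tau> \<in> \<Omega> \<Longrightarrow> k < n \<Longrightarrow> \<tau> (L (e k)) \<in> C"
  by (rule one_form_smooth[OF _ L_vf])

section \<open>Components of the preconnection, torsion and curvature\<close>

definition gcoef :: "('g lie_covec \<Rightarrow> 'g lie_covec \<Rightarrow> 'g lie_covec) \<Rightarrow> ('g \<Rightarrow> real) \<Rightarrow> 'g form \<Rightarrow> nat \<Rightarrow> 'g \<Rightarrow> real" where
  "gcoef \<Xi> a \<tau> k = pb a (\<tau> (L (e k))) +
     (\<Sum>i<n. \<Sum>j<n. \<Xi> (f i) (f j) (e k) *\<^sub>R (L (e i) a * \<tau> (L (e j))))"

lemma gcoef_apply:
  "gcoef \<Xi> a \<tau> k g = pb a (\<tau> (L (e k))) g + (\<Sum>i<n. \<Sum>j<n. \<Xi> (f i) (f j) (e k) * (L (e i) a g * \<tau> (L (e j)) g))"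
  by (simp add: gcoef_def sum_fun_apply)

lemma gcoef_smooth:
  assumes "a \<in> C" "\<tau> \<in> \<Omega>" "k < n"
  shows "gcoef \<Xi> a \<tau> k \<in> C"
proof -
  have "(\<lambda>g. pb a (\<tau> (L (e k))) g + (\<Sum>i<n. \<Sum>j<n. \<Xi> (f i) (f j) (e k) * (L (e i) a g * \<tau> (L (e j)) g))) \<in> C"
    using assms
    by (intro smooth_funs_add smooth_funs_sum smooth_funs_cmult smooth_funs_mult pb_smooth
        form_L_smooth[OF assms(2)] left_inv_field_smooth[OF e_in assms(1)]) auto
  then show ?thesis by (simp add: gcoef_apply[abs_def])
qed

abbreviation "\<Gamma> \<equiv> gamma G A pb n e f"

lemma gamma_form: "a \<in> C \<Longrightarrow> \<tau> \<in> \<Omega> \<Longrightarrow> \<Gamma> \<Xi> a \<tau> \<in> \<Omega>"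
  unfolding gamma_def gcoef_def[symmetric]
  by (intro one_forms_sum_closed one_forms_form_scale \<omega>_form) (auto intro: \<omega>_form gcoef_smooth)

lemma gamma_L:
  assumes "k < n"
  shows "\<Gamma> \<Xi> a \<tau> (L (e k)) g = gcoef \<Xi> a \<tau> k g"
proof -
  have "\<Gamma> \<Xi> a \<tau> (L (e k)) g = (\<Sum>j<n. gcoef \<Xi> a \<tau> j g * (if j = k then 1 else 0))"
    unfolding gamma_def gcoef_def[symmetric]
    by (simp add: sum_fun_apply form_scale_def \<omega>_L assms)
  also have "\<dots> = (\<Sum>j<n. if j = k then gcoef \<Xi> a \<tau> j g else 0)" by (rule sum.cong) auto
  finally show ?thesis using assms by simp
qed

lemma gamma_L': "k < n \<Longrightarrow> \<Gamma> \<Xi> a \<tau> (L (e k)) = gcoef \<Xi> a \<tau> k"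
  using gamma_L by blast

lemma pb_derivation:
  assumes "x \<in> C" "y \<in> C" "z \<in> C"
  shows pb_add_fst: "pb (\<lambda>u. x u + y u) z g = pb x z g + pb y z g"
    and pb_mult_fst: "pb (\<lambda>u. x u * y u) z g = pb x z g * y g + x g * pb y z g"
    and pb_cmult_fst: "pb (\<lambda>u. c * x u) z g = c * pb x z g"
    and pb_add_snd: "pb z (\<lambda>u. x u + y u) g = pb z x g + pb z y g"
    and pb_mult_snd: "pb z (\<lambda>u. x u * y u) g = pb z x g * y g + x g * pb z y g"
    and pb_cmult_snd: "pb z (\<lambda>u. c * x u) g = c * pb z x g"
  using tangent_add[OF pb_tangent_fst[OF assms(3), of g] assms(1,2)]
    tangent_mult[OF pb_tangent_fst[OF assms(3), of g] assms(1,2)]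
    tangent_cmult[OF pb_tangent_fst[OF assms(3), of g] assms(1), of c]
    tangent_add[OF pb_tangent_snd[OF assms(3), of g] assms(1,2)]
    tangent_mult[OF pb_tangent_snd[OF assms(3), of g] assms(1,2)]
    tangent_cmult[OF pb_tangent_snd[OF assms(3), of g] assms(1), of c] assms
  by (simp_all add: smooth_funs_add smooth_funs_mult smooth_funs_cmult)

lemma pb_sum2_snd:
  assumes z: "z \<in> C" and x: "\<And>i j. i < n \<Longrightarrow> j < n \<Longrightarrow> x i j \<in> C"
  shows "pb z (\<lambda>u. \<Sum>i<n. \<Sum>j<n. x i j u) g = (\<Sum>i<n. \<Sum>j<n. pb z (x i j) g)"
proof -
  have "(\<lambda>u. \<Sum>i<n. \<Sum>j<n. x i j u) \<in> C" using x by (intro smooth_funs_sum) auto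
  then show ?thesis
    using tangent_sum2[OF pb_tangent_snd[OF z, of g], of "{..<n}" "{..<n}" x] x by simp
qed

lemma L_derivation:
  assumes i: "i < n" and "x \<in> C" "y \<in> C"
  shows L_add: "L (e i) (\<lambda>u. x u + y u) g = L (e i) x g + L (e i) y g"
    and L_mult: "L (e i) (\<lambda>u. x u * y u) g = L (e i) x g * y g + x g * L (e i) y g"
    and L_cmult: "L (e i) (\<lambda>u. c * x u) g = c * L (e i) x g"
  using tangent_add[OF left_inv_field_tangent[OF e_in[OF i]] assms(2,3)]
    tangent_mult[OF left_inv_field_tangent[OF e_in[OF i]] assms(2,3)]
    tangent_cmult[OF left_inv_field_tangent[OF e_in[OF i]] assms(2)]
  by auto

lemma sum2_cong: "(\<And>i j. i < n \<Longrightarrow> j < n \<Longrightarrow> F i j = H i j) \<Longrightarrow> (\<Sum>i<n. \<Sum>j<n. F i j) = (\<Sum>i<n. \<Sum>j<n. H i j :: real)"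
  by (intro sum.cong refl) auto

text \<open>Each identity is compared on the frame fields, where it reduces to the bracket being a
  derivation in both arguments and to \<open>L (e i)\<close> being a derivation. The frame
  components of \<Xi> are constant.\<close>

lemma gamma_preconnection: "preconnection A pb (\<Gamma> \<Xi>)"
  unfolding preconnection_def bilin_on_def lin_on_def
proof (intro conjI ballI allI)
  fix x \<tau> assume x: "x \<in> C" and \<tau>: "\<tau> \<in> \<Omega>"
  show "\<Gamma> \<Xi> x \<tau> \<in> \<Omega>" by (rule gamma_form[OF x \<tau>])
next
  fix \<tau> x y assume \<tau>: "\<tau> \<in> \<Omega>" and x: "x \<in> C" and y: "y \<in> C"
  show "\<Gamma> \<Xi> (x + y) \<tau> = \<Gamma> \<Xi> x \<tau> + \<Gamma> \<Xi> y \<tau>"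
  proof (rule one_form_eqI)
    fix k g assume k: "k < n"
    have "gcoef \<Xi> (\<lambda>u. x u + y u) \<tau> k g = gcoef \<Xi> x \<tau> k g + gcoef \<Xi> y \<tau> k g"
      unfolding gcoef_apply pb_add_fst[OF x y form_L_smooth[OF \<tau> k]]
      by (simp add: L_add x y algebra_simps sum.distrib)
    then show "\<Gamma> \<Xi> (x + y) \<tau> (L (e k)) g = (\<Gamma> \<Xi> x \<tau> + \<Gamma> \<Xi> y \<tau>) (L (e k)) g"
      using k by (simp add: gamma_L plus_fun_def)
  qed (intro gamma_form one_forms_closed smooth_funs_fun_ops x y \<tau>)+
  show "\<Gamma> \<Xi> (x * y) \<tau> = form_scale y (\<Gamma> \<Xi> x \<tau>) + form_scale x (\<Gamma> \<Xi> y \<tau>)"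
  proof (rule one_form_eqI)
    fix k g assume k: "k < n"
    have "gcoef \<Xi> (\<lambda>u. x u * y u) \<tau> k g = y g * gcoef \<Xi> x \<tau> k g + x g * gcoef \<Xi> y \<tau> k g"
      unfolding gcoef_apply pb_mult_fst[OF x y form_L_smooth[OF \<tau> k]]
      by (simp add: L_mult x y algebra_simps sum.distrib sum_distrib_left)
    then show "\<Gamma> \<Xi> (x * y) \<tau> (L (e k)) g = (form_scale y (\<Gamma> \<Xi> x \<tau>) + form_scale x (\<Gamma> \<Xi> y \<tau>)) (L (e k)) g"
      using k by (simp add: gamma_L form_scale_def times_fun_def)
  qed (intro gamma_form one_forms_closed smooth_funs_fun_ops x y \<tau>)+
  show "\<Gamma> \<Xi> x (form_scale y \<tau>) = form_scale y (\<Gamma> \<Xi> x \<tau>) + form_scale (pb x y) \<tau>"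
  proof (rule one_form_eqI)
    fix k g assume k: "k < n"
    have "form_scale y \<tau> (L (e j)) = (\<lambda>u. y u * \<tau> (L (e j)) u)" for j
      by (simp add: form_scale_def times_fun_def)
    then have "gcoef \<Xi> x (form_scale y \<tau>) k g = y g * gcoef \<Xi> x \<tau> k g + pb x y g * \<tau> (L (e k)) g"
      unfolding gcoef_apply using pb_mult_snd[OF y form_L_smooth[OF \<tau> k] x]
      by (simp add: algebra_simps sum_distrib_left)
    then show "\<Gamma> \<Xi> x (form_scale y \<tau>) (L (e k)) g = (form_scale y (\<Gamma> \<Xi> x \<tau>) + form_scale (pb x y) \<tau>) (L (e k)) g"
      using k by (simp add: gamma_L form_scale_def)
  qed (intro gamma_form one_forms_closed smooth_funs_fun_ops pb_smooth x y \<tau>)+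
next
  fix \<tau> c x assume \<tau>: "\<tau> \<in> \<Omega>" and x: "x \<in> C"
  show "\<Gamma> \<Xi> (c *\<^sub>R x) \<tau> = c *\<^sub>R \<Gamma> \<Xi> x \<tau>"
  proof (rule one_form_eqI)
    fix k g assume k: "k < n"
    have "gcoef \<Xi> (\<lambda>u. c * x u) \<tau> k g = c * gcoef \<Xi> x \<tau> k g"
      unfolding gcoef_apply pb_cmult_fst[OF x x form_L_smooth[OF \<tau> k]]
      by (simp add: L_cmult[where y=x] x algebra_simps sum_distrib_left)
    then show "\<Gamma> \<Xi> (c *\<^sub>R x) \<tau> (L (e k)) g = (c *\<^sub>R \<Gamma> \<Xi> x \<tau>) (L (e k)) g"
      using k by (simp add: gamma_L scaleR_fun_def)
  qed (intro gamma_form one_forms_closed smooth_funs_fun_ops x \<tau>)+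
next
  fix x \<tau> \<sigma> assume x: "x \<in> C" and \<tau>: "\<tau> \<in> \<Omega>" and \<sigma>: "\<sigma> \<in> \<Omega>"
  show "\<Gamma> \<Xi> x (\<tau> + \<sigma>) = \<Gamma> \<Xi> x \<tau> + \<Gamma> \<Xi> x \<sigma>"
  proof (rule one_form_eqI)
    fix k g assume k: "k < n"
    have "gcoef \<Xi> x (\<tau> + \<sigma>) k g = gcoef \<Xi> x \<tau> k g + gcoef \<Xi> x \<sigma> k g"
      unfolding gcoef_apply using pb_add_snd[OF form_L_smooth[OF \<tau> k] form_L_smooth[OF \<sigma> k] x]
      by (simp add: plus_fun_def algebra_simps sum.distrib)
    then show "\<Gamma> \<Xi> x (\<tau> + \<sigma>) (L (e k)) g = (\<Gamma> \<Xi> x \<tau> + \<Gamma> \<Xi> x \<sigma>) (L (e k)) g"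
      using k by (simp add: gamma_L)
  qed (intro gamma_form one_forms_closed smooth_funs_fun_ops x \<tau> \<sigma>)+
next
  fix x c \<tau> assume x: "x \<in> C" and \<tau>: "\<tau> \<in> \<Omega>"
  show "\<Gamma> \<Xi> x (c *\<^sub>R \<tau>) = c *\<^sub>R \<Gamma> \<Xi> x \<tau>"
  proof (rule one_form_eqI)
    fix k g assume k: "k < n"
    have "gcoef \<Xi> x (c *\<^sub>R \<tau>) k g = c * gcoef \<Xi> x \<tau> k g"
      unfolding gcoef_apply using pb_cmult_snd[OF form_L_smooth[OF \<tau> k] x x]
      by (simp add: scaleR_fun_def algebra_simps sum_distrib_left)
    then show "\<Gamma> \<Xi> x (c *\<^sub>R \<tau>) (L (e k)) g = (c *\<^sub>R \<Gamma> \<Xi> x \<tau>) (L (e k)) g"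
      using k by (simp add: gamma_L)
  qed (intro gamma_form one_forms_closed smooth_funs_fun_ops x \<tau>)+
qed

text \<open>The two bracket terms in the derivative of {x, y} cancel those of the preconnection, so
  the difference depends only on first derivatives of x and y. Constancy of its coefficients lets
  evaluation at the identity on \<open>da i\<close> and \<open>da j\<close> detect all of
  them.\<close>

lemma gamma_compatible_iff:
  "poisson_compatible A pb (\<Gamma> \<Xi>) \<longleftrightarrow>
    (\<forall>i<n. \<forall>j<n. \<forall>k<n. \<Xi> (f i) (f j) (e k) - \<Xi> (f j) (f i) (e k) = e k (\<pi> i j))"
proof -
  let ?X = "\<lambda>i j k. \<Xi> (f i) (f j) (e k)"
  have dL: "ext_d A y (L (e k)) = L (e k) y" if "k < n" for y k
    by (simp add: ext_d_def L_vf that)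
  have *: "ext_d A (pb x y) (L (e k)) g - (\<Gamma> \<Xi> x (ext_d A y) - \<Gamma> \<Xi> y (ext_d A x)) (L (e k)) g =
      (\<Sum>i<n. \<Sum>j<n. (e k (\<pi> i j) - (?X i j k - ?X j i k)) * (L (e i) x g * L (e j) y g))"
    if x: "x \<in> C" and y: "y \<in> C" and k: "k < n" for x y k g
  proof -
    have s: "(\<Sum>i<n. \<Sum>j<n. ?X i j k * (L (e i) y g * L (e j) x g)) = (\<Sum>i<n. \<Sum>j<n. ?X j i k * (L (e i) x g * L (e j) y g))"
      by (subst sum.swap) (simp add: mult_ac)
    have "(\<Gamma> \<Xi> x (ext_d A y) - \<Gamma> \<Xi> y (ext_d A x)) (L (e k)) g = gcoef \<Xi> x (ext_d A y) k g - gcoef \<Xi> y (ext_d A x) k g"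
      by (simp add: gamma_L k)
    also have "\<dots> = pb x (L (e k) y) g - pb y (L (e k) x) g +
      ((\<Sum>i<n. \<Sum>j<n. ?X i j k * (L (e i) x g * L (e j) y g)) - (\<Sum>i<n. \<Sum>j<n. ?X j i k * (L (e i) x g * L (e j) y g)))"
      unfolding gcoef_apply s[symmetric] by (simp add: dL k)
    also have "pb y (L (e k) x) g = - pb (L (e k) x) y g"
      by (rule pb_anti[OF y left_inv_field_smooth[OF e_in[OF k] x]])
    finally show ?thesis
      unfolding dL[OF k] left_inv_derivative_pb[OF e_in[OF k] x y]
      by (simp add: left_diff_distrib sum_subtractf mult.assoc)
  qed
  show ?thesis
  proof
    assume c: "poisson_compatible A pb (\<Gamma> \<Xi>)"
    show "\<forall>i<n. \<forall>j<n. \<forall>k<n. ?X i j k - ?X j i k = e k (\<pi> i j)"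
    proof (intro allI impI)
      fix i j k assume ijk: "i < n" "j < n" "k < n"
      have "ext_d A (pb (da i) (da j)) = \<Gamma> \<Xi> (da i) (ext_d A (da j)) - \<Gamma> \<Xi> (da j) (ext_d A (da i))"
        using c ijk da(1) unfolding poisson_compatible_def by blast
      then have "0 = (\<Sum>a<n. \<Sum>b<n. (e k (\<pi> a b) - (?X a b k - ?X b a k)) * (L (e a) (da i) \<one> * L (e b) (da j) \<one>))"
        using *[OF da(1)[OF ijk(1)] da(1)[OF ijk(2)] ijk(3), of \<one>] by simp
      also have "\<dots> = (\<Sum>a<n. \<Sum>b<n. if a = i then (if b = j then e k (\<pi> a b) - (?X a b k - ?X b a k) else 0) else 0)"
        using ijk by (intro sum2_cong) (simp add: left_inv_field_one da)
      also have "\<dots> = (\<Sum>a<n. if a = i then (\<Sum>b<n. if b = j then e k (\<pi> a b) - (?X a b k - ?X b a k) else 0) else 0)"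
        by (intro sum.cong) auto
      also have "\<dots> = e k (\<pi> i j) - (?X i j k - ?X j i k)" using ijk by simp
      finally show "?X i j k - ?X j i k = e k (\<pi> i j)" by simp
    qed
  next
    assume X: "\<forall>i<n. \<forall>j<n. \<forall>k<n. ?X i j k - ?X j i k = e k (\<pi> i j)"
    show "poisson_compatible A pb (\<Gamma> \<Xi>)"
      unfolding poisson_compatible_def
    proof (intro ballI)
      fix x y assume x: "x \<in> C" and y: "y \<in> C"
      show "ext_d A (pb x y) = \<Gamma> \<Xi> x (ext_d A y) - \<Gamma> \<Xi> y (ext_d A x)"
      proof (rule one_form_eqI)
        fix k g assume k: "k < n"
        have "(\<Sum>i<n. \<Sum>j<n. (e k (\<pi> i j) - (?X i j k - ?X j i k)) * (L (e i) x g * L (e j) y g)) = 0"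
          using X k by (intro sum.neutral ballI) simp
        then show "ext_d A (pb x y) (L (e k)) g = (\<Gamma> \<Xi> x (ext_d A y) - \<Gamma> \<Xi> y (ext_d A x)) (L (e k)) g"
          using *[OF x y k, of g] by simp
      qed (intro one_forms_closed gamma_form ext_d_one_form pb_smooth x y)+
    qed
  qed
qed

lemma jacobi:
  assumes "x \<in> C" "y \<in> C" "z \<in> C"
  shows "pb x (pb y z) g - pb y (pb x z) g - pb (pb x y) z g = 0"
proof -
  have "pb x (pb y z) + pb y (pb z x) + pb z (pb x y) = 0"
    using poisson assms unfolding poisson_bracket_def by blast
  then have "pb x (pb y z) g + pb y (pb z x) g + pb z (pb x y) g = 0"
    by (simp add: fun_eq_iff)
  moreover have "pb y (pb z x) g = - pb y (pb x z) g"
  proof -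
    have "pb z x = (\<lambda>u. (-1) * pb x z u)" using pb_anti[OF assms(3,1)] by auto
    then show ?thesis using pb_cmult_snd[OF pb_smooth[OF assms(1,3)] assms(1,2), of "-1" g] by simp
  qed
  moreover have "pb z (pb x y) g = - pb (pb x y) z g"
    by (rule pb_anti[OF assms(3) pb_smooth[OF assms(1,2)]])
  ultimately show ?thesis by simp
qed

text \<open>Everything but a tensorial remainder cancels: the Jacobi identity removes the double
  brackets of the components of \<tau>, and \<open>left_inv_derivative_pb\<close> matches the
  brackets with derivatives of x and y. What remains compares products of the \<Xi> matrices with
  the structure constants of the dual bracket.\<close>

lemma gamma_curvature:
  fixes \<Xi> :: "'g lie_covec \<Rightarrow> 'g lie_covec \<Rightarrow> 'g lie_covec"
  defines "X \<equiv> \<lambda>i j k. \<Xi> (f i) (f j) (e k)"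
  assumes x: "x \<in> C" and y: "y \<in> C" and \<tau>: "\<tau> \<in> \<Omega>" and k: "k < n"
  shows "(\<Gamma> \<Xi> x (\<Gamma> \<Xi> y \<tau>) - \<Gamma> \<Xi> y (\<Gamma> \<Xi> x \<tau>) - \<Gamma> \<Xi> (pb x y) \<tau>) (L (e k)) g =
    (\<Sum>a<n. \<Sum>b<n. \<Sum>m<n. (\<Sum>j<n. X a j k * X b m j - X b j k * X a m j - X j m k * e j (\<pi> a b)) *
       (L (e a) x g * L (e b) y g * \<tau> (L (e m)) g))"
proof -
  let ?t = "\<lambda>j. \<tau> (L (e j))"
  have t: "?t j \<in> C" if "j < n" for j by (rule form_L_smooth[OF \<tau> that])
  have Lx: "L (e i) w \<in> C" if "i < n" "w \<in> C" for i w by (rule left_inv_field_smooth[OF e_in[OF that(1)] that(2)])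
  have E: "\<Gamma> \<Xi> x (\<Gamma> \<Xi> y \<tau>) (L (e k)) g =
      pb x (pb y (?t k)) g + (\<Sum>i<n. \<Sum>j<n. X i j k * (pb x (L (e i) y) g * ?t j g + L (e i) y g * pb x (?t j) g)) +
      (\<Sum>i<n. \<Sum>j<n. X i j k * (L (e i) x g * pb y (?t j) g)) +
      (\<Sum>i<n. \<Sum>j<n. X i j k * (L (e i) x g * (\<Sum>l<n. \<Sum>m<n. X l m j * (L (e l) y g * ?t m g))))"
    if x: "x \<in> C" and y: "y \<in> C" for x y
  proof -
    let ?s = "\<lambda>i j u. X i j k * (L (e i) y u * ?t j u)"
    have s: "?s i j \<in> C" if "i < n" "j < n" for i j
      using that by (intro smooth_funs_cmult smooth_funs_mult Lx t y)
    have S: "(\<lambda>u. \<Sum>i<n. \<Sum>j<n. ?s i j u) \<in> C" by (intro smooth_funs_sum s) auto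
    have "\<Gamma> \<Xi> x (\<Gamma> \<Xi> y \<tau>) (L (e k)) g = pb x (gcoef \<Xi> y \<tau> k) g + (\<Sum>i<n. \<Sum>j<n. X i j k * (L (e i) x g * gcoef \<Xi> y \<tau> j g))"
      unfolding gamma_L[OF k] gcoef_apply[of _ x] X_def using k by (simp add: gamma_L')
    also have "pb x (gcoef \<Xi> y \<tau> k) g = pb x (pb y (?t k)) g + (\<Sum>i<n. \<Sum>j<n. pb x (?s i j) g)"
    proof -
      have "gcoef \<Xi> y \<tau> k = (\<lambda>u. pb y (?t k) u + (\<Sum>i<n. \<Sum>j<n. ?s i j u))"
        by (rule ext) (simp add: gcoef_apply X_def)
      then show ?thesis
        using pb_add_snd[OF pb_smooth[OF y t[OF k]] S x] pb_sum2_snd[OF x s] by simp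
    qed
    also have "(\<Sum>i<n. \<Sum>j<n. pb x (?s i j) g) = (\<Sum>i<n. \<Sum>j<n. X i j k * (pb x (L (e i) y) g * ?t j g + L (e i) y g * pb x (?t j) g))"
    proof (rule sum2_cong)
      fix i j assume ij: "i < n" "j < n"
      show "pb x (?s i j) g = X i j k * (pb x (L (e i) y) g * ?t j g + L (e i) y g * pb x (?t j) g)"
        using pb_cmult_snd[OF smooth_funs_mult[OF Lx[OF ij(1) y] t[OF ij(2)]] x x]
          pb_mult_snd[OF Lx[OF ij(1) y] t[OF ij(2)] x] by simp
    qed
    also have "(\<Sum>i<n. \<Sum>j<n. X i j k * (L (e i) x g * gcoef \<Xi> y \<tau> j g)) =
      (\<Sum>i<n. \<Sum>j<n. X i j k * (L (e i) x g * pb y (?t j) g)) +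
      (\<Sum>i<n. \<Sum>j<n. X i j k * (L (e i) x g * (\<Sum>l<n. \<Sum>m<n. X l m j * (L (e l) y g * ?t m g))))"
      unfolding gcoef_apply X_def by (simp add: distrib_left sum.distrib)
    finally show ?thesis by simp
  qed
  have P: "\<Gamma> \<Xi> (pb x y) \<tau> (L (e k)) g = pb (pb x y) (?t k) g +
      (\<Sum>i<n. \<Sum>j<n. X i j k * ((pb (L (e i) x) y g + pb x (L (e i) y) g) * ?t j g)) +
      (\<Sum>i<n. \<Sum>j<n. X i j k * ((\<Sum>a<n. \<Sum>b<n. e i (\<pi> a b) * (L (e a) x g * L (e b) y g)) * ?t j g))"
  proof -
    have "\<Gamma> \<Xi> (pb x y) \<tau> (L (e k)) g = pb (pb x y) (?t k) g + (\<Sum>i<n. \<Sum>j<n. X i j k * (L (e i) (pb x y) g * ?t j g))"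
      unfolding gamma_L[OF k] gcoef_apply X_def by simp
    also have "(\<Sum>i<n. \<Sum>j<n. X i j k * (L (e i) (pb x y) g * ?t j g)) =
      (\<Sum>i<n. \<Sum>j<n. X i j k * ((pb (L (e i) x) y g + pb x (L (e i) y) g) * ?t j g) +
         X i j k * ((\<Sum>a<n. \<Sum>b<n. e i (\<pi> a b) * (L (e a) x g * L (e b) y g)) * ?t j g))"
      by (rule sum2_cong) (simp add: left_inv_derivative_pb e_in x y mult.assoc distrib_left distrib_right)
    finally show ?thesis by (simp add: sum.distrib)
  qed
  note Q1 = trilinear_nested[where t="\<lambda>m. ?t m g" and k=k and X=X]
  note Q2 = trilinear_bracket[where t="\<lambda>m. ?t m g" and k=k and X=X and c="\<lambda>a b j. e j (\<pi> a b)"]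
  have Q3: "(\<Sum>i<n. \<Sum>j<n. X i j k * (L (e i) y g * (\<Sum>l<n. \<Sum>m<n. X l m j * (L (e l) x g * ?t m g)))) =
      (\<Sum>a<n. \<Sum>b<n. \<Sum>m<n. (\<Sum>j<n. X b j k * X a m j) * (L (e a) x g * L (e b) y g * ?t m g))"
    unfolding Q1[where p="\<lambda>i. L (e i) y g" and q="\<lambda>l. L (e l) x g"] by (subst sum.swap) (simp add: mult_ac)
  have R: "(\<Sum>a<n. \<Sum>b<n. \<Sum>m<n. (\<Sum>j<n. X a j k * X b m j - X b j k * X a m j - X j m k * e j (\<pi> a b)) *
       (L (e a) x g * L (e b) y g * ?t m g)) =
    (\<Sum>a<n. \<Sum>b<n. \<Sum>m<n. (\<Sum>j<n. X a j k * X b m j) * (L (e a) x g * L (e b) y g * ?t m g)) -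
    (\<Sum>a<n. \<Sum>b<n. \<Sum>m<n. (\<Sum>j<n. X b j k * X a m j) * (L (e a) x g * L (e b) y g * ?t m g)) -
    (\<Sum>a<n. \<Sum>b<n. \<Sum>m<n. (\<Sum>j<n. X j m k * e j (\<pi> a b)) * (L (e a) x g * L (e b) y g * ?t m g))"
    by (simp add: sum_subtractf left_diff_distrib)
  \<comment> \<open>All terms containing exactly one \<Xi> and one Poisson bracket; they cancel once
    antisymmetry puts the brackets in a common order.\<close>
  have cross: "(\<Sum>i<n. \<Sum>j<n. X i j k * (pb x (L (e i) y) g * ?t j g + L (e i) y g * pb x (?t j) g)) +
      (\<Sum>i<n. \<Sum>j<n. X i j k * (L (e i) x g * pb y (?t j) g)) -
      ((\<Sum>i<n. \<Sum>j<n. X i j k * (pb y (L (e i) x) g * ?t j g + L (e i) x g * pb y (?t j) g)) +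
      (\<Sum>i<n. \<Sum>j<n. X i j k * (L (e i) y g * pb x (?t j) g))) -
      (\<Sum>i<n. \<Sum>j<n. X i j k * ((pb (L (e i) x) y g + pb x (L (e i) y) g) * ?t j g)) = 0"
  proof -
    have "(\<Sum>i<n. \<Sum>j<n. X i j k * (pb y (L (e i) x) g * ?t j g + L (e i) x g * pb y (?t j) g)) =
      (\<Sum>i<n. \<Sum>j<n. X i j k * (- pb (L (e i) x) y g * ?t j g + L (e i) x g * pb y (?t j) g))"
      by (rule sum2_cong) (simp add: pb_anti[OF y Lx[OF _ x]])
    then show ?thesis by (simp add: sum.distrib sum_negf sum_subtractf algebra_simps)
  qed
  show ?thesis
    unfolding R using E[OF x y] E[OF y x] P cross jacobi[OF x y t[OF k], of g] Q1[where p="\<lambda>i. L (e i) x g" and q="\<lambda>l. L (e l) y g"] Q2[where p="\<lambda>i. L (e i) x g" and q="\<lambda>l. L (e l) y g"] Q3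
    by (simp only: fun_diff_def)
qed

end

section \<open>Pre-Lie structures\<close>

lemma sum_delta_mult:
  fixes h :: "nat \<Rightarrow> real"
  assumes "m < n"
  shows "(\<Sum>i<n. h i * (if i = m then 1 else 0)) = h m"
    and "(\<Sum>i<n. h i * (c * (if i = m then 1 else 0))) = h m * c"
proof -
  have "(\<Sum>i<n. h i * (if i = m then 1 else 0)) = (\<Sum>i<n. if i = m then h i else 0)"
    by (rule sum.cong) auto
  then show 1: "(\<Sum>i<n. h i * (if i = m then 1 else 0)) = h m" using assms by simp
  have "(\<Sum>i<n. h i * (c * (if i = m then 1 else 0))) = (\<Sum>i<n. if i = m then h i * c else 0)"
    by (rule sum.cong) auto
  then show "(\<Sum>i<n. h i * (c * (if i = m then 1 else 0))) = h m * c" using assms by simp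
qed

context poisson_lie_frame
begin

abbreviation "\<D> \<equiv> lie_dual G A"
abbreviation "\<A> \<equiv> lie_alg G A"

text \<open>With M a the matrix of \<Xi>(f a, -), these are the entries of [M a, M b] minus the
  matrix of the dual bracket of f a and f b. The bracket enters through derivatives of \<pi>, not
  through commutators of \<Xi>, so that flatness can be stated without the torsion
  condition.\<close>

definition curv :: "('g lie_covec \<Rightarrow> 'g lie_covec \<Rightarrow> 'g lie_covec) \<Rightarrow> nat \<Rightarrow> nat \<Rightarrow> nat \<Rightarrow> nat \<Rightarrow> real" where
  "curv \<Xi> a b m k = (\<Sum>j<n. \<Xi> (f a) (f j) (e k) * \<Xi> (f b) (f m) (e j) - \<Xi> (f b) (f j) (e k) * \<Xi> (f a) (f m) (e j)
     - \<Xi> (f j) (f m) (e k) * e j (\<pi> a b))"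

text \<open>The coefficients \<open>curv\<close> are constants, so evaluating the tensorial
  curvature at the identity on \<open>da a\<close>, \<open>da b\<close> and the invariant form
  \<omega> m isolates each of them.\<close>

lemma gamma_flat_iff: "flat_preconnection A pb (\<Gamma> \<Xi>) \<longleftrightarrow> (\<forall>a<n. \<forall>b<n. \<forall>m<n. \<forall>k<n. curv \<Xi> a b m k = 0)"
proof
  assume flat: "flat_preconnection A pb (\<Gamma> \<Xi>)"
  show "\<forall>a<n. \<forall>b<n. \<forall>m<n. \<forall>k<n. curv \<Xi> a b m k = 0"
  proof (intro allI impI)
    fix a b m k assume lt: "a < n" "b < n" "m < n" "k < n"
    have "\<Gamma> \<Xi> (da a) (\<Gamma> \<Xi> (da b) (\<omega> m)) - \<Gamma> \<Xi> (da b) (\<Gamma> \<Xi> (da a) (\<omega> m)) - \<Gamma> \<Xi> (pb (da a) (da b)) (\<omega> m) = 0"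
      using flat da(1)[OF lt(1)] da(1)[OF lt(2)] \<omega>_form[OF lt(3)] unfolding flat_preconnection_def by blast
    from fun_cong[OF fun_cong[OF this, of "L (e k)"], of \<one>]
    have "0 = (\<Sum>a'<n. \<Sum>b'<n. \<Sum>m'<n. curv \<Xi> a' b' m' k *
        (L (e a') (da a) \<one> * L (e b') (da b) \<one> * \<omega> m (L (e m')) \<one>))"
      unfolding gamma_curvature[OF da(1)[OF lt(1)] da(1)[OF lt(2)] \<omega>_form[OF lt(3)] lt(4)] curv_def by simp
    also have "\<dots> = (\<Sum>a'<n. \<Sum>b'<n. \<Sum>m'<n. curv \<Xi> a' b' m' k *
        ((if a' = a then 1 else 0) * (if b' = b then 1 else 0) * (if m' = m then 1 else 0)))"
      using lt by (intro sum.cong refl) (simp add: left_inv_field_one da \<omega>_L eq_commute[of m])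
    also have "\<dots> = curv \<Xi> a b m k"
      by (simp only: sum_delta_mult[OF lt(3)] sum_delta_mult[OF lt(2)] sum_delta_mult[OF lt(1)])
    finally show "curv \<Xi> a b m k = 0" by simp
  qed
next
  assume R: "\<forall>a<n. \<forall>b<n. \<forall>m<n. \<forall>k<n. curv \<Xi> a b m k = 0"
  show "flat_preconnection A pb (\<Gamma> \<Xi>)"
    unfolding flat_preconnection_def
  proof (intro ballI)
    fix x y \<tau> assume x: "x \<in> C" and y: "y \<in> C" and \<tau>: "\<tau> \<in> \<Omega>"
    show "\<Gamma> \<Xi> x (\<Gamma> \<Xi> y \<tau>) - \<Gamma> \<Xi> y (\<Gamma> \<Xi> x \<tau>) - \<Gamma> \<Xi> (pb x y) \<tau> = 0"
    proof (rule one_form_eqI)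
      fix k g assume k: "k < n"
      show "(\<Gamma> \<Xi> x (\<Gamma> \<Xi> y \<tau>) - \<Gamma> \<Xi> y (\<Gamma> \<Xi> x \<tau>) - \<Gamma> \<Xi> (pb x y) \<tau>) (L (e k)) g = 0 (L (e k)) g"
        unfolding gamma_curvature[OF x y \<tau> k] curv_def[symmetric] using R k by (simp add: sum.neutral)
    next
      show "0 \<in> \<Omega>" using one_forms_scaleR[OF \<tau>, of 0] by (simp only: scaleR_zero_left)
    qed (intro one_forms_diff gamma_form pb_smooth x y \<tau>)
  qed
qed

lemma subspace_lie_dual: "subspace \<D>"
  by (auto simp: subspace_def lie_dual_def lin_on_def algebra_simps)

lemma lie_dual_outside: "\<phi> \<in> \<D> \<Longrightarrow> x \<notin> \<A> \<Longrightarrow> \<phi> x = 0"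
  by (simp add: lie_dual_def)

lemma lie_dualI:
  assumes "\<And>x y. x \<in> \<A> \<Longrightarrow> y \<in> \<A> \<Longrightarrow> \<phi> (x + y) = \<phi> x + \<phi> y" "\<And>x c. x \<in> \<A> \<Longrightarrow> \<phi> (c *\<^sub>R x) = c * \<phi> x"
    "\<And>x. x \<notin> \<A> \<Longrightarrow> \<phi> x = 0"
  shows "\<phi> \<in> \<D>"
  using assms by (simp add: lie_dual_def lin_on_def)

lemma lie_dual_add: "\<phi> \<in> \<D> \<Longrightarrow> x \<in> \<A> \<Longrightarrow> y \<in> \<A> \<Longrightarrow> \<phi> (x + y) = \<phi> x + \<phi> y"
  and lie_dual_scale: "\<phi> \<in> \<D> \<Longrightarrow> x \<in> \<A> \<Longrightarrow> \<phi> (c *\<^sub>R x) = c * \<phi> x"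
  by (simp_all add: lie_dual_def lin_on_def)

lemma lie_dual_basis_expand:
  assumes "\<phi> \<in> \<D>"
  shows "\<phi> = (\<Sum>i<n. \<phi> (e i) *\<^sub>R f i)"
proof (rule lie_dual_eqI[OF assms])
  show "(\<Sum>i<n. \<phi> (e i) *\<^sub>R f i) \<in> \<D>"
    by (intro subspace_sum[OF subspace_lie_dual] subspace_scale[OF subspace_lie_dual] f_in) simp
  fix i assume i: "i < n"
  have "(\<Sum>j<n. \<phi> (e j) *\<^sub>R f j) (e i) = (\<Sum>j<n. \<phi> (e j) * (if j = i then 1 else 0))"
    by (simp add: sum_fun_apply f_e i)
  then show "\<phi> (e i) = (\<Sum>i<n. \<phi> (e i) *\<^sub>R f i) (e i)" using sum_delta_mult(1)[OF i] by simp
qed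

lemma dual_bracket_in: "\<phi> \<in> \<D> \<Longrightarrow> \<psi> \<in> \<D> \<Longrightarrow> dual_bracket G A pb \<phi> \<psi> \<in> \<D>"
proof (rule lie_dualI)
  assume d: "\<phi> \<in> \<D>" "\<psi> \<in> \<D>"
  show "dual_bracket G A pb \<phi> \<psi> (x + y) = dual_bracket G A pb \<phi> \<psi> x + dual_bracket G A pb \<phi> \<psi> y"
    if "x \<in> \<A>" "y \<in> \<A>" for x y
    using that by (simp add: dual_bracket_eq[OF d] subspace_add[OF subspace_lie_alg, unfolded plus_fun_def]
        subspace_add[OF subspace_lie_alg] algebra_simps sum.distrib)
  show "dual_bracket G A pb \<phi> \<psi> (c *\<^sub>R x) = c * dual_bracket G A pb \<phi> \<psi> x" if "x \<in> \<A>" for x c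
    using that by (simp add: dual_bracket_eq[OF d] subspace_scale[OF subspace_lie_alg] sum_distrib_left mult_ac)
qed (simp add: dual_bracket_def)

context
  fixes \<Xi> :: "'g lie_covec \<Rightarrow> 'g lie_covec \<Rightarrow> 'g lie_covec"
  assumes bilin: "bilin_on \<D> \<D> \<D> \<Xi>"
begin

lemma \<Xi>_in: "\<phi> \<in> \<D> \<Longrightarrow> \<psi> \<in> \<D> \<Longrightarrow> \<Xi> \<phi> \<psi> \<in> \<D>"
  using bilin unfolding bilin_on_def by blast

lemma \<Xi>_lin: "\<psi> \<in> \<D> \<Longrightarrow> lin_on \<D> (\<lambda>\<phi>. \<Xi> \<phi> \<psi>)" "\<phi> \<in> \<D> \<Longrightarrow> lin_on \<D> (\<Xi> \<phi>)"
  using bilin unfolding bilin_on_def by blast+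

lemma \<Xi>_expand:
  assumes \<phi>: "\<phi> \<in> \<D>" and \<psi>: "\<psi> \<in> \<D>"
  shows "\<Xi> \<phi> \<psi> x = (\<Sum>i<n. \<Sum>j<n. \<Xi> (f i) (f j) x * (\<phi> (e i) * \<psi> (e j)))"
proof -
  have "\<Xi> \<phi> \<psi> = \<Xi> (\<Sum>i<n. \<phi> (e i) *\<^sub>R f i) \<psi>" using lie_dual_basis_expand[OF \<phi>] by simp
  also have "\<dots> = (\<Sum>i<n. \<phi> (e i) *\<^sub>R \<Xi> (f i) \<psi>)"
    by (rule lin_on_sum[OF \<Xi>_lin(1)[OF \<psi>] subspace_lie_dual]) (simp_all add: f_in)
  finally have "\<Xi> \<phi> \<psi> x = (\<Sum>i<n. \<phi> (e i) * \<Xi> (f i) \<psi> x)" by (simp add: sum_fun_apply)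
  also have "\<dots> = (\<Sum>i<n. \<phi> (e i) * (\<Sum>j<n. \<psi> (e j) * \<Xi> (f i) (f j) x))"
  proof (intro sum.cong refl arg_cong2[where f="(*)"])
    fix i assume "i \<in> {..<n}"
    then have i: "f i \<in> \<D>" by (simp add: f_in)
    have "\<Xi> (f i) \<psi> = \<Xi> (f i) (\<Sum>j<n. \<psi> (e j) *\<^sub>R f j)" using lie_dual_basis_expand[OF \<psi>] by simp
    also have "\<dots> = (\<Sum>j<n. \<psi> (e j) *\<^sub>R \<Xi> (f i) (f j))"
      by (rule lin_on_sum[OF \<Xi>_lin(2)[OF i] subspace_lie_dual]) (simp_all add: f_in)
    finally show "\<Xi> (f i) \<psi> x = (\<Sum>j<n. \<psi> (e j) * \<Xi> (f i) (f j) x)" by (simp add: sum_fun_apply)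
  qed
  finally show ?thesis by (simp add: sum_distrib_left mult_ac)
qed

lemma \<Xi>_commutator_iff:
  "(\<forall>\<phi>\<in>\<D>. \<forall>\<psi>\<in>\<D>. \<Xi> \<phi> \<psi> - \<Xi> \<psi> \<phi> = dual_bracket G A pb \<phi> \<psi>) \<longleftrightarrow>
    (\<forall>i<n. \<forall>j<n. \<forall>k<n. \<Xi> (f i) (f j) (e k) - \<Xi> (f j) (f i) (e k) = e k (\<pi> i j))"
proof
  assume H: "\<forall>\<phi>\<in>\<D>. \<forall>\<psi>\<in>\<D>. \<Xi> \<phi> \<psi> - \<Xi> \<psi> \<phi> = dual_bracket G A pb \<phi> \<psi>"
  show "\<forall>i<n. \<forall>j<n. \<forall>k<n. \<Xi> (f i) (f j) (e k) - \<Xi> (f j) (f i) (e k) = e k (\<pi> i j)"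
  proof (intro allI impI)
    fix i j k assume lt: "i < n" "j < n" "k < n"
    have "\<Xi> (f i) (f j) - \<Xi> (f j) (f i) = dual_bracket G A pb (f i) (f j)"
      using H f_in lt by blast
    then have "\<Xi> (f i) (f j) (e k) - \<Xi> (f j) (f i) (e k) = dual_bracket G A pb (f i) (f j) (e k)"
      by (metis fun_diff_def)
    also have "\<dots> = (\<Sum>a<n. \<Sum>b<n. e k (\<pi> a b) * ((if a = i then 1 else 0) * (if b = j then 1 else 0)))"
      unfolding dual_bracket_eq[OF f_in[OF lt(1)] f_in[OF lt(2)] e_in[OF lt(3)]]
      using lt by (intro sum.cong refl) (simp add: f_e eq_commute[of i] eq_commute[of j])
    also have "\<dots> = e k (\<pi> i j)"
      by (simp only: sum_delta_mult[OF lt(2)] sum_delta_mult[OF lt(1)])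
    finally show "\<Xi> (f i) (f j) (e k) - \<Xi> (f j) (f i) (e k) = e k (\<pi> i j)" .
  qed
next
  assume H: "\<forall>i<n. \<forall>j<n. \<forall>k<n. \<Xi> (f i) (f j) (e k) - \<Xi> (f j) (f i) (e k) = e k (\<pi> i j)"
  show "\<forall>\<phi>\<in>\<D>. \<forall>\<psi>\<in>\<D>. \<Xi> \<phi> \<psi> - \<Xi> \<psi> \<phi> = dual_bracket G A pb \<phi> \<psi>"
  proof (intro ballI)
    fix \<phi> \<psi> assume d: "\<phi> \<in> \<D>" "\<psi> \<in> \<D>"
    show "\<Xi> \<phi> \<psi> - \<Xi> \<psi> \<phi> = dual_bracket G A pb \<phi> \<psi>"
    proof (rule lie_dual_eqI[OF subspace_diff[OF subspace_lie_dual \<Xi>_in[OF d] \<Xi>_in[OF d(2,1)]] dual_bracket_in[OF d]])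
      fix k assume k: "k < n"
      have "\<Xi> \<psi> \<phi> (e k) = (\<Sum>i<n. \<Sum>j<n. \<Xi> (f j) (f i) (e k) * (\<phi> (e i) * \<psi> (e j)))"
        unfolding \<Xi>_expand[OF d(2,1)] by (subst sum.swap) (simp add: mult_ac)
      then have "(\<Xi> \<phi> \<psi> - \<Xi> \<psi> \<phi>) (e k) =
          (\<Sum>i<n. \<Sum>j<n. (\<Xi> (f i) (f j) (e k) - \<Xi> (f j) (f i) (e k)) * (\<phi> (e i) * \<psi> (e j)))"
        by (simp add: \<Xi>_expand[OF d] left_diff_distrib sum_subtractf)
      also have "\<dots> = dual_bracket G A pb \<phi> \<psi> (e k)"
        unfolding dual_bracket_eq[OF d e_in[OF k]] using H k by (intro sum.cong refl) (simp add: mult.assoc)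
      finally show "(\<Xi> \<phi> \<psi> - \<Xi> \<psi> \<phi>) (e k) = dual_bracket G A pb \<phi> \<psi> (e k)" .
    qed
  qed
qed

text \<open>The commutator assumption turns \<Xi>(\<phi>, \<psi>) - \<Xi>(\<psi>, \<phi>) inside the
  first argument into the dual bracket, which is the form in which \<open>curv\<close> measures
  it.\<close>

lemma \<Xi>_associator:
  assumes comm: "\<And>\<phi> \<psi>. \<phi> \<in> \<D> \<Longrightarrow> \<psi> \<in> \<D> \<Longrightarrow> \<Xi> \<phi> \<psi> - \<Xi> \<psi> \<phi> = dual_bracket G A pb \<phi> \<psi>"
    and d: "\<phi> \<in> \<D>" "\<psi> \<in> \<D>" "\<zeta> \<in> \<D>" and k: "k < n"
  shows "(\<Xi> \<phi> (\<Xi> \<psi> \<zeta>) - \<Xi> \<psi> (\<Xi> \<phi> \<zeta>) - (\<Xi> (\<Xi> \<phi> \<psi>) \<zeta> - \<Xi> (\<Xi> \<psi> \<phi>) \<zeta>)) (e k) =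
    (\<Sum>a<n. \<Sum>b<n. \<Sum>m<n. curv \<Xi> a b m k * (\<phi> (e a) * \<psi> (e b) * \<zeta> (e m)))"
proof -
  define X where "X i j k = \<Xi> (f i) (f j) (e k)" for i j k
  have E: "\<Xi> \<phi> (\<Xi> \<psi> \<zeta>) (e k) = (\<Sum>a<n. \<Sum>b<n. \<Sum>m<n. (\<Sum>j<n. X a j k * X b m j) * (\<phi> (e a) * \<psi> (e b) * \<zeta> (e m)))"
    if "\<phi> \<in> \<D>" "\<psi> \<in> \<D>" for \<phi> \<psi>
    unfolding \<Xi>_expand[OF that(1) \<Xi>_in[OF that(2) d(3)]] \<Xi>_expand[OF that(2) d(3)] X_def[symmetric]
    by (rule trilinear_nested)
  have "\<Xi> (\<Xi> \<phi> \<psi>) \<zeta> (e k) - \<Xi> (\<Xi> \<psi> \<phi>) \<zeta> (e k) =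
      (\<Sum>i<n. \<Sum>j<n. X i j k * ((\<Xi> \<phi> \<psi> - \<Xi> \<psi> \<phi>) (e i) * \<zeta> (e j)))"
    unfolding \<Xi>_expand[OF \<Xi>_in[OF d(1,2)] d(3)] \<Xi>_expand[OF \<Xi>_in[OF d(2,1)] d(3)]
    by (simp add: X_def left_diff_distrib right_diff_distrib sum_subtractf)
  also have "\<dots> = (\<Sum>i<n. \<Sum>j<n. X i j k * ((\<Sum>a<n. \<Sum>b<n. e i (\<pi> a b) * (\<phi> (e a) * \<psi> (e b))) * \<zeta> (e j)))"
    unfolding comm[OF d(1,2)] by (rule sum2_cong) (simp add: dual_bracket_eq[OF d(1,2) e_in] mult.assoc)
  also have "\<dots> = (\<Sum>a<n. \<Sum>b<n. \<Sum>m<n. (\<Sum>j<n. X j m k * e j (\<pi> a b)) * (\<phi> (e a) * \<psi> (e b) * \<zeta> (e m)))"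
    by (rule trilinear_bracket[where c="\<lambda>a b j. e j (\<pi> a b)"])
  finally have B: "\<Xi> (\<Xi> \<phi> \<psi>) \<zeta> (e k) - \<Xi> (\<Xi> \<psi> \<phi>) \<zeta> (e k) = \<dots>" .
  have S: "\<Xi> \<psi> (\<Xi> \<phi> \<zeta>) (e k) = (\<Sum>a<n. \<Sum>b<n. \<Sum>m<n. (\<Sum>j<n. X b j k * X a m j) * (\<phi> (e a) * \<psi> (e b) * \<zeta> (e m)))"
    unfolding E[OF d(2,1)] by (subst sum.swap) (simp add: mult_ac)
  have "(\<Sum>a<n. \<Sum>b<n. \<Sum>m<n. curv \<Xi> a b m k * (\<phi> (e a) * \<psi> (e b) * \<zeta> (e m))) =
      \<Xi> \<phi> (\<Xi> \<psi> \<zeta>) (e k) - \<Xi> \<psi> (\<Xi> \<phi> \<zeta>) (e k) - (\<Xi> (\<Xi> \<phi> \<psi>) \<zeta> (e k) - \<Xi> (\<Xi> \<psi> \<phi>) \<zeta> (e k))"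
    unfolding E[OF d(1,2)] S B by (simp add: curv_def X_def sum_subtractf left_diff_distrib)
  then show ?thesis by simp
qed

text \<open>Torsion comes first: the commutator condition corresponds to Poisson compatibility, and
  under it the associator condition corresponds to flatness.\<close>

lemma pre_lie_iff:
  "left_pre_lie \<D> (dual_bracket G A pb) \<Xi> \<longleftrightarrow> poisson_compatible A pb (\<Gamma> \<Xi>) \<and> flat_preconnection A pb (\<Gamma> \<Xi>)"
proof -
  let ?comm = "\<forall>\<phi>\<in>\<D>. \<forall>\<psi>\<in>\<D>. \<Xi> \<phi> \<psi> - \<Xi> \<psi> \<phi> = dual_bracket G A pb \<phi> \<psi>"
  let ?assoc = "\<forall>\<phi>\<in>\<D>. \<forall>\<psi>\<in>\<D>. \<forall>\<zeta>\<in>\<D>. \<Xi> (\<Xi> \<phi> \<psi>) \<zeta> - \<Xi> (\<Xi> \<psi> \<phi>) \<zeta> = \<Xi> \<phi> (\<Xi> \<psi> \<zeta>) - \<Xi> \<psi> (\<Xi> \<phi> \<zeta>)"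
  have "?assoc \<longleftrightarrow> (\<forall>a<n. \<forall>b<n. \<forall>m<n. \<forall>k<n. curv \<Xi> a b m k = 0)" if comm: ?comm
  proof
    assume assoc: ?assoc
    show "\<forall>a<n. \<forall>b<n. \<forall>m<n. \<forall>k<n. curv \<Xi> a b m k = 0"
    proof (intro allI impI)
      fix a b m k assume lt: "a < n" "b < n" "m < n" "k < n"
      note d = f_in[OF lt(1)] f_in[OF lt(2)] f_in[OF lt(3)]
      have "\<Xi> (\<Xi> (f a) (f b)) (f m) - \<Xi> (\<Xi> (f b) (f a)) (f m) = \<Xi> (f a) (\<Xi> (f b) (f m)) - \<Xi> (f b) (\<Xi> (f a) (f m))"
        using assoc d by blast
      then have "0 = (\<Sum>a'<n. \<Sum>b'<n. \<Sum>m'<n. curv \<Xi> a' b' m' k * (f a (e a') * f b (e b') * f m (e m')))"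
        using \<Xi>_associator[OF comm[rule_format] d lt(4)] by simp
      also have "\<dots> = (\<Sum>a'<n. \<Sum>b'<n. \<Sum>m'<n. curv \<Xi> a' b' m' k *
          ((if a' = a then 1 else 0) * (if b' = b then 1 else 0) * (if m' = m then 1 else 0)))"
        using lt by (intro sum.cong refl) (simp add: f_e eq_commute[of m] eq_commute[of a] eq_commute[of b])
      also have "\<dots> = curv \<Xi> a b m k"
        by (simp only: sum_delta_mult[OF lt(3)] sum_delta_mult[OF lt(2)] sum_delta_mult[OF lt(1)])
      finally show "curv \<Xi> a b m k = 0" by simp
    qed
  next
    assume R: "\<forall>a<n. \<forall>b<n. \<forall>m<n. \<forall>k<n. curv \<Xi> a b m k = 0"
    show ?assoc
    proof (intro ballI)
      fix \<phi> \<psi> \<zeta> assume d: "\<phi> \<in> \<D>" "\<psi> \<in> \<D>" "\<zeta> \<in> \<D>"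
      show "\<Xi> (\<Xi> \<phi> \<psi>) \<zeta> - \<Xi> (\<Xi> \<psi> \<phi>) \<zeta> = \<Xi> \<phi> (\<Xi> \<psi> \<zeta>) - \<Xi> \<psi> (\<Xi> \<phi> \<zeta>)"
      proof (rule lie_dual_eqI)
        fix k assume k: "k < n"
        have "(\<Sum>a<n. \<Sum>b<n. \<Sum>m<n. curv \<Xi> a b m k * (\<phi> (e a) * \<psi> (e b) * \<zeta> (e m))) = 0"
          using R k by (simp add: sum.neutral)
        then show "(\<Xi> (\<Xi> \<phi> \<psi>) \<zeta> - \<Xi> (\<Xi> \<psi> \<phi>) \<zeta>) (e k) = (\<Xi> \<phi> (\<Xi> \<psi> \<zeta>) - \<Xi> \<psi> (\<Xi> \<phi> \<zeta>)) (e k)"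
          using \<Xi>_associator[OF comm[rule_format] d k] by simp
      qed (intro subspace_diff[OF subspace_lie_dual] \<Xi>_in d)+
    qed
  qed
  then show ?thesis
    unfolding left_pre_lie_def gamma_flat_iff gamma_compatible_iff \<Xi>_commutator_iff[symmetric] using bilin by blast
qed

end

end

section \<open>Bicovariance\<close>

context poisson_lie_frame
begin

section \<open>Lie bracket, adjoint and coadjoint actions, and the cocycle
  \<open>D_check\<close>\<close>

lemma lie_algI: "x \<in> tangent_space A \<one> \<Longrightarrow> x \<in> \<A>"
  and lie_algD: "x \<in> \<A> \<Longrightarrow> x \<in> tangent_space A \<one>"
  by (simp_all add: lie_alg_def)

text \<open>Iterating the Leibniz rule produces cross terms x a * y b + x b * y a, symmetric in x
  and y, which cancel in the commutator. On a nonsmooth function both invariant derivatives are the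
  zero function.\<close>

lemma lie_bracket_in:
  assumes x: "x \<in> \<A>" and y: "y \<in> \<A>"
  shows "lie_bracket G x y \<in> \<A>"
proof (rule lie_algI, rule tangent_spaceI)
  note xt = lie_algD[OF x] and yt = lie_algD[OF y]
  have Lm: "L z (\<lambda>u. a u * b u) = (\<lambda>u. L z a u * b u + a u * L z b u)" if "z \<in> \<A>" "a \<in> C" "b \<in> C" for z a b
    using tangent_mult[OF left_inv_field_tangent[OF that(1)] that(2,3)] by blast
  have La: "L z (\<lambda>u. a u + b u) = (\<lambda>u. L z a u + L z b u)" if "z \<in> \<A>" "a \<in> C" "b \<in> C" for z a b
    using tangent_add[OF left_inv_field_tangent[OF that(1)] that(2,3)] by blast
  have Lc: "L z (\<lambda>u. c * a u) = (\<lambda>u. c * L z a u)" if "z \<in> \<A>" "a \<in> C" for z a c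
    using tangent_cmult[OF left_inv_field_tangent[OF that(1)] that(2)] by blast
  fix a b assume ab: "a \<in> C" "b \<in> C"
  note L = left_inv_field_smooth[OF x ab(1)] left_inv_field_smooth[OF x ab(2)]
    left_inv_field_smooth[OF y ab(1)] left_inv_field_smooth[OF y ab(2)]
  show "lie_bracket G x y (\<lambda>u. a u + b u) = lie_bracket G x y a + lie_bracket G x y b"
    unfolding lie_bracket_def La[OF x ab] La[OF y ab] tangent_add[OF xt L(3,4)] tangent_add[OF yt L(1,2)] by simp
  show "lie_bracket G x y (\<lambda>u. a u * b u) = lie_bracket G x y a * b \<one> + a \<one> * lie_bracket G x y b"
    unfolding lie_bracket_def Lm[OF x ab] Lm[OF y ab]
      tangent_add[OF xt smooth_funs_mult[OF L(3) ab(2)] smooth_funs_mult[OF ab(1) L(4)]]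
      tangent_add[OF yt smooth_funs_mult[OF L(1) ab(2)] smooth_funs_mult[OF ab(1) L(2)]]
      tangent_mult[OF xt L(3) ab(2)] tangent_mult[OF xt ab(1) L(4)]
      tangent_mult[OF yt L(1) ab(2)] tangent_mult[OF yt ab(1) L(2)] left_inv_field_one
    by (simp add: algebra_simps)
  show "lie_bracket G x y (\<lambda>u. c * a u) = c * lie_bracket G x y a" for c
    unfolding lie_bracket_def Lc[OF x ab(1)] Lc[OF y ab(1)] tangent_cmult[OF xt L(3)] tangent_cmult[OF yt L(1)]
    by (simp add: algebra_simps)
next
  fix a assume a: "a \<notin> C"
  have L0: "L z a = (\<lambda>u. 0)" if "z \<in> \<A>" for z
    using tangent_nonsmooth[OF left_inv_field_tangent[OF that] a] by blast
  show "lie_bracket G x y a = 0"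
    unfolding lie_bracket_def L0[OF x] L0[OF y] tangent_const[OF lie_algD[OF x]] tangent_const[OF lie_algD[OF y]] by simp
qed

lemma lie_bracket_anti: "lie_bracket G x y = (-1) *\<^sub>R lie_bracket G y x"
  by (simp add: lie_bracket_def fun_eq_iff)

lemma lie_bracket_add_fst:
  assumes "x \<in> \<A>" "y \<in> \<A>" "z \<in> \<A>"
  shows "lie_bracket G (x + y) z = lie_bracket G x z + lie_bracket G y z"
proof
  fix a
  show "lie_bracket G (x + y) z a = (lie_bracket G x z + lie_bracket G y z) a"
  proof (cases "a \<in> C")
    case True
    have "L (x + y) a = (\<lambda>u. L x a u + L y a u)" by (simp add: left_inv_field_def fun_eq_iff)
    then show ?thesis
      using tangent_add[OF lie_algD[OF assms(3)] left_inv_field_smooth[OF assms(1) True] left_inv_field_smooth[OF assms(2) True]]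
      by (simp add: lie_bracket_def)
  next
    case False
    then show ?thesis
      using tangent_nonsmooth[OF lie_algD[OF lie_bracket_in[OF _ assms(3)]], of _ a]
        assms subspace_add[OF subspace_lie_alg assms(1,2)] by simp
  qed
qed

lemma lie_bracket_scale_fst:
  assumes "x \<in> \<A>" "z \<in> \<A>"
  shows "lie_bracket G (c *\<^sub>R x) z = c *\<^sub>R lie_bracket G x z"
proof
  fix a
  show "lie_bracket G (c *\<^sub>R x) z a = (c *\<^sub>R lie_bracket G x z) a"
  proof (cases "a \<in> C")
    case True
    have "L (c *\<^sub>R x) a = (\<lambda>u. c * L x a u)" by (simp add: left_inv_field_def fun_eq_iff)
    then show ?thesis
      using tangent_cmult[OF lie_algD[OF assms(2)] left_inv_field_smooth[OF assms(1) True]]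
      by (simp add: lie_bracket_def right_diff_distrib)
  next
    case False
    then show ?thesis
      using tangent_nonsmooth[OF lie_algD[OF lie_bracket_in[OF _ assms(2)]], of _ a]
        assms subspace_scale[OF subspace_lie_alg assms(1)] by simp
  qed
qed

lemma lie_bracket_lin_snd:
  assumes "x \<in> \<A>" "y \<in> \<A>" "z \<in> \<A>"
  shows "lie_bracket G z (x + y) = lie_bracket G z x + lie_bracket G z y"
    and "lie_bracket G z (c *\<^sub>R x) = c *\<^sub>R lie_bracket G z x"
proof -
  show "lie_bracket G z (x + y) = lie_bracket G z x + lie_bracket G z y"
    unfolding lie_bracket_anti[of z] lie_bracket_add_fst[OF assms] scaleR_add_right by (rule refl)
  show "lie_bracket G z (c *\<^sub>R x) = c *\<^sub>R lie_bracket G z x"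
    unfolding lie_bracket_anti[of z] lie_bracket_scale_fst[OF assms(1,3)] by (simp add: mult.commute)
qed

lemma coad_in:
  assumes x: "x \<in> \<A>" and \<phi>: "\<phi> \<in> \<D>"
  shows "coad G A x \<phi> \<in> \<D>"
proof (rule lie_dualI)
  fix y z assume y: "y \<in> \<A>" and z: "z \<in> \<A>"
  show "coad G A x \<phi> (y + z) = coad G A x \<phi> y + coad G A x \<phi> z"
    unfolding coad_def lie_bracket_lin_snd(1)[OF y z x] lie_dual_add[OF \<phi> lie_bracket_in[OF x y] lie_bracket_in[OF x z]]
    using y z subspace_add[OF subspace_lie_alg y z] by simp
next
  fix y c assume y: "y \<in> \<A>"
  show "coad G A x \<phi> (c *\<^sub>R y) = c * coad G A x \<phi> y"
    unfolding coad_def lie_bracket_lin_snd(2)[OF y y x] lie_dual_scale[OF \<phi> lie_bracket_in[OF x y]]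
    using y subspace_scale[OF subspace_lie_alg y] by simp
qed (simp add: coad_def)

lemma conj_morphism: "smooth_morphism A A (\<lambda>k. g \<otimes> k \<otimes> inv g)"
  by (intro morphism_intros)

lemma Ad_in:
  assumes "y \<in> \<A>"
  shows "Ad G g y \<in> \<A>"
proof -
  have "(\<lambda>k. a (g \<otimes> k \<otimes> inv g)) \<in> C \<Longrightarrow> a \<in> C" for a
    using smooth_morphism_funs[OF conj_morphism[of "inv g"], of "\<lambda>k. a (g \<otimes> k \<otimes> inv g)"] by (simp add: m_assoc)
  from tangent_push[OF conj_morphism this lie_algD[OF assms]] show ?thesis
    by (intro lie_algI) (simp add: Ad_def)
qed

lemma Ad_mult: "Ad G (g \<otimes> h) y = Ad G g (Ad G h y)"
  by (simp add: Ad_def m_assoc inv_mult_group)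

lemma Ad_one: "Ad G \<one> y = y"
  by (simp add: Ad_def)

lemma Ad_inv_cancel: "Ad G (inv g) (Ad G g y) = y"
  by (simp add: Ad_one flip: Ad_mult)

lemma Ad_lin: "Ad G g (x + y) = Ad G g x + Ad G g y" "Ad G g (c *\<^sub>R x) = c *\<^sub>R Ad G g x"
  by (simp_all add: Ad_def fun_eq_iff)

lemma Ad_bracket: "Ad G g (lie_bracket G x y) = lie_bracket G (Ad G g x) (Ad G g y)"
  by (simp add: Ad_def lie_bracket_def left_inv_field_def m_assoc)

lemma coAd_in:
  assumes "\<phi> \<in> \<D>"
  shows "coAd G A g \<phi> \<in> \<D>"
  by (rule lie_dualI)
    (use assms in \<open>simp_all add: coAd_def Ad_lin Ad_in lie_dual_add lie_dual_scale subspace_add[OF subspace_lie_alg]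
      subspace_scale[OF subspace_lie_alg]\<close>)

lemma coAd_mult: "coAd G A (g \<otimes> h) \<phi> = coAd G A g (coAd G A h \<phi>)"
  by (simp add: coAd_def fun_eq_iff inv_mult_group Ad_mult Ad_in)

lemma coAd_one: "\<phi> \<in> \<D> \<Longrightarrow> coAd G A \<one> \<phi> = \<phi>"
  by (auto simp: coAd_def fun_eq_iff Ad_one lie_dual_outside)

lemma Ad_smooth:
  assumes "y \<in> \<A>" "a \<in> C"
  shows "(\<lambda>g. Ad G g y a) \<in> C"
  using tangent_param_smooth[OF atlas atlas conj_smooth[OF assms(2)] lie_algD[OF assms(1)]] by (simp add: Ad_def)

text \<open>g occurs twice in the conjugation, and \<open>tangent_diagonal\<close> separates the
  occurrences. The left one gives z (L y a); the right one, by \<open>inv_tangent\<close> and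
  commuting the derivatives, gives - y (L z a).\<close>

lemma Ad_derivative:
  assumes z: "z \<in> \<A>" and y: "y \<in> \<A>" and a: "a \<in> C"
  shows "z (\<lambda>g. Ad G g y a) = lie_bracket G z y a"
proof -
  note zt = lie_algD[OF z] and yt = lie_algD[OF y]
  have S3: "smooth_morphism (prod_atlas A (prod_atlas A A)) A (\<lambda>w. fst (snd w) \<otimes> fst w \<otimes> inv (snd (snd w)))"
  proof -
    note P = smooth_atlas_prod[OF atlas atlas_prod]
    note s = smooth_morphism_snd[OF atlas atlas_prod]
    note c = mult_morphism[OF P]
    show ?thesis
      by (intro c inv_morphism smooth_morphism_fst[OF atlas atlas_prod] smooth_morphism_comp[OF s fst_morphism]
          smooth_morphism_comp[OF s snd_morphism])
  qed
  have F: "(\<lambda>w. y (\<lambda>k. a (fst w \<otimes> k \<otimes> inv (snd w)))) \<in> smooth_funs (prod_atlas A A)"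
    using tangent_param_smooth[OF atlas atlas_prod smooth_morphism_funs[OF S3 a] yt] by simp
  have "z (\<lambda>g. Ad G g y a) = z (\<lambda>g. y (\<lambda>k. a (g \<otimes> k))) + z (\<lambda>g. y (\<lambda>k. a (k \<otimes> inv g)))"
    using tangent_diagonal[OF atlas F zt] by (simp add: Ad_def)
  also have "z (\<lambda>g. y (\<lambda>k. a (g \<otimes> k))) = z (L y a)" by (simp add: left_inv_field_def[abs_def])
  also have "z (\<lambda>g. y (\<lambda>k. a (k \<otimes> inv g))) = - y (L z a)"
  proof -
    have K: "(\<lambda>w. a (snd w \<otimes> inv (fst w))) \<in> smooth_funs (prod_atlas A A)"
      by (rule smooth_morphism_funs[OF _ a]) (intro morphism_intros)
    have i: "z (\<lambda>g. a (k \<otimes> inv g)) = - L z a k" for k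
      using inv_tangent[OF z, of "\<lambda>g. a (k \<otimes> g)"] a by (simp add: left_inv_field_def)
    have "z (\<lambda>g. y (\<lambda>k. a (k \<otimes> inv g))) = y (\<lambda>k. z (\<lambda>g. a (k \<otimes> inv g)))"
      using tangent_commute[OF atlas atlas K zt yt] by simp
    also have "\<dots> = y (\<lambda>k. - L z a k)" by (simp only: i)
    also have "\<dots> = - y (L z a)" by (rule tangent_minus[OF yt left_inv_field_smooth[OF z a]])
    finally show ?thesis .
  qed
  finally show ?thesis by (simp add: lie_bracket_def)
qed

text \<open>Expresses the coadjoint action through real functions \<open>Ad\<close> on the test
  functions \<open>da l\<close>, from which smoothness and derivatives in g are inherited.\<close>

lemma coAd_basis:
  assumes \<phi>: "\<phi> \<in> \<D>" and y: "y \<in> \<A>"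
  shows "coAd G A g \<phi> y = (\<Sum>l<n. Ad G (inv g) y (da l) * \<phi> (e l))"
  unfolding coAd_def lie_dual_expand[OF \<phi> Ad_in[OF y]] using y
  by (simp add: f_eq_da[OF Ad_in[OF y]])

lemma coAd_smooth:
  assumes \<phi>: "\<phi> \<in> \<D>" and y: "y \<in> \<A>"
  shows "(\<lambda>g. coAd G A g \<phi> y) \<in> C"
proof -
  have "(\<lambda>g. \<Sum>l<n. Ad G (inv g) y (da l) * \<phi> (e l)) \<in> C"
    by (intro smooth_funs_sum smooth_funs_mult smooth_funs_const
        smooth_morphism_funs[OF inv_morphism[OF smooth_morphism_id] Ad_smooth[OF y da(1)]]) simp
  then show ?thesis by (simp add: coAd_basis[OF assms])
qed

lemma coAd_derivative:
  assumes z: "z \<in> \<A>" and \<phi>: "\<phi> \<in> \<D>" and y: "y \<in> \<A>"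
  shows "z (\<lambda>g. coAd G A g \<phi> y) = coad G A z \<phi> y"
proof -
  note zt = lie_algD[OF z]
  have s: "(\<lambda>g. Ad G (inv g) y (da l)) \<in> C" if "l < n" for l
    by (rule smooth_morphism_funs[OF inv_morphism[OF smooth_morphism_id] Ad_smooth[OF y da(1)[OF that]]])
  have t: "z (\<lambda>g. \<phi> (e l) * Ad G (inv g) y (da l)) = - (lie_bracket G z y (da l) * \<phi> (e l))" if "l < n" for l
    using inv_tangent[OF z Ad_smooth[OF y da(1)[OF that]]] Ad_derivative[OF z y da(1)[OF that]]
      tangent_cmult[OF zt s[OF that]] by simp
  have "z (\<lambda>g. coAd G A g \<phi> y) = z (\<lambda>g. \<Sum>l<n. \<phi> (e l) * Ad G (inv g) y (da l))"
    by (simp add: coAd_basis[OF \<phi> y] mult.commute)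
  also have "\<dots> = (\<Sum>l<n. z (\<lambda>g. \<phi> (e l) * Ad G (inv g) y (da l)))"
    by (rule tangent_sum[OF zt]) (auto intro: smooth_funs_cmult s)
  also have "\<dots> = - (\<Sum>l<n. lie_bracket G z y (da l) * \<phi> (e l))" by (simp add: t sum_negf)
  also have "\<dots> = coad G A z \<phi> y"
    using lie_dual_expand[OF \<phi> lie_bracket_in[OF z y]] y by (simp add: coad_def f_eq_da[OF lie_bracket_in[OF z y]])
  finally show ?thesis .
qed

lemma D_check_contract_in:
  assumes "\<phi> \<in> \<D>"
  shows "contract_fst \<phi> (D_check G A pb g) \<in> \<A>"
  unfolding D_check_eq contract_fst_tensor2[OF assms]
  by (intro subspace_sum[OF subspace_lie_alg] subspace_scale[OF subspace_lie_alg] e_in) simp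

text \<open>The bracket with y is moved onto \<psi> as a coadjoint action, so g enters only through
  the smooth coefficients \<pi>.\<close>

lemma D_check_pairing:
  assumes \<phi>: "\<phi> \<in> \<D>" and \<psi>: "\<psi> \<in> \<D>" and y: "y \<in> \<A>"
  shows "\<psi> (lie_bracket G (contract_fst \<phi> (D_check G A pb g)) y) =
    (\<Sum>i<n. \<Sum>j<n. \<pi> i j g * \<phi> (e i) * coad G A y \<psi> (e j))"
proof -
  let ?w = "contract_fst \<phi> (D_check G A pb g)"
  have w: "?w \<in> \<A>" by (rule D_check_contract_in[OF \<phi>])
  have "\<psi> (lie_bracket G ?w y) = coad G A y \<psi> ?w"
    using w y lie_dual_scale[OF \<psi> lie_bracket_in[OF y w], of "-1"] lie_bracket_anti[of ?w y] by (simp add: coad_def)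
  also have "\<dots> = (\<Sum>j<n. (\<Sum>i<n. \<pi> i j g * \<phi> (e i)) * coad G A y \<psi> (e j))"
    unfolding D_check_eq contract_fst_tensor2[OF \<phi>]
    by (rule lie_dual_sum[OF coad_in[OF y \<psi>]]) (auto simp: e_in)
  also have "\<dots> = (\<Sum>i<n. \<Sum>j<n. \<pi> i j g * \<phi> (e i) * coad G A y \<psi> (e j))"
    unfolding sum_distrib_right by (rule sum.swap)
  finally show ?thesis .
qed

text \<open>Multiplicativity of the bivector makes \<open>D_check\<close> a 1-cocycle of the group
  for the adjoint action on tensors; contracting with \<phi> transfers one of the two adjoint
  actions to \<phi>.\<close>

lemma D_check_mult:
  assumes \<phi>: "\<phi> \<in> \<D>"
  shows "contract_fst \<phi> (D_check G A pb (g \<otimes> h)) =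
    Ad G (inv h) (contract_fst (coAd G A h \<phi>) (D_check G A pb g)) + contract_fst \<phi> (D_check G A pb h)"
proof
  fix b
  let ?D = "D_check G A pb"
  let ?c = "\<lambda>a k. a (inv h \<otimes> k \<otimes> h) :: real"
  have cC: "?c a \<in> C \<longleftrightarrow> a \<in> C" for a
    using rtrans_smooth_iff[of "\<lambda>k. a (inv h \<otimes> k)" h] by (simp add: m_assoc)
  have D: "?D (g \<otimes> h) a b = ?D g (?c a) (?c b) + ?D h a b" for a
  proof (cases "a \<in> C \<and> b \<in> C")
    case True
    have s: "(\<lambda>x. w (inv h \<otimes> (inv g \<otimes> x))) \<in> C" if "w \<in> C" for w
      using ltrans_smooth_iff[of w "inv h \<otimes> inv g"] that by (simp add: m_assoc)
    have s': "(\<lambda>x. w (inv h \<otimes> (inv g \<otimes> (x \<otimes> h)))) \<in> C" if "w \<in> C" for w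
      using rtrans_smooth_iff[of "\<lambda>x. w (inv h \<otimes> (inv g \<otimes> x))" h] s[OF that] by simp
    have s'': "(\<lambda>x. w (inv h \<otimes> (x \<otimes> h))) \<in> C" if "w \<in> C" for w
      using cC[of w] that by (simp add: m_assoc)
    show ?thesis
      using True by (simp add: D_check_def push2_def o_def bivector_def pb_mult inv_mult_group m_assoc s s' s'')
  next
    case False
    then show ?thesis
      by (auto simp: D_check_def push2_def o_def bivector_def cC)
  qed
  have in_A: "(\<lambda>a. ?D k a x) \<in> \<A>" for k x
  proof -
    have "(\<lambda>a. ?D k a x) = (\<Sum>i<n. (\<Sum>j<n. \<pi> i j k * e j x) *\<^sub>R e i)"
      by (simp add: D_check_eq tensor2_def fun_eq_iff sum_fun_apply sum_distrib_left sum_distrib_right mult_ac)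
    also have "\<dots> \<in> \<A>"
      by (intro subspace_sum[OF subspace_lie_alg] subspace_scale[OF subspace_lie_alg] e_in) simp
    finally show ?thesis .
  qed
  have Ad_c: "(\<lambda>a. w (?c a)) = Ad G (inv h) w" for w :: "'g lie_vec"
    by (simp add: Ad_def)
  have "contract_fst \<phi> (?D (g \<otimes> h)) b = \<phi> (Ad G (inv h) (\<lambda>a. ?D g a (?c b)) + (\<lambda>a. ?D h a b))"
    by (simp add: contract_fst_def D Ad_def plus_fun_def)
  also have "\<dots> = \<phi> (Ad G (inv h) (\<lambda>a. ?D g a (?c b))) + \<phi> (\<lambda>a. ?D h a b)"
    by (rule lie_dual_add[OF \<phi> Ad_in[OF in_A] in_A])
  also have "\<phi> (Ad G (inv h) (\<lambda>a. ?D g a (?c b))) = coAd G A h \<phi> (\<lambda>a. ?D g a (?c b))"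
    using in_A by (simp add: coAd_def)
  finally show "contract_fst \<phi> (?D (g \<otimes> h)) b =
      (Ad G (inv h) (contract_fst (coAd G A h \<phi>) (?D g)) + contract_fst \<phi> (?D h)) b"
    by (simp add: contract_fst_def Ad_def)
qed

section \<open>The defect of bicovariance and its derivative at the identity\<close>

context
  fixes \<Xi> :: "'g lie_covec \<Rightarrow> 'g lie_covec \<Rightarrow> 'g lie_covec"
  assumes bilin: "bilin_on \<D> \<D> \<D> \<Xi>"
begin

text \<open>Left side minus right side of the bicovariance condition at y. The outer inverse
  coadjoint action has become \<open>Ad G g\<close> on y, and the sign in \<open>coad\<close> makes
  the last term positive.\<close>

definition defect :: "'g \<Rightarrow> 'g lie_covec \<Rightarrow> 'g lie_covec \<Rightarrow> 'g lie_vec \<Rightarrow> real" where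
  "defect g \<phi> \<psi> y = \<Xi> \<phi> \<psi> y - \<Xi> (coAd G A g \<phi>) (coAd G A g \<psi>) (Ad G g y) +
     \<psi> (lie_bracket G (contract_fst \<phi> (D_check G A pb g)) y)"

lemma defect_iff:
  assumes \<phi>: "\<phi> \<in> \<D>" and \<psi>: "\<psi> \<in> \<D>"
  shows "\<Xi> \<phi> \<psi> - coAd G A (inv g) (\<Xi> (coAd G A g \<phi>) (coAd G A g \<psi>)) =
      coad G A (contract_fst \<phi> (D_check G A pb g)) \<psi> \<longleftrightarrow> (\<forall>y\<in>\<A>. defect g \<phi> \<psi> y = 0)"
proof -
  note in\<Xi> = \<Xi>_in[OF bilin]
  have "(\<Xi> \<phi> \<psi> - coAd G A (inv g) (\<Xi> (coAd G A g \<phi>) (coAd G A g \<psi>))) y -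
      coad G A (contract_fst \<phi> (D_check G A pb g)) \<psi> y = (if y \<in> \<A> then defect g \<phi> \<psi> y else 0)" for y
    using lie_dual_outside[OF in\<Xi>[OF \<phi> \<psi>]] by (simp add: defect_def coAd_def coad_def)
  note D = this
  show ?thesis
  proof
    assume eq: "\<Xi> \<phi> \<psi> - coAd G A (inv g) (\<Xi> (coAd G A g \<phi>) (coAd G A g \<psi>)) =
      coad G A (contract_fst \<phi> (D_check G A pb g)) \<psi>"
    show "\<forall>y\<in>\<A>. defect g \<phi> \<psi> y = 0"
      using D unfolding eq by (metis diff_self)
  next
    assume z: "\<forall>y\<in>\<A>. defect g \<phi> \<psi> y = 0"
    show "\<Xi> \<phi> \<psi> - coAd G A (inv g) (\<Xi> (coAd G A g \<phi>) (coAd G A g \<psi>)) =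
      coad G A (contract_fst \<phi> (D_check G A pb g)) \<psi>"
    proof
      fix y
      show "(\<Xi> \<phi> \<psi> - coAd G A (inv g) (\<Xi> (coAd G A g \<phi>) (coAd G A g \<psi>))) y =
        coad G A (contract_fst \<phi> (D_check G A pb g)) \<psi> y"
        using D[of y] z by (cases "y \<in> \<A>") simp_all
    qed
  qed
qed

lemma defect_one:
  assumes "\<phi> \<in> \<D>" "\<psi> \<in> \<D>" "y \<in> \<A>"
  shows "defect \<one> \<phi> \<psi> y = 0"
proof -
  have "\<psi> (lie_bracket G (contract_fst \<phi> (D_check G A pb \<one>)) y) = 0"
    unfolding D_check_pairing[OF assms] by (intro sum.neutral ballI) (simp add: \<pi>_one)
  then show ?thesis by (simp add: defect_def coAd_one assms Ad_one)
qed

text \<open>The part with \<Xi> telescopes, being the difference between \<Xi> and its transform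
  under the group, and the last part inherits the cocycle rule \<open>D_check_mult\<close>, since
  \<open>Ad\<close> respects Lie brackets.\<close>

lemma defect_mult:
  assumes \<phi>: "\<phi> \<in> \<D>" and \<psi>: "\<psi> \<in> \<D>" and y: "y \<in> \<A>"
  shows "defect (g \<otimes> h) \<phi> \<psi> y = defect h \<phi> \<psi> y + defect g (coAd G A h \<phi>) (coAd G A h \<psi>) (Ad G h y)"
proof -
  let ?v = "contract_fst (coAd G A h \<phi>) (D_check G A pb g)"
  let ?w = "contract_fst \<phi> (D_check G A pb h)"
  have v: "?v \<in> \<A>" by (rule D_check_contract_in[OF coAd_in[OF \<phi>]])
  have w: "?w \<in> \<A>" by (rule D_check_contract_in[OF \<phi>])
  have "\<psi> (lie_bracket G (contract_fst \<phi> (D_check G A pb (g \<otimes> h))) y) =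
      \<psi> (lie_bracket G (Ad G (inv h) ?v) y) + \<psi> (lie_bracket G ?w y)"
    unfolding D_check_mult[OF \<phi>] lie_bracket_add_fst[OF Ad_in[OF v] w y]
    by (rule lie_dual_add[OF \<psi> lie_bracket_in[OF Ad_in[OF v] y] lie_bracket_in[OF w y]])
  also have "\<psi> (lie_bracket G (Ad G (inv h) ?v) y) = coAd G A h \<psi> (lie_bracket G ?v (Ad G h y))"
    using lie_bracket_in[OF v Ad_in[OF y]] by (simp add: coAd_def Ad_bracket Ad_inv_cancel)
  finally show ?thesis by (simp add: defect_def coAd_mult Ad_mult)
qed

definition inf_defect :: "'g lie_covec \<Rightarrow> 'g lie_covec \<Rightarrow> 'g lie_vec \<Rightarrow> 'g lie_vec \<Rightarrow> real" where
  "inf_defect \<phi> \<psi> y z = dual_bracket G A pb \<phi> (coad G A y \<psi>) z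
     - (\<Xi> \<phi> \<psi> (lie_bracket G z y) + \<Xi> (coad G A z \<phi>) \<psi> y + \<Xi> \<phi> (coad G A z \<psi>) y)"

text \<open>Expansion in the bases leaves g only inside \<pi>, the coordinates of the coadjoint
  action and the coordinates of \<open>Ad G g y\<close>. All have known derivatives at the identity,
  and the Leibniz rule for the triple products gives one term for each argument of \<Xi>.\<close>

lemma defect_smooth_derivative:
  assumes \<phi>: "\<phi> \<in> \<D>" and \<psi>: "\<psi> \<in> \<D>" and y: "y \<in> \<A>"
  shows defect_smooth: "(\<lambda>g. defect g \<phi> \<psi> y) \<in> C"
    and defect_derivative: "z \<in> \<A> \<Longrightarrow> z (\<lambda>g. defect g \<phi> \<psi> y) = inf_defect \<phi> \<psi> y z"
proof -
  note in\<Xi> = \<Xi>_in[OF bilin] and ex = \<Xi>_expand[OF bilin]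
  define X where "X i j k = \<Xi> (f i) (f j) (e k)" for i j k
  let ?P = "\<lambda>i g. coAd G A g \<phi> (e i)" and ?Q = "\<lambda>j g. coAd G A g \<psi> (e j)" and ?R = "\<lambda>k g. Ad G g y (da k)"
  have tri: "\<Xi> \<phi>' \<psi>' y' = (\<Sum>k<n. \<Sum>i<n. \<Sum>j<n. X i j k * (\<phi>' (e i) * \<psi>' (e j) * y' (da k)))"
    if "\<phi>' \<in> \<D>" "\<psi>' \<in> \<D>" "y' \<in> \<A>" for \<phi>' \<psi>' y'
    unfolding lie_dual_expand[OF in\<Xi>[OF that(1,2)] that(3)] ex[OF that(1,2), of "e _"] X_def
    by (simp add: sum_distrib_left f_eq_da[OF that(3)] mult_ac)
  have sP: "?P i \<in> C" "?Q i \<in> C" "?R i \<in> C" if "i < n" for i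
    using that by (simp_all add: coAd_smooth \<phi> \<psi> y e_in Ad_smooth da)
  let ?T = "\<lambda>k i j g. X i j k * (?P i g * ?Q j g * ?R k g)"
  have sT: "?T k i j \<in> C" if "k < n" "i < n" "j < n" for k i j
    using that by (intro smooth_funs_cmult smooth_funs_mult sP)
  let ?W = "\<lambda>i j g. \<pi> i j g * (\<phi> (e i) * coad G A y \<psi> (e j))"
  have sW: "?W i j \<in> C" if "i < n" "j < n" for i j
    using that by (intro smooth_funs_mult smooth_funs_const \<pi>_smooth)
  have def: "(\<lambda>g. defect g \<phi> \<psi> y) = (\<lambda>g. (\<Xi> \<phi> \<psi> y - (\<Sum>k<n. \<Sum>i<n. \<Sum>j<n. ?T k i j g)) + (\<Sum>i<n. \<Sum>j<n. ?W i j g))"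
    unfolding defect_def tri[OF coAd_in[OF \<phi>] coAd_in[OF \<psi>] Ad_in[OF y]] D_check_pairing[OF assms]
    by (simp only: mult.assoc)
  have S1: "(\<lambda>g. \<Sum>k<n. \<Sum>i<n. \<Sum>j<n. ?T k i j g) \<in> C" by (intro smooth_funs_sum sT) auto
  have S2: "(\<lambda>g. \<Sum>i<n. \<Sum>j<n. ?W i j g) \<in> C" by (intro smooth_funs_sum sW) auto
  show "(\<lambda>g. defect g \<phi> \<psi> y) \<in> C"
    unfolding def by (intro smooth_funs_add smooth_funs_diff smooth_funs_const S1 S2)
  show "z (\<lambda>g. defect g \<phi> \<psi> y) = inf_defect \<phi> \<psi> y z" if z: "z \<in> \<A>"
  proof -
    note zt = lie_algD[OF z]
    have "z (\<lambda>g. defect g \<phi> \<psi> y) = - z (\<lambda>g. \<Sum>k<n. \<Sum>i<n. \<Sum>j<n. ?T k i j g) + z (\<lambda>g. \<Sum>i<n. \<Sum>j<n. ?W i j g)"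
      unfolding def tangent_add[OF zt smooth_funs_diff[OF smooth_funs_const S1] S2] tangent_diff[OF zt smooth_funs_const S1]
        tangent_const[OF zt] by simp
    also have "z (\<lambda>g. \<Sum>i<n. \<Sum>j<n. ?W i j g) = dual_bracket G A pb \<phi> (coad G A y \<psi>) z"
    proof -
      have "z (?W i j) = z (\<pi> i j) * \<phi> (e i) * coad G A y \<psi> (e j)" if "i < n" "j < n" for i j
        using tangent_mult[OF zt \<pi>_smooth[OF that] smooth_funs_const] tangent_const[OF zt] by simp
      then show ?thesis
        unfolding dual_bracket_eq[OF \<phi> coad_in[OF y \<psi>] z]
        by (subst tangent_sum2[OF zt]) (simp_all add: sW)
    qed
    also have "z (\<lambda>g. \<Sum>k<n. \<Sum>i<n. \<Sum>j<n. ?T k i j g) =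
        \<Xi> \<phi> \<psi> (lie_bracket G z y) + \<Xi> (coad G A z \<phi>) \<psi> y + \<Xi> \<phi> (coad G A z \<psi>) y"
    proof -
      have t: "z (?T k i j) = X i j k * (\<phi> (e i) * \<psi> (e j) * lie_bracket G z y (da k)) +
          X i j k * (coad G A z \<phi> (e i) * \<psi> (e j) * y (da k)) + X i j k * (\<phi> (e i) * coad G A z \<psi> (e j) * y (da k))"
        if lt: "k < n" "i < n" "j < n" for k i j
      proof -
        have "z (?T k i j) = X i j k * z (\<lambda>g. ?P i g * ?Q j g * ?R k g)"
          by (rule tangent_cmult[OF zt]) (intro smooth_funs_mult sP lt)
        also have "z (\<lambda>g. ?P i g * ?Q j g * ?R k g) = z (\<lambda>g. ?P i g * ?Q j g) * ?R k \<one> + (?P i \<one> * ?Q j \<one>) * z (?R k)"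
          by (rule tangent_mult[OF zt]) (intro smooth_funs_mult sP lt)+
        also have "z (\<lambda>g. ?P i g * ?Q j g) = z (?P i) * ?Q j \<one> + ?P i \<one> * z (?Q j)"
          by (rule tangent_mult[OF zt]) (intro sP lt)+
        also have "z (?R k) = lie_bracket G z y (da k)" by (rule Ad_derivative[OF z y da(1)[OF lt(1)]])
        also have "z (?P i) = coad G A z \<phi> (e i)" by (rule coAd_derivative[OF z \<phi> e_in[OF lt(2)]])
        also have "z (?Q j) = coad G A z \<psi> (e j)" by (rule coAd_derivative[OF z \<psi> e_in[OF lt(3)]])
        finally show ?thesis by (simp add: coAd_one \<phi> \<psi> Ad_one algebra_simps)
      qed
      have "z (\<lambda>g. \<Sum>k<n. \<Sum>i<n. \<Sum>j<n. ?T k i j g) = (\<Sum>k<n. z (\<lambda>g. \<Sum>i<n. \<Sum>j<n. ?T k i j g))"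
        by (rule tangent_sum[OF zt]) (intro smooth_funs_sum sT, auto)
      also have "\<dots> = (\<Sum>k<n. \<Sum>i<n. \<Sum>j<n. z (?T k i j))"
        by (intro sum.cong refl tangent_sum2[OF zt] sT) auto
      also have "\<dots> = \<Xi> \<phi> \<psi> (lie_bracket G z y) + \<Xi> (coad G A z \<phi>) \<psi> y + \<Xi> \<phi> (coad G A z \<psi>) y"
        unfolding tri[OF \<phi> \<psi> lie_bracket_in[OF z y]] tri[OF coad_in[OF z \<phi>] \<psi> y] tri[OF \<phi> coad_in[OF z \<psi>] y]
          sum.distrib[symmetric]
        by (intro sum.cong refl t) auto
      finally show ?thesis .
    qed
    finally show ?thesis by (simp add: inf_defect_def)
  qed
qed

lemma defect_vanishes_iff:
  assumes conn: "connected (UNIV :: 'g set)"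
  shows "(\<forall>g. \<forall>\<phi>\<in>\<D>. \<forall>\<psi>\<in>\<D>. \<forall>y\<in>\<A>. defect g \<phi> \<psi> y = 0) \<longleftrightarrow>
    (\<forall>\<phi>\<in>\<D>. \<forall>\<psi>\<in>\<D>. \<forall>y\<in>\<A>. \<forall>z\<in>\<A>. inf_defect \<phi> \<psi> y z = 0)"
proof
  assume H: "\<forall>g. \<forall>\<phi>\<in>\<D>. \<forall>\<psi>\<in>\<D>. \<forall>y\<in>\<A>. defect g \<phi> \<psi> y = 0"
  show "\<forall>\<phi>\<in>\<D>. \<forall>\<psi>\<in>\<D>. \<forall>y\<in>\<A>. \<forall>z\<in>\<A>. inf_defect \<phi> \<psi> y z = 0"
  proof (intro ballI)
    fix \<phi> \<psi> y z assume d: "\<phi> \<in> \<D>" "\<psi> \<in> \<D>" "y \<in> \<A>" "z \<in> \<A>"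
    then have "(\<lambda>g. defect g \<phi> \<psi> y) = (\<lambda>g. 0)" using H by blast
    then show "inf_defect \<phi> \<psi> y z = 0"
      using defect_derivative[OF d] tangent_const[OF lie_algD[OF d(4)], of 0] by simp
  qed
next
  assume I: "\<forall>\<phi>\<in>\<D>. \<forall>\<psi>\<in>\<D>. \<forall>y\<in>\<A>. \<forall>z\<in>\<A>. inf_defect \<phi> \<psi> y z = 0"
  show "\<forall>g. \<forall>\<phi>\<in>\<D>. \<forall>\<psi>\<in>\<D>. \<forall>y\<in>\<A>. defect g \<phi> \<psi> y = 0"
  proof (intro allI ballI)
    fix g \<phi> \<psi> y assume d: "\<phi> \<in> \<D>" "\<psi> \<in> \<D>" "y \<in> \<A>"
    let ?u = "\<lambda>g. defect g \<phi> \<psi> y"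
    have "v ?u = 0" if v: "v \<in> tangent_space A h" for h v
    proof -
      have "(\<lambda>k. a (k \<otimes> inv h)) \<in> C \<Longrightarrow> a \<in> C" for a by simp
      from tangent_push[OF rtrans_morphism[of "inv h"] this v]
      have z: "(\<lambda>a. v (\<lambda>k. a (k \<otimes> inv h))) \<in> \<A>" (is "?z \<in> _") by (simp add: lie_alg_def)
      have d': "coAd G A h \<phi> \<in> \<D>" "coAd G A h \<psi> \<in> \<D>" "Ad G h y \<in> \<A>" by (simp_all add: coAd_in Ad_in d)
      \<comment> \<open>Right translation carries v to the identity. By \<open>defect_mult\<close>
        the translated function is a constant plus a defect with arguments transported by h, whose
        derivative at the identity is again an \<open>inf_defect\<close>.\<close>
      have "v ?u = ?z (\<lambda>k. ?u (k \<otimes> h))" by (simp add: m_assoc)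
      also have "\<dots> = ?z (\<lambda>k. ?u h + defect k (coAd G A h \<phi>) (coAd G A h \<psi>) (Ad G h y))"
        by (simp only: defect_mult[OF d])
      also have "\<dots> = ?z (\<lambda>k. ?u h) + ?z (\<lambda>k. defect k (coAd G A h \<phi>) (coAd G A h \<psi>) (Ad G h y))"
        by (rule tangent_add[OF lie_algD[OF z] smooth_funs_const defect_smooth[OF d']])
      also have "\<dots> = 0"
        unfolding tangent_const[OF lie_algD[OF z]] defect_derivative[OF d' z] using I d' z by simp
      finally show ?thesis .
    qed
    then have "?u g = ?u \<one>" by (rule tangent_zero_imp_constant[OF atlas defect_smooth[OF d] conn])
    then show "?u g = 0" using defect_one[OF d] by simp
  qed
qed

text \<open>The slices of a dual cobracket are coadjoint images up to sign, so at (y, z) the two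
  sides become values of \<Xi> on coadjoint images. The commutator rule rewrites the dual bracket in
  \<open>inf_defect\<close> into the two remaining terms.\<close>

lemma bicovariance_identity_iff:
  assumes comm: "\<And>\<phi> \<psi>. \<phi> \<in> \<D> \<Longrightarrow> \<psi> \<in> \<D> \<Longrightarrow> \<Xi> \<phi> \<psi> - \<Xi> \<psi> \<phi> = dual_bracket G A pb \<phi> \<psi>"
    and \<phi>: "\<phi> \<in> \<D>" and \<psi>: "\<psi> \<in> \<D>"
  shows "dual_cobracket G A (\<Xi> \<phi> \<psi>) - map_fst (\<Xi> \<phi>) (dual_cobracket G A \<psi>) - map_snd (\<Xi> \<phi>) (dual_cobracket G A \<psi>)
      = map_fst (\<lambda>\<zeta>. \<Xi> \<zeta> \<psi>) (dual_cobracket G A \<phi>) - map_snd (\<lambda>\<zeta>. \<Xi> \<zeta> \<phi>) (dual_cobracket G A \<psi>)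
    \<longleftrightarrow> (\<forall>y\<in>\<A>. \<forall>z\<in>\<A>. inf_defect \<phi> \<psi> y z = 0)" (is "?lhs = ?rhs \<longleftrightarrow> _")
proof -
  note in\<Xi> = \<Xi>_in[OF bilin]
  have neg: "(-1) *\<^sub>R \<zeta> \<in> \<D>" if "\<zeta> \<in> \<D>" for \<zeta> by (rule subspace_scale[OF subspace_lie_dual that])
  have d_snd: "(\<lambda>w. dual_cobracket G A \<psi>' w z) = coad G A z \<psi>'" if "\<psi>' \<in> \<D>" "z \<in> \<A>" for \<psi>' z
  proof
    fix w
    show "dual_cobracket G A \<psi>' w z = coad G A z \<psi>' w"
    proof (cases "w \<in> \<A>")
      case True
      then show ?thesis
        using that lie_dual_scale[OF that(1) lie_bracket_in[OF that(2) True], of "-1"] lie_bracket_anti[of w z]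
        by (simp add: dual_cobracket_def coad_def)
    qed (simp add: dual_cobracket_def coad_def)
  qed
  have d_fst: "(\<lambda>w. dual_cobracket G A \<psi>' y w) = (-1) *\<^sub>R coad G A y \<psi>'" if "y \<in> \<A>" for \<psi>' y
    using that by (auto simp: dual_cobracket_def coad_def fun_eq_iff)
  have \<Xi>_neg: "\<Xi> ((-1) *\<^sub>R \<zeta>) \<eta> = (-1) *\<^sub>R \<Xi> \<zeta> \<eta>" "\<Xi> \<eta> ((-1) *\<^sub>R \<zeta>) = (-1) *\<^sub>R \<Xi> \<eta> \<zeta>" if "\<zeta> \<in> \<D>" "\<eta> \<in> \<D>" for \<zeta> \<eta>
    using \<Xi>_lin[OF bilin] that unfolding lin_on_def by blast+
  have in_case: "?lhs y z - ?rhs y z = inf_defect \<phi> \<psi> y z" if y: "y \<in> \<A>" and z: "z \<in> \<A>" for y z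
  proof -
    note c = coad_in[OF y \<psi>]
    have br: "dual_bracket G A pb \<phi> (coad G A y \<psi>) z = \<Xi> \<phi> (coad G A y \<psi>) z - \<Xi> (coad G A y \<psi>) \<phi> z"
      using comm[OF \<phi> c] by (metis fun_diff_def)
    have "\<Xi> \<phi> \<psi> (lie_bracket G y z) = - \<Xi> \<phi> \<psi> (lie_bracket G z y)"
      using lie_dual_scale[OF in\<Xi>[OF \<phi> \<psi>] lie_bracket_in[OF z y], of "-1"] lie_bracket_anti[of y z] by simp
    then show ?thesis
      unfolding inf_defect_def br fun_diff_def map_fst_def map_snd_def d_snd[OF \<psi> z] d_snd[OF \<phi> z] d_fst[OF y] \<Xi>_neg[OF c \<phi>]
      by (simp add: dual_cobracket_def y z) (simp add: coad_def z)
  qed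
  have zero: "\<Xi> \<zeta> 0 = 0" "\<Xi> 0 \<zeta> = 0" if "\<zeta> \<in> \<D>" for \<zeta>
  proof -
    have "\<Xi> \<zeta> (0 *\<^sub>R \<zeta>) = 0 *\<^sub>R \<Xi> \<zeta> \<zeta>" "\<Xi> (0 *\<^sub>R \<zeta>) \<zeta> = 0 *\<^sub>R \<Xi> \<zeta> \<zeta>"
      using \<Xi>_lin[OF bilin] that unfolding lin_on_def by blast+
    then show "\<Xi> \<zeta> 0 = 0" "\<Xi> 0 \<zeta> = 0" by (simp_all only: scaleR_zero_left)
  qed
  \<comment> \<open>Off the Lie algebra a slice of a cobracket is either 0, where bilinearity gives
    0, or a covector, whose image under \<Xi> is again a covector and vanishes at the outside
    argument. So equality of the two sides as HOL functions is decided on the Lie algebra.\<close>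
  have out_case: "?lhs y z = 0 \<and> ?rhs y z = 0" if yz: "\<not> (y \<in> \<A> \<and> z \<in> \<A>)" for y z
  proof -
    have m1: "\<Xi> \<zeta> (\<lambda>w. dual_cobracket G A \<psi>' w z) y = 0" "\<Xi> (\<lambda>w. dual_cobracket G A \<psi>' w z) \<zeta> y = 0"
      if "\<zeta> \<in> \<D>" "\<psi>' \<in> \<D>" for \<zeta> \<psi>'
    proof -
      consider "z \<notin> \<A>" | "z \<in> \<A>" "y \<notin> \<A>" using yz by blast
      then have "\<Xi> \<zeta> (\<lambda>w. dual_cobracket G A \<psi>' w z) y = 0 \<and> \<Xi> (\<lambda>w. dual_cobracket G A \<psi>' w z) \<zeta> y = 0"
      proof cases
        case 1
        then have "(\<lambda>w. dual_cobracket G A \<psi>' w z) = 0" by (simp add: dual_cobracket_def fun_eq_iff)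
        then show ?thesis using zero[OF that(1)] by simp
      next
        case 2
        then show ?thesis unfolding d_snd[OF that(2) 2(1)]
          using lie_dual_outside[OF in\<Xi>] that coad_in[OF 2(1) that(2)] by simp
      qed
      then show "\<Xi> \<zeta> (\<lambda>w. dual_cobracket G A \<psi>' w z) y = 0" "\<Xi> (\<lambda>w. dual_cobracket G A \<psi>' w z) \<zeta> y = 0" by auto
    qed
    have m2: "\<Xi> \<zeta> (\<lambda>w. dual_cobracket G A \<psi>' y w) z = 0" "\<Xi> (\<lambda>w. dual_cobracket G A \<psi>' y w) \<zeta> z = 0"
      if "\<zeta> \<in> \<D>" "\<psi>' \<in> \<D>" for \<zeta> \<psi>'
    proof -
      consider "y \<notin> \<A>" | "y \<in> \<A>" "z \<notin> \<A>" using yz by blast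
      then have "\<Xi> \<zeta> (\<lambda>w. dual_cobracket G A \<psi>' y w) z = 0 \<and> \<Xi> (\<lambda>w. dual_cobracket G A \<psi>' y w) \<zeta> z = 0"
      proof cases
        case 1
        then have "dual_cobracket G A \<psi>' y = 0" by (simp add: dual_cobracket_def fun_eq_iff)
        moreover have "\<Xi> \<zeta> 0 z = 0" "\<Xi> 0 \<zeta> z = 0" by (simp_all add: zero[OF that(1)])
        ultimately show ?thesis by metis
      next
        case 2
        then show ?thesis unfolding d_fst[OF 2(1)]
          by (intro conjI lie_dual_outside[OF in\<Xi>] that neg[OF coad_in[OF 2(1) that(2)]] 2(2))
      qed
      then show "\<Xi> \<zeta> (\<lambda>w. dual_cobracket G A \<psi>' y w) z = 0" "\<Xi> (\<lambda>w. dual_cobracket G A \<psi>' y w) \<zeta> z = 0" by auto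
    qed
    have "dual_cobracket G A (\<Xi> \<phi> \<psi>) y z = 0" using yz by (auto simp: dual_cobracket_def)
    then show ?thesis by (simp add: map_fst_def map_snd_def m1 m2 \<phi> \<psi>)
  qed
  show ?thesis
  proof
    assume "?lhs = ?rhs"
    then have "?lhs y z - ?rhs y z = 0" for y z by simp
    then show "\<forall>y\<in>\<A>. \<forall>z\<in>\<A>. inf_defect \<phi> \<psi> y z = 0" using in_case by metis
  next
    assume I: "\<forall>y\<in>\<A>. \<forall>z\<in>\<A>. inf_defect \<phi> \<psi> y z = 0"
    show "?lhs = ?rhs"
    proof (intro ext)
      fix y z
      show "?lhs y z = ?rhs y z"
      proof (cases "y \<in> \<A> \<and> z \<in> \<A>")
        case True
        then show ?thesis using in_case[of y z] I by simp
      next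
        case False
        then show ?thesis using out_case[OF False] by simp
      qed
    qed
  qed
qed

end

text \<open>Evaluating the preconnection on \<open>da i\<close> and \<omega> j at the identity
  returns the coefficient of \<Xi> plus a bracket term that is the same for every \<Xi>. Bilinearity
  extends equality from the basis to all covectors.\<close>

lemma is_gamma_unique:
  assumes "is_gamma G A pb n e f \<gamma> \<Xi>" "is_gamma G A pb n e f \<gamma> \<Xi>'" "\<phi> \<in> \<D>" "\<psi> \<in> \<D>"
  shows "\<Xi>' \<phi> \<psi> = \<Xi> \<phi> \<psi>"
proof -
  have b: "bilin_on \<D> \<D> \<D> \<Xi>" "bilin_on \<D> \<D> \<D> \<Xi>'" using assms unfolding is_gamma_def by blast+
  have val: "gcoef \<Xi>'' (da i) (\<omega> j) k \<one> = pb (da i) (\<omega> j (L (e k))) \<one> + \<Xi>'' (f i) (f j) (e k)"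
    if lt: "i < n" "j < n" "k < n" for \<Xi>'' i j k
  proof -
    have "(\<Sum>a<n. \<Sum>b<n. \<Xi>'' (f a) (f b) (e k) * (L (e a) (da i) \<one> * \<omega> j (L (e b)) \<one>)) =
      (\<Sum>a<n. \<Sum>b<n. \<Xi>'' (f a) (f b) (e k) * ((if a = i then 1 else 0) * (if b = j then 1 else 0)))"
      using lt by (intro sum.cong refl) (simp add: left_inv_field_one da \<omega>_L eq_commute[of j])
    also have "\<dots> = \<Xi>'' (f i) (f j) (e k)"
      by (simp only: sum_delta_mult[OF lt(2)] sum_delta_mult[OF lt(1)])
    finally show ?thesis by (simp add: gcoef_apply)
  qed
  have eq: "\<Xi>' (f i) (f j) (e k) = \<Xi> (f i) (f j) (e k)" if lt: "i < n" "j < n" "k < n" for i j k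
  proof -
    have "\<Gamma> \<Xi>' (da i) (\<omega> j) = \<Gamma> \<Xi> (da i) (\<omega> j)"
      using assms(1,2) da(1)[OF lt(1)] \<omega>_form[OF lt(2)] unfolding is_gamma_def by metis
    then have "gcoef \<Xi>' (da i) (\<omega> j) k \<one> = gcoef \<Xi> (da i) (\<omega> j) k \<one>"
      using gamma_L[OF lt(3)] by metis
    then show ?thesis by (simp add: val[OF lt])
  qed
  show ?thesis
    by (rule lie_dual_eqI[OF \<Xi>_in[OF b(2) assms(3,4)] \<Xi>_in[OF b(1) assms(3,4)]])
      (simp add: \<Xi>_expand[OF b(1) assms(3,4)] \<Xi>_expand[OF b(2) assms(3,4)] eq)
qed

text \<open>Bicovariance binds \<Xi> existentially; uniqueness on the dual, which the coadjoint
  action preserves, makes every representing \<Xi> satisfy the same condition.\<close>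

lemma bicovariant_iff:
  assumes "is_gamma G A pb n e f \<gamma> \<Xi>"
  shows "bicovariant G A pb n e f \<gamma> \<longleftrightarrow> (\<forall>g. \<forall>\<phi>\<in>\<D>. \<forall>\<psi>\<in>\<D>.
    \<Xi> \<phi> \<psi> - coAd G A (inv g) (\<Xi> (coAd G A g \<phi>) (coAd G A g \<psi>)) = coad G A (contract_fst \<phi> (D_check G A pb g)) \<psi>)"
proof -
  have "(\<forall>g. \<forall>\<phi>\<in>\<D>. \<forall>\<psi>\<in>\<D>. \<Xi>' \<phi> \<psi> - coAd G A (inv g) (\<Xi>' (coAd G A g \<phi>) (coAd G A g \<psi>)) =
      coad G A (contract_fst \<phi> (D_check G A pb g)) \<psi>) \<longleftrightarrow>
    (\<forall>g. \<forall>\<phi>\<in>\<D>. \<forall>\<psi>\<in>\<D>. \<Xi> \<phi> \<psi> - coAd G A (inv g) (\<Xi> (coAd G A g \<phi>) (coAd G A g \<psi>)) =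
      coad G A (contract_fst \<phi> (D_check G A pb g)) \<psi>)" if "is_gamma G A pb n e f \<gamma> \<Xi>'" for \<Xi>'
    by (simp add: is_gamma_unique[OF assms that] coAd_in)
  then show ?thesis unfolding bicovariant_def using assms by blast
qed

text \<open>The two maps agree only on smooth functions and 1-forms. All three properties stay
  within these sets, which is why the closure lemmas for forms are called.\<close>

lemma is_gamma_transfer:
  assumes "is_gamma G A pb n e f \<gamma> \<Xi>"
  shows "preconnection A pb \<gamma>" and "poisson_compatible A pb \<gamma> \<longleftrightarrow> poisson_compatible A pb (\<Gamma> \<Xi>)"
    and "flat_preconnection A pb \<gamma> \<longleftrightarrow> flat_preconnection A pb (\<Gamma> \<Xi>)"
proof -
  have g: "\<gamma> a \<tau> = \<Gamma> \<Xi> a \<tau>" if "a \<in> C" "\<tau> \<in> \<Omega>" for a \<tau>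
    using assms that unfolding is_gamma_def by blast
  show "preconnection A pb \<gamma>"
    using gamma_preconnection[of \<Xi>] unfolding preconnection_def bilin_on_def lin_on_def
    by (simp add: g smooth_funs_fun_ops one_forms_add one_forms_scaleR one_forms_form_scale)
  show "poisson_compatible A pb \<gamma> \<longleftrightarrow> poisson_compatible A pb (\<Gamma> \<Xi>)"
    unfolding poisson_compatible_def by (simp add: g ext_d_one_form)
  show "flat_preconnection A pb \<gamma> \<longleftrightarrow> flat_preconnection A pb (\<Gamma> \<Xi>)"
    unfolding flat_preconnection_def by (simp add: g gamma_form pb_smooth)
qed

end

theorem corollary4p2:
  fixes G :: "('g::{t2_space, second_countable_topology}, 'b) monoid_scheme"
    and A :: "('g, 'e::real_inner) chart set"
    and pb :: "'g bracket"
    and n :: nat and e :: "nat \<Rightarrow> 'g lie_vec" and f :: "nat \<Rightarrow> 'g lie_covec"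
  assumes "poisson_lie_group G A pb"
    and "connected (UNIV :: 'g set)"
    and "simply_connected (UNIV :: 'g set)"
    and "dual_bases G A n e f"
  shows
    "((\<exists>\<gamma>. preconnection A pb \<gamma> \<and> left_covariant G A pb n e f \<gamma> \<and>
           poisson_compatible A pb \<gamma> \<and> flat_preconnection A pb \<gamma>) \<longleftrightarrow>
      (\<exists>\<Xi>. left_pre_lie (lie_dual G A) (dual_bracket G A pb) \<Xi>)) \<and>
     (\<forall>\<gamma> \<Xi>. is_gamma G A pb n e f \<gamma> \<Xi> \<longrightarrow>
        (preconnection A pb \<gamma> \<and> poisson_compatible A pb \<gamma> \<and> flat_preconnection A pb \<gamma> \<longleftrightarrow>
         left_pre_lie (lie_dual G A) (dual_bracket G A pb) \<Xi>)) \<and>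
     (\<forall>\<gamma> \<Xi>. is_gamma G A pb n e f \<gamma> \<Xi> \<longrightarrow>
        preconnection A pb \<gamma> \<and> poisson_compatible A pb \<gamma> \<and> flat_preconnection A pb \<gamma> \<longrightarrow>
        (bicovariant G A pb n e f \<gamma> \<longleftrightarrow>
         (\<forall>\<phi>\<in>lie_dual G A. \<forall>\<psi>\<in>lie_dual G A.
            dual_cobracket G A (\<Xi> \<phi> \<psi>)
              - map_fst (\<Xi> \<phi>) (dual_cobracket G A \<psi>)
              - map_snd (\<Xi> \<phi>) (dual_cobracket G A \<psi>)
            = map_fst (\<lambda>\<zeta>. \<Xi> \<zeta> \<psi>) (dual_cobracket G A \<phi>)
              - map_snd (\<lambda>\<zeta>. \<Xi> \<zeta> \<phi>) (dual_cobracket G A \<psi>))))"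
proof -
  interpret poisson_lie_group G A pb by (rule assms(1))
  interpret poisson_lie_frame G A pb n e f by unfold_locales (rule assms(4))
  have bilin: "bilin_on \<D> \<D> \<D> \<Xi>" if "is_gamma G A pb n e f \<gamma> \<Xi>" for \<gamma> \<Xi>
    using that unfolding is_gamma_def by blast
  have main: "(preconnection A pb \<gamma> \<and> poisson_compatible A pb \<gamma> \<and> flat_preconnection A pb \<gamma>) \<longleftrightarrow>
      left_pre_lie \<D> (dual_bracket G A pb) \<Xi>" if "is_gamma G A pb n e f \<gamma> \<Xi>" for \<gamma> \<Xi>
    unfolding pre_lie_iff[OF bilin[OF that]] is_gamma_transfer(2,3)[OF that]
    using is_gamma_transfer(1)[OF that] by blast
  have bicov: "bicovariant G A pb n e f \<gamma> \<longleftrightarrow> (\<forall>\<phi>\<in>\<D>. \<forall>\<psi>\<in>\<D>.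
        dual_cobracket G A (\<Xi> \<phi> \<psi>) - map_fst (\<Xi> \<phi>) (dual_cobracket G A \<psi>) - map_snd (\<Xi> \<phi>) (dual_cobracket G A \<psi>)
        = map_fst (\<lambda>\<zeta>. \<Xi> \<zeta> \<psi>) (dual_cobracket G A \<phi>) - map_snd (\<lambda>\<zeta>. \<Xi> \<zeta> \<phi>) (dual_cobracket G A \<psi>))"
    if g: "is_gamma G A pb n e f \<gamma> \<Xi>"
      and flat: "preconnection A pb \<gamma> \<and> poisson_compatible A pb \<gamma> \<and> flat_preconnection A pb \<gamma>" for \<gamma> \<Xi>
  proof -
    note b = bilin[OF g]
    \<comment> \<open>Compatibility and flatness enter the bicovariance criterion only through the
      commutator half of the pre-Lie structure.\<close>
    have comm: "\<Xi> \<phi> \<psi> - \<Xi> \<psi> \<phi> = dual_bracket G A pb \<phi> \<psi>" if "\<phi> \<in> \<D>" "\<psi> \<in> \<D>" for \<phi> \<psi>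
      using main[OF g] flat that unfolding left_pre_lie_def by blast
    have "bicovariant G A pb n e f \<gamma> \<longleftrightarrow> (\<forall>g. \<forall>\<phi>\<in>\<D>. \<forall>\<psi>\<in>\<D>. \<forall>y\<in>\<A>. defect \<Xi> g \<phi> \<psi> y = 0)"
      unfolding bicovariant_iff[OF g] using defect_iff[OF b] by simp
    also have "\<dots> \<longleftrightarrow> (\<forall>\<phi>\<in>\<D>. \<forall>\<psi>\<in>\<D>. \<forall>y\<in>\<A>. \<forall>z\<in>\<A>. inf_defect \<Xi> \<phi> \<psi> y z = 0)"
      by (rule defect_vanishes_iff[OF b assms(2)])
    finally show ?thesis using bicovariance_identity_iff[OF b comm] by simp
  qed
  have "(\<exists>\<gamma>. preconnection A pb \<gamma> \<and> left_covariant G A pb n e f \<gamma> \<and>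
           poisson_compatible A pb \<gamma> \<and> flat_preconnection A pb \<gamma>) \<longleftrightarrow>
      (\<exists>\<Xi>. left_pre_lie \<D> (dual_bracket G A pb) \<Xi>)"
  proof
    assume "\<exists>\<gamma>. preconnection A pb \<gamma> \<and> left_covariant G A pb n e f \<gamma> \<and>
           poisson_compatible A pb \<gamma> \<and> flat_preconnection A pb \<gamma>"
    then show "\<exists>\<Xi>. left_pre_lie \<D> (dual_bracket G A pb) \<Xi>"
      unfolding left_covariant_def using main by blast
  next
    assume "\<exists>\<Xi>. left_pre_lie \<D> (dual_bracket G A pb) \<Xi>"
    then obtain \<Xi> where p: "left_pre_lie \<D> (dual_bracket G A pb) \<Xi>" by blast
    then have g: "is_gamma G A pb n e f (\<Gamma> \<Xi>) \<Xi>" by (simp add: is_gamma_def left_pre_lie_def)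
    then show "\<exists>\<gamma>. preconnection A pb \<gamma> \<and> left_covariant G A pb n e f \<gamma> \<and>
           poisson_compatible A pb \<gamma> \<and> flat_preconnection A pb \<gamma>"
      using main[OF g] p unfolding left_covariant_def by blast
  qed
  then show ?thesis using main bicov by simp
qed

end
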